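(* Let $t\in\mathbb R$ with $0<|t|<1$, and let $P(t)$ be the CR Paneitz operator of the Rossi sphere $(S^3_t,T^{1,0}S^3_t)$ with respect to the contact form $\theta$, regarded as an unbounded operator on $L^2(S^3)$ with domain $\{u\in L^2(S^3):P(t)u\in L^2(S^3)\}$. The negative spectrum of $P(t)$ consists of eigenvalues of finite multiplicity and has $0$ as its only accumulation point. In particular, $P(t)$ does not have closed range in $L^2(S^3)$.
   Context: **Rossi sphere.** $S^3=\{(z,w)\in\mathbb C^2:|z|^2+|w|^2=1\}$, whose standard CR structure is spanned by $Z_1^{\mathrm{std}}=\overline w\,\partial_z-\overline z\,\partial_w$, with contact form $\theta=\frac{\sqrt{-1}}2(z\,d\overline z+w\,d\overline w-\overline z\,dz-\overline w\,dw)|_{S^3}$. For $0<|t|<1$, the Rossi sphere is $S^3_t=S^3$ with CR structure $T^{1,0}S^3_t=\mathbb C\,(Z_1^{\mathrm{std}}+t\,\overline{Z_1^{\mathrm{std}}})$; $\theta$ is a contact form for it (it annihilates $T^{1,0}S^3_t$ and its Levi form $\mathcal L_\theta(Z,W)=-\sqrt{-1}\,d\theta(Z,\overline W)$ on $T^{1,0}S^3_t$ is positive definite). $L^2(S^3)$ is defined with the volume form $\theta\wedge d\theta$. **CR Paneitz operator** of a three-dimensional manifold $M$ with CR structure $T^{1,0}M$ and contact form $\theta$. The Reeb field $T$ satisfies $\theta(T)=1$, $d\theta(T,\cdot)=0$. Let $Z_1$ be a local frame of $T^{1,0}M$, $Z_{\bar1}=\overline{Z_1}$, and let $\theta^1$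 be the one-form with $\theta^1(Z_1)=1$, $\theta^1(Z_{\bar1})=\theta^1(T)=0$, $\theta^{\bar1}=\overline{\theta^1}$. Then $d\theta=\sqrt{-1}\,h_{1\bar1}\theta^1\wedge\theta^{\bar1}$ with $h_{1\bar1}=\mathcal L_\theta(Z_1,Z_1)>0$; put $h^{1\bar1}=1/h_{1\bar1}$. The Tanaka–Webster connection form $\omega_1{}^1$ and torsion $A^1{}_{\bar1}$ are determined by $d\theta^1=\theta^1\wedge\omega_1{}^1+A^1{}_{\bar1}\,\theta\wedge\theta^{\bar1}$ and $dh_{1\bar1}=h_{1\bar1}(\omega_1{}^1+\omega_{\bar1}{}^{\bar1})$, with $\omega_{\bar1}{}^{\bar1}=\overline{\omega_1{}^1}$; put $A_{11}=h_{1\bar1}\overline{A^1{}_{\bar1}}$. The Kohn Laplacian is $\Box_bu=-h^{1\bar1}\bigl(Z_1Z_{\bar1}u-\omega_{\bar1}{}^{\bar1}(Z_1)Z_{\bar1}u\bigr)$. The CR Paneitz operator is the fourth-order differential operator, independent of the frame, given by $$Pu=h^{1\bar1}\bigl(Z_{\bar1}W_1-\omega_1{}^1(Z_{\bar1})W_1\bigr),\qquad W_1=-Z_1(\Box_bu)+\sqrt{-1}\,A_{11}h^{1\bar1}Z_{\bar1}u,$$ i.e. $Pu=(u_{\bar1}{}^{\bar1}{}_1+\sqrt{-1}A_{11}u^1)^1$ in Tanaka–Webster covariant-derivative notation. In the domain, $Pu$ is taken in the sense of distributions; on a closed $M$ the operator with this domain is known to be self-adjoint. *)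

theory Defs
  imports "HOL-Analysis.Analysis"
begin

section \<open>Smooth functions and complex tensors on the three-sphere\<close>

type_synonym c2 = "complex \<times> complex"

definition S3 :: "c2 set" where
  "S3 = {(z, w). (cmod z)\<^sup>2 + (cmod w)\<^sup>2 = 1}"

primrec Ck_on :: "nat \<Rightarrow> 'a::real_normed_vector set \<Rightarrow> ('a \<Rightarrow> 'b::real_normed_vector) \<Rightarrow> bool" where
  "Ck_on 0 S f \<longleftrightarrow> continuous_on S f"
| "Ck_on (Suc k) S f \<longleftrightarrow> (\<forall>x\<in>S. f differentiable (at x)) \<and>
     (\<forall>v. Ck_on k S (\<lambda>x. frechet_derivative f (at x) v))"

text \<open>A function on \<open>S3\<close> is a function on the ambient space of which only the values on \<open>S3\<close>
  matter.  It is differentiated through its extension that is constant along rays; derivatives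
  in directions tangent to \<open>S3\<close> do not depend on the extension.\<close>

definition radial_ext :: "(c2 \<Rightarrow> 'b) \<Rightarrow> c2 \<Rightarrow> 'b" where
  "radial_ext f = (\<lambda>q. f (q /\<^sub>R norm q))"

definition smooth_S3 :: "(c2 \<Rightarrow> complex) \<Rightarrow> bool" where
  "smooth_S3 f \<longleftrightarrow> (\<forall>k. Ck_on k (- {0}) (radial_ext f))"

text \<open>Complex tangent vectors of the ambient space are given by their coefficients with respect to
  \<open>d/dz, d/dzbar, d/dw, d/dwbar\<close> (in this order), complex covectors by
  their coefficients with respect to the dual basis \<open>dz, dzbar, dw, dwbar\<close>.  A vector field on
  \<open>S3\<close> is a field of vectors that are tangent to \<open>S3\<close>.  A one-form on \<open>S3\<close> is represented by a
  field of covectors along \<open>S3\<close>, of which only the restriction to tangent vectors matters.\<close>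

type_synonym cvec = "complex ^ 4"
type_synonym cfield = "c2 \<Rightarrow> cvec"

definition pairing :: "cvec \<Rightarrow> cvec \<Rightarrow> complex" where
  "pairing \<alpha> X = (\<Sum>j\<in>UNIV. \<alpha> $ j * X $ j)"

definition conj_vec :: "cvec \<Rightarrow> cvec" where
  "conj_vec X = vector [cnj (X $ 2), cnj (X $ 1), cnj (X $ 4), cnj (X $ 3)]"

definition real_vec :: "c2 \<Rightarrow> cvec" where
  "real_vec v = vector [fst v, cnj (fst v), snd v, cnj (snd v)]"

text \<open>Tangency: annihilation by the differential of \<open>|z|\<^sup>2 + |w|\<^sup>2\<close>.\<close>

definition tangent_S3 :: "c2 \<Rightarrow> cvec set" where
  "tangent_S3 p = {X. pairing (vector [cnj (fst p), fst p, cnj (snd p), snd p]) X = 0}"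

definition smooth_field :: "cfield \<Rightarrow> bool" where
  "smooth_field X \<longleftrightarrow> (\<forall>j. smooth_S3 (\<lambda>p. X p $ j))"

text \<open>The differential of a function: its Wirtinger derivatives
  \<open>d/dz = (d/dx - \<i> d/dy) / 2\<close> and \<open>d/dzbar = (d/dx + \<i> d/dy) / 2\<close>, and likewise for \<open>w\<close>.\<close>

definition diff_fun :: "(c2 \<Rightarrow> complex) \<Rightarrow> cfield" where
  "diff_fun f p =
    (let D = frechet_derivative (radial_ext f) (at p) in
     vector [(D (1, 0) - \<i> * D (\<i>, 0)) / 2, (D (1, 0) + \<i> * D (\<i>, 0)) / 2,
             (D (0, 1) - \<i> * D (0, \<i>)) / 2, (D (0, 1) + \<i> * D (0, \<i>)) / 2])"

definition vf_apply :: "cfield \<Rightarrow> (c2 \<Rightarrow> complex) \<Rightarrow> c2 \<Rightarrow> complex" where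
  "vf_apply X f p = pairing (diff_fun f p) (X p)"

definition wedge :: "cvec \<Rightarrow> cvec \<Rightarrow> cvec \<Rightarrow> cvec \<Rightarrow> complex" where
  "wedge \<alpha> \<beta> X Y = pairing \<alpha> X * pairing \<beta> Y - pairing \<alpha> Y * pairing \<beta> X"

text \<open>\<open>d (\<Sum>\<^sub>j \<alpha>\<^sub>j dx\<^sub>j) = \<Sum>\<^sub>j d\<alpha>\<^sub>j \<and> dx\<^sub>j\<close>; on tangent vectors of \<open>S3\<close> this depends only
  on the restriction of the form to tangent vectors.\<close>

definition ext_d :: "cfield \<Rightarrow> c2 \<Rightarrow> cvec \<Rightarrow> cvec \<Rightarrow> complex" where
  "ext_d \<alpha> p X Y = (\<Sum>j\<in>UNIV. wedge (diff_fun (\<lambda>q. \<alpha> q $ j) p) (axis j 1) X Y)"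


section \<open>The Tanaka--Webster connection and the CR Paneitz operator\<close>

text \<open>The CR structure is given by a global frame \<open>Z\<close> of \<open>T\<^sup>1\<^sup>,\<^sup>0\<close>, with contact form \<open>\<theta>\<close>.\<close>

definition is_reeb :: "cfield \<Rightarrow> cfield \<Rightarrow> bool" where
  "is_reeb \<theta> T \<longleftrightarrow> smooth_field T \<and>
     (\<forall>p\<in>S3. T p \<in> tangent_S3 p \<and> pairing (\<theta> p) (T p) = 1 \<and>
       (\<forall>X\<in>tangent_S3 p. ext_d \<theta> p (T p) X = 0))"

definition is_coframe :: "cfield \<Rightarrow> cfield \<Rightarrow> cfield \<Rightarrow> bool" where
  "is_coframe Z T \<theta>1 \<longleftrightarrow> smooth_field \<theta>1 \<and>
     (\<forall>p\<in>S3. pairing (\<theta>1 p) (Z p) = 1 \<and> pairing (\<theta>1 p) (conj_vec (Z p)) = 0 \<and>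
       pairing (\<theta>1 p) (T p) = 0)"

definition levi :: "cfield \<Rightarrow> c2 \<Rightarrow> cvec \<Rightarrow> cvec \<Rightarrow> complex" where
  "levi \<theta> p X Y = - \<i> * ext_d \<theta> p X (conj_vec Y)"

definition levi_coeff :: "cfield \<Rightarrow> cfield \<Rightarrow> c2 \<Rightarrow> complex" where
  "levi_coeff \<theta> Z p = levi \<theta> p (Z p) (Z p)"

text \<open>\<open>\<omega>\<close> is the connection form \<open>\<omega>\<^sub>1\<^sup>1\<close>, and the function \<open>A\<close> is the torsion coefficient
  with upper index \<open>1\<close> and lower index \<open>1bar\<close>.\<close>

definition is_tanaka_webster :: "cfield \<Rightarrow> cfield \<Rightarrow> cfield \<Rightarrow> (c2 \<Rightarrow> complex) \<Rightarrow> bool" where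
  "is_tanaka_webster \<theta> Z \<omega> A \<longleftrightarrow> smooth_field \<omega> \<and> smooth_S3 A \<and>
     (\<exists>T \<theta>1. is_reeb \<theta> T \<and> is_coframe Z T \<theta>1 \<and>
       (\<forall>p\<in>S3. \<forall>X\<in>tangent_S3 p. \<forall>Y\<in>tangent_S3 p.
          ext_d \<theta>1 p X Y =
            wedge (\<theta>1 p) (\<omega> p) X Y + A p * wedge (\<theta> p) (conj_vec (\<theta>1 p)) X Y)) \<and>
     (\<forall>p\<in>S3. \<forall>X\<in>tangent_S3 p.
        pairing (diff_fun (levi_coeff \<theta> Z) p) X =
          levi_coeff \<theta> Z p * (pairing (\<omega> p) X + pairing (conj_vec (\<omega> p)) X))"

text \<open>The choice below is harmless, since the structure equations determine \<open>A\<close> on \<open>S3\<close> and \<open>\<omega>\<close> on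
  tangent vectors of \<open>S3\<close>.\<close>

definition tanaka_webster :: "cfield \<Rightarrow> cfield \<Rightarrow> cfield \<times> (c2 \<Rightarrow> complex)" where
  "tanaka_webster \<theta> Z = (SOME (\<omega>, A). is_tanaka_webster \<theta> Z \<omega> A)"

definition kohn_laplacian ::
    "cfield \<Rightarrow> cfield \<Rightarrow> (c2 \<Rightarrow> complex) \<Rightarrow> c2 \<Rightarrow> complex" where
  "kohn_laplacian \<theta> Z u p =
    (let \<omega> = fst (tanaka_webster \<theta> Z); Zbar = (\<lambda>q. conj_vec (Z q)) in
     - (1 / levi_coeff \<theta> Z p) *
       (vf_apply Z (vf_apply Zbar u) p - pairing (conj_vec (\<omega> p)) (Z p) * vf_apply Zbar u p))"

definition cr_paneitz ::
    "cfield \<Rightarrow> cfield \<Rightarrow> (c2 \<Rightarrow> complex) \<Rightarrow> c2 \<Rightarrow> complex" where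
  "cr_paneitz \<theta> Z u p =
    (let (\<omega>, A) = tanaka_webster \<theta> Z;
         Zbar = (\<lambda>q. conj_vec (Z q));
         h = levi_coeff \<theta> Z;
         A11 = (\<lambda>q. h q * cnj (A q));
         W = (\<lambda>q. - vf_apply Z (kohn_laplacian \<theta> Z u) q
                  + \<i> * A11 q * (1 / h q) * vf_apply Zbar u q)
     in (1 / h p) * (vf_apply Zbar W p - pairing (\<omega> p) (Zbar p) * W p))"


section \<open>The volume form \<open>\<theta> \<and> d\<theta>\<close> and square-integrable functions\<close>

definition contact_volume :: "cfield \<Rightarrow> c2 \<Rightarrow> cvec \<Rightarrow> cvec \<Rightarrow> cvec \<Rightarrow> complex" where
  "contact_volume \<theta> p X Y V =
     pairing (\<theta> p) X * ext_d \<theta> p Y V + pairing (\<theta> p) Y * ext_d \<theta> p V X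
       + pairing (\<theta> p) V * ext_d \<theta> p X Y"

text \<open>Integration of the volume form in the Hopf coordinates, which map the open box
  diffeomorphically onto the complement of a null set.\<close>

definition hopf :: "real \<times> real \<times> real \<Rightarrow> c2" where
  "hopf = (\<lambda>(\<eta>, a, b). (of_real (cos \<eta>) * cis a, of_real (sin \<eta>) * cis b))"

definition hopf_box :: "(real \<times> real \<times> real) set" where
  "hopf_box = {0<..<pi / 2} \<times> {0<..<2 * pi} \<times> {0<..<2 * pi}"

definition contact_measure :: "cfield \<Rightarrow> c2 measure" where
  "contact_measure \<theta> =
     distr
       (density (restrict_space lborel hopf_box)
         (\<lambda>x. let D = frechet_derivative hopf (at x) in
              ennreal (cmod (contact_volume \<theta> (hopf x)
                (real_vec (D (1, 0, 0))) (real_vec (D (0, 1, 0))) (real_vec (D (0, 0, 1)))))))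
       (restrict_space borel S3) hopf"

definition L2 :: "'a measure \<Rightarrow> ('a \<Rightarrow> complex) set" where
  "L2 M = {u \<in> borel_measurable M. integrable M (\<lambda>x. (cmod (u x))\<^sup>2)}"

definition L2_norm :: "'a measure \<Rightarrow> ('a \<Rightarrow> complex) \<Rightarrow> real" where
  "L2_norm M u = sqrt (\<integral>x. (cmod (u x))\<^sup>2 \<partial>M)"


section \<open>Unbounded operators on \<open>L\<^sup>2\<close>\<close>

text \<open>An operator on \<open>L2 M\<close> is given by its graph, a set of pairs of functions that is closed under
  almost everywhere equality (functions are not identified when they agree almost everywhere).\<close>

type_synonym 'a operator = "(('a \<Rightarrow> complex) \<times> ('a \<Rightarrow> complex)) set"

definition resolvent_set :: "'a measure \<Rightarrow> 'a operator \<Rightarrow> complex set" where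
  "resolvent_set M G = {\<mu>.
     (\<forall>v\<in>L2 M. \<exists>(u, w)\<in>G. AE x in M. w x - \<mu> * u x = v x) \<and>
     (\<exists>C. \<forall>(u, w)\<in>G. L2_norm M u \<le> C * L2_norm M (\<lambda>x. w x - \<mu> * u x))}"

definition op_spectrum :: "'a measure \<Rightarrow> 'a operator \<Rightarrow> complex set" where
  "op_spectrum M G = - resolvent_set M G"

definition negative_spectrum :: "'a measure \<Rightarrow> 'a operator \<Rightarrow> complex set" where
  "negative_spectrum M G = op_spectrum M G \<inter> {\<mu>. Im \<mu> = 0 \<and> Re \<mu> < 0}"

definition eigenspace :: "'a measure \<Rightarrow> 'a operator \<Rightarrow> complex \<Rightarrow> ('a \<Rightarrow> complex) set" where
  "eigenspace M G \<mu> = {u. \<exists>w. (u, w) \<in> G \<and> (AE x in M. w x = \<mu> * u x)}"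

definition is_eigenvalue :: "'a measure \<Rightarrow> 'a operator \<Rightarrow> complex \<Rightarrow> bool" where
  "is_eigenvalue M G \<mu> \<longleftrightarrow> (\<exists>u\<in>eigenspace M G \<mu>. \<not> (AE x in M. u x = 0))"

definition finite_multiplicity :: "'a measure \<Rightarrow> 'a operator \<Rightarrow> complex \<Rightarrow> bool" where
  "finite_multiplicity M G \<mu> \<longleftrightarrow>
     (\<exists>B. finite B \<and> B \<subseteq> eigenspace M G \<mu> \<and>
       (\<forall>u\<in>eigenspace M G \<mu>. \<exists>c. AE x in M. u x = (\<Sum>b\<in>B. c b * b x)))"

definition closed_range :: "'a measure \<Rightarrow> 'a operator \<Rightarrow> bool" where
  "closed_range M G \<longleftrightarrow>
     (\<forall>w v. (\<forall>n::nat. w n \<in> snd ` G) \<and> v \<in> L2 M \<and>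
        (\<lambda>n. L2_norm M (\<lambda>x. w n x - v x)) \<longlonglongrightarrow> 0 \<longrightarrow> v \<in> snd ` G)"

text \<open>\<open>P u = v\<close> in the sense of distributions on \<open>S3\<close>, for a linear differential operator \<open>P\<close>:
  \<open>g\<close> is the value on the test function \<open>\<psi>\<close> of the transpose of \<open>P\<close> with respect to the
  measure \<open>M\<close>.\<close>

definition distributional ::
    "c2 measure \<Rightarrow> ((c2 \<Rightarrow> complex) \<Rightarrow> c2 \<Rightarrow> complex) \<Rightarrow> (c2 \<Rightarrow> complex) \<Rightarrow> (c2 \<Rightarrow> complex) \<Rightarrow> bool"
  where
  "distributional M P u v \<longleftrightarrow>
     (\<forall>\<psi> g. smooth_S3 \<psi> \<and> smooth_S3 g \<and>
        (\<forall>\<phi>. smooth_S3 \<phi> \<longrightarrow> (\<integral>x. P \<phi> x * \<psi> x \<partial>M) = (\<integral>x. \<phi> x * g x \<partial>M))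
      \<longrightarrow> (\<integral>x. v x * \<psi> x \<partial>M) = (\<integral>x. u x * g x \<partial>M))"

definition maximal_operator ::
    "c2 measure \<Rightarrow> ((c2 \<Rightarrow> complex) \<Rightarrow> c2 \<Rightarrow> complex) \<Rightarrow> c2 operator" where
  "maximal_operator M P = {(u, v). u \<in> L2 M \<and> v \<in> L2 M \<and> distributional M P u v}"


section \<open>The Rossi sphere\<close>

text \<open>The form \<open>\<theta> = (\<i>/2) (z dzbar + w dwbar - zbar dz - wbar dw)\<close>.\<close>

definition contact_form :: cfield where
  "contact_form = (\<lambda>(z, w).
     (\<i> / 2) *s vector [- cnj z, z, - cnj w, w])"

definition Z_std :: cfield where
  "Z_std = (\<lambda>(z, w). vector [cnj w, 0, - cnj z, 0])"

definition Z_rossi :: "real \<Rightarrow> cfield" where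
  "Z_rossi t p = Z_std p + complex_of_real t *s conj_vec (Z_std p)"

definition S3_measure :: "c2 measure" where
  "S3_measure = contact_measure contact_form"

definition rossi_paneitz :: "real \<Rightarrow> c2 operator" where
  "rossi_paneitz t = maximal_operator S3_measure (cr_paneitz contact_form (Z_rossi t))"

end

theory Submission
  imports Defs "HOL-Real_Asymp.Real_Asymp"
begin

text \<open>
  Let \<open>L = wbar d/dz - zbar d/dw\<close> and \<open>h = 1 - t\<^sup>2\<close>.  With \<open>Z = L + t Lbar\<close>, the structure equations
  give \<open>P = h\<^sup>-\<^sup>2 Zbar (Z\<^sup>2 + 4 t) Zbar\<close>.  On harmonic polynomials of degree \<open>n\<close> the fields \<open>L\<close> and \<open>Lbar\<close>
  are the ladder operators of \<open>n + 1\<close> copies of the \<open>(n + 1)\<close>-dimensional representation of \<open>SU(2)\<close>,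
  so \<open>h\<^sup>2 P\<close> becomes a real symmetric matrix \<open>Qm t n\<close>, and \<open>P\<close> is diagonal in an orthonormal basis of
  \<open>L\<^sup>2\<close> consisting of smooth functions.

  For odd \<open>n\<close> an explicit vector makes the form of \<open>Qm t n\<close> negative, so there are infinitely many
  negative eigenvalues.  Conversely, \<open>Qm t n\<close> is nonnegative on vectors whose two extreme
  entries vanish, because the energy \<open>(|Z x|\<^sup>2 + |Zbar x|\<^sup>2) / 2\<close> exceeds the commutator term there
  (by weighted AM-GM).  The two remaining directions can be corrected by vectors that \<open>Zbar\<close> or \<open>Z\<close>
  annihilates up to an error of order \<open>|t|\<^sup>n\<close>, so the form is bounded below by \<open>-\<epsilon>\<close> for all large \<open>n\<close>.
  Hence only finitely many eigenvalues lie below \<open>-\<epsilon>\<close>.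
\<close>

section \<open>The matrices of the CR Paneitz operator\<close>

text \<open>The lower bound for the form of \<open>Qm t n\<close> has the shape
  \<open>energy^2 - ((1 - t^2) * n / 2)^2\<close>, and near either extreme weight the ground level
  of the energy is itself \<open>(1 - t^2) * n / 2\<close> to leading order in \<open>n\<close>.
  There the two terms cancel, and an estimate of this kind cannot decide the sign. Forcing the
  extreme entries to vanish excludes these ground states and raises the level by a fixed factor
  \<open>1 + \<epsilon>\<close>, which also pays for the torsion term, of lower order in
  \<open>n\<close>. The two excluded directions are treated through the factorization instead:
  \<open>Zb t n\<close> acts first in \<open>Qm t n\<close>, and the ground state is an approximate
  null vector of \<open>Zb t n\<close>, so \<open>Qm t n\<close> is tiny on it. Reality of the
  operator enters as \<open>Qm_swap\<close>. It yields the symmetry of the matrix, the reflection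
  that exchanges the two ends, the negative vector for odd \<open>n\<close>, and the fact that
  conjugates of eigenfunctions are eigenfunctions, which is what the distributional definition of
  the domain tests.\<close>

definition cf :: "nat \<Rightarrow> nat \<Rightarrow> real" where
  "cf n p = sqrt (real (Suc p) * real (n - p))"

text \<open>Sequences are total functions, but only indices up to \<open>n\<close> count. Since
  \<open>cf n p = 0\<close> for \<open>n \<le> p\<close>, both ladder operators return 0 beyond
  \<open>n\<close> by themselves.\<close>

definition up :: "nat \<Rightarrow> (nat \<Rightarrow> real) \<Rightarrow> nat \<Rightarrow> real" where
  "up n x p = (case p of 0 \<Rightarrow> 0 | Suc q \<Rightarrow> cf n q * x q)"

definition dn :: "nat \<Rightarrow> (nat \<Rightarrow> real) \<Rightarrow> nat \<Rightarrow> real" where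
  "dn n x p = cf n p * x (Suc p)"

text \<open>The commutator of \<open>up\<close> and \<open>dn\<close>. The explicit cutoff matches
  their vanishing beyond \<open>n\<close>, so that \<open>up_dn\<close> is an equation of functions
  and can be used for rewriting under further operators.\<close>

definition wt :: "nat \<Rightarrow> (nat \<Rightarrow> real) \<Rightarrow> nat \<Rightarrow> real" where
  "wt n x p = (if p \<le> n then (2 * real p - real n) * x p else 0)"

definition ip :: "nat \<Rightarrow> (nat \<Rightarrow> real) \<Rightarrow> (nat \<Rightarrow> real) \<Rightarrow> real" where
  "ip n x y = (\<Sum>p\<le>n. x p * y p)"

text \<open>On the coefficients of a harmonic polynomial, \<open>L\<close> acts as \<open>up n\<close> and \<open>Lbar\<close> as \<open>- dn n\<close>, hence \<open>Z\<close> as \<open>Za t n\<close>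
  and \<open>Zbar\<close> as \<open>Zb t n\<close>.\<close>

definition Za :: "real \<Rightarrow> nat \<Rightarrow> (nat \<Rightarrow> real) \<Rightarrow> nat \<Rightarrow> real" where
  "Za t n x p = up n x p - t * dn n x p"

definition Zb :: "real \<Rightarrow> nat \<Rightarrow> (nat \<Rightarrow> real) \<Rightarrow> nat \<Rightarrow> real" where
  "Zb t n x p = t * up n x p - dn n x p"

definition Qm :: "real \<Rightarrow> nat \<Rightarrow> (nat \<Rightarrow> real) \<Rightarrow> nat \<Rightarrow> real" where
  "Qm t n x = Zb t n (\<lambda>p. Za t n (Za t n (Zb t n x)) p + 4 * t * Zb t n x p)"

lemma cf_nonneg: "0 \<le> cf n p" by (simp add: cf_def)

lemma cf_pos: "p < n \<Longrightarrow> 0 < cf n p" by (simp add: cf_def)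

lemma cf_zero: "n \<le> p \<Longrightarrow> cf n p = 0" by (simp add: cf_def)

lemma cf_sq: "cf n p * cf n p = real (Suc p) * real (n - p)" 
  by (simp add: cf_def flip: power2_eq_square)

lemma cf_sq_le: "p \<le> n \<Longrightarrow> cf n p * cf n p = (real p + 1) * (real n - real p)" 
  by (simp add: cf_sq of_nat_diff)

lemma up_0 [simp]: "up n x 0 = 0" and up_Suc [simp]: "up n x (Suc p) = cf n p * x p"
  by (simp_all add: up_def)

lemma up_add: "up n (\<lambda>p. x p + y p) = (\<lambda>p. up n x p + up n y p)"
  and up_diff: "up n (\<lambda>p. x p - y p) = (\<lambda>p. up n x p - up n y p)"
  and up_scale: "up n (\<lambda>p. a * x p) = (\<lambda>p. a * up n x p)"
  by (rule ext, simp add: up_def algebra_simps split: nat.split)+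

lemma dn_add: "dn n (\<lambda>p. x p + y p) = (\<lambda>p. dn n x p + dn n y p)"
  and dn_diff: "dn n (\<lambda>p. x p - y p) = (\<lambda>p. dn n x p - dn n y p)"
  and dn_scale: "dn n (\<lambda>p. a * x p) = (\<lambda>p. a * dn n x p)"
  by (rule ext, simp add: dn_def algebra_simps)+

lemma wt_add: "wt n (\<lambda>p. x p + y p) = (\<lambda>p. wt n x p + wt n y p)"
  and wt_diff: "wt n (\<lambda>p. x p - y p) = (\<lambda>p. wt n x p - wt n y p)"
  and wt_scale: "wt n (\<lambda>p. a * x p) = (\<lambda>p. a * wt n x p)"
  by (rule ext, simp add: wt_def algebra_simps)+

lemma up_dn: "up n (dn n x) = (\<lambda>p. dn n (up n x) p + wt n x p)"
proof
  fix p show "up n (dn n x) p = dn n (up n x) p + wt n x p"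
  proof (cases p)
    case 0
    then show ?thesis using cf_sq[of n 0] by (simp add: dn_def wt_def flip: mult.assoc)
  next
    case (Suc q)
    show ?thesis
    proof (cases "Suc q \<le> n")
      case True
      have "cf n q * cf n q = cf n (Suc q) * cf n (Suc q) + (2 * real (Suc q) - real n)"
        using True by (simp add: cf_sq_le algebra_simps)
      then show ?thesis using Suc True
        by (simp add: dn_def wt_def flip: mult.assoc) (simp add: algebra_simps)
    next
      case False
      then show ?thesis using Suc by (simp add: dn_def wt_def cf_zero)
    qed
  qed
qed

lemma up_wt: "up n (wt n x) = (\<lambda>p. wt n (up n x) p - 2 * up n x p)"
proof
  fix p show "up n (wt n x) p = wt n (up n x) p - 2 * up n x p"
    by (cases p) (auto simp: wt_def cf_zero algebra_simps)
qed

lemma dn_wt: "dn n (wt n x) = (\<lambda>p. wt n (dn n x) p + 2 * dn n x p)"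
proof
  fix p show "dn n (wt n x) p = wt n (dn n x) p + 2 * dn n x p"
    by (cases "Suc p \<le> n") (auto simp: wt_def dn_def cf_zero algebra_simps)
qed

text \<open>Used as rewrite rules, these bring every word in the three operators into the order
  \<open>wt\<close>, \<open>dn\<close>, \<open>up\<close> (a Poincare-Birkhoff-Witt normal form);
  operator identities then become linear algebra in the coefficients.\<close>

lemmas word_simps = up_add up_diff up_scale dn_add dn_diff dn_scale wt_add wt_diff wt_scale
  up_dn up_wt dn_wt

lemma Za_abs: "Za t n x = (\<lambda>p. up n x p - t * dn n x p)"
  and Zb_abs: "Zb t n x = (\<lambda>p. t * up n x p - dn n x p)"
  by (simp_all add: fun_eq_iff Za_def Zb_def)

lemma Za_add: "Za t n (\<lambda>p. x p + y p) = (\<lambda>p. Za t n x p + Za t n y p)"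
  and Za_diff: "Za t n (\<lambda>p. x p - y p) = (\<lambda>p. Za t n x p - Za t n y p)"
  and Za_scale: "Za t n (\<lambda>p. a * x p) = (\<lambda>p. a * Za t n x p)"
  by (simp_all add: Za_abs word_simps algebra_simps)

lemma Zb_add: "Zb t n (\<lambda>p. x p + y p) = (\<lambda>p. Zb t n x p + Zb t n y p)"
  and Zb_diff: "Zb t n (\<lambda>p. x p - y p) = (\<lambda>p. Zb t n x p - Zb t n y p)"
  and Zb_scale: "Zb t n (\<lambda>p. a * x p) = (\<lambda>p. a * Zb t n x p)"
  by (simp_all add: Zb_abs word_simps algebra_simps)

lemmas Z_lin = Za_add Za_diff Za_scale Zb_add Zb_diff Zb_scale

lemma Za_Zb: "Za t n (Zb t n x) = (\<lambda>p. Zb t n (Za t n x) p - (1 - t\<^sup>2) * wt n x p)"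
  by (simp add: Za_abs Zb_abs word_simps algebra_simps power2_eq_square)

text \<open>The two quartic words differ by commutators, and \<open>4 * t\<close> is the coefficient
  for which the quadratic terms absorb the difference. The identity expresses that the CR Paneitz
  operator is real.\<close>

lemma Qm_swap: "Qm t n x = Za t n (\<lambda>p. Zb t n (Zb t n (Za t n x)) p + 4 * t * Za t n x p)"
  unfolding Qm_def Za_abs Zb_abs word_simps
  by (rule ext) algebra

lemma Qm_add: "Qm t n (\<lambda>p. x p + y p) = (\<lambda>p. Qm t n x p + Qm t n y p)"
  and Qm_scale: "Qm t n (\<lambda>p. a * x p) = (\<lambda>p. a * Qm t n x p)"
  by (simp_all add: Qm_def Z_lin algebra_simps)

lemma ip_add: "ip n (\<lambda>p. x p + y p) z = ip n x z + ip n y z"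
  and ip_diff: "ip n (\<lambda>p. x p - y p) z = ip n x z - ip n y z"
  and ip_scale: "ip n (\<lambda>p. a * x p) z = a * ip n x z"
  and ip_add_right: "ip n z (\<lambda>p. x p + y p) = ip n z x + ip n z y"
  and ip_diff_right: "ip n z (\<lambda>p. x p - y p) = ip n z x - ip n z y"
  and ip_scale_right: "ip n z (\<lambda>p. a * x p) = a * ip n z x"
  by (simp_all add: ip_def algebra_simps sum.distrib sum_subtractf sum_distrib_left)

lemmas ip_simps = ip_add ip_diff ip_scale ip_add_right ip_diff_right ip_scale_right

lemma ip_commute: "ip n x y = ip n y x"
  by (simp add: ip_def mult.commute)

lemma ip_nonneg: "0 \<le> ip n x x"
  by (simp add: ip_def sum_nonneg)

lemma ip_eq_0: "ip n x x = 0 \<longleftrightarrow> (\<forall>p\<le>n. x p = 0)"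
  by (subst ip_def, subst sum_nonneg_eq_0_iff) auto

lemma ip_Cauchy_Schwarz: "(ip n x y)\<^sup>2 \<le> ip n x x * ip n y y"
  using Cauchy_Schwarz_ineq_sum[of x y "{..n}"] by (simp add: ip_def power2_eq_square)

lemma ip_cong: "(\<And>p. p \<le> n \<Longrightarrow> x p = x' p) \<Longrightarrow> (\<And>p. p \<le> n \<Longrightarrow> y p = y' p) \<Longrightarrow> ip n x y = ip n x' y'"
  by (simp add: ip_def)

lemma ip_up: "ip n (up n x) y = ip n x (dn n y)"
proof -
  have "ip n (up n x) y = (\<Sum>p<n. cf n p * x p * y (Suc p))"
    by (simp add: ip_def sum.atMost_shift)
  also have "\<dots> = ip n x (dn n y)"
    by (simp add: ip_def dn_def cf_zero lessThan_Suc_atMost[symmetric] mult_ac)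
  finally show ?thesis .
qed

lemma ip_dn: "ip n (dn n x) y = ip n x (up n y)"
  by (metis ip_up ip_commute)

lemma ip_Za: "ip n (Za t n x) y = - ip n x (Zb t n y)"
  by (simp add: Za_abs Zb_abs ip_simps ip_up ip_dn)

lemma ip_Zb: "ip n (Zb t n x) y = - ip n x (Za t n y)"
  by (simp add: Za_abs Zb_abs ip_simps ip_up ip_dn)

lemma ip_Qm: "ip n (Qm t n x) y = ip n x (Qm t n y)"
  by (subst Qm_swap) (simp add: Qm_def ip_Za ip_Zb ip_simps Z_lin)

section \<open>The energy form and lower bounds away from the two ends\<close>

definition energy :: "real \<Rightarrow> nat \<Rightarrow> (nat \<Rightarrow> real) \<Rightarrow> real" where
  "energy t n x = (ip n (Za t n x) (Za t n x) + ip n (Zb t n x) (Zb t n x)) / 2"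

lemma ip_wt_le: "ip n (wt n x) (wt n x) \<le> (real n)\<^sup>2 * ip n x x"
proof -
  have "(wt n x p)\<^sup>2 \<le> (real n)\<^sup>2 * (x p)\<^sup>2" if "p \<le> n" for p
  proof -
    have "(2 * real p - real n)\<^sup>2 \<le> (real n)\<^sup>2"
      using that by (intro power2_le_iff_abs_le[THEN iffD2]) auto
    then show ?thesis using that
      by (simp add: wt_def power_mult_distrib mult_right_mono)
  qed
  then show ?thesis
    by (auto simp: ip_def sum_distrib_left power2_eq_square intro!: sum_mono)
qed

text \<open>With \<open>a = Za Zb x\<close> and \<open>b = Zb Za x\<close> the leading part of the
  form is \<open>ip n a b\<close>, a quarter of the squared norm of \<open>a + b\<close> minus that
  of \<open>a - b\<close>. The sum satisfies \<open>ip n (a + b) x = - 2 * energy\<close>, so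
  Cauchy-Schwarz bounds it below; the difference is a multiple of \<open>wt n x\<close>, of norm at
  most \<open>n\<close> times that of \<open>x\<close>. The factor \<open>ip n x x\<close> stands
  where a Rayleigh quotient would divide.\<close>

lemma Qm_form_ge:
  "ip n (Qm t n x) x * ip n x x \<ge>
     (energy t n x)\<^sup>2 - 4 * \<bar>t\<bar> * energy t n x * ip n x x - ((1 - t\<^sup>2) * real n / 2)\<^sup>2 * (ip n x x)\<^sup>2"
proof -
  let ?h = "1 - t\<^sup>2" and ?A = "Za t n x" and ?B = "Zb t n x"
  define a where "a = Za t n ?B"
  define b where "b = Zb t n ?A"
  have ab: "a = (\<lambda>p. b p - ?h * wt n x p)"
    unfolding a_def b_def by (rule Za_Zb)
  have form: "ip n (Qm t n x) x = ip n a b - 4 * t * ip n ?B ?A"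
    by (simp add: Qm_def ip_Zb ip_add ip_Za ip_scale a_def b_def)
  have 1: "4 * ip n a b = ip n (\<lambda>p. a p + b p) (\<lambda>p. a p + b p) - ?h\<^sup>2 * ip n (wt n x) (wt n x)"
    unfolding ab ip_simps ip_commute[of n "wt n x" b] by (simp add: power2_eq_square algebra_simps)
  have "ip n (\<lambda>p. a p + b p) x = - 2 * energy t n x"
    by (simp add: a_def b_def ip_add ip_Za ip_Zb energy_def)
  then have "4 * (energy t n x)\<^sup>2 = (ip n (\<lambda>p. a p + b p) x)\<^sup>2"
    by simp
  also have "\<dots> \<le> ip n (\<lambda>p. a p + b p) (\<lambda>p. a p + b p) * ip n x x"
    by (rule ip_Cauchy_Schwarz)
  finally have 2: "4 * (energy t n x)\<^sup>2 \<le> ip n (\<lambda>p. a p + b p) (\<lambda>p. a p + b p) * ip n x x" .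
  have "?h\<^sup>2 * ip n (wt n x) (wt n x) * ip n x x \<le> ?h\<^sup>2 * ((real n)\<^sup>2 * ip n x x) * ip n x x"
    by (intro mult_right_mono mult_left_mono ip_wt_le ip_nonneg) auto
  then have 3: "?h\<^sup>2 * ip n (wt n x) (wt n x) * ip n x x \<le> 4 * ((?h * real n / 2)\<^sup>2 * (ip n x x)\<^sup>2)"
    by (simp add: power2_eq_square field_simps)
  have 4: "(energy t n x)\<^sup>2 - (?h * real n / 2)\<^sup>2 * (ip n x x)\<^sup>2 \<le> ip n a b * ip n x x"
    using 2 3 arg_cong[OF 1, of "\<lambda>z. z * ip n x x"] by (simp add: algebra_simps)
  have "0 \<le> ip n (\<lambda>p. ?A p - ?B p) (\<lambda>p. ?A p - ?B p)" "0 \<le> ip n (\<lambda>p. ?A p + ?B p) (\<lambda>p. ?A p + ?B p)"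
    by (rule ip_nonneg)+
  then have "\<bar>ip n ?B ?A\<bar> \<le> energy t n x"
    by (simp add: ip_simps energy_def ip_commute[of n ?B ?A])
  then have "\<bar>t * ip n ?B ?A\<bar> \<le> \<bar>t\<bar> * energy t n x"
    by (simp add: abs_mult mult_left_mono)
  then have "t * ip n ?B ?A \<le> \<bar>t\<bar> * energy t n x"
    by linarith
  then have "t * ip n ?B ?A * ip n x x \<le> \<bar>t\<bar> * energy t n x * ip n x x"
    by (intro mult_right_mono ip_nonneg)
  with 4 show ?thesis
    by (simp add: form algebra_simps)
qed

text \<open>Only indices that differ by 2 are coupled: the energy consists of two tridiagonal
  (Jacobi) matrices, on the even and on the odd indices, and AM-GM can be applied link by
  link.\<close>

lemma energy_eq:
  "energy t n x = (1 + t\<^sup>2) * (\<Sum>p\<le>n. (real p * (real n - real p) + real n / 2) * (x p)\<^sup>2)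
     - 2 * t * (\<Sum>q<n. cf n q * cf n (Suc q) * x q * x (Suc (Suc q)))"
proof -
  have "energy t n x = (1 + t\<^sup>2) / 2 * (ip n (up n x) (up n x) + ip n (dn n x) (dn n x))
      - 2 * t * ip n (up n x) (dn n x)"
    unfolding energy_def Za_abs Zb_abs ip_simps ip_commute[of n "dn n x" "up n x"]
    by (simp add: power2_eq_square field_simps)
  moreover have "ip n (up n x) (up n x) + ip n (dn n x) (dn n x)
      = 2 * (\<Sum>p\<le>n. (real p * (real n - real p) + real n / 2) * (x p)\<^sup>2)"
  proof -
    have "ip n (up n x) (up n x) = (\<Sum>p\<le>n. (real p + 1) * (real n - real p) * (x p)\<^sup>2)"
      unfolding ip_up by (auto simp: ip_def dn_def cf_sq_le power2_eq_square mult_ac intro!: sum.cong)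
    moreover have "ip n (dn n x) (dn n x) = (\<Sum>p\<le>n. real p * (real n - real p + 1) * (x p)\<^sup>2)"
    proof -
      have "x p * up n (dn n x) p = real p * (real n - real p + 1) * (x p)\<^sup>2" if "p \<le> n" for p
      proof (cases p)
        case (Suc q)
        have "x p * up n (dn n x) p = (cf n q * cf n q) * (x p)\<^sup>2"
          using Suc by (simp add: dn_def power2_eq_square)
        also have "cf n q * cf n q = real p * (real n - real p + 1)"
          using Suc that by (simp add: cf_sq_le)
        finally show ?thesis .
      qed simp
      then show ?thesis unfolding ip_dn by (simp add: ip_def)
    qed
    ultimately show ?thesis
      by (simp add: sum.distrib[symmetric] sum_distrib_left algebra_simps)
  qed
  moreover have "ip n (up n x) (dn n x) = (\<Sum>q<n. cf n q * cf n (Suc q) * x q * x (Suc (Suc q)))"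
    by (simp add: ip_def sum.atMost_shift dn_def mult_ac)
  ultimately show ?thesis
    by simp
qed

text \<open>The link between \<open>q\<close> and \<open>q + 2\<close> is split by AM-GM with ratio
  \<open>s q\<close>. Hypothesis \<open>le\<close> says that at each index the diagonal pays for its
  shares of the upper and the lower link. Links that touch index 0 or \<open>n\<close> vanish with
  \<open>x 0\<close> and \<open>x n\<close>; this is why the shares carry the conditions
  \<open>p + 3 \<le> n\<close> and \<open>3 \<le> p\<close>, and why more than the ground level can
  be gained.\<close>

lemma energy_ge_Jacobi:
  fixes s :: "nat \<Rightarrow> real"
  assumes s: "\<And>p. 0 < s p" and x0: "x 0 = 0" and xn: "x n = 0"
    and le: "\<And>p. 1 \<le> p \<Longrightarrow> p < n \<Longrightarrow>
      (if p + 3 \<le> n then \<bar>t\<bar> * s p * ((real p + 1) * (real n - real p)) else 0)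
      + (if 3 \<le> p then \<bar>t\<bar> / s (p - 2) * (real p * (real n - real p + 1)) else 0)
      \<le> (1 + t\<^sup>2) * (real p * (real n - real p) + real n / 2) - \<Lambda>"
  shows "\<Lambda> * ip n x x \<le> energy t n x"
proof -
  let ?a = "\<lambda>p. if 1 \<le> p \<and> p + 3 \<le> n then \<bar>t\<bar> * s p * ((real p + 1) * (real n - real p)) * (x p)\<^sup>2 else 0"
  let ?b = "\<lambda>q. if 1 \<le> q \<and> q + 3 \<le> n then \<bar>t\<bar> / s q * ((real q + 2) * (real n - real q - 1)) * (x (q + 2))\<^sup>2 else 0"
  let ?c = "\<lambda>p. if 3 \<le> p \<and> p < n then \<bar>t\<bar> / s (p - 2) * (real p * (real n - real p + 1)) * (x p)\<^sup>2 else 0"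
  have pt: "2 * t * (cf n q * cf n (Suc q) * x q * x (Suc (Suc q))) \<le> ?a q + ?b q" if "q < n" for q
  proof (cases "1 \<le> q \<and> q + 3 \<le> n")
    case True
    define r where "r = sqrt (s q)"
    have r: "r > 0" "r * r = s q" using s[of q] by (simp_all add: r_def)
    have "0 \<le> (r * (cf n q * \<bar>x q\<bar>) - cf n (Suc q) * \<bar>x (q + 2)\<bar> / r)\<^sup>2" by simp
    also have "\<dots> = s q * ((real q + 1) * (real n - real q)) * (x q)\<^sup>2
        + ((real q + 2) * (real n - real q - 1)) * (x (q + 2))\<^sup>2 / s q
        - 2 * (cf n q * cf n (Suc q) * \<bar>x q\<bar> * \<bar>x (q + 2)\<bar>)"
    proof -
      have "(r * (cf n q * \<bar>x q\<bar>) - cf n (Suc q) * \<bar>x (q + 2)\<bar> / r)\<^sup>2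
        = (r * r) * (cf n q * cf n q) * (x q)\<^sup>2 + (cf n (Suc q) * cf n (Suc q)) * (x (q + 2))\<^sup>2 / (r * r)
          - 2 * (cf n q * cf n (Suc q) * \<bar>x q\<bar> * \<bar>x (q + 2)\<bar>)"
        using r(1) by (simp add: power2_eq_square field_simps)
      also have "(r * r) * (cf n q * cf n q) * (x q)\<^sup>2 = s q * ((real q + 1) * (real n - real q)) * (x q)\<^sup>2"
        using True by (simp add: r(2) cf_sq_le)
      also have "cf n (Suc q) * cf n (Suc q) = (real q + 2) * (real n - real q - 1)"
        using True by (simp add: cf_sq_le algebra_simps)
      finally show ?thesis by (simp add: r(2))
    qed
    finally have "\<bar>t\<bar> * (2 * (cf n q * cf n (Suc q) * \<bar>x q\<bar> * \<bar>x (q + 2)\<bar>)) \<le>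
        \<bar>t\<bar> * (s q * ((real q + 1) * (real n - real q)) * (x q)\<^sup>2
        + ((real q + 2) * (real n - real q - 1)) * (x (q + 2))\<^sup>2 / s q)"
      by (intro mult_left_mono) auto
    moreover have "2 * t * (cf n q * cf n (Suc q) * x q * x (Suc (Suc q)))
       \<le> \<bar>2 * t * (cf n q * cf n (Suc q) * x q * x (Suc (Suc q)))\<bar>" by simp
    moreover have "\<bar>2 * t * (cf n q * cf n (Suc q) * x q * x (Suc (Suc q)))\<bar>
       = \<bar>t\<bar> * (2 * (cf n q * cf n (Suc q) * \<bar>x q\<bar> * \<bar>x (q + 2)\<bar>))"
      by (simp add: abs_mult cf_nonneg mult_ac)
    moreover have "?a q + ?b q = \<bar>t\<bar> * (s q * ((real q + 1) * (real n - real q)) * (x q)\<^sup>2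
        + ((real q + 2) * (real n - real q - 1)) * (x (q + 2))\<^sup>2 / s q)"
      using True by (simp add: distrib_left mult.assoc)
    ultimately show ?thesis by linarith
  next
    case False
    then have "q = 0 \<or> q + 2 = n \<or> q + 1 = n" using that by auto
    then have z: "cf n q * cf n (Suc q) * x q * x (Suc (Suc q)) = 0"
      using x0 xn cf_zero[of n "Suc q"] by auto
    show ?thesis unfolding z if_not_P[OF False] by simp
  qed
  have "2 * t * (\<Sum>q<n. cf n q * cf n (Suc q) * x q * x (Suc (Suc q))) \<le> (\<Sum>q<n. ?a q + ?b q)"
    unfolding sum_distrib_left by (intro sum_mono pt) simp
  also have "\<dots> = (\<Sum>q<n. ?a q) + (\<Sum>q<n. ?b q)" by (rule sum.distrib)
  also have "(\<Sum>q<n. ?a q) = (\<Sum>p\<le>n. ?a p)"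
    by (simp add: lessThan_Suc_atMost[symmetric])
  also have "(\<Sum>q<n. ?b q) = (\<Sum>q<n. ?c (q + 2))"
    by (rule sum.cong[OF refl]) (auto simp: algebra_simps)
  also have "\<dots> = (\<Sum>p\<in>(\<lambda>q. q + 2) ` {..<n}. ?c p)"
    by (rule sum.reindex[unfolded o_def, symmetric]) (auto simp: inj_on_def)
  also have "\<dots> = (\<Sum>p\<in>{3..<n}. ?c p)"
  proof (rule sum.mono_neutral_right)
    show "{3..<n} \<subseteq> (\<lambda>q. q + 2) ` {..<n}"
    proof
      fix p assume "p \<in> {3..<n}"
      then have "p = (p - 2) + 2" "p - 2 \<in> {..<n}" by auto
      then show "p \<in> (\<lambda>q. q + 2) ` {..<n}" by blast
    qed
  qed auto
  also have "\<dots> = (\<Sum>p\<le>n. ?c p)"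
    by (rule sum.mono_neutral_left) auto
  finally have 1: "2 * t * (\<Sum>q<n. cf n q * cf n (Suc q) * x q * x (Suc (Suc q))) \<le> (\<Sum>p\<le>n. ?a p) + (\<Sum>p\<le>n. ?c p)" .
  have "\<Lambda> * ip n x x + (\<Sum>p\<le>n. ?a p) + (\<Sum>p\<le>n. ?c p)
      = (\<Sum>p\<le>n. \<Lambda> * (x p)\<^sup>2 + ?a p + ?c p)"
    by (simp add: ip_def sum.distrib sum_distrib_left power2_eq_square)
  also have "\<dots> \<le> (\<Sum>p\<le>n. (1 + t\<^sup>2) * ((real p * (real n - real p) + real n / 2) * (x p)\<^sup>2))"
  proof (rule sum_mono)
    fix p assume p: "p \<in> {..n}"
    show "\<Lambda> * (x p)\<^sup>2 + ?a p + ?c p \<le> (1 + t\<^sup>2) * ((real p * (real n - real p) + real n / 2) * (x p)\<^sup>2)"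
    proof (cases "p = 0 \<or> p = n")
      case True
      then show ?thesis using x0 xn by auto
    next
      case False
      then have p: "1 \<le> p" "p < n" using p by auto
      have ac: "?a p + ?c p = ((if p + 3 \<le> n then \<bar>t\<bar> * s p * ((real p + 1) * (real n - real p)) else 0)
          + (if 3 \<le> p then \<bar>t\<bar> / s (p - 2) * (real p * (real n - real p + 1)) else 0)) * (x p)\<^sup>2"
        using p by (simp add: distrib_right)
      have "((1 + t\<^sup>2) * (real p * (real n - real p) + real n / 2) - \<Lambda>) * (x p)\<^sup>2
          = (1 + t\<^sup>2) * ((real p * (real n - real p) + real n / 2) * (x p)\<^sup>2) - \<Lambda> * (x p)\<^sup>2"
        by (simp only: left_diff_distrib mult.assoc)
      then show ?thesis
        using mult_right_mono[OF le[OF p], of "(x p)\<^sup>2"] unfolding ac[symmetric] by simp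
    qed
  qed
  finally show ?thesis
    using 1 unfolding energy_eq sum_distrib_left by simp
qed

text \<open>The weights grow away from the two ends of the spectrum of the weight operator; each end
  behaves like a squeezed harmonic oscillator, whose exact ground state corresponds to \<open>\<sigma> = 0\<close>.\<close>

lemma end_weights:
  fixes T :: real
  assumes T: "0 < T" "T < 1"
  obtains \<epsilon> :: real and P :: nat and s :: "nat \<Rightarrow> real" where
    "0 < \<epsilon>" "\<epsilon> \<le> 1/2" "\<And>p. T < s p" "\<And>p. s p \<le> 1" "\<And>p. P \<le> p \<Longrightarrow> s p = 1" "3 \<le> P * (1 - T)"
    "\<And>p. 1 \<le> p \<Longrightarrow> T * s p * (real p + 1) + (if 3 \<le> p then T / s (p - 2) * real p else 0)
       \<le> (1 + T\<^sup>2) * (real p + 1/2) - (1 + 2 * \<epsilon>) * (1 - T\<^sup>2) / 2"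
proof -
  \<comment> \<open>The weights are \<open>T + \<sigma> p\<close>. As \<open>\<sigma> p\<close>
    costs a factor \<open>T\<close> while \<open>\<sigma> (p - 2)\<close> pays in full,
    \<open>\<sigma>\<close> may start like \<open>(1 - T) / (p + 2)\<close>, then grow with slope
    \<open>\<kappa>\<close> until it reaches \<open>1 - T\<close> and the weight is 1. Linear growth
    is admissible once \<open>(1 - T) * p\<close> is at least 4, which fixes \<open>p1\<close>;
    \<open>\<kappa>\<close> makes the two branches meet there. The entries of the minimum
    \<open>\<epsilon>\<close> are the slacks of the different regimes, and \<open>P\<close> lies
    past saturation.\<close>
  define p1 where "p1 = 4 / (1 - T)"
  define \<kappa> where "\<kappa> = (1 - T) / (p1 * (p1 + 2))"
  define \<epsilon> where "\<epsilon> = min (1/2) (min \<kappa> ((1 - T)\<^sup>2))"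
  define m where "m p = max ((1 - T) / (real p + 2)) (\<kappa> * real p)" for p :: nat
  define \<sigma> where "\<sigma> p = min (1 - T) (m p)" for p :: nat
  define P where "P = nat \<lceil>p1 * (p1 + 2)\<rceil>"
  have p1: "p1 > 4" using T by (simp add: p1_def field_simps)
  have \<kappa>: "\<kappa> > 0" using T p1 by (simp add: \<kappa>_def)
  have \<epsilon>: "\<epsilon> > 0" "\<epsilon> \<le> 1/2" "\<epsilon> \<le> \<kappa>" "\<epsilon> \<le> (1 - T)\<^sup>2" using T \<kappa> by (auto simp: \<epsilon>_def)
  have \<epsilon>h: "\<epsilon> * (1 - T\<^sup>2) \<le> \<epsilon>" using \<epsilon> by (simp add: mult_left_le)
  have \<epsilon>h0: "\<epsilon> * (1 - T\<^sup>2) \<ge> 0" using \<epsilon> T by (simp add: power2_eq_square mult_le_one)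
  have m_pos: "m p > 0" for p using T by (simp add: m_def less_max_iff_disj)
  have \<sigma>: "0 < \<sigma> p" "\<sigma> p \<le> 1 - T" "\<sigma> p \<le> m p" for p
    using m_pos[of p] T by (auto simp: \<sigma>_def)
  \<comment> \<open>For \<open>\<sigma> = 0\<close> and \<open>\<epsilon> = 0\<close> the required
    condition is an equality. After subtracting it and using \<open>T / (T + y) \<le> 1 - y\<close>,
    exactly this inequality remains.\<close>
  have key: "T * \<sigma> p * (real p + 1) + \<epsilon> * (1 - T\<^sup>2) \<le> real p * \<sigma> (p - 2)" if p: "3 \<le> p" for p
  proof -
    have p2: "real (p - 2) = real p - 2" using p by simp
    show ?thesis
    proof (cases "\<kappa> * real p \<le> (1 - T) / (real p + 2)")
      case True
      then have "\<sigma> p \<le> (1 - T) / (real p + 2)" using \<sigma>(3)[of p] by (simp add: m_def)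
      then have "T * \<sigma> p * (real p + 1) \<le> T * ((1 - T) / (real p + 2)) * (real p + 1)"
        using T by (intro mult_right_mono mult_left_mono) auto
      also have "\<dots> = (T * (1 - T)) * ((real p + 1) / (real p + 2))" by simp
      also have "\<dots> \<le> (T * (1 - T)) * 1" using T by (intro mult_left_mono) auto
      finally have 1: "T * \<sigma> p * (real p + 1) \<le> T * (1 - T)" by simp
      have "(1 - T) / real p \<le> 1 - T" using mult_left_mono[of 1 "real p" "1 - T"] T p by (simp add: divide_le_eq)
      moreover have "(1 - T) / real p \<le> m (p - 2)" by (simp add: m_def p2)
      ultimately have "(1 - T) / real p \<le> \<sigma> (p - 2)" by (simp add: \<sigma>_def)
      then have "1 - T \<le> real p * \<sigma> (p - 2)" using p by (simp add: field_simps)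
      moreover have "T * (1 - T) + \<epsilon> \<le> 1 - T" using \<epsilon>(4) by (simp add: power2_eq_square algebra_simps)
      ultimately show ?thesis using 1 \<epsilon>h by linarith
    next
      case False
      have "p1 \<le> real p"
      proof (rule ccontr)
        assume "\<not> p1 \<le> real p"
        then have "real p * (real p + 2) \<le> p1 * (p1 + 2)" by (intro mult_mono) auto
        then have "\<kappa> * (real p * (real p + 2)) \<le> \<kappa> * (p1 * (p1 + 2))" using \<kappa> by (simp add: mult_left_mono)
        also have "\<dots> = 1 - T" using p1 by (simp add: \<kappa>_def)
        finally show False using False p by (simp add: field_simps)
      qed
      then have p4: "4 \<le> (1 - T) * real p" using T by (simp add: p1_def field_simps)
      have "\<sigma> p \<le> \<kappa> * real p" using False \<sigma>(3)[of p] by (simp add: m_def)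
      show ?thesis
      proof (cases "1 - T \<le> \<kappa> * real (p - 2)")
        case True
        then have "real p * \<sigma> (p - 2) = real p * (1 - T)" by (simp add: \<sigma>_def m_def max_def)
        moreover have "T * \<sigma> p * (real p + 1) \<le> T * (1 - T) * (real p + 1)"
          using T \<sigma>(2)[of p] by (intro mult_right_mono mult_left_mono) auto
        moreover have "T * (1 - T) * (real p + 1) + (1 - T)\<^sup>2 \<le> real p * (1 - T)"
        proof -
          have "(1 - T) * ((1 - T) * real p - 1) \<ge> 0" using p4 T by simp
          then show ?thesis by (simp add: power2_eq_square algebra_simps)
        qed
        ultimately show ?thesis using \<epsilon>h \<epsilon>(4) by linarith
      next
        case False
        then have "\<kappa> * (real p - 2) \<le> \<sigma> (p - 2)" by (simp add: \<sigma>_def m_def p2)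
        then have 1: "real p * (\<kappa> * (real p - 2)) \<le> real p * \<sigma> (p - 2)" by (simp add: mult_left_mono)
        have "T * \<sigma> p * (real p + 1) \<le> T * (\<kappa> * real p) * (real p + 1)"
          using T \<open>\<sigma> p \<le> \<kappa> * real p\<close> by (intro mult_right_mono mult_left_mono) auto
        moreover have "T * (\<kappa> * real p) * (real p + 1) + \<kappa> \<le> real p * (\<kappa> * (real p - 2))"
        proof -
          have "(1 - T) * real p - 2 - T \<ge> 1" using p4 T by linarith
          then have "\<kappa> * (real p * ((1 - T) * real p - 2 - T)) \<ge> \<kappa> * (1 * 1)"
            using \<kappa> p by (intro mult_left_mono mult_mono) auto
          then show ?thesis by (simp add: algebra_simps)
        qed
        ultimately show ?thesis using 1 \<epsilon>h \<epsilon>(3) by linarith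
      qed
    qed
  qed
  show thesis
  proof (rule that[of \<epsilon> "\<lambda>p. T + \<sigma> p" P])
    show "0 < \<epsilon>" "\<epsilon> \<le> 1/2" by fact+
    show "T < T + \<sigma> p" "T + \<sigma> p \<le> 1" for p using \<sigma>[of p] by auto
    have P: "p1 * (p1 + 2) \<le> real P" unfolding P_def by (rule real_nat_ceiling_ge)
    show "T + \<sigma> p = 1" if "P \<le> p" for p
    proof -
      have "\<kappa> * (p1 * (p1 + 2)) \<le> \<kappa> * real p" using \<kappa> P that by (intro mult_left_mono) auto
      then have "1 - T \<le> \<kappa> * real p" using p1 by (simp add: \<kappa>_def)
      then show ?thesis by (simp add: \<sigma>_def m_def max_def)
    qed
    have "p1 * 1 \<le> p1 * (p1 + 2)" using p1 by (intro mult_left_mono) auto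
    then have "4 / (1 - T) \<le> real P" using P p1_def by linarith
    then show "3 \<le> P * (1 - T)" using T by (simp add: field_simps)
    fix p :: nat assume p: "1 \<le> p"
    have T2: "T * (1 - T) \<le> 1/4"
      using zero_le_power2[of "T - 1/2"] by (simp add: power2_eq_square algebra_simps)
    have rhs: "(1 + T\<^sup>2) * (real p + 1/2) - (1 + 2 * \<epsilon>) * (1 - T\<^sup>2) / 2 = (1 + T\<^sup>2) * real p + T\<^sup>2 - \<epsilon> * (1 - T\<^sup>2)"
      by (simp add: field_simps)
    have first: "T * (T + \<sigma> p) * (real p + 1) = T\<^sup>2 * real p + T\<^sup>2 + T * \<sigma> p * (real p + 1)"
      by (simp add: power2_eq_square algebra_simps)
    show "T * (T + \<sigma> p) * (real p + 1) + (if 3 \<le> p then T / (T + \<sigma> (p - 2)) * real p else 0)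
       \<le> (1 + T\<^sup>2) * (real p + 1/2) - (1 + 2 * \<epsilon>) * (1 - T\<^sup>2) / 2"
    proof (cases "3 \<le> p")
      case True
      let ?y = "\<sigma> (p - 2)"
      have "T \<le> (1 - ?y) * (T + ?y)"
      proof -
        have "0 \<le> ?y * (1 - T - ?y)" using \<sigma>[of "p - 2"] by (intro mult_nonneg_nonneg) auto
        then show ?thesis by (simp add: algebra_simps)
      qed
      then have "T / (T + ?y) \<le> 1 - ?y" using \<sigma>[of "p - 2"] T by (simp add: field_simps)
      then have "T / (T + ?y) * real p \<le> (1 - ?y) * real p" by (intro mult_right_mono) auto
      then show ?thesis unfolding rhs first using key[OF True] True by (simp add: algebra_simps)
    next
      case False
      then have "p = 1 \<or> p = 2" using p by auto
      moreover have "T * \<sigma> p \<le> T * (1 - T)" using \<sigma>(2)[of p] T by (intro mult_left_mono) auto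
      ultimately have "T * \<sigma> p * (real p + 1) + \<epsilon> * (1 - T\<^sup>2) \<le> real p"
        using T2 \<epsilon>h \<epsilon>(2) by auto
      then show ?thesis unfolding rhs first using False by (simp add: algebra_simps)
    qed
  qed
qed

text \<open>Hypothesis \<open>lead\<close> is the oscillator limit of the condition. Multiplied by
  \<open>n - p\<close> it gives the condition for finite \<open>n\<close> up to errors of size at
  most \<open>2 * p\<close>; lowering the gap from \<open>1 + 2 * \<epsilon>\<close> to
  \<open>1 + \<epsilon>\<close> frees \<open>\<epsilon> * (1 - T^2) * n / 2\<close>, which covers
  them.\<close>

lemma end_weight_step:
  fixes T s X \<epsilon> :: real
  assumes T: "0 < T" "T < 1" and X: "0 \<le> X" "X \<le> 1" and \<epsilon>: "0 < \<epsilon>" "\<epsilon> \<le> 1/2"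
    and lead: "T * s * (real p + 1) + X * real p \<le> (1 + T\<^sup>2) * (real p + 1/2) - (1 + 2 * \<epsilon>) * (1 - T\<^sup>2) / 2"
    and p: "p \<le> n" "4 * real p \<le> \<epsilon> * (1 - T\<^sup>2) * real n"
  shows "T * s * ((real p + 1) * (real n - real p)) + X * (real p * (real n - real p + 1))
    \<le> (1 + T\<^sup>2) * (real p * (real n - real p) + real n / 2) - (1 + \<epsilon>) * (1 - T\<^sup>2) * real n / 2"
proof -
  let ?h = "1 - T\<^sup>2" and ?q = "real n - real p"
  have T2: "T\<^sup>2 \<le> 1" using T by (simp add: power_le_one)
  have "(T * s * (real p + 1) + X * real p) * ?q
      \<le> ((1 + T\<^sup>2) * (real p + 1/2) - (1 + 2 * \<epsilon>) * ?h / 2) * ?q"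
    using p by (intro mult_right_mono lead) auto
  moreover have "X * real p \<le> 1 * real p" using X by (intro mult_right_mono) auto
  moreover have "(1 + 2 * \<epsilon>) * ?h * real p \<le> 2 * 1 * real p"
    using \<epsilon> T2 T by (intro mult_right_mono mult_mono) auto
  moreover have "0 \<le> (1 + T\<^sup>2) * real p" by simp
  moreover have "(1 + T\<^sup>2) * (real p * ?q + real n / 2) - (1 + \<epsilon>) * ?h * real n / 2
      - (T * s * ((real p + 1) * ?q) + X * (real p * (?q + 1)))
    = ((1 + T\<^sup>2) * (real p + 1/2) - (1 + 2 * \<epsilon>) * ?h / 2) * ?q - (T * s * (real p + 1) + X * real p) * ?q
      + (1 + T\<^sup>2) * real p / 2 + \<epsilon> * ?h * real n / 2 - (1 + 2 * \<epsilon>) * ?h * real p / 2 - X * real p"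
    by (simp add: field_simps)
  ultimately show ?thesis using p(2) by linarith
qed

text \<open>The weights of \<open>end_weights\<close> serve at index 0, their mirror image at index
  \<open>n\<close>, and the constant weight 1 in between, where plain AM-GM already leaves a surplus
  proportional to \<open>p * (n - p)\<close>.\<close>

lemma energy_gap:
  assumes T: "0 < \<bar>t\<bar>" "\<bar>t\<bar> < 1"
  obtains \<epsilon> :: real and N :: nat where "0 < \<epsilon>"
    "\<And>n x. N \<le> n \<Longrightarrow> x 0 = 0 \<Longrightarrow> x n = 0 \<Longrightarrow>
       (1 + \<epsilon>) * (1 - t\<^sup>2) * real n / 2 * ip n x x \<le> energy t n x"
proof -
  define T where "T = \<bar>t\<bar>"
  have T: "0 < T" "T < 1" and t2: "t\<^sup>2 = T\<^sup>2" using T by (auto simp: T_def)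
  obtain \<epsilon> :: real and P :: nat and s :: "nat \<Rightarrow> real" where \<epsilon>: "0 < \<epsilon>" "\<epsilon> \<le> 1/2"
    and s: "\<And>p. T < s p" "\<And>p. s p \<le> 1" "\<And>p. P \<le> p \<Longrightarrow> s p = (1::real)"
    and P: "3 \<le> P * (1 - T)"
    and lead: "\<And>p. 1 \<le> p \<Longrightarrow> T * s p * (real p + 1) + (if 3 \<le> p then T / s (p - 2) * real p else 0)
       \<le> (1 + T\<^sup>2) * (real p + 1/2) - (1 + 2 * \<epsilon>) * (1 - T\<^sup>2) / 2"
    by (rule end_weights[OF T]) (rule that)
  let ?h = "1 - T\<^sup>2"
  have h: "0 < ?h" "?h \<le> 1" using T by (simp_all add: power_less_one_iff)
  \<comment> \<open>The first entry keeps the two ends apart, the second makes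
    \<open>end_weight_step\<close> applicable for all \<open>p\<close> up to
    \<open>P + 2\<close>.\<close>
  define N where "N = max (2 * P + 10) (nat \<lceil>4 * (P + 2) / (\<epsilon> * ?h)\<rceil>)"
  show thesis
  proof (rule that[OF \<epsilon>(1)])
    fix n :: nat and x :: "nat \<Rightarrow> real"
    assume n: "N \<le> n" and x: "x 0 = 0" "x n = 0"
    have n1: "2 * P + 10 \<le> n" using n by (simp add: N_def)
    have "4 * (P + 2) / (\<epsilon> * ?h) \<le> real n"
      using n by (simp add: N_def)
    then have n2: "4 * real (P + 2) \<le> \<epsilon> * ?h * real n"
      using \<epsilon> h by (simp add: field_simps)
    \<comment> \<open>The reflection of indices sends the link starting at \<open>p\<close> to the
      one starting at \<open>n - 2 - p\<close> and exchanges its two endpoints; hence the shifted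
      index and the reciprocal.\<close>
    define r where "r p = (if 2 * p + 2 \<le> n then s p else 1 / s (n - 2 - p))" for p
    have s0: "0 < s p" for p using s(1)[of p] T by linarith
    have X: "0 \<le> T / s p" "T / s p \<le> 1" for p
      using s(1)[of p] s0[of p] T by (auto simp: field_simps)
    have r1: "r p = 1" if "P \<le> p" "p + P + 2 \<le> n" for p
      using that s(3) by (auto simp: r_def)
    have left: "T * s p * ((real p + 1) * (real n - real p))
        + (if 3 \<le> p then T / s (p - 2) * (real p * (real n - real p + 1)) else 0)
        \<le> (1 + T\<^sup>2) * (real p * (real n - real p) + real n / 2) - (1 + \<epsilon>) * ?h * real n / 2"
      if "1 \<le> p" "p \<le> P + 2" for p
      using end_weight_step[OF T _ _ \<epsilon>, of "if 3 \<le> p then T / s (p - 2) else 0" "s p" p n]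
        lead[OF that(1)] X that n1 n2 by (auto split: if_splits)
    have "(1 + \<epsilon>) * (1 - t\<^sup>2) * real n / 2 * ip n x x \<le> energy t n x"
    proof (rule energy_ge_Jacobi[where s = r])
      show "0 < r p" for p using s0 by (simp add: r_def)
      show "x 0 = 0" "x n = 0" by fact+
      fix p assume p: "1 \<le> p" "p < n"
      show "(if p + 3 \<le> n then \<bar>t\<bar> * r p * ((real p + 1) * (real n - real p)) else 0)
        + (if 3 \<le> p then \<bar>t\<bar> / r (p - 2) * (real p * (real n - real p + 1)) else 0)
        \<le> (1 + t\<^sup>2) * (real p * (real n - real p) + real n / 2) - (1 + \<epsilon>) * (1 - t\<^sup>2) * real n / 2"
        unfolding T_def[symmetric] t2
      proof -
        consider "p \<le> P + 2" | "P + 2 < p" "p + P + 2 < n" | "n \<le> p + P + 2" by linarith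
        then show "(if p + 3 \<le> n then T * r p * ((real p + 1) * (real n - real p)) else 0)
          + (if 3 \<le> p then T / r (p - 2) * (real p * (real n - real p + 1)) else 0)
          \<le> (1 + T\<^sup>2) * (real p * (real n - real p) + real n / 2) - (1 + \<epsilon>) * ?h * real n / 2"
        proof cases
          case 1
          then have "r p = s p" "r (p - 2) = s (p - 2)" "p + 3 \<le> n" using n1 by (auto simp: r_def)
          then show ?thesis using left[OF p(1) 1] by (cases "3 \<le> p") simp_all
        next
          case 2
          then have "r p = 1" "r (p - 2) = 1" using r1 by auto
          \<comment> \<open>In this range \<open>p * (n - p)\<close> is at least
            \<open>P * (n - P)\<close>, hence at least \<open>P * n / 2\<close>, and
            \<open>3 \<le> P * (1 - T)\<close> outweighs \<open>(1 + \<epsilon>) * (1 + T)\<close>,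
            which is at most 3.\<close>
          have "(1 + \<epsilon>) * ?h * real n / 2 \<le> (1 - T)\<^sup>2 * (real p * (real n - real p))"
          proof -
            have "0 \<le> (real p - real P) * (real n - real p - real P)"
              using 2 by (intro mult_nonneg_nonneg) auto
            then have "real P * (real n - real P) \<le> real p * (real n - real p)" by (simp add: algebra_simps)
            moreover have "real P * (real n / 2) \<le> real P * (real n - real P)"
              using n1 by (intro mult_left_mono) auto
            ultimately have a: "real P * (real n / 2) \<le> real p * (real n - real p)" by linarith
            have "(1 + \<epsilon>) * (1 + T) \<le> (3/2) * 2" using \<epsilon> T by (intro mult_mono) auto
            then have "(1 + \<epsilon>) * (1 + T) * (1 - T) \<le> real P * (1 - T) * (1 - T)"
              using P T by (intro mult_right_mono) auto
            then have "(1 + \<epsilon>) * ?h \<le> (1 - T)\<^sup>2 * real P" by (simp add: power2_eq_square algebra_simps)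
            then have "(1 + \<epsilon>) * ?h * (real n / 2) \<le> (1 - T)\<^sup>2 * real P * (real n / 2)"
              by (intro mult_right_mono) auto
            also have "\<dots> \<le> (1 - T)\<^sup>2 * (real p * (real n - real p))"
              using mult_left_mono[OF a, of "(1 - T)\<^sup>2"] by (simp add: mult.assoc)
            finally show ?thesis by simp
          qed
          moreover have "0 \<le> (1 - T)\<^sup>2 * (real n / 2)" by simp
          moreover have "(1 + T\<^sup>2) * (real p * (real n - real p) + real n / 2)
              = T * ((real p + 1) * (real n - real p)) + T * (real p * (real n - real p + 1))
                + (1 - T)\<^sup>2 * (real p * (real n - real p)) + (1 - T)\<^sup>2 * (real n / 2)"
            by (simp add: power2_eq_square field_simps)
          ultimately have "T * ((real p + 1) * (real n - real p)) + T * (real p * (real n - real p + 1))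
            \<le> (1 + T\<^sup>2) * (real p * (real n - real p) + real n / 2) - (1 + \<epsilon>) * ?h * real n / 2"
            by linarith
          then show ?thesis using \<open>r p = 1\<close> \<open>r (p - 2) = 1\<close> 2 by simp
        next
          case 3
          define q where "q = n - p"
          have q: "1 \<le> q" "q \<le> P + 2" "p = n - q" "q \<le> n" using p 3 by (auto simp: q_def)
          have rp: "real p = real n - real q" using q by simp
          have "r p = 1 / s (q - 2)" if "3 \<le> q"
          proof -
            have "n - 2 - p = q - 2" "\<not> 2 * p + 2 \<le> n" using that q n1 by auto
            then show ?thesis unfolding r_def by simp
          qed
          moreover have "r (p - 2) = 1 / s q"
          proof -
            have "n - 2 - (p - 2) = q" "\<not> 2 * (p - 2) + 2 \<le> n" using q n1 by auto
            then show ?thesis unfolding r_def by simp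
          qed
          moreover have "3 \<le> p" "p + 3 \<le> n \<longleftrightarrow> 3 \<le> q" using q n1 by auto
          moreover have "(real p + 1) * (real n - real p) = real q * (real n - real q + 1)"
            "real p * (real n - real p + 1) = (real q + 1) * (real n - real q)"
            "real p * (real n - real p) = real q * (real n - real q)"
            by (simp_all add: rp algebra_simps)
          ultimately show ?thesis using left[OF q(1,2)] by (cases "3 \<le> q") simp_all
        qed
      qed
    qed
    then show "(1 + \<epsilon>) * (1 - t\<^sup>2) * real n / 2 * ip n x x \<le> energy t n x" .
  qed
qed

text \<open>Write \<open>E\<close>, \<open>R\<close>, \<open>H\<close> as below. The bound of
  \<open>Qm_form_ge\<close> is \<open>(E - 4 * |t| * R) * E - (H * R)^2\<close>, and both factors
  are at least \<open>H * R\<close>: the energy gap gives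
  \<open>E \<ge> (1 + \<epsilon>) * H * R\<close>, and for large \<open>n\<close> the surplus
  \<open>\<epsilon> * H\<close> exceeds \<open>4 * |t|\<close>.\<close>

lemma Qm_nonneg_off_ends:
  assumes T: "0 < \<bar>t\<bar>" "\<bar>t\<bar> < 1"
  obtains N :: nat where "\<And>n x. N \<le> n \<Longrightarrow> x 0 = 0 \<Longrightarrow> x n = 0 \<Longrightarrow> 0 \<le> ip n (Qm t n x) x"
proof -
  obtain \<epsilon> N where \<epsilon>: "0 < \<epsilon>" and gap: "\<And>n x. N \<le> n \<Longrightarrow> x 0 = 0 \<Longrightarrow> x n = 0 \<Longrightarrow>
       (1 + \<epsilon>) * (1 - t\<^sup>2) * real n / 2 * ip n x x \<le> energy t n x"
    by (rule energy_gap[OF T]) (rule that)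
  let ?h = "1 - t\<^sup>2"
  have h: "0 < ?h" using T by (simp add: abs_square_less_1)
  show thesis
  proof (rule that[of "max N (nat \<lceil>8 * \<bar>t\<bar> * (1 + \<epsilon>) / (\<epsilon> * ?h)\<rceil>)"])
    fix n :: nat and x :: "nat \<Rightarrow> real"
    assume "max N (nat \<lceil>8 * \<bar>t\<bar> * (1 + \<epsilon>) / (\<epsilon> * ?h)\<rceil>) \<le> n" and x: "x 0 = 0" "x n = 0"
    then have n: "N \<le> n" "8 * \<bar>t\<bar> * (1 + \<epsilon>) / (\<epsilon> * ?h) \<le> real n" by auto
    then have n2: "8 * \<bar>t\<bar> * (1 + \<epsilon>) \<le> \<epsilon> * ?h * real n" using \<epsilon> h by (simp add: field_simps)
    define R where "R = ip n x x"
    define E where "E = energy t n x"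
    define H where "H = ?h * real n / 2"
    show "0 \<le> ip n (Qm t n x) x"
    proof (cases "R = 0")
      case True
      have "(ip n (Qm t n x) x)\<^sup>2 \<le> ip n (Qm t n x) (Qm t n x) * R"
        unfolding R_def by (rule ip_Cauchy_Schwarz)
      then show ?thesis using True by simp
    next
      case False
      then have R: "0 < R" using ip_nonneg[of n x] by (simp add: R_def)
      have H: "0 \<le> H" using h by (simp add: H_def)
      have g: "(1 + \<epsilon>) * H * R \<le> E" using gap[OF n(1) x] by (simp add: R_def E_def H_def)
      have tH: "4 * \<bar>t\<bar> * (1 + \<epsilon>) \<le> \<epsilon> * H" using n2 by (simp add: H_def)
      then have tH': "4 * \<bar>t\<bar> * 1 \<le> \<epsilon> * H" using \<epsilon> mult_left_mono[of 1 "1+\<epsilon>" "4 * \<bar>t\<bar>"] by linarith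
      have "(E - 4 * \<bar>t\<bar> * R) * E \<ge> (H * R) * (H * R)"
      proof (intro mult_mono)
        have "\<epsilon> * H * R \<ge> 4 * \<bar>t\<bar> * R" using tH' R by simp
        then show "H * R \<le> E - 4 * \<bar>t\<bar> * R" using g by (simp add: algebra_simps)
        have "0 \<le> \<epsilon> * H * R" using \<epsilon> H R by simp
        then show "H * R \<le> E" using g by (simp add: algebra_simps)
        show "0 \<le> H * R" using H R by simp
        then show "0 \<le> E - 4 * \<bar>t\<bar> * R" using \<open>H * R \<le> E - 4 * \<bar>t\<bar> * R\<close> by linarith
      qed
      then have "0 \<le> E\<^sup>2 - 4 * \<bar>t\<bar> * E * R - H\<^sup>2 * R\<^sup>2" by (simp add: power2_eq_square algebra_simps)
      also have "\<dots> \<le> ip n (Qm t n x) x * R"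
        using Qm_form_ge[of t n x] by (simp add: R_def E_def H_def)
      finally show ?thesis using R by (simp add: zero_le_mult_iff)
    qed
  qed
qed

text \<open>An approximate null vector concentrated at index \<open>0\<close>: \<open>Zb t n\<close> maps it to a
  multiple of the last basis vector, and to \<open>0\<close> if \<open>n\<close> is even.\<close>

fun nullv :: "real \<Rightarrow> nat \<Rightarrow> nat \<Rightarrow> real" where
  "nullv t n 0 = 1"
| "nullv t n (Suc 0) = 0"
| "nullv t n (Suc (Suc p)) = (if Suc (Suc p) \<le> n then t * cf n p / cf n (Suc p) * nullv t n p else 0)"

lemma nullv_odd: "odd p \<Longrightarrow> nullv t n p = 0"
  by (induction t n p rule: nullv.induct) auto

text \<open>The squared ratio of successive coefficients contains
  \<open>(n - p) / (n - p - 1)\<close>, which spoils plain geometric decay near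
  \<open>p = n\<close>. The factor \<open>n + 1 - p\<close> compensates for it, so that every step
  of length 2 gains the full \<open>t^2\<close>.\<close>

lemma nullv_sq_le:
  assumes "p \<le> n"
  shows "(nullv t n p)\<^sup>2 * (real n + 1 - real p) \<le> (real n + 1) * \<bar>t\<bar> ^ p"
  using assms
proof (induction t n p rule: nullv.induct)
  case (3 t n p)
  let ?f = "(nullv t n p)\<^sup>2"
  have p: "Suc (Suc p) \<le> n" using 3 by simp
  define c where "c = (cf n p / cf n (Suc p))\<^sup>2"
  have c: "c = (real p + 1) * (real n - real p) / ((real p + 2) * (real n - real p - 1))"
    using p by (simp add: c_def power_divide power2_eq_square cf_sq_le add.commute algebra_simps)
  have "c * (real n + 1 - real (Suc (Suc p))) \<le> real n + 1 - real p"
  proof -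
    have d: "real n + 1 - real (Suc (Suc p)) = real n - real p - 1" "real n - real p - 1 > 0" using p by auto
    have "c * (real n + 1 - real (Suc (Suc p))) = (real p + 1) / (real p + 2) * (real n - real p)"
      unfolding c d(1) using d(2) by simp
    also have "\<dots> \<le> 1 * (real n - real p)" using p by (intro mult_right_mono) auto
    finally show ?thesis by simp
  qed
  then have "c * (real n + 1 - real (Suc (Suc p))) * ?f \<le> (real n + 1 - real p) * ?f"
    by (intro mult_right_mono) auto
  also have "\<dots> \<le> (real n + 1) * \<bar>t\<bar> ^ p" using 3 p by (simp add: mult.commute)
  finally have "t\<^sup>2 * (c * (real n + 1 - real (Suc (Suc p))) * ?f) \<le> t\<^sup>2 * ((real n + 1) * \<bar>t\<bar> ^ p)"
    by (intro mult_left_mono) auto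
  moreover have "(nullv t n (Suc (Suc p)))\<^sup>2 = t\<^sup>2 * (c * ?f)"
    using p by (simp add: c_def power_mult_distrib power_divide)
  ultimately show ?case by (simp add: mult_ac power2_eq_square)
qed auto

lemma nullv_sq_le':
  assumes "p \<le> n" shows "(nullv t n p)\<^sup>2 \<le> (real n + 1) * \<bar>t\<bar> ^ p"
proof -
  have "(nullv t n p)\<^sup>2 * 1 \<le> (nullv t n p)\<^sup>2 * (real n + 1 - real p)"
    using assms by (intro mult_left_mono) auto
  then show ?thesis using nullv_sq_le[OF assms, of t] by linarith
qed

lemma Zb_nullv:
  "Zb t n (nullv t n) p = (if p = n then t * up n (nullv t n) n else 0)"
proof (cases p)
  case 0
  then show ?thesis by (simp add: Zb_def dn_def)
next
  case (Suc q)
  then show ?thesis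
    using cf_pos[of "Suc q" n] by (auto simp: Zb_def dn_def cf_zero not_le) 
qed

section \<open>Norm bounds, the reflection, and the lower bound for large degree\<close>

lemma ip_add_le: "ip n (\<lambda>p. x p + y p) (\<lambda>p. x p + y p) \<le> 2 * ip n x x + 2 * ip n y y"
  using ip_nonneg[of n "\<lambda>p. x p - y p"] by (simp add: ip_simps ip_commute[of n y x])

lemma ip_up_le: "ip n (up n x) (up n x) \<le> (real n + 1)\<^sup>2 * ip n x x"
  and ip_dn_le: "ip n (dn n x) (dn n x) \<le> (real n + 1)\<^sup>2 * ip n x x"
proof -
  have c: "cf n p * cf n p \<le> (real n + 1)\<^sup>2" if "p \<le> n" for p
    unfolding cf_sq_le[OF that] power2_eq_square using that by (intro mult_mono) auto
  have "ip n (up n x) (up n x) = (\<Sum>p\<le>n. (cf n p * cf n p) * (x p * x p))"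
    unfolding ip_up by (simp add: ip_def dn_def mult_ac)
  also have "\<dots> \<le> (\<Sum>p\<le>n. (real n + 1)\<^sup>2 * (x p * x p))"
    by (intro sum_mono mult_right_mono c) auto
  finally show "ip n (up n x) (up n x) \<le> (real n + 1)\<^sup>2 * ip n x x"
    by (simp add: ip_def sum_distrib_left)
  have "ip n (dn n x) (dn n x) = (\<Sum>p<n. (cf n p * cf n p) * (x (Suc p) * x (Suc p)))"
    unfolding ip_dn by (simp add: ip_def sum.atMost_shift dn_def mult_ac)
  also have "\<dots> \<le> (\<Sum>p<n. (real n + 1)\<^sup>2 * (x (Suc p) * x (Suc p)))"
    by (intro sum_mono mult_right_mono c) auto
  also have "\<dots> \<le> (real n + 1)\<^sup>2 * ip n x x"
    by (simp add: ip_def sum.atMost_shift sum_distrib_left distrib_left)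
  finally show "ip n (dn n x) (dn n x) \<le> (real n + 1)\<^sup>2 * ip n x x" .
qed

lemma ip_Za_le: assumes "\<bar>t\<bar> \<le> 1" shows "ip n (Za t n x) (Za t n x) \<le> 4 * (real n + 1)\<^sup>2 * ip n x x"
  and ip_Zb_le: "ip n (Zb t n x) (Zb t n x) \<le> 4 * (real n + 1)\<^sup>2 * ip n x x"
proof -
  have sc: "ip n (\<lambda>p. c * y p) (\<lambda>p. c * y p) \<le> ip n y y" if "\<bar>c\<bar> \<le> 1" for c y
  proof -
    have "c * c \<le> 1" using that by (metis abs_square_le_1 power2_eq_square)
    then have "(c * c) * ip n y y \<le> 1 * ip n y y" by (intro mult_right_mono ip_nonneg)
    then show ?thesis by (simp add: ip_simps)
  qed
  have "Za t n x = (\<lambda>p. up n x p + (- t) * dn n x p)" by (simp add: Za_abs)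
  then show "ip n (Za t n x) (Za t n x) \<le> 4 * (real n + 1)\<^sup>2 * ip n x x"
    using ip_add_le[of n "up n x" "\<lambda>p. (- t) * dn n x p"] sc[of "- t" "dn n x"] ip_up_le[of n x] ip_dn_le[of n x] assms
    by simp
  have "Zb t n x = (\<lambda>p. t * up n x p + (- 1) * dn n x p)" by (simp add: Zb_abs)
  then show "ip n (Zb t n x) (Zb t n x) \<le> 4 * (real n + 1)\<^sup>2 * ip n x x"
    using ip_add_le[of n "\<lambda>p. t * up n x p" "\<lambda>p. (- 1) * dn n x p"] sc[of "- 1" "dn n x"] sc[of t "up n x"]
      ip_up_le[of n x] ip_dn_le[of n x] assms
    by simp
qed

text \<open>Since \<open>Qm\<close> factors through \<open>Zb\<close>, a vector with tiny image
  under \<open>Zb\<close> has tiny image under \<open>Qm\<close>. Crude bounds for the remaining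
  factors suffice, as a polynomial loss in \<open>n\<close> is harmless against
  \<open>|t| ^ n\<close>.\<close>

lemma ip_Qm_le:
  assumes t: "\<bar>t\<bar> \<le> 1"
  shows "ip n (Qm t n x) (Qm t n x) \<le> 256 * (real n + 1) ^ 6 * ip n (Zb t n x) (Zb t n x)"
proof -
  define N where "N = (real n + 1)\<^sup>2"
  let ?y = "Zb t n x"
  have za: "ip n (Za t n y) (Za t n y) \<le> 4 * N * ip n y y"
    and zb: "ip n (Zb t n y) (Zb t n y) \<le> 4 * N * ip n y y" for y
    unfolding N_def by (rule ip_Za_le[OF t] ip_Zb_le[OF t])+
  have N: "1 \<le> N" by (simp add: N_def one_le_power)
  have 1: "ip n (Za t n (Za t n ?y)) (Za t n (Za t n ?y)) \<le> 16 * N * N * ip n ?y ?y"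
  proof -
    have "ip n (Za t n (Za t n ?y)) (Za t n (Za t n ?y)) \<le> 4 * N * ip n (Za t n ?y) (Za t n ?y)"
      by (rule za)
    also have "\<dots> \<le> 4 * N * (4 * N * ip n ?y ?y)"
      by (intro mult_left_mono za) (use N in auto)
    finally show ?thesis by (simp add: algebra_simps)
  qed
  have 2: "ip n (\<lambda>p. 4 * t * ?y p) (\<lambda>p. 4 * t * ?y p) \<le> 16 * ip n ?y ?y"
  proof -
    have "t * t \<le> 1" using t by (metis abs_square_le_1 power2_eq_square)
    then have "16 * (t * t) * ip n ?y ?y \<le> 16 * 1 * ip n ?y ?y" by (intro mult_right_mono mult_left_mono ip_nonneg) auto
    then show ?thesis by (simp add: ip_simps mult_ac)
  qed
  have "1 * 1 * ip n ?y ?y \<le> N * N * ip n ?y ?y" using N by (intro mult_right_mono mult_mono ip_nonneg) auto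
  then have 3: "ip n (\<lambda>p. Za t n (Za t n ?y) p + 4 * t * ?y p) (\<lambda>p. Za t n (Za t n ?y) p + 4 * t * ?y p)
      \<le> 64 * N * N * ip n ?y ?y"
    using 1 2 ip_add_le[of n "Za t n (Za t n ?y)" "\<lambda>p. 4 * t * ?y p"] by simp
  have "ip n (Qm t n x) (Qm t n x) \<le> 4 * N * (64 * N * N * ip n ?y ?y)"
    unfolding Qm_def by (rule order_trans[OF zb mult_left_mono[OF 3]]) (use N in auto)
  also have "\<dots> = 256 * (real n + 1) ^ 6 * ip n ?y ?y"
    by (simp add: N_def eval_nat_numeral)
  finally show ?thesis .
qed

text \<open>The Weyl reflection. It exchanges \<open>up\<close> and \<open>dn\<close>, hence
  \<open>Za\<close> and \<open>Zb\<close> up to sign, and by \<open>Qm_swap\<close> it commutes with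
  \<open>Qm\<close>; so it carries the approximate null vector at index 0 to one at index
  \<open>n\<close>.\<close>

definition rv :: "nat \<Rightarrow> (nat \<Rightarrow> real) \<Rightarrow> nat \<Rightarrow> real" where
  "rv n x p = (if p \<le> n then x (n - p) else 0)"

lemma cf_rev: "q < n \<Longrightarrow> cf n (n - Suc q) = cf n q"
  by (simp add: cf_def mult.commute of_nat_diff Suc_diff_Suc)

lemma up_rv: "up n (rv n x) = rv n (dn n x)"
proof
  fix p show "up n (rv n x) p = rv n (dn n x) p"
  proof (cases p)
    case 0 then show ?thesis by (simp add: rv_def dn_def cf_zero)
  next
    case (Suc q) then show ?thesis
      by (auto simp: rv_def dn_def cf_zero cf_rev Suc_diff_Suc not_le)
  qed
qed

lemma dn_rv: "dn n (rv n x) = rv n (up n x)"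
proof
  fix p show "dn n (rv n x) p = rv n (up n x) p"
  proof (cases "p < n")
    case True
    then have "n - p = Suc (n - Suc p)" by simp
    then show ?thesis using True by (simp add: rv_def dn_def cf_rev)
  qed (auto simp: rv_def dn_def cf_zero)
qed

lemma rv_lin: "rv n (\<lambda>p. x p + y p) = (\<lambda>p. rv n x p + rv n y p)"
   "rv n (\<lambda>p. x p - y p) = (\<lambda>p. rv n x p - rv n y p)"
   "rv n (\<lambda>p. a * x p) = (\<lambda>p. a * rv n x p)"
  by (auto simp: rv_def)

lemma Qm_rv: "Qm t n (rv n x) = rv n (Qm t n x)"
proof -
  have a: "Za t n (rv n y) = (\<lambda>p. (- 1) * rv n (Zb t n y) p)" and b: "Zb t n (rv n y) = (\<lambda>p. (- 1) * rv n (Za t n y) p)" for y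
    by (simp_all add: Za_abs Zb_abs up_rv dn_rv rv_lin)
  show ?thesis
    by (subst (2) Qm_swap) (simp only: Qm_def a b Z_lin rv_lin, simp)
qed

lemma ip_rv: "ip n (rv n x) (rv n y) = ip n x y"
  unfolding ip_def
  by (rule sum.reindex_bij_witness[of _ "\<lambda>p. n - p" "\<lambda>p. n - p"]) (auto simp: rv_def)

text \<open>What is left sits at index \<open>n\<close> and is fed by entry \<open>n - 1\<close>.
  For even \<open>n\<close> that entry has odd index and vanishes, so the null vector is exact; for
  odd \<open>n\<close> it is exponentially small.\<close>

lemma Zb_nullv_sq_le:
  assumes "1 \<le> n" and t: "\<bar>t\<bar> \<le> 1"
  shows "ip n (Zb t n (nullv t n)) (Zb t n (nullv t n)) \<le> (if odd n then (real n + 1)\<^sup>2 * \<bar>t\<bar> ^ n else 0)"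
proof -
  obtain m where m: "n = Suc m" using assms by (cases n) auto
  have "ip n (Zb t n (nullv t n)) (Zb t n (nullv t n)) = (\<Sum>p\<le>n. if p = n then (t * up n (nullv t n) n)\<^sup>2 else 0)"
    unfolding ip_def Zb_nullv by (intro sum.cong) (auto simp: power2_eq_square)
  also have "\<dots> = (t * up n (nullv t n) n)\<^sup>2" by simp
  also have "\<dots> = t\<^sup>2 * (real m + 1) * (nullv t n m)\<^sup>2"
    using cf_sq_le[of m n] m by (simp add: power_mult_distrib power2_eq_square)
  finally have e: "ip n (Zb t n (nullv t n)) (Zb t n (nullv t n)) = t\<^sup>2 * (real m + 1) * (nullv t n m)\<^sup>2" .
  show ?thesis
  proof (cases "odd n")
    case True
    have tt: "t\<^sup>2 = \<bar>t\<bar> * \<bar>t\<bar>" by (simp add: power2_eq_square)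
    have "t\<^sup>2 * (real m + 1) * (nullv t n m)\<^sup>2 \<le> t\<^sup>2 * (real m + 1) * ((real n + 1) * \<bar>t\<bar> ^ m)"
      using m by (intro mult_left_mono nullv_sq_le') auto
    also have "\<dots> = (real m + 1) * (real n + 1) * (\<bar>t\<bar> ^ n * \<bar>t\<bar>)"
      unfolding tt m power_Suc by (simp only: mult_ac)
    also have "\<dots> \<le> (real n + 1) * (real n + 1) * (\<bar>t\<bar> ^ n * 1)"
      using m t by (intro mult_mono) auto
    finally show ?thesis using e True by (simp add: power2_eq_square)
  next
    case False
    then have "nullv t n m = 0" using m by (intro nullv_odd) auto
    then show ?thesis using e False by simp
  qed
qed

lemma ip_nullv_le:
  assumes t: "\<bar>t\<bar> \<le> 1"
  shows "ip n (nullv t n) (nullv t n) \<le> (real n + 1)\<^sup>2"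
proof -
  have "ip n (nullv t n) (nullv t n) \<le> (\<Sum>p\<le>n. real n + 1)"
    unfolding ip_def
  proof (rule sum_mono)
    fix p assume "p \<in> {..n}"
    then have "(nullv t n p)\<^sup>2 \<le> (real n + 1) * \<bar>t\<bar> ^ p" by (simp add: nullv_sq_le')
    also have "\<dots> \<le> (real n + 1) * 1" using t by (intro mult_left_mono power_le_one) auto
    finally show "nullv t n p * nullv t n p \<le> real n + 1" by (simp add: power2_eq_square)
  qed
  then show ?thesis by (simp add: power2_eq_square algebra_simps)
qed

lemma tendsto_poly_times_power:
  fixes T :: real assumes "0 < T" "T < 1"
  shows "(\<lambda>n. (real n + 1) ^ 10 * T ^ n) \<longlonglongrightarrow> 0"
  using assms by real_asymp

text \<open>A combination of the null vector \<open>f\<close> and its reflection \<open>g\<close>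
  with the same extreme entries as \<open>x\<close> is subtracted. The remainder \<open>y\<close>
  falls under \<open>Qm_nonneg_off_ends\<close>, and the cross terms are controlled by the norms of
  \<open>Qm t n f\<close> and \<open>Qm t n g\<close>.\<close>

lemma Qm_form_ge_neg:
  assumes t: "0 < \<bar>t\<bar>" "\<bar>t\<bar> < 1" and \<epsilon>: "0 < \<epsilon>"
  obtains N :: nat where "\<And>n x. N \<le> n \<Longrightarrow> - \<epsilon> * ip n x x \<le> ip n (Qm t n x) x"
proof -
  obtain N0 where N0: "\<And>n x. N0 \<le> n \<Longrightarrow> x 0 = 0 \<Longrightarrow> x n = 0 \<Longrightarrow> 0 \<le> ip n (Qm t n x) x"
    by (rule Qm_nonneg_off_ends[OF t]) (rule that)
  \<comment> \<open>\<open>16384 = 64 * 256\<close> collects the constants of the final estimate for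
    odd \<open>n\<close>. The bound by 1 serves even \<open>n\<close>, where it keeps the 2 by 2
    system for the coefficients invertible.\<close>
  define \<delta> where "\<delta> = min 1 (\<epsilon>\<^sup>2 / 16384)"
  have \<delta>: "0 < \<delta>" "\<delta> \<le> 1" "\<delta> \<le> \<epsilon>\<^sup>2 / 16384" using \<epsilon> by (auto simp: \<delta>_def)
  have "eventually (\<lambda>n. (real n + 1) ^ 10 * \<bar>t\<bar> ^ n < \<delta>) sequentially"
    using order_tendstoD(2)[OF tendsto_poly_times_power[OF t] \<delta>(1)] .
  then obtain N1 where N1: "\<And>n. N1 \<le> n \<Longrightarrow> (real n + 1) ^ 10 * \<bar>t\<bar> ^ n < \<delta>"
    unfolding eventually_sequentially by blast
  have t1: "\<bar>t\<bar> \<le> 1" using t by simp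
  show thesis
  proof (rule that[of "max 1 (max N0 N1)"])
    fix n :: nat and x :: "nat \<Rightarrow> real"
    assume "max 1 (max N0 N1) \<le> n"
    then have n: "1 \<le> n" "N0 \<le> n" "N1 \<le> n" by auto
    define f where "f = nullv t n"
    define g where "g = rv n f"
    have f0: "f 0 = 1" and gn: "g n = 1" and g0: "g 0 = f n"
      by (simp_all add: f_def g_def rv_def)
    have Qg: "Qm t n g = rv n (Qm t n f)" by (simp add: g_def Qm_rv)
    have QQ: "ip n (Qm t n f) (Qm t n f) \<le> 256 * (real n + 1) ^ 6 * ip n (Zb t n f) (Zb t n f)"
      by (rule ip_Qm_le[OF t1])
    show "- \<epsilon> * ip n x x \<le> ip n (Qm t n x) x"
    proof (cases "even n")
      case True
      then have "ip n (Zb t n f) (Zb t n f) \<le> 0" using Zb_nullv_sq_le[OF n(1) t1] by (simp add: f_def)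
      then have "ip n (Zb t n f) (Zb t n f) = 0" using ip_nonneg[of n "Zb t n f"] by simp
      then have "ip n (Qm t n f) (Qm t n f) \<le> 0" using QQ by simp
      then have z: "ip n (Qm t n f) (Qm t n f) = 0" using ip_nonneg[of n "Qm t n f"] by simp
      then have z': "ip n (Qm t n g) (Qm t n g) = 0" unfolding Qg ip_rv .
      have Qf0: "ip n (Qm t n f) y = 0" and Qg0: "ip n (Qm t n g) y = 0" for y
        using ip_Cauchy_Schwarz[of n "Qm t n f" y] ip_Cauchy_Schwarz[of n "Qm t n g" y] z z' by simp_all
      have "(f n)\<^sup>2 \<le> (real n + 1) ^ 1 * \<bar>t\<bar> ^ n" using nullv_sq_le'[of n n t] by (simp add: f_def)
      also have "\<dots> \<le> (real n + 1) ^ 10 * \<bar>t\<bar> ^ n" by (intro mult_right_mono power_increasing) auto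
      also have "\<dots> < 1" using N1[OF n(3)] \<delta> by simp
      finally have fn: "1 - (f n)\<^sup>2 > 0" by simp
      \<comment> \<open>For even \<open>n\<close> the null vectors may reach the opposite end:
        \<open>a\<close> and \<open>b\<close> solve \<open>a + b * f n = x 0\<close> and
        \<open>a * f n + b = x n\<close>.\<close>
      define a where "a = (x 0 - f n * x n) / (1 - (f n)\<^sup>2)"
      define b where "b = (x n - f n * x 0) / (1 - (f n)\<^sup>2)"
      define y where "y = (\<lambda>p. x p - (a * f p + b * g p))"
      have "y 0 = 0" "y n = 0"
      proof -
        define d where "d = 1 - (f n)\<^sup>2"
        have d: "d \<noteq> 0" "a * d = x 0 - f n * x n" "b * d = x n - f n * x 0"
          using fn by (simp_all add: d_def a_def b_def)
        have "(a + b * f n) * d = a * d + b * d * f n" "(a * f n + b) * d = a * d * f n + b * d"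
          by (simp_all add: algebra_simps)
        then have "(a + b * f n) * d = x 0 * d" "(a * f n + b) * d = x n * d"
          unfolding d(2,3) by (simp_all add: algebra_simps d_def power2_eq_square)
        then show "y 0 = 0" "y n = 0"
          using d(1) by (simp_all add: y_def f0 gn g0)
      qed
      then have "0 \<le> ip n (Qm t n y) y" by (intro N0 n)
      also have "ip n (Qm t n y) y = ip n (Qm t n x) x"
      proof -
        have xy: "x = (\<lambda>p. y p + (a * f p + b * g p))" by (simp add: y_def)
        have "ip n (Qm t n x) x = ip n (Qm t n y) x"
          by (subst (1) xy) (simp add: Qm_add Qm_scale ip_simps Qf0 Qg0)
        also have "\<dots> = ip n (Qm t n x) y" by (metis ip_Qm ip_commute)
        also have "\<dots> = ip n (Qm t n y) y"
          by (subst (1) xy) (simp add: Qm_add Qm_scale ip_simps Qf0 Qg0)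
        finally show ?thesis by simp
      qed
      finally show ?thesis using mult_nonneg_nonneg[OF less_imp_le[OF \<epsilon>] ip_nonneg[of n x]] by simp
    next
      case False
      define D where "D = ip n (Qm t n f) (Qm t n f)"
      define R where "R = ip n x x"
      have R0: "0 \<le> R" by (simp add: R_def ip_nonneg)
      have D0: "0 \<le> D" by (simp add: D_def ip_nonneg)
      have Dg: "ip n (Qm t n g) (Qm t n g) = D" unfolding Qg ip_rv D_def ..
      have "D \<le> 256 * (real n + 1) ^ 6 * ((real n + 1)\<^sup>2 * \<bar>t\<bar> ^ n)"
        unfolding D_def using Zb_nullv_sq_le[OF n(1) t1] False
        by (intro order_trans[OF QQ] mult_left_mono) (simp_all add: f_def)
      moreover have "256 * a ^ 6 * (a\<^sup>2 * z) = 256 * (a ^ 8 * z)" for a z :: real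
        by (simp add: eval_nat_numeral)
      ultimately have D: "D \<le> 256 * ((real n + 1) ^ 8 * \<bar>t\<bar> ^ n)" by simp
      \<comment> \<open>By parity each null vector vanishes at the opposite end, so the coefficients
        are just \<open>x 0\<close> and \<open>x n\<close>; in exchange only the bound
        \<open>D\<close> is available for \<open>Qm t n f\<close>.\<close>
      have fn: "f n = 0" using False by (simp add: f_def nullv_odd)
      have xp: "(x p)\<^sup>2 \<le> R" if "p \<le> n" for p
        unfolding R_def ip_def power2_eq_square using that by (intro member_le_sum) auto
      define a where "a = x 0"
      define b where "b = x n"
      have ab: "\<bar>a\<bar> \<le> sqrt R" "\<bar>b\<bar> \<le> sqrt R"
        using xp[of 0] xp[of n] by (simp_all add: a_def b_def real_le_rsqrt)
      define \<eta> where "\<eta> = (\<lambda>p. a * f p + b * g p)"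
      define y where "y = (\<lambda>p. x p - \<eta> p)"
      have "y 0 = 0" "y n = 0" by (simp_all add: y_def \<eta>_def f0 gn g0 fn a_def b_def)
      then have y: "0 \<le> ip n (Qm t n y) y" by (intro N0 n)
      have CS: "\<bar>ip n u v\<bar> \<le> sqrt (ip n u u) * sqrt (ip n v v)" for u v
        using real_sqrt_le_mono[OF ip_Cauchy_Schwarz[of n u v]] by (simp add: real_sqrt_mult)
      have Q\<eta>: "\<bar>ip n (Qm t n \<eta>) v\<bar> \<le> 2 * sqrt R * sqrt D * sqrt (ip n v v)" for v
      proof -
        have "ip n (Qm t n \<eta>) v = a * ip n (Qm t n f) v + b * ip n (Qm t n g) v"
          by (simp add: \<eta>_def Qm_add Qm_scale ip_simps)
        then have "\<bar>ip n (Qm t n \<eta>) v\<bar> \<le> \<bar>a\<bar> * \<bar>ip n (Qm t n f) v\<bar> + \<bar>b\<bar> * \<bar>ip n (Qm t n g) v\<bar>"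
          by (simp add: abs_mult[symmetric] abs_triangle_ineq)
        also have "\<dots> \<le> sqrt R * (sqrt D * sqrt (ip n v v)) + sqrt R * (sqrt D * sqrt (ip n v v))"
          using CS[of "Qm t n f" v] CS[of "Qm t n g" v] R0 ab unfolding Dg D_def[symmetric]
          by (intro add_mono mult_mono) auto
        finally show ?thesis by (simp add: mult_ac)
      qed
      have ff: "ip n f f \<le> (real n + 1)\<^sup>2" by (simp add: f_def ip_nullv_le[OF t1])
      have gg: "ip n g g = ip n f f" by (simp add: g_def ip_rv)
      have "ip n \<eta> \<eta> \<le> 2 * (a\<^sup>2 * ip n f f) + 2 * (b\<^sup>2 * ip n f f)"
        unfolding \<eta>_def using ip_add_le[of n "\<lambda>p. a * f p" "\<lambda>p. b * g p"]
        by (simp add: ip_scale ip_scale_right gg power2_eq_square mult.assoc)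
      also have "\<dots> \<le> 2 * (R * (real n + 1)\<^sup>2) + 2 * (R * (real n + 1)\<^sup>2)"
        using xp[of 0] xp[of n] ff R0 ip_nonneg[of n f] unfolding a_def b_def
        by (intro add_mono mult_left_mono mult_mono) auto
      finally have "ip n \<eta> \<eta> \<le> (2 * (real n + 1))\<^sup>2 * R" by (simp add: power2_eq_square algebra_simps)
      then have "sqrt (ip n \<eta> \<eta>) \<le> sqrt ((2 * (real n + 1))\<^sup>2 * R)" by (rule real_sqrt_le_mono)
      also have "\<dots> = 2 * (real n + 1) * sqrt R" by (simp add: real_sqrt_mult)
      finally have s\<eta>: "sqrt (ip n \<eta> \<eta>) \<le> 2 * (real n + 1) * sqrt R" .
      have "x = (\<lambda>p. y p + \<eta> p)" by (simp add: y_def)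
      then have "ip n (Qm t n x) x = ip n (Qm t n y) y + 2 * ip n (Qm t n \<eta>) x - ip n (Qm t n \<eta>) \<eta>"
        by (simp add: Qm_add ip_simps ip_Qm[of n t y \<eta>] ip_commute[of n y "Qm t n \<eta>"])
      then have "ip n (Qm t n x) x \<ge> - 2 * \<bar>ip n (Qm t n \<eta>) x\<bar> - \<bar>ip n (Qm t n \<eta>) \<eta>\<bar>"
        using y by linarith
      moreover have RR: "2 * sqrt R * sqrt D * sqrt R = 2 * sqrt D * R"
        using R0 by simp
      moreover have "\<bar>ip n (Qm t n \<eta>) x\<bar> \<le> 2 * sqrt D * R"
        using Q\<eta>[of x] RR by (simp add: R_def[symmetric])
      moreover have "\<bar>ip n (Qm t n \<eta>) \<eta>\<bar> \<le> 2 * sqrt R * sqrt D * (2 * (real n + 1) * sqrt R)"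
        using R0 D0 s\<eta> by (intro order_trans[OF Q\<eta>] mult_left_mono) auto
      moreover have "2 * sqrt R * sqrt D * (2 * (real n + 1) * sqrt R) = 4 * (real n + 1) * sqrt D * R"
        proof -
        have "sqrt R * sqrt R = R" using R0 by simp
        moreover have "2 * a * d * (2 * m * a) = 4 * m * d * (a * a)" for a d m :: real
          by simp
        ultimately show ?thesis by metis
      qed
      moreover have "4 * sqrt D * R \<le> 4 * (real n + 1) * sqrt D * R"
        using R0 D0 by (intro mult_right_mono) auto
      ultimately have 1: "ip n (Qm t n x) x \<ge> - (8 * (real n + 1) * sqrt D) * R"
        by (simp add: algebra_simps)
      have "(8 * (real n + 1) * sqrt D)\<^sup>2 = 64 * (real n + 1)\<^sup>2 * D"
        by (simp only: power_mult_distrib real_sqrt_pow2[OF D0]) simp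
      also have "\<dots> \<le> 64 * (real n + 1)\<^sup>2 * (256 * ((real n + 1) ^ 8 * \<bar>t\<bar> ^ n))"
        by (intro mult_left_mono D) auto
      also have "\<dots> = 16384 * ((real n + 1) ^ 10 * \<bar>t\<bar> ^ n)"
        by (simp add: eval_nat_numeral mult_ac)
      also have "\<dots> \<le> \<epsilon>\<^sup>2" using N1[OF n(3)] \<delta> by simp
      finally have "8 * (real n + 1) * sqrt D \<le> \<epsilon>" by (rule power2_le_imp_le) (use \<epsilon> in simp)
      then have "8 * (real n + 1) * sqrt D * R \<le> \<epsilon> * R" using R0 by (rule mult_right_mono)
      then show ?thesis using 1 by (simp add: R_def)
    qed
  qed
qed

text \<open>For odd \<open>n\<close> the recursion for \<open>v\<close> terminates exactly and
  \<open>((Zb t n)\<^sup>2 + 4 t) v = t (n + 2) e\<^sub>0\<close>, so the form is computable on the solution \<open>u\<close> of \<open>Za t n u = v\<close>.\<close>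

fun negv :: "real \<Rightarrow> nat \<Rightarrow> nat \<Rightarrow> real" where
  "negv t n 0 = 1"
| "negv t n (Suc 0) = 0"
| "negv t n (Suc (Suc p)) = (if p < n then t * cf n (Suc p) / cf n p * negv t n p else 0)"

lemma negv_odd: "odd p \<Longrightarrow> negv t n p = 0"
  by (induction t n p rule: negv.induct) auto

fun negu :: "real \<Rightarrow> nat \<Rightarrow> nat \<Rightarrow> real" where
  "negu t n 0 = 0"
| "negu t n (Suc 0) = - 1 / (t * cf n 0)"
| "negu t n (Suc (Suc p)) = (cf n p * negu t n p - negv t n (Suc p)) / (t * cf n (Suc p))"

lemma negu_even: "even p \<Longrightarrow> negu t n p = 0"
  by (induction t n p rule: negu.induct) (auto simp: negv_odd)

text \<open>Below index \<open>n\<close> the equations hold by the forward recursion. The last one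
  has no unknown left and is consistent by parity: for odd \<open>n\<close> both
  \<open>negu t n (n - 1)\<close> and \<open>negv t n n\<close> are 0.\<close>

lemma Za_negu:
  assumes t: "t \<noteq> 0" and n: "odd n" and p: "p \<le> n"
  shows "Za t n (negu t n) p = negv t n p"
proof (cases p)
  case 0
  have "0 < n" using n by (cases n) auto
  then show ?thesis using 0 t cf_pos[of 0 n] by (simp add: Za_def dn_def)
next
  case (Suc q)
  show ?thesis
  proof (cases "Suc q < n")
    case True
    then show ?thesis using Suc t cf_pos[of "Suc q" n] by (simp add: Za_def dn_def)
  next
    case False
    then have "n = Suc q" using Suc p by simp
    then show ?thesis using Suc n by (simp add: Za_def dn_def cf_zero negu_even negv_odd)
  qed
qed

lemma Zb_negv:
  "q < n \<Longrightarrow> Zb t n (negv t n) (Suc q) = t * (2 * real q + 2 - real n) / cf n q * negv t n q"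
  "Zb t n (negv t n) 0 = 0"
proof -
  assume q: "q < n"
  have c: "0 < cf n q" using cf_pos[OF q] .
  have "Zb t n (negv t n) (Suc q) = t * (cf n q * cf n q - cf n (Suc q) * cf n (Suc q)) / cf n q * negv t n q"
    using q c by (simp add: Zb_def dn_def field_simps)
  also have "cf n q * cf n q - cf n (Suc q) * cf n (Suc q) = 2 * real q + 2 - real n"
    using q by (simp add: cf_sq_le algebra_simps)
  finally show "Zb t n (negv t n) (Suc q) = t * (2 * real q + 2 - real n) / cf n q * negv t n q" .
qed (simp add: Zb_def dn_def)

text \<open>At an even index \<open>p\<close> the contributions from below and above are
  \<open>t * (2 * p - 2 - n)\<close> and \<open>t * (2 * p + 2 - n)\<close> times the entry; their
  difference \<open>- 4 * t\<close> cancels the torsion term. At index 0 nothing comes from below,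
  which leaves \<open>t * (n + 2)\<close>.\<close>

lemma Zb_Zb_negv:
  assumes n: "odd n" and p: "p \<le> n"
  shows "Zb t n (Zb t n (negv t n)) p + 4 * t * negv t n p = (if p = 0 then t * (real n + 2) else 0)"
proof (cases "odd p")
  case True
  have e: "Zb t n (negv t n) q = 0" if "even q" for q
    using that by (cases q) (auto simp: Zb_def dn_def negv_odd)
  show ?thesis using True e[of "Suc p"] e[of "p - 1"]
    by (cases p) (auto simp: Zb_def[of t n "Zb t n (negv t n)"] dn_def negv_odd)
next
  case False
  then have p: "p < n" using p n by (cases "p = n") auto
  have c: "0 < cf n p" using cf_pos[OF p] .
  have d: "dn n (Zb t n (negv t n)) p = t * (2 * real p + 2 - real n) * negv t n p"
    using c by (simp add: dn_def Zb_negv(1)[OF p])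
  show ?thesis
  proof (cases p)
    case 0
    then show ?thesis using d by (simp add: Zb_def[of t n "Zb t n (negv t n)"] algebra_simps)
  next
    case (Suc q')
    then obtain q where q: "p = Suc (Suc q)" using False by (cases q') auto
    have qn: "q < n" using p q by simp
    have c': "0 < cf n q" "0 < cf n (Suc q)" using cf_pos p q by auto
    have "t * up n (Zb t n (negv t n)) p = t * (2 * real q + 2 - real n) * negv t n p"
      using c' qn by (simp add: q Zb_negv(1)[OF qn])
    then show ?thesis using d q by (simp add: Zb_def[of t n "Zb t n (negv t n)"] algebra_simps)
  qed
qed

text \<open>By \<open>Qm_swap\<close>, \<open>Qm\<close> maps \<open>negu\<close> to
  \<open>Za\<close> of \<open>t * (n + 2)\<close> times the first basis vector. Moving
  \<open>Za\<close> to the other side leaves only the entry of \<open>Zb t n (negu t n)\<close> at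
  0, which is \<open>1 / t\<close>.\<close>

lemma Qm_negu:
  assumes t: "t \<noteq> 0" and n: "odd n"
  shows "ip n (Qm t n (negu t n)) (negu t n) = - (real n + 2)"
proof -
  let ?u = "negu t n" and ?v = "negv t n"
  have n0: "0 < n" using n by (cases n) auto
  define w where "w = (\<lambda>p. Zb t n (Zb t n (Za t n ?u)) p + 4 * t * Za t n ?u p)"
  \<comment> \<open>\<open>Za_negu\<close> is known only for indices up to \<open>n\<close>; these
    congruences show that the operators see no other entries.\<close>
  have uc: "up n x p = up n y p" and dc: "dn n x p = dn n y p"
    if "\<And>p. p \<le> n \<Longrightarrow> x p = y p" for x y p
    using that by (cases p; cases "p \<le> n"; auto simp: cf_zero)
      (use that in \<open>cases "p < n"; auto simp: dn_def cf_zero\<close>)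
  have zc: "Zb t n x p = Zb t n y p" and za: "Za t n x p = Za t n y p"
    if "\<And>p. p \<le> n \<Longrightarrow> x p = y p" for x y p
    using uc[of x y p] dc[of x y p] that by (simp_all add: Za_def Zb_def)
  have "w p = (if p = 0 then t * (real n + 2) else 0)" if "p \<le> n" for p
  proof -
    have "Zb t n (Zb t n (Za t n ?u)) p = Zb t n (Zb t n ?v) p"
      by (intro zc Za_negu t n)
    then show ?thesis using Zb_Zb_negv[OF n that, of t] Za_negu[OF t n that] by (simp add: w_def)
  qed
  then have "Za t n w p = Za t n (\<lambda>p. if p = 0 then t * (real n + 2) else 0) p" for p
    by (intro za)
  then have "Qm t n ?u = Za t n (\<lambda>p. if p = 0 then t * (real n + 2) else 0)"
    unfolding Qm_swap w_def[symmetric] by blast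
  then have "ip n (Qm t n ?u) ?u = - ip n (\<lambda>p. if p = 0 then t * (real n + 2) else 0) (Zb t n ?u)"
    by (simp add: ip_Za)
  also have "\<dots> = - (t * (real n + 2) * Zb t n ?u 0)"
    by (simp add: ip_def if_distrib[of "\<lambda>z. z * _"] cong: if_cong)
  also have "Zb t n ?u 0 = 1 / t"
    using cf_pos[OF n0] t by (simp add: Zb_def dn_def)
  finally show ?thesis using t by simp
qed

section \<open>Symmetric operators in finite dimension\<close>

definition unitv :: "nat \<Rightarrow> nat \<Rightarrow> real" where "unitv p q = (if q = p then 1 else 0)"

definition cutoff :: "nat \<Rightarrow> (nat \<Rightarrow> real) \<Rightarrow> nat \<Rightarrow> real" where
  "cutoff n x p = (if p \<le> n then x p else 0)"

lemma ip_unitv: "p \<le> n \<Longrightarrow> ip n (unitv p) x = x p" "p \<le> n \<Longrightarrow> ip n x (unitv p) = x p"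
  by (simp_all add: ip_def unitv_def if_distrib[of "\<lambda>z. z * _"] if_distrib[of "\<lambda>z. _ * z"] cong: if_cong)

lemma ip_sum: "ip n (\<lambda>p. \<Sum>i\<in>I. f i p) y = (\<Sum>i\<in>I. ip n (f i) y)"
  "ip n y (\<lambda>p. \<Sum>i\<in>I. f i p) = (\<Sum>i\<in>I. ip n y (f i))"
  by (simp_all add: ip_def sum_distrib_left sum_distrib_right sum.swap[of _ I])

definition orthonormal :: "nat \<Rightarrow> nat \<Rightarrow> (nat \<Rightarrow> nat \<Rightarrow> real) \<Rightarrow> bool" where
  "orthonormal n k q \<longleftrightarrow> (\<forall>i<k. \<forall>j<k. ip n (q i) (q j) = (if i = j then 1 else 0))"

definition resid :: "nat \<Rightarrow> (nat \<Rightarrow> nat \<Rightarrow> real) \<Rightarrow> nat \<Rightarrow> nat \<Rightarrow> real" where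
  "resid k q p = (\<lambda>r. unitv p r - (\<Sum>i<k. q i p * q i r))"

lemma resid:
  assumes q: "orthonormal n k q" and p: "p \<le> n"
  shows "i < k \<Longrightarrow> ip n (resid k q p) (q i) = 0"
    and "ip n (resid k q p) (resid k q p) = 1 - (\<Sum>i<k. (q i p)\<^sup>2)"
proof -
  have 1: "ip n (resid k q p) (q i) = 0" if "i < k" for i
    using q that p
    by (simp add: resid_def ip_diff ip_unitv ip_sum ip_scale orthonormal_def if_distrib[of "\<lambda>z. _ * z"] cong: if_cong)
  then show "i < k \<Longrightarrow> ip n (resid k q p) (q i) = 0" .
  have "ip n (resid k q p) (resid k q p) = ip n (resid k q p) (unitv p) - (\<Sum>i<k. q i p * ip n (resid k q p) (q i))"
    by (subst (2) resid_def) (simp add: ip_diff_right ip_sum ip_scale_right)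
  also have "\<dots> = resid k q p p" using 1 p by (simp add: ip_unitv)
  finally show "ip n (resid k q p) (resid k q p) = 1 - (\<Sum>i<k. (q i p)\<^sup>2)"
    by (simp add: resid_def unitv_def power2_eq_square)
qed

text \<open>This is the trace of the projection onto the orthogonal complement. Positive for
  \<open>k \<le> n\<close>, it yields a further vector; zero for \<open>k = n + 1\<close>, it yields
  completeness.\<close>

lemma sum_resid:
  assumes q: "orthonormal n k q"
  shows "(\<Sum>p\<le>n. ip n (resid k q p) (resid k q p)) = real (n + 1) - real k"
proof -
  have "(\<Sum>p\<le>n. ip n (resid k q p) (resid k q p)) = (\<Sum>p\<le>n. 1 - (\<Sum>i<k. (q i p)\<^sup>2))"
    by (intro sum.cong refl resid(2)[OF q]) auto
  also have "\<dots> = real (n + 1) - (\<Sum>i<k. ip n (q i) (q i))"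
    by (simp add: sum_subtractf ip_def power2_eq_square sum.swap[of _ "{..<k}"])
  also have "(\<Sum>i<k. ip n (q i) (q i)) = real k"
    using q by (simp add: orthonormal_def)
  finally show ?thesis .
qed

lemma orthonormal_complete:
  assumes q: "orthonormal n (Suc n) q" and p: "p \<le> n" and r: "r \<le> n"
  shows "(\<Sum>i\<le>n. q i p * q i r) = (if p = r then 1 else 0)"
proof -
  have "(\<Sum>p\<le>n. ip n (resid (Suc n) q p) (resid (Suc n) q p)) = 0"
    using sum_resid[OF q] by simp
  then have "ip n (resid (Suc n) q p) (resid (Suc n) q p) = 0"
    using p by (subst (asm) sum_nonneg_eq_0_iff) (auto simp: ip_nonneg)
  then have "resid (Suc n) q p r = 0" using r by (simp add: ip_eq_0)
  then show ?thesis by (auto simp: resid_def unitv_def lessThan_Suc_atMost)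
qed

lemma quadratic_nonneg_imp_linear_zero:
  fixes b c :: real
  assumes "\<And>s. 0 \<le> 2 * s * b + s\<^sup>2 * c" and c: "0 \<le> c"
  shows "b = 0"
proof -
  have "0 \<le> 2 * (- b / (c + 1)) * b + (- b / (c + 1))\<^sup>2 * c" by (rule assms)
  also have "\<dots> = - (b\<^sup>2 * (c + 2)) / (c + 1)\<^sup>2"
    using c by (simp add: power2_eq_square divide_simps) (simp add: algebra_simps)
  finally have "b\<^sup>2 * (c + 2) / (c + 1)\<^sup>2 \<le> 0" by simp
  then have "b\<^sup>2 * (c + 2) \<le> 0" using c by (simp add: pos_divide_le_eq)
  then show ?thesis using c by (simp add: mult_le_0_iff)
qed

locale symmetric_op =
  fixes n :: nat and A :: "(nat \<Rightarrow> real) \<Rightarrow> nat \<Rightarrow> real"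
  assumes add: "A (\<lambda>p. x p + y p) = (\<lambda>p. A x p + A y p)"
    and scale: "A (\<lambda>p. a * x p) = (\<lambda>p. a * A x p)"
    and sym: "ip n (A x) y = ip n x (A y)"
begin

lemma A_expand:
  assumes "\<And>p. n < p \<Longrightarrow> x p = 0"
  shows "A x = (\<lambda>r. \<Sum>p\<le>n. x p * A (unitv p) r)"
proof -
  have zero: "A (\<lambda>p. 0) = (\<lambda>p. 0)" using scale[of 0 "\<lambda>p. 0"] by simp
  have "A (\<lambda>r. \<Sum>p\<in>I. x p * unitv p r) = (\<lambda>r. \<Sum>p\<in>I. x p * A (unitv p) r)" if "finite I" for I
    using that by induction (simp_all add: zero add scale)
  moreover have "x = (\<lambda>r. \<Sum>p\<le>n. x p * unitv p r)"
    using assms by (force simp: unitv_def if_distrib[of "\<lambda>z. _ * z"] cong: if_cong)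
  ultimately show ?thesis by (metis finite_atMost)
qed

text \<open>A minimizer of the quadratic form on the unit sphere of the complement of the vectors
  found so far. Its first variation vanishes in every direction of the complement, which
  \<open>A\<close> preserves by symmetry.\<close>

lemma eigenvector_step:
  assumes q: "orthonormal n k q" and k: "k \<le> n"
    and eig: "\<And>i p. i < k \<Longrightarrow> p \<le> n \<Longrightarrow> A (q i) p = l i * q i p"
  shows "\<exists>x m. ip n x x = 1 \<and> (\<forall>i<k. ip n x (q i) = 0) \<and> (\<forall>p\<le>n. A x p = m * x p)"
proof -
  define V where "V = {x. (\<forall>p>n. x p = 0) \<and> (\<forall>i<k. ip n x (q i) = 0)}"
  define K where "K = {x \<in> V. ip n x x = 1}"
  define F where "F x = ip n (A x) x" for x
  have lin: "(\<lambda>p. x p + a * y p) \<in> V" if "x \<in> V" "y \<in> V" for x y a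
    using that by (simp add: V_def ip_add ip_scale)
  have cut: "ip n (cutoff n x) y = ip n x y" "ip n y (cutoff n x) = ip n y x" for x y
    by (simp_all add: ip_def cutoff_def)
  have "K \<noteq> {}"
  proof -
    have "\<exists>p\<le>n. ip n (resid k q p) (resid k q p) > 0"
    proof (rule ccontr)
      assume "\<not> ?thesis"
      then have "(\<Sum>p\<le>n. ip n (resid k q p) (resid k q p)) \<le> 0" by (intro sum_nonpos) auto
      then show False using sum_resid[OF q] k by simp
    qed
    then obtain p where p: "p \<le> n" and pos: "ip n (resid k q p) (resid k q p) > 0" by auto
    define c where "c = sqrt (ip n (resid k q p) (resid k q p))"
    have c: "c > 0" "c * c = ip n (resid k q p) (resid k q p)" using pos by (simp_all add: c_def)
    have "(\<lambda>r. (1 / c) * cutoff n (resid k q p) r) \<in> K"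
      using pos c resid(1)[OF q p] unfolding K_def V_def mem_Collect_eq ip_scale ip_scale_right cut
      by (simp add: cutoff_def)
    then show ?thesis by blast
  qed
  moreover have "compact K"
  proof -
    \<comment> \<open>In the product topology on all sequences, Tychonoff applies because the
      coordinates beyond \<open>n\<close> are pinned to 0.\<close>
    define C where "C p = (if p \<le> n then {-1..1} else {0 :: real})" for p
    have "compact (Pi\<^sub>E UNIV C)"
    proof -
      have "compactin (product_topology (\<lambda>i. euclidean) UNIV) (Pi\<^sub>E UNIV C)"
        unfolding compactin_PiE by (simp add: C_def)
      then show ?thesis by (simp add: euclidean_product_topology)
    qed
    moreover have "closed K"
    proof -
      have "K = (\<Inter>p\<in>{n<..}. {x. x p = 0}) \<inter> (\<Inter>i\<in>{..<k}. {x. ip n x (q i) = 0}) \<inter> {x. ip n x x = 1}"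
        by (auto simp: K_def V_def)
      moreover have "closed {x. x p = (0::real)}" for p :: nat
        by (intro closed_Collect_eq continuous_intros continuous_on_product_coordinates)
      moreover have "closed {x. ip n x y = 0}" for y
        unfolding ip_def
        by (intro closed_Collect_eq continuous_intros continuous_on_product_coordinates)
      moreover have "closed {x. ip n x x = 1}"
        unfolding ip_def
        by (intro closed_Collect_eq continuous_intros continuous_on_product_coordinates)
      ultimately show ?thesis by (simp only:) (intro closed_Int closed_INT ballI)
    qed
    moreover have "K \<subseteq> Pi\<^sub>E UNIV C"
    proof
      fix x assume x: "x \<in> K"
      have "x p \<in> C p" for p
      proof (cases "p \<le> n")
        case True
        have "(x p)\<^sup>2 \<le> ip n x x"
          unfolding ip_def power2_eq_square using True by (intro member_le_sum) auto
        then have "\<bar>x p\<bar> \<le> 1" using x by (simp add: K_def abs_square_le_1)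
        then show ?thesis using True by (auto simp: C_def)
      next
        case False
        then show ?thesis using x by (auto simp: C_def K_def V_def)
      qed
      then show "x \<in> Pi\<^sub>E UNIV C" by auto
    qed
    ultimately show ?thesis by (metis compact_Int_closed inf.absorb_iff2)
  qed
  moreover have "continuous_on K F"
  proof -
    have "continuous_on K (\<lambda>x. ip n (\<lambda>r. \<Sum>p\<le>n. x p * A (unitv p) r) x)"
      unfolding ip_def
      by (intro continuous_intros continuous_on_subset[OF continuous_on_product_coordinates]) auto
    moreover have "F x = ip n (\<lambda>r. \<Sum>p\<le>n. x p * A (unitv p) r) x" if "x \<in> K" for x
      unfolding F_def using A_expand[of x] that by (simp add: K_def V_def)
    ultimately show ?thesis by (simp cong: continuous_on_cong)
  qed
  ultimately obtain x where x: "x \<in> K" and min: "\<And>y. y \<in> K \<Longrightarrow> F x \<le> F y"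
    using continuous_attains_inf by metis
  have xV: "x \<in> V" and x1: "ip n x x = 1" using x by (auto simp: K_def)
  define m where "m = F x"
  have form: "m * ip n y y \<le> F y" if y: "y \<in> V" for y
  proof (cases "ip n y y = 0")
    case True
    then show ?thesis using y ip_Cauchy_Schwarz[of n "A y" y] by (simp add: F_def)
  next
    case False
    define c where "c = sqrt (ip n y y)"
    have "ip n y y > 0" using False ip_nonneg[of n y] by simp
    then have c: "c > 0" "c * c = ip n y y" by (simp_all add: c_def)
    have "(\<lambda>p. (1 / c) * y p) \<in> K"
      using y c False unfolding K_def V_def mem_Collect_eq ip_scale ip_scale_right by simp
    then have "m \<le> F (\<lambda>p. (1 / c) * y p)" unfolding m_def by (rule min)
    also have "\<dots> = F y / (c * c)"
      unfolding F_def scale ip_scale ip_scale_right by simp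
    finally have "m \<le> F y / ip n y y" using c by simp
    then show ?thesis using \<open>ip n y y > 0\<close> by (simp add: pos_le_divide_eq)
  qed
  have stat: "ip n (A x) y - m * ip n x y = 0" if y: "y \<in> V" for y
  proof (rule quadratic_nonneg_imp_linear_zero[where c = "F y - m * ip n y y"])
    show "0 \<le> F y - m * ip n y y" using form[OF y] by simp
    fix s :: real
    have "m * ip n (\<lambda>p. x p + s * y p) (\<lambda>p. x p + s * y p) \<le> F (\<lambda>p. x p + s * y p)"
      by (intro form lin xV y)
    also have "F (\<lambda>p. x p + s * y p) = m + 2 * s * ip n (A x) y + s\<^sup>2 * F y"
      using sym[of y x] ip_commute[of n y "A x"]
      by (simp add: F_def m_def add scale ip_simps power2_eq_square algebra_simps)
    also have "m * ip n (\<lambda>p. x p + s * y p) (\<lambda>p. x p + s * y p) = m + m * (2 * s * ip n x y + s\<^sup>2 * ip n y y)"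
      using x1 ip_commute[of n y x] by (simp add: ip_simps power2_eq_square algebra_simps)
    finally show "0 \<le> 2 * s * (ip n (A x) y - m * ip n x y) + s\<^sup>2 * (F y - m * ip n y y)"
      by (simp add: algebra_simps)
  qed
  \<comment> \<open>The residual \<open>A x - m * x\<close>, cut off beyond \<open>n\<close>, lies
    in \<open>V\<close> and by stationarity is orthogonal to \<open>V\<close>, hence to
    itself.\<close>
  define z where "z = (\<lambda>p. cutoff n (A x) p + (- m) * x p)"
  have Ax: "cutoff n (A x) \<in> V"
  proof -
    have "ip n (A x) (q i) = 0" if "i < k" for i
    proof -
      have "ip n (A x) (q i) = ip n x (\<lambda>p. l i * q i p)"
        unfolding sym using eig that by (intro ip_cong) auto
      then show ?thesis using xV that by (simp add: ip_scale_right V_def)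
    qed
    then show ?thesis unfolding V_def mem_Collect_eq cut by (simp add: cutoff_def)
  qed
  have "z \<in> V" unfolding z_def by (rule lin[OF Ax xV])
  then have "ip n z z = 0"
    using stat[of z] by (subst z_def) (simp add: ip_diff ip_scale cut)
  then have Axp: "A x p = m * x p" if "p \<le> n" for p
    using that by (auto simp: ip_eq_0 z_def cutoff_def)
  show ?thesis
    using x1 xV Axp by (intro exI[of _ x] exI[of _ m]) (simp add: V_def)
qed

theorem spectral:
  obtains q :: "nat \<Rightarrow> nat \<Rightarrow> real" and l :: "nat \<Rightarrow> real" where
    "orthonormal n (Suc n) q" "\<And>i p. i \<le> n \<Longrightarrow> p \<le> n \<Longrightarrow> A (q i) p = l i * q i p"
proof -
  have "k \<le> Suc n \<Longrightarrow> \<exists>q l. orthonormal n k q \<and> (\<forall>i<k. \<forall>p\<le>n. A (q i) p = l i * q i p)" for k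
  proof (induction k)
    case 0
    then show ?case by (simp add: orthonormal_def)
  next
    case (Suc k)
    then obtain q l where q: "orthonormal n k q" "\<And>i p. i < k \<Longrightarrow> p \<le> n \<Longrightarrow> A (q i) p = l i * q i p"
      by auto
    obtain x m where x: "ip n x x = 1" "\<forall>i<k. ip n x (q i) = 0" "\<forall>p\<le>n. A x p = m * x p"
      using eigenvector_step[OF q(1) _ q(2)] Suc.prems by auto
    have "orthonormal n (Suc k) (q(k := x))"
    proof -
      have "ip n (q i) x = 0" if "i < k" for i using x(2) that ip_commute[of n x "q i"] by simp
      then show ?thesis using q(1) x by (auto simp: orthonormal_def less_Suc_eq)
    qed
    moreover have "\<forall>i<Suc k. \<forall>p\<le>n. A ((q(k := x)) i) p = (l(k := m)) i * (q(k := x)) i p"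
      using q(2) x(3) by (auto simp: less_Suc_eq)
    ultimately show ?case by blast
  qed
  from this[of "Suc n"] show thesis using that by (auto simp: less_Suc_eq_le)
qed

end

section \<open>Operators on \<open>L\<^sup>2\<close> with an orthonormal basis of eigenfunctions\<close>

lemma L2I: "u \<in> borel_measurable M \<Longrightarrow> integrable M (\<lambda>x. (cmod (u x))\<^sup>2) \<Longrightarrow> u \<in> L2 M"
  by (simp add: L2_def)

lemma L2_measurable [measurable_dest]: "u \<in> L2 M \<Longrightarrow> u \<in> borel_measurable M"
  and L2_integrable: "u \<in> L2 M \<Longrightarrow> integrable M (\<lambda>x. (cmod (u x))\<^sup>2)"
  by (simp_all add: L2_def)

lemma L2_mult_integrable:
  assumes u: "u \<in> L2 M" and v: "v \<in> L2 M"
  shows "integrable M (\<lambda>x. u x * v x)"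
proof (rule Bochner_Integration.integrable_bound)
  show "integrable M (\<lambda>x. (cmod (u x))\<^sup>2 + (cmod (v x))\<^sup>2)"
    using u v by (intro Bochner_Integration.integrable_add L2_integrable)
  show "(\<lambda>x. u x * v x) \<in> borel_measurable M"
    using u v by (intro borel_measurable_times L2_measurable)
  have "a * b \<le> a\<^sup>2 + b\<^sup>2" if "0 \<le> a" "0 \<le> b" for a b :: real
  proof -
    have "0 \<le> a * b" using that by simp
    then show ?thesis using sum_squares_ge_zero[of "a - b" 0] by (simp add: power2_eq_square algebra_simps)
  qed
  then show "AE x in M. norm (u x * v x) \<le> norm ((cmod (u x))\<^sup>2 + (cmod (v x))\<^sup>2)"
    by (simp add: norm_mult)
qed

lemma borel_measurable_cnj [measurable (raw)]:
  "f \<in> borel_measurable M \<Longrightarrow> (\<lambda>x. cnj (f x)) \<in> borel_measurable M"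
  by (rule borel_measurable_continuous_on[of cnj]) (auto intro: continuous_intros)

lemma L2_cnj: "u \<in> L2 M \<Longrightarrow> (\<lambda>x. cnj (u x)) \<in> L2 M"
  by (auto simp: L2_def intro: borel_measurable_cnj)

lemma L2_scale: "u \<in> L2 M \<Longrightarrow> (\<lambda>x. c * u x) \<in> L2 M"
  by (auto simp: L2_def norm_mult power_mult_distrib)

lemma L2_add:
  assumes u: "u \<in> L2 M" and v: "v \<in> L2 M"
  shows "(\<lambda>x. u x + v x) \<in> L2 M"
proof (rule L2I)
  show "(\<lambda>x. u x + v x) \<in> borel_measurable M"
    using u v by (intro borel_measurable_add L2_measurable)
  show "integrable M (\<lambda>x. (cmod (u x + v x))\<^sup>2)"
  proof (rule Bochner_Integration.integrable_bound)
    show "integrable M (\<lambda>x. 2 * (cmod (u x))\<^sup>2 + 2 * (cmod (v x))\<^sup>2)"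
      using u v by (intro Bochner_Integration.integrable_add integrable_mult_right L2_integrable)
    show "(\<lambda>x. (cmod (u x + v x))\<^sup>2) \<in> borel_measurable M"
      using L2_measurable[OF u] L2_measurable[OF v] by measurable
    have "(cmod (a + b))\<^sup>2 \<le> 2 * (cmod a)\<^sup>2 + 2 * (cmod b)\<^sup>2" for a b
    proof -
      have "(cmod (a + b))\<^sup>2 \<le> (cmod a + cmod b)\<^sup>2" by (intro power_mono norm_triangle_ineq) auto
      also have "\<dots> \<le> 2 * (cmod a)\<^sup>2 + 2 * (cmod b)\<^sup>2"
        using sum_squares_ge_zero[of "cmod a - cmod b" 0] by (simp add: power2_eq_square algebra_simps)
      finally show ?thesis .
    qed
    then show "AE x in M. norm ((cmod (u x + v x))\<^sup>2) \<le> norm (2 * (cmod (u x))\<^sup>2 + 2 * (cmod (v x))\<^sup>2)"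
      by simp
  qed
qed

lemma L2_diff: "u \<in> L2 M \<Longrightarrow> v \<in> L2 M \<Longrightarrow> (\<lambda>x. u x - v x) \<in> L2 M"
  using L2_add[of u M "\<lambda>x. (-1) * v x"] L2_scale[of v M "-1"] by simp

lemma L2_zero: "(\<lambda>x. 0) \<in> L2 M"
  by (simp add: L2_def)

lemma L2_sum: "(\<And>i. i \<in> I \<Longrightarrow> f i \<in> L2 M) \<Longrightarrow> (\<lambda>x. \<Sum>i\<in>I. f i x) \<in> L2 M"
  by (induction I rule: infinite_finite_induct) (auto intro: L2_zero L2_add)

definition cip :: "'a measure \<Rightarrow> ('a \<Rightarrow> complex) \<Rightarrow> ('a \<Rightarrow> complex) \<Rightarrow> complex" where
  "cip M u v = (\<integral>x. u x * cnj (v x) \<partial>M)"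

lemma cip_integrable: "u \<in> L2 M \<Longrightarrow> v \<in> L2 M \<Longrightarrow> integrable M (\<lambda>x. u x * cnj (v x))"
  by (intro L2_mult_integrable L2_cnj)

lemma cip_add: "u \<in> L2 M \<Longrightarrow> v \<in> L2 M \<Longrightarrow> w \<in> L2 M \<Longrightarrow> cip M (\<lambda>x. u x + v x) w = cip M u w + cip M v w"
  and cip_diff: "u \<in> L2 M \<Longrightarrow> v \<in> L2 M \<Longrightarrow> w \<in> L2 M \<Longrightarrow> cip M (\<lambda>x. u x - v x) w = cip M u w - cip M v w"
  by (simp_all add: cip_def ring_distribs cip_integrable)

lemma cip_scale: "cip M (\<lambda>x. c * u x) w = c * cip M u w"
  by (simp add: cip_def mult.assoc)

lemma cip_sum: "(\<And>i. i \<in> I \<Longrightarrow> f i \<in> L2 M) \<Longrightarrow> w \<in> L2 M \<Longrightarrow>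
    cip M (\<lambda>x. \<Sum>i\<in>I. f i x) w = (\<Sum>i\<in>I. cip M (f i) w)"
  by (simp add: cip_def sum_distrib_right cip_integrable)

lemma cip_cnj: "cip M v u = cnj (cip M u v)"
  unfolding cip_def Bochner_Integration.integral_cnj[symmetric]
  by (simp only: complex_cnj_mult complex_cnj_cnj mult.commute)

lemma cip_self: "cip M u u = complex_of_real (\<integral>x. (cmod (u x))\<^sup>2 \<partial>M)"
  by (simp add: cip_def complex_norm_square[symmetric] del: of_real_power)

lemma L2_norm_sq: "(L2_norm M u)\<^sup>2 = (\<integral>x. (cmod (u x))\<^sup>2 \<partial>M)"
  by (simp add: L2_norm_def)

lemma L2_norm_nonneg: "0 \<le> L2_norm M u"
  by (simp add: L2_norm_def)

lemma cip_norm: "cip M u u = complex_of_real ((L2_norm M u)\<^sup>2)"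
  by (simp add: cip_self L2_norm_sq)

lemma L2_norm_cong_AE:
  assumes "u \<in> borel_measurable M" "v \<in> borel_measurable M" "AE x in M. u x = v x"
  shows "L2_norm M u = L2_norm M v"
proof -
  have "(\<integral>x. (cmod (u x))\<^sup>2 \<partial>M) = (\<integral>x. (cmod (v x))\<^sup>2 \<partial>M)"
    using assms by (intro integral_cong_AE) auto
  then show ?thesis by (simp add: L2_norm_def)
qed

lemma L2_norm_0_AE:
  assumes "u \<in> L2 M" "L2_norm M u = 0" shows "AE x in M. u x = 0"
proof -
  have "(\<integral>x. (cmod (u x))\<^sup>2 \<partial>M) = 0" using assms(2) by (simp flip: L2_norm_sq)
  then have "AE x in M. (cmod (u x))\<^sup>2 = 0"
    using integral_nonneg_eq_0_iff_AE[OF L2_integrable[OF assms(1)]] by simp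
  then show ?thesis by simp
qed

lemma cip_Cauchy_Schwarz:
  assumes u: "u \<in> L2 M" and v: "v \<in> L2 M"
  shows "cmod (cip M u v) \<le> L2_norm M u * L2_norm M v"
proof (cases "L2_norm M v = 0")
  case True
  then have v0: "AE x in M. v x = 0" using v by (rule L2_norm_0_AE[rotated])
  have "cip M u v = (\<integral>x. 0 \<partial>M)"
    unfolding cip_def using v0 L2_measurable[OF u] L2_measurable[OF v]
    by (intro integral_cong_AE) auto
  then show ?thesis using L2_norm_nonneg[of M u] True by simp
next
  case False
  define a where "a = (L2_norm M v)\<^sup>2"
  have a: "a > 0" using False by (simp add: a_def)
  define c where "c = cip M u v / a"
  define w where "w = (\<lambda>x. u x - c * v x)"
  have cv: "(\<lambda>x. c * v x) \<in> L2 M" by (rule L2_scale[OF v])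
  have w: "w \<in> L2 M" unfolding w_def by (rule L2_diff[OF u cv])
  have wv: "cip M w v = 0"
    unfolding w_def cip_diff[OF u cv v] cip_scale using a by (simp add: cip_norm a_def c_def)
  have vw: "cip M v w = 0" using wv cip_cnj[of M v w] by simp
  have "cip M w w = cip M u w - c * cip M v w"
    using cip_diff[OF u cv w] by (simp add: cip_scale flip: w_def)
  also have "\<dots> = cnj (cip M w u)"
    using vw cip_cnj[of M u w] by simp
  also have "cip M w u = cip M u u - c * cip M v u"
    unfolding w_def cip_diff[OF u cv u] cip_scale by simp
  also have "c * cip M v u = complex_of_real ((cmod (cip M u v))\<^sup>2 / a)"
    using cip_cnj[of M v u] by (simp add: c_def complex_norm_square[symmetric] del: of_real_power)
  finally have "complex_of_real ((L2_norm M w)\<^sup>2) = complex_of_real ((L2_norm M u)\<^sup>2 - (cmod (cip M u v))\<^sup>2 / a)"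
    by (simp add: cip_norm)
  then have "(L2_norm M w)\<^sup>2 = (L2_norm M u)\<^sup>2 - (cmod (cip M u v))\<^sup>2 / a"
    by (simp only: of_real_eq_iff)
  then have "(cmod (cip M u v))\<^sup>2 / a \<le> (L2_norm M u)\<^sup>2" using zero_le_power2[of "L2_norm M w"] by linarith
  then have "(cmod (cip M u v))\<^sup>2 \<le> (L2_norm M u * L2_norm M v)\<^sup>2"
    using a by (simp add: a_def field_simps power_mult_distrib)
  then show ?thesis by (rule power2_le_imp_le[OF _ mult_nonneg_nonneg[OF L2_norm_nonneg L2_norm_nonneg]])
qed

lemma L2_norm_triangle:
  assumes u: "u \<in> L2 M" and v: "v \<in> L2 M"
  shows "L2_norm M (\<lambda>x. u x + v x) \<le> L2_norm M u + L2_norm M v"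
proof (rule power2_le_imp_le)
  have uv: "(\<lambda>x. u x + v x) \<in> L2 M" by (rule L2_add[OF u v])
  have "cip M (\<lambda>x. u x + v x) (\<lambda>x. u x + v x) = cip M u (\<lambda>x. u x + v x) + cip M v (\<lambda>x. u x + v x)"
    by (rule cip_add[OF u v uv])
  also have "\<dots> = cnj (cip M u u + cip M v u) + cnj (cip M u v + cip M v v)"
    by (simp add: cip_cnj[of M _ "\<lambda>x. u x + v x"] cip_add[OF u v u] cip_add[OF u v v])
  finally have "complex_of_real ((L2_norm M (\<lambda>x. u x + v x))\<^sup>2) =
      complex_of_real ((L2_norm M u)\<^sup>2) + complex_of_real ((L2_norm M v)\<^sup>2) + (cip M u v + cnj (cip M u v))"
    by (simp add: cip_norm cip_cnj[of M v u])
  then have "(L2_norm M (\<lambda>x. u x + v x))\<^sup>2 = (L2_norm M u)\<^sup>2 + (L2_norm M v)\<^sup>2 + 2 * Re (cip M u v)"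
    by (simp add: complex_eq_iff)
  moreover have "Re (cip M u v) \<le> L2_norm M u * L2_norm M v"
    using complex_Re_le_cmod cip_Cauchy_Schwarz[OF u v] by (rule order_trans)
  ultimately show "(L2_norm M (\<lambda>x. u x + v x))\<^sup>2 \<le> (L2_norm M u + L2_norm M v)\<^sup>2"
    by (simp add: power2_eq_square algebra_simps)
  show "0 \<le> L2_norm M u + L2_norm M v" by (simp add: L2_norm_nonneg)
qed

lemma L2_norm_sum:
  "(\<And>i. i \<in> I \<Longrightarrow> f i \<in> L2 M) \<Longrightarrow> L2_norm M (\<lambda>x. \<Sum>i\<in>I. f i x) \<le> (\<Sum>i\<in>I. L2_norm M (f i))"
proof (induction I rule: infinite_finite_induct)
  case (insert i I)
  then have "L2_norm M (\<lambda>x. f i x + (\<Sum>i\<in>I. f i x)) \<le> L2_norm M (f i) + L2_norm M (\<lambda>x. \<Sum>i\<in>I. f i x)"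
    by (intro L2_norm_triangle L2_sum) auto
  with insert show ?case by simp
qed (auto simp: L2_norm_def)

text \<open>Completeness in its series form. Fatou's lemma bounds the \<open>L\<^sup>2\<close> norm
  of the sum of moduli, so the series converges absolutely almost everywhere, and the same bound for
  tails controls the remainder.\<close>

lemma L2_series:
  assumes g: "\<And>k. g k \<in> L2 M" and sum: "summable (\<lambda>k. L2_norm M (g k))"
  obtains u where "u \<in> L2 M" "\<And>N. L2_norm M (\<lambda>x. u x - (\<Sum>k<N. g k x)) \<le> (\<Sum>k. L2_norm M (g (k + N)))"
proof -
  define G where "G x = (\<Sum>k. ennreal (cmod (g k x)))" for x
  \<comment> \<open>The default 0 concerns the null set where the series of moduli diverges and
    keeps \<open>u\<close> measurable.\<close>
  define u where "u x = (if G x = \<infinity> then 0 else \<Sum>k. g k x)" for x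
  have [measurable]: "g k \<in> borel_measurable M" for k using g by (rule L2_measurable)
  have Gm [measurable]: "G \<in> borel_measurable M" unfolding G_def by measurable
  have um [measurable]: "u \<in> borel_measurable M" unfolding u_def by measurable
  have norm_nn: "(\<integral>\<^sup>+x. ennreal ((cmod (v x))\<^sup>2) \<partial>M) = ennreal ((L2_norm M v)\<^sup>2)" if "v \<in> L2 M" for v
    using L2_integrable[OF that] by (simp add: nn_integral_eq_integral L2_norm_sq)
  have part: "(\<integral>\<^sup>+x. (\<Sum>k\<in>I. ennreal (cmod (g k x)))\<^sup>2 \<partial>M) \<le> ennreal ((\<Sum>k\<in>I. L2_norm M (g k))\<^sup>2)"
    if "finite I" for I
  proof -
    have gk: "(\<lambda>x. complex_of_real (cmod (g k x))) \<in> L2 M" for k using g[of k] by (simp add: L2_def)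
    then have s: "(\<lambda>x. \<Sum>k\<in>I. complex_of_real (cmod (g k x))) \<in> L2 M" by (intro L2_sum)
    have "(\<Sum>k\<in>I. ennreal (cmod (g k x)))\<^sup>2 = ennreal ((cmod (\<Sum>k\<in>I. complex_of_real (cmod (g k x))))\<^sup>2)" for x
    proof -
      have "cmod (\<Sum>k\<in>I. complex_of_real (cmod (g k x))) = (\<Sum>k\<in>I. cmod (g k x))"
        unfolding of_real_sum[symmetric] norm_of_real by (simp add: sum_nonneg)
      then show ?thesis by (simp add: sum_nonneg flip: ennreal_power)
    qed
    then have "(\<integral>\<^sup>+x. (\<Sum>k\<in>I. ennreal (cmod (g k x)))\<^sup>2 \<partial>M)
        = ennreal ((L2_norm M (\<lambda>x. \<Sum>k\<in>I. complex_of_real (cmod (g k x))))\<^sup>2)"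
      using norm_nn[OF s] by simp
    also have "\<dots> \<le> ennreal ((\<Sum>k\<in>I. L2_norm M (g k))\<^sup>2)"
    proof (intro ennreal_leI power_mono L2_norm_nonneg)
      have "L2_norm M (\<lambda>x. \<Sum>k\<in>I. complex_of_real (cmod (g k x)))
          \<le> (\<Sum>k\<in>I. L2_norm M (\<lambda>x. complex_of_real (cmod (g k x))))"
        by (intro L2_norm_sum gk)
      then show "L2_norm M (\<lambda>x. \<Sum>k\<in>I. complex_of_real (cmod (g k x))) \<le> (\<Sum>k\<in>I. L2_norm M (g k))"
        by (simp add: L2_norm_def)
    qed
    finally show ?thesis .
  qed
  have tail: "(\<integral>\<^sup>+x. (\<Sum>k. ennreal (cmod (g (k + N) x)))\<^sup>2 \<partial>M) \<le> ennreal ((\<Sum>k. L2_norm M (g (k + N)))\<^sup>2)" for N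
  proof -
    have sumN: "summable (\<lambda>k. L2_norm M (g (k + N)))" using sum by (rule summable_ignore_initial_segment)
    have lim: "(\<lambda>n. (\<Sum>k<n. ennreal (cmod (g (k + N) x)))\<^sup>2) \<longlonglongrightarrow> (\<Sum>k. ennreal (cmod (g (k + N) x)))\<^sup>2" for x
      unfolding power2_eq_square by (intro tendsto_mult_ennreal summable_LIMSEQ) auto
    have "(\<integral>\<^sup>+x. (\<Sum>k. ennreal (cmod (g (k + N) x)))\<^sup>2 \<partial>M)
        = (\<integral>\<^sup>+x. liminf (\<lambda>n. (\<Sum>k<n. ennreal (cmod (g (k + N) x)))\<^sup>2) \<partial>M)"
      by (intro nn_integral_cong lim_imp_Liminf[symmetric] lim) auto
    also have "\<dots> \<le> liminf (\<lambda>n. \<integral>\<^sup>+x. (\<Sum>k<n. ennreal (cmod (g (k + N) x)))\<^sup>2 \<partial>M)"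
      by (intro nn_integral_liminf) measurable
    also have "\<dots> \<le> ennreal ((\<Sum>k. L2_norm M (g (k + N)))\<^sup>2)"
    proof (rule Liminf_le, simp, intro always_eventually allI)
      fix n
      have "(\<integral>\<^sup>+x. (\<Sum>k<n. ennreal (cmod (g (k + N) x)))\<^sup>2 \<partial>M)
          = (\<integral>\<^sup>+x. (\<Sum>k\<in>(\<lambda>k. k + N) ` {..<n}. ennreal (cmod (g k x)))\<^sup>2 \<partial>M)"
        by (simp add: sum.reindex o_def)
      also have "\<dots> \<le> ennreal ((\<Sum>k\<in>(\<lambda>k. k + N) ` {..<n}. L2_norm M (g k))\<^sup>2)"
        by (intro part) auto
      also have "\<dots> = ennreal ((\<Sum>k<n. L2_norm M (g (k + N)))\<^sup>2)"
        by (simp add: sum.reindex o_def)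
      also have "\<dots> \<le> ennreal ((\<Sum>k. L2_norm M (g (k + N)))\<^sup>2)"
        using sumN by (intro ennreal_leI power_mono sum_le_suminf sum_nonneg) (auto simp: L2_norm_nonneg)
      finally show "(\<integral>\<^sup>+x. (\<Sum>k<n. ennreal (cmod (g (k + N) x)))\<^sup>2 \<partial>M) \<le> ennreal ((\<Sum>k. L2_norm M (g (k + N)))\<^sup>2)" .
    qed
    finally show ?thesis .
  qed
  have "AE x in M. (G x)\<^sup>2 \<noteq> \<infinity>"
  proof (rule nn_integral_PInf_AE)
    have "(\<integral>\<^sup>+x. (G x)\<^sup>2 \<partial>M) \<le> ennreal ((\<Sum>k. L2_norm M (g (k + 0)))\<^sup>2)"
      using tail[of 0] by (simp add: G_def)
    then show "(\<integral>\<^sup>+x. (G x)\<^sup>2 \<partial>M) \<noteq> \<infinity>" by (auto simp: top_unique)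
  qed measurable
  then have ae: "AE x in M. G x \<noteq> \<infinity> \<and> summable (\<lambda>k. cmod (g k x))"
  proof (eventually_elim)
    case (elim x)
    then have "G x \<noteq> \<infinity>" by (auto simp: ennreal_top_mult power2_eq_square)
    then show ?case
      using summable_suminf_not_top[of "\<lambda>k. cmod (g k x)"] by (simp add: G_def)
  qed
  have dist: "AE x in M. ennreal ((cmod (u x - (\<Sum>k<N. g k x)))\<^sup>2) \<le> (\<Sum>k. ennreal (cmod (g (k + N) x)))\<^sup>2" for N
    using ae
  proof eventually_elim
    case (elim x)
    have s: "summable (\<lambda>k. g k x)" using elim by (auto intro: summable_norm_cancel)
    have sN: "summable (\<lambda>k. cmod (g (k + N) x))" using elim summable_iff_shift[of "\<lambda>k. cmod (g k x)" N] by simp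
    have "u x - (\<Sum>k<N. g k x) = (\<Sum>k. g (k + N) x)"
      using suminf_split_initial_segment[OF s, of N] elim by (simp add: u_def)
    then have "cmod (u x - (\<Sum>k<N. g k x)) \<le> (\<Sum>k. cmod (g (k + N) x))"
      using summable_norm[OF sN] by simp
    then have "ennreal ((cmod (u x - (\<Sum>k<N. g k x)))\<^sup>2) \<le> ennreal ((\<Sum>k. cmod (g (k + N) x))\<^sup>2)"
      by (intro ennreal_leI power_mono) auto
    also have "\<dots> = (\<Sum>k. ennreal (cmod (g (k + N) x)))\<^sup>2"
      using sN by (subst suminf_ennreal2) (auto simp: suminf_nonneg ennreal_power)
    finally show ?case .
  qed
  have fin: "(\<integral>\<^sup>+x. ennreal ((cmod (u x - (\<Sum>k<N. g k x)))\<^sup>2) \<partial>M) \<le> ennreal ((\<Sum>k. L2_norm M (g (k + N)))\<^sup>2)" for N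
    by (rule order_trans[OF nn_integral_mono_AE[OF dist] tail])
  have dL2: "(\<lambda>x. u x - (\<Sum>k<N. g k x)) \<in> L2 M" for N
  proof (rule L2I)
    show "integrable M (\<lambda>x. (cmod (u x - (\<Sum>k<N. g k x)))\<^sup>2)"
      using fin[of N] by (intro integrableI_bounded) (auto simp: less_top[symmetric] top_unique)
  qed measurable
  show thesis
  proof (rule that)
    show "u \<in> L2 M" using dL2[of 0] by simp
    fix N
    have "ennreal ((L2_norm M (\<lambda>x. u x - (\<Sum>k<N. g k x)))\<^sup>2) \<le> ennreal ((\<Sum>k. L2_norm M (g (k + N)))\<^sup>2)"
      using fin[of N] unfolding norm_nn[OF dL2] .
    moreover have "0 \<le> (\<Sum>k. L2_norm M (g (k + N)))"
      by (intro suminf_nonneg summable_ignore_initial_segment[OF sum] L2_norm_nonneg)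
    ultimately show "L2_norm M (\<lambda>x. u x - (\<Sum>k<N. g k x)) \<le> (\<Sum>k. L2_norm M (g (k + N)))"
      by (auto simp: ennreal_le_iff intro: power2_le_imp_le)
  qed
qed

section \<open>Bessel, Riesz-Fischer and Parseval\<close>

locale orthonormal_basis =
  fixes M :: "'a measure" and \<phi> :: "nat \<Rightarrow> 'a \<Rightarrow> complex"
  assumes \<phi>: "\<And>i. \<phi> i \<in> L2 M"
    and orth: "\<And>i j. cip M (\<phi> i) (\<phi> j) = (if i = j then 1 else 0)"
    and complete: "\<And>u. u \<in> L2 M \<Longrightarrow> (\<And>i. cip M u (\<phi> i) = 0) \<Longrightarrow> AE x in M. u x = 0"
begin

abbreviation coef :: "('a \<Rightarrow> complex) \<Rightarrow> nat \<Rightarrow> complex" where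
  "coef u i \<equiv> cip M u (\<phi> i)"

abbreviation psum :: "(nat \<Rightarrow> complex) \<Rightarrow> nat set \<Rightarrow> 'a \<Rightarrow> complex" where
  "psum c I \<equiv> \<lambda>x. \<Sum>i\<in>I. c i * \<phi> i x"

lemma psum_L2: "psum c I \<in> L2 M"
  by (intro L2_sum L2_scale \<phi>)

lemma coef_psum: "finite I \<Longrightarrow> coef (psum c I) i = (if i \<in> I then c i else 0)"
  by (subst cip_sum) (auto intro: L2_scale \<phi> simp: cip_scale orth if_distrib[of "\<lambda>z. _ * z"] cong: if_cong)

lemma psum_norm: "finite I \<Longrightarrow> (L2_norm M (psum c I))\<^sup>2 = (\<Sum>i\<in>I. (cmod (c i))\<^sup>2)"
proof -
  assume I: "finite I"
  have "cip M (psum c I) (psum c I) = (\<Sum>i\<in>I. c i * cip M (\<phi> i) (psum c I))"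
    by (subst cip_sum) (auto intro: L2_scale \<phi> psum_L2 simp: cip_scale)
  also have "\<dots> = (\<Sum>i\<in>I. complex_of_real ((cmod (c i))\<^sup>2))"
    by (intro sum.cong refl) (simp add: cip_cnj[of M _ "psum c I"] coef_psum I complex_norm_square del: of_real_power)
  finally have "complex_of_real ((L2_norm M (psum c I))\<^sup>2) = complex_of_real (\<Sum>i\<in>I. (cmod (c i))\<^sup>2)"
    by (simp only: cip_norm of_real_sum)
  then show ?thesis by (simp only: of_real_eq_iff)
qed

lemma psum_dist:
  assumes u: "u \<in> L2 M" and I: "finite I"
  shows "(L2_norm M (\<lambda>x. u x - psum (coef u) I x))\<^sup>2 = (L2_norm M u)\<^sup>2 - (\<Sum>i\<in>I. (cmod (coef u i))\<^sup>2)"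
proof -
  let ?s = "psum (coef u) I"
  define w where "w = (\<lambda>x. u x - ?s x)"
  have w: "w \<in> L2 M" unfolding w_def by (intro L2_diff u psum_L2)
  have "coef w i = 0" if "i \<in> I" for i
    unfolding w_def cip_diff[OF u psum_L2 \<phi>] coef_psum[OF I] using that by simp
  then have sw: "cip M ?s w = 0"
    by (subst cip_sum) (auto intro: L2_scale \<phi> w simp: cip_scale cip_cnj[of M _ w])
  then have ws: "cip M w ?s = 0" using cip_cnj[of M w ?s] by simp
  have "cip M u u = cip M w u + cip M ?s u"
    using cip_add[OF w psum_L2 u, of "coef u" I] by (simp add: w_def)
  also have "cip M w u = cnj (cip M w w + cip M ?s w)"
    using cip_add[OF w psum_L2 w, of "coef u" I] cip_cnj[of M w u] by (simp add: w_def)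
  also have "cip M ?s u = cnj (cip M w ?s + cip M ?s ?s)"
    using cip_add[OF w psum_L2 psum_L2[of "coef u" I], of "coef u" I] cip_cnj[of M ?s u] by (simp add: w_def)
  finally have "complex_of_real ((L2_norm M u)\<^sup>2) = complex_of_real ((L2_norm M w)\<^sup>2 + (L2_norm M ?s)\<^sup>2)"
    unfolding sw ws cip_norm by simp
  then have "(L2_norm M u)\<^sup>2 = (L2_norm M w)\<^sup>2 + (L2_norm M ?s)\<^sup>2" by (simp only: of_real_eq_iff)
  then show ?thesis using psum_norm[OF I, of "coef u"] by (simp add: w_def)
qed

lemma Bessel_sum: "u \<in> L2 M \<Longrightarrow> finite I \<Longrightarrow> (\<Sum>i\<in>I. (cmod (coef u i))\<^sup>2) \<le> (L2_norm M u)\<^sup>2"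
  using psum_dist[of u I] zero_le_power2[of "L2_norm M (\<lambda>x. u x - psum (coef u) I x)"] by linarith

lemma Bessel: "u \<in> L2 M \<Longrightarrow> summable (\<lambda>i. (cmod (coef u i))\<^sup>2)"
  by (rule summableI_nonneg_bounded[where x = "(L2_norm M u)\<^sup>2"]) (auto intro: Bessel_sum)

text \<open>The terms \<open>c i * \<phi> i\<close> need not be absolutely summable in norm, so
  \<open>L2_series\<close> is applied to blocks of them, the \<open>k\<close>-th of norm at most
  \<open>2 ^ (- k)\<close>. The sequence \<open>r\<close> marks block boundaries; convergence is
  therefore obtained only along \<open>r\<close> here.\<close>

lemma Riesz_Fischer:
  assumes c: "summable (\<lambda>i. (cmod (c i))\<^sup>2)"
  obtains u r where "u \<in> L2 M" "\<And>i. coef u i = c i" "\<And>K. K \<le> r K"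
    "(\<lambda>K. L2_norm M (\<lambda>x. u x - psum c {..<r K} x)) \<longlonglongrightarrow> 0"
proof -
  have ex: "\<exists>N. \<forall>m\<ge>N. \<forall>n\<ge>m. norm (\<Sum>i=m..<n. (cmod (c i))\<^sup>2) < ((1/2) ^ k)\<^sup>2" for k :: nat
    using c[unfolded summable_Cauchy, rule_format, of "((1/2) ^ k)\<^sup>2"] by auto
  define N where "N k = (SOME N. \<forall>m\<ge>N. \<forall>n\<ge>m. norm (\<Sum>i=m..<n. (cmod (c i))\<^sup>2) < ((1/2) ^ k)\<^sup>2)" for k :: nat
  have N: "norm (\<Sum>i=m..<n. (cmod (c i))\<^sup>2) < ((1/2) ^ k)\<^sup>2" if "N k \<le> m" "m \<le> n" for k m n
    using someI_ex[OF ex[of k]] that unfolding N_def by blast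
  \<comment> \<open>The sum makes \<open>r\<close> nondecreasing with
    \<open>N k \<le> r (Suc k)\<close>; the summand \<open>k\<close> makes it unbounded.\<close>
  define r where "r k = (\<Sum>j<k. N j) + k" for k
  have r: "r k \<le> r (Suc k)" "N k \<le> r (Suc k)" "k \<le> r k" for k by (simp_all add: r_def)
  define g where "g k = psum c {r (Suc k)..<r (Suc (Suc k))}" for k
  have gL2: "g k \<in> L2 M" for k unfolding g_def by (rule psum_L2)
  have gn: "L2_norm M (g k) \<le> (1/2) ^ k" for k
  proof (rule power2_le_imp_le)
    show "(L2_norm M (g k))\<^sup>2 \<le> ((1/2) ^ k)\<^sup>2"
      using N[of k "r (Suc k)" "r (Suc (Suc k))"] r[of k] r[of "Suc k"] by (simp add: g_def psum_norm)
  qed simp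
  have sg: "summable (\<lambda>k. L2_norm M (g k))"
    by (rule summable_comparison_test'[of "\<lambda>k. (1/2::real) ^ k" 0])
      (auto simp: gn L2_norm_nonneg summable_geometric)
  obtain v where v: "v \<in> L2 M" and dist: "\<And>K. L2_norm M (\<lambda>x. v x - (\<Sum>k<K. g k x)) \<le> (\<Sum>k. L2_norm M (g (k + K)))"
    by (rule L2_series[OF gL2 sg]) (rule that)
  define s where "s K = psum c {..<r (Suc K)}" for K
  have s: "s K x = psum c {..<r (Suc 0)} x + (\<Sum>k<K. g k x)" for K x
  proof (induction K)
    case (Suc K)
    have "{..<r (Suc (Suc K))} = {..<r (Suc K)} \<union> {r (Suc K)..<r (Suc (Suc K))}"
      using r(1)[of "Suc K"] by auto
    then have "s (Suc K) x = s K x + g K x"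
      unfolding s_def g_def by (simp add: sum.union_disjoint ivl_disj_int)
    then show ?case using Suc by simp
  qed (simp add: s_def)
  define u where "u = (\<lambda>x. v x + psum c {..<r (Suc 0)} x)"
  have u: "u \<in> L2 M" unfolding u_def by (intro L2_add v psum_L2)
  have lim: "(\<lambda>K. L2_norm M (\<lambda>x. u x - s K x)) \<longlonglongrightarrow> 0"
  proof (rule tendsto_sandwich[of "\<lambda>_. 0" _ _ "\<lambda>K. \<Sum>k. L2_norm M (g (k + K))"])
    have "L2_norm M (\<lambda>x. u x - s K x) = L2_norm M (\<lambda>x. v x - (\<Sum>k<K. g k x))" for K
      by (simp add: s u_def)
    then show "\<forall>\<^sub>F K in sequentially. L2_norm M (\<lambda>x. u x - s K x) \<le> (\<Sum>k. L2_norm M (g (k + K)))"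
      using dist by simp
    show "(\<lambda>K. \<Sum>k. L2_norm M (g (k + K))) \<longlonglongrightarrow> 0"
      by (rule suminf_exist_split2[OF sg])
  qed (simp_all add: L2_norm_nonneg)
  have "coef u i = c i" for i
  proof -
    have "(\<lambda>K. coef u i - coef (s K) i) \<longlonglongrightarrow> 0"
    proof (rule Lim_null_comparison)
      have "norm (coef u i - coef (s K) i) \<le> L2_norm M (\<lambda>x. u x - s K x) * L2_norm M (\<phi> i)" for K
      proof -
        have "(\<lambda>x. u x - s K x) \<in> L2 M" unfolding s_def by (intro L2_diff u psum_L2)
        from cip_Cauchy_Schwarz[OF this \<phi>[of i]] show ?thesis
          using cip_diff[OF u _ \<phi>, of "s K" i] by (simp add: s_def psum_L2)
      qed
      then show "\<forall>\<^sub>F K in sequentially. norm (coef u i - coef (s K) i) \<le> L2_norm M (\<lambda>x. u x - s K x) * L2_norm M (\<phi> i)"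
        by simp
      show "(\<lambda>K. L2_norm M (\<lambda>x. u x - s K x) * L2_norm M (\<phi> i)) \<longlonglongrightarrow> 0"
        using lim tendsto_mult_left_zero by blast
    qed
    moreover have "\<forall>\<^sub>F K in sequentially. coef u i - coef (s K) i = coef u i - c i"
      unfolding eventually_sequentially
    proof (intro exI allI impI)
      fix K assume "i \<le> K"
      then have "i < r (Suc K)" using r(3)[of "Suc K"] by simp
      then show "coef u i - coef (s K) i = coef u i - c i" by (simp add: s_def coef_psum)
    qed
    ultimately have "(\<lambda>K. coef u i - c i) \<longlonglongrightarrow> 0"
      by (rule Lim_transform_eventually)
    then have "coef u i - c i = 0" using LIMSEQ_unique tendsto_const by blast
    then show ?thesis by simp
  qed
  then show thesis
  proof (rule that[OF u, of "\<lambda>K. r (Suc K)"])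
    show "K \<le> r (Suc K)" for K using r(3)[of "Suc K"] by simp
    show "(\<lambda>K. L2_norm M (\<lambda>x. u x - psum c {..<r (Suc K)} x)) \<longlonglongrightarrow> 0"
      using lim by (simp add: s_def)
  qed
qed

text \<open>The function built from the coefficients of \<open>u\<close> agrees with
  \<open>u\<close> almost everywhere by completeness. Convergence along \<open>r\<close> extends to
  all \<open>n\<close> because, by \<open>psum_dist\<close>, the distance to the partial sums does
  not increase.\<close>

lemma psum_tendsto:
  assumes u: "u \<in> L2 M"
  shows "(\<lambda>n. L2_norm M (\<lambda>x. u x - psum (coef u) {..<n} x)) \<longlonglongrightarrow> 0"
proof -
  obtain v r where v: "v \<in> L2 M" and cv: "\<And>i. coef v i = coef u i" and r: "\<And>K. K \<le> r K"
    and lim: "(\<lambda>K. L2_norm M (\<lambda>x. v x - psum (coef u) {..<r K} x)) \<longlonglongrightarrow> 0"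
    by (rule Riesz_Fischer[OF Bessel[OF u]]) (rule that)
  have uv: "AE x in M. u x - v x = 0"
    by (rule complete) (auto intro: L2_diff u v simp: cip_diff u v \<phi> cv)
  have eq: "L2_norm M (\<lambda>x. u x - psum (coef u) {..<n} x) = L2_norm M (\<lambda>x. v x - psum (coef u) {..<n} x)" for n
    using uv by (intro L2_norm_cong_AE L2_measurable L2_diff u v psum_L2) auto
  show ?thesis
  proof (rule LIMSEQ_I)
    fix e :: real assume e: "0 < e"
    obtain K where "\<forall>n\<ge>K. norm (L2_norm M (\<lambda>x. v x - psum (coef u) {..<r n} x) - 0) < e"
      using LIMSEQ_D[OF lim e] by blast
    then have K: "L2_norm M (\<lambda>x. v x - psum (coef u) {..<r K} x) < e"
      by (auto simp: abs_less_iff)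
    have "norm (L2_norm M (\<lambda>x. u x - psum (coef u) {..<n} x) - 0) < e" if n: "r K \<le> n" for n
    proof -
      have "(L2_norm M (\<lambda>x. u x - psum (coef u) {..<n} x))\<^sup>2 \<le> (L2_norm M (\<lambda>x. u x - psum (coef u) {..<r K} x))\<^sup>2"
        using n by (simp add: psum_dist u sum_mono2)
      then have "L2_norm M (\<lambda>x. u x - psum (coef u) {..<n} x) \<le> L2_norm M (\<lambda>x. u x - psum (coef u) {..<r K} x)"
        by (rule power2_le_imp_le) (rule L2_norm_nonneg)
      then show ?thesis using K L2_norm_nonneg[of M "\<lambda>x. u x - psum (coef u) {..<n} x"] by (simp add: eq)
    qed
    then show "\<exists>no. \<forall>n\<ge>no. norm (L2_norm M (\<lambda>x. u x - psum (coef u) {..<n} x) - 0) < e" by blast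
  qed
qed

lemma Parseval:
  assumes u: "u \<in> L2 M"
  shows "(\<lambda>i. (cmod (coef u i))\<^sup>2) sums (L2_norm M u)\<^sup>2"
proof -
  have "(\<lambda>n. (L2_norm M u)\<^sup>2 - (L2_norm M (\<lambda>x. u x - psum (coef u) {..<n} x))\<^sup>2) \<longlonglongrightarrow> (L2_norm M u)\<^sup>2 - 0\<^sup>2"
    by (intro tendsto_intros psum_tendsto u)
  then show ?thesis by (simp add: psum_dist u sums_def)
qed

text \<open>\<open>distributional\<close> uses the bilinear pairing, without conjugation; it is the
  inner product with the conjugate of \<open>g\<close>, so continuity carries the expansion of
  \<open>u\<close> over.\<close>

lemma pairing_sums:
  assumes u: "u \<in> L2 M" and g: "g \<in> L2 M"
  shows "(\<lambda>i. coef u i * (\<integral>x. \<phi> i x * g x \<partial>M)) sums (\<integral>x. u x * g x \<partial>M)"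
proof -
  define w where "w = (\<lambda>x. cnj (g x))"
  have w: "w \<in> L2 M" unfolding w_def by (rule L2_cnj[OF g])
  have i: "(\<integral>x. v x * g x \<partial>M) = cip M v w" for v by (simp add: cip_def w_def)
  have "(\<lambda>n. cip M u w - cip M (psum (coef u) {..<n}) w) \<longlonglongrightarrow> 0"
  proof (rule Lim_null_comparison)
    show "\<forall>\<^sub>F n in sequentially. norm (cip M u w - cip M (psum (coef u) {..<n}) w)
        \<le> L2_norm M (\<lambda>x. u x - psum (coef u) {..<n} x) * L2_norm M w"
      using cip_Cauchy_Schwarz[OF L2_diff[OF u psum_L2] w] by (simp add: cip_diff[OF u psum_L2 w])
    show "(\<lambda>n. L2_norm M (\<lambda>x. u x - psum (coef u) {..<n} x) * L2_norm M w) \<longlonglongrightarrow> 0"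
      by (intro tendsto_mult_left_zero psum_tendsto u)
  qed
  from tendsto_diff[OF tendsto_const[of "cip M u w"] this]
  have "(\<lambda>n. cip M (psum (coef u) {..<n}) w) \<longlonglongrightarrow> cip M u w" by simp
  moreover have "cip M (psum (coef u) {..<n}) w = (\<Sum>i<n. coef u i * cip M (\<phi> i) w)" for n
    by (subst cip_sum) (auto intro: L2_scale \<phi> w simp: cip_scale)
  ultimately show ?thesis by (simp add: i sums_def)
qed

end

section \<open>The negative spectrum of a diagonal operator\<close>

locale diagonal_operator = orthonormal_basis +
  fixes \<nu> :: "nat \<Rightarrow> real" and G :: "'a operator"
  assumes graph: "(u, w) \<in> G \<longleftrightarrow> u \<in> L2 M \<and> w \<in> L2 M \<and> (\<forall>i. coef w i = \<nu> i * coef u i)"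
    and neg_finite: "\<And>\<epsilon>. 0 < \<epsilon> \<Longrightarrow> finite {i. \<nu> i < - \<epsilon>}"
    and neg_infinite: "infinite {i. \<nu> i < 0}"
begin

lemma basis_graph: "(\<phi> i, \<lambda>x. \<nu> i * \<phi> i x) \<in> G"
  unfolding graph by (auto intro: \<phi> L2_scale simp: cip_scale orth)

lemma basis_norm: "L2_norm M (\<phi> i) = 1"
proof -
  have "complex_of_real ((L2_norm M (\<phi> i))\<^sup>2) = complex_of_real 1" using orth[of i i] by (simp add: cip_norm)
  then have "(L2_norm M (\<phi> i))\<^sup>2 = 1" by (simp only: of_real_eq_iff)
  then show ?thesis using L2_norm_nonneg[of M "\<phi> i"] by (simp add: power2_eq_1_iff)
qed

lemma L2_norm_zero: "L2_norm M (\<lambda>x. 0) = 0"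
  by (simp add: L2_norm_def)

lemma basis_nonzero: "\<not> (AE x in M. \<phi> i x = 0)"
proof
  assume "AE x in M. \<phi> i x = 0"
  then have "L2_norm M (\<phi> i) = L2_norm M (\<lambda>x. 0)" by (intro L2_norm_cong_AE L2_measurable \<phi> L2_zero)
  then show False by (simp add: basis_norm L2_norm_zero)
qed

lemma eigenvalue_not_resolvent: "complex_of_real (\<nu> i) \<notin> resolvent_set M G"
proof
  assume "complex_of_real (\<nu> i) \<in> resolvent_set M G"
  then obtain C where "\<forall>(u, w)\<in>G. L2_norm M u \<le> C * L2_norm M (\<lambda>x. w x - \<nu> i * u x)"
    by (auto simp: resolvent_set_def)
  from bspec[OF this basis_graph[of i]] show False by (simp add: basis_norm L2_norm_zero)
qed

text \<open>Only finitely many \<open>\<nu> i\<close> lie below \<open>m / 2\<close> and the others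
  are at least \<open>- m / 2\<close> away from \<open>m\<close>, so the distance \<open>d\<close>
  to all of them is positive. Dividing coefficients by \<open>\<nu> i - m\<close> then gives a
  bounded inverse.\<close>

lemma resolvent_neg:
  assumes m: "m < 0" and ne: "\<And>i. \<nu> i \<noteq> m"
  shows "complex_of_real m \<in> resolvent_set M G"
proof -
  obtain d where d: "0 < d" "\<And>i. d \<le> \<bar>\<nu> i - m\<bar>"
  proof -
    let ?F = "{i. \<nu> i < - (- m / 2)}"
    have fin: "finite ?F" using m by (intro neg_finite) simp
    define d where "d = Min (insert (- m / 2) ((\<lambda>i. \<bar>\<nu> i - m\<bar>) ` ?F))"
    have "0 < d" unfolding d_def using fin m ne by (subst Min_gr_iff) auto
    moreover have "d \<le> \<bar>\<nu> i - m\<bar>" for i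
    proof (cases "i \<in> ?F")
      case True
      then show ?thesis unfolding d_def using fin by (intro Min_le) auto
    next
      case False
      have "d \<le> - m / 2" unfolding d_def using fin by (intro Min_le) auto
      then show ?thesis using False m by auto
    qed
    ultimately show thesis by (rule that)
  qed
  have bound: "cmod z \<le> (1 / d) * cmod ((\<nu> i - m) * z)" for i and z :: complex
  proof -
    have "d * cmod z \<le> \<bar>\<nu> i - m\<bar> * cmod z" by (intro mult_right_mono d) auto
    also have "\<dots> = cmod ((\<nu> i - m) * z)" by (simp add: norm_mult flip: of_real_diff)
    finally show ?thesis using d(1) by (simp add: field_simps)
  qed
  have cf: "coef (\<lambda>x. w x - m * u x) i = (\<nu> i - m) * coef u i" if "(u, w) \<in> G" for u w :: "'a \<Rightarrow> complex" and i
    using that by (simp add: graph cip_diff L2_scale \<phi> cip_scale algebra_simps)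
  have "\<exists>(u, w)\<in>G. AE x in M. w x - complex_of_real m * u x = v x" if v: "v \<in> L2 M" for v
  proof -
    define c where "c i = coef v i / (\<nu> i - m)" for i
    have ne': "complex_of_real (\<nu> i) - complex_of_real m \<noteq> 0" for i
      using ne[of i] by (simp flip: of_real_diff)
    have "(cmod (c i))\<^sup>2 \<le> (1 / d)\<^sup>2 * (cmod (coef v i))\<^sup>2" for i
    proof -
      have "cmod (c i) \<le> (1 / d) * cmod (coef v i)" using bound[of "c i" i] ne'[of i] by (simp add: c_def)
      then have "(cmod (c i))\<^sup>2 \<le> ((1 / d) * cmod (coef v i))\<^sup>2" by (intro power_mono) auto
      then show ?thesis by (simp only: power_mult_distrib)
    qed
    then have "summable (\<lambda>i. (cmod (c i))\<^sup>2)"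
      by (intro summable_comparison_test'[OF summable_mult[OF Bessel[OF v]], of 0]) auto
    then obtain u where u: "u \<in> L2 M" "\<And>i. coef u i = c i"
      by (rule Riesz_Fischer) blast
    define w where "w = (\<lambda>x. v x + m * u x)"
    have "(u, w) \<in> G"
      unfolding graph w_def using u v ne'
      by (auto intro: L2_add L2_scale simp: cip_add L2_scale \<phi> cip_scale c_def field_simps)
    moreover have "AE x in M. w x - complex_of_real m * u x = v x" by (simp add: w_def)
    ultimately show ?thesis by blast
  qed
  moreover have "L2_norm M u \<le> 1 / d * L2_norm M (\<lambda>x. w x - complex_of_real m * u x)" if uw: "(u, w) \<in> G" for u w
  proof (rule power2_le_imp_le)
    have u: "u \<in> L2 M" and w: "w \<in> L2 M" using uw by (auto simp: graph)
    have v: "(\<lambda>x. w x - complex_of_real m * u x) \<in> L2 M" by (intro L2_diff L2_scale u w)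
    have "(L2_norm M u)\<^sup>2 \<le> (1 / d)\<^sup>2 * (L2_norm M (\<lambda>x. w x - complex_of_real m * u x))\<^sup>2"
    proof (rule sums_le[OF _ Parseval[OF u] sums_mult[OF Parseval[OF v]]])
      fix i
      have "(cmod (coef u i))\<^sup>2 \<le> ((1 / d) * cmod ((\<nu> i - m) * coef u i))\<^sup>2"
        by (intro power_mono bound) auto
      then show "(cmod (coef u i))\<^sup>2 \<le> (1 / d)\<^sup>2 * (cmod (coef (\<lambda>x. w x - complex_of_real m * u x) i))\<^sup>2"
        by (simp only: power_mult_distrib cf[OF uw])
    qed
    then show "(L2_norm M u)\<^sup>2 \<le> (1 / d * L2_norm M (\<lambda>x. w x - complex_of_real m * u x))\<^sup>2"
      by (simp only: power_mult_distrib)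
    show "0 \<le> 1 / d * L2_norm M (\<lambda>x. w x - complex_of_real m * u x)" using d by (simp add: L2_norm_nonneg)
  qed
  ultimately show ?thesis unfolding resolvent_set_def by blast
qed

lemma negative_spectrum_eq: "negative_spectrum M G = (\<lambda>i. complex_of_real (\<nu> i)) ` {i. \<nu> i < 0}"
proof (intro set_eqI iffI)
  fix \<mu> assume \<mu>: "\<mu> \<in> negative_spectrum M G"
  then have \<mu>': "\<mu> = complex_of_real (Re \<mu>)" "Re \<mu> < 0" "\<mu> \<notin> resolvent_set M G"
    by (auto simp: negative_spectrum_def op_spectrum_def complex_eq_iff)
  then obtain i where "\<nu> i = Re \<mu>" using resolvent_neg[of "Re \<mu>"] by metis
  then show "\<mu> \<in> (\<lambda>i. complex_of_real (\<nu> i)) ` {i. \<nu> i < 0}" using \<mu>' by (intro image_eqI[of _ _ i]) auto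
next
  fix \<mu> assume "\<mu> \<in> (\<lambda>i. complex_of_real (\<nu> i)) ` {i. \<nu> i < 0}"
  then show "\<mu> \<in> negative_spectrum M G"
    using eigenvalue_not_resolvent by (auto simp: negative_spectrum_def op_spectrum_def)
qed

lemma eigenvalue_basis: "is_eigenvalue M G (complex_of_real (\<nu> i))"
  unfolding is_eigenvalue_def eigenspace_def using basis_graph[of i] basis_nonzero[of i] by auto

text \<open>\<open>neg_finite\<close> counts indices, not values, so a negative \<open>m\<close>
  occurs finitely often. An eigenfunction has no coefficient at any other index and equals its
  finite partial sum by completeness.\<close>

lemma finite_multiplicity_neg:
  assumes "m < 0" shows "finite_multiplicity M G (complex_of_real m)"
proof -
  define I where "I = {i. \<nu> i = m}"
  have I: "finite I" by (rule finite_subset[OF _ neg_finite[of "- m / 2"]]) (use assms in \<open>auto simp: I_def\<close>)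
  have inj: "inj_on \<phi> I"
  proof (rule inj_onI)
    fix i j assume "\<phi> i = \<phi> j"
    then show "i = j" using orth[of i j] orth[of i i] by (auto split: if_splits)
  qed
  have "\<exists>c. AE x in M. u x = (\<Sum>b\<in>\<phi> ` I. c b * b x)" if "u \<in> eigenspace M G (complex_of_real m)" for u
  proof -
    obtain w where uw: "(u, w) \<in> G" and e: "AE x in M. w x = m * u x"
      using \<open>u \<in> _\<close> by (auto simp: eigenspace_def)
    have u: "u \<in> L2 M" and w: "w \<in> L2 M" and cw: "\<And>i. coef w i = \<nu> i * coef u i" using uw by (auto simp: graph)
    have "coef w i = coef (\<lambda>x. m * u x) i" for i
      unfolding cip_def using e
      by (intro integral_cong_AE borel_measurable_times borel_measurable_cnj L2_measurable \<phi> w u L2_scale) auto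
    then have "coef u i = 0" if "i \<notin> I" for i
      using cw[of i] that by (simp add: cip_scale I_def)
    then have "AE x in M. u x - psum (coef u) I x = 0"
      by (intro complete) (auto intro: L2_diff u psum_L2 simp: cip_diff u psum_L2 \<phi> coef_psum I)
    moreover have "psum (coef u) I x = (\<Sum>b\<in>\<phi> ` I. coef u (the_inv_into I \<phi> b) * b x)" for x
      using inj by (simp add: sum.reindex the_inv_into_f_f)
    ultimately show ?thesis by (intro exI[of _ "\<lambda>b. coef u (the_inv_into I \<phi> b)"]) simp
  qed
  moreover have "\<phi> ` I \<subseteq> eigenspace M G (complex_of_real m)"
    using basis_graph by (auto simp: eigenspace_def I_def)
  ultimately show ?thesis unfolding finite_multiplicity_def using I by blast
qed

lemma negative_near_zero: "0 < \<epsilon> \<Longrightarrow> infinite {i. - \<epsilon> \<le> \<nu> i \<and> \<nu> i < 0}"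
proof
  assume "0 < \<epsilon>" "finite {i. - \<epsilon> \<le> \<nu> i \<and> \<nu> i < 0}"
  then have "finite ({i. - \<epsilon> \<le> \<nu> i \<and> \<nu> i < 0} \<union> {i. \<nu> i < - \<epsilon>})" using neg_finite by simp
  moreover have "{i. \<nu> i < 0} \<subseteq> {i. - \<epsilon> \<le> \<nu> i \<and> \<nu> i < 0} \<union> {i. \<nu> i < - \<epsilon>}" by auto
  ultimately show False using neg_infinite finite_subset by blast
qed

lemma limit_points: "{x. x islimpt negative_spectrum M G} = {0}"
proof -
  have "0 islimpt negative_spectrum M G"
    unfolding islimpt_approachable
  proof (intro allI impI)
    fix e :: real assume e: "0 < e"
    obtain i where "- (e / 2) \<le> \<nu> i" "\<nu> i < 0"
      using infinite_imp_nonempty[OF negative_near_zero[of "e / 2"]] e by auto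
    then show "\<exists>x'\<in>negative_spectrum M G. x' \<noteq> 0 \<and> dist x' 0 < e"
      unfolding negative_spectrum_eq using e by (intro bexI[of _ "complex_of_real (\<nu> i)"]) auto
  qed
  moreover have "\<not> x islimpt negative_spectrum M G" if "x \<noteq> 0" for x
  proof
    assume "x islimpt negative_spectrum M G"
    then have "infinite (negative_spectrum M G \<inter> ball x (cmod x / 2))"
      using that by (simp add: islimpt_eq_infinite_ball)
    moreover have "negative_spectrum M G \<inter> ball x (cmod x / 2)
        \<subseteq> (\<lambda>i. complex_of_real (\<nu> i)) ` {i. \<nu> i < - (cmod x / 2)}"
    proof
      fix y assume y: "y \<in> negative_spectrum M G \<inter> ball x (cmod x / 2)"
      then obtain i where i: "y = complex_of_real (\<nu> i)" "\<nu> i < 0" by (auto simp: negative_spectrum_eq)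
      have "cmod x - cmod y \<le> cmod (x - y)" by (rule norm_triangle_ineq2)
      then have "cmod x / 2 < cmod y" using y by (simp add: dist_norm)
      then show "y \<in> (\<lambda>i. complex_of_real (\<nu> i)) ` {i. \<nu> i < - (cmod x / 2)}" using i by auto
    qed
    moreover have "finite {i. \<nu> i < - (cmod x / 2)}" using that by (intro neg_finite) simp
    ultimately show False by (meson finite_imageI finite_subset)
  qed
  ultimately show ?thesis by auto
qed

text \<open>Along indices \<open>r k\<close> with eigenvalues at most \<open>2 ^ (- k)\<close> in
  modulus, the function \<open>v\<close> with these eigenvalues as coefficients is a limit of images
  of finite sums with coefficients 1. A preimage of \<open>v\<close> would have all coefficients 1
  along \<open>r\<close>, against Bessel.\<close>

lemma not_closed_range: "\<not> closed_range M G"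
proof
  assume cl: "closed_range M G"
  define S where "S k = {i. - ((1/2) ^ k) \<le> \<nu> i \<and> \<nu> i < 0}" for k :: nat
  have S: "infinite (S k)" for k unfolding S_def by (rule negative_near_zero) simp
  have "\<exists>r. \<forall>k. r k \<in> S k \<and> r k < r (Suc k)"
  proof (rule dependent_nat_choice)
    show "\<exists>x. x \<in> S 0" using infinite_imp_nonempty[OF S] by blast
    show "\<exists>y. y \<in> S (Suc k) \<and> x < y" for x k
      using S[of "Suc k"] unfolding infinite_nat_iff_unbounded by blast
  qed
  then obtain r where r: "\<And>k. r k \<in> S k" and mono: "strict_mono r" by (auto simp: strict_mono_Suc_iff)
  have inj: "inj r" using mono by (rule strict_mono_imp_inj_on)
  define c where "c i = (if i \<in> range r then complex_of_real (\<nu> i) else 0)" for i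
  define d where "d i = (if i \<in> range r then 1 else 0 :: complex)" for i
  have "summable (\<lambda>k. (cmod (c (r k)))\<^sup>2)"
  proof (rule summable_comparison_test'[of "\<lambda>k. (1/4::real) ^ k" 0])
    fix k
    have "\<bar>\<nu> (r k)\<bar>\<^sup>2 \<le> ((1/2) ^ k)\<^sup>2" using r[of k] by (intro power_mono) (auto simp: S_def)
    then show "norm ((cmod (c (r k)))\<^sup>2) \<le> (1/4) ^ k"
      by (simp add: c_def power2_eq_square flip: power_mult_distrib)
  qed (simp add: summable_geometric)
  then have "summable (\<lambda>i. (cmod (c i))\<^sup>2)"
    by (subst (asm) summable_mono_reindex[OF mono, where f = "\<lambda>i. (cmod (c i))\<^sup>2"]) (auto simp: c_def)
  then obtain v where v: "v \<in> L2 M" "\<And>i. coef v i = c i" by (rule Riesz_Fischer) blast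
  have "psum c {..<n} \<in> snd ` G" for n
  proof -
    have "(psum d {..<n}, psum c {..<n}) \<in> G"
      by (auto simp: graph psum_L2 coef_psum c_def d_def)
    then show ?thesis by force
  qed
  moreover have "(\<lambda>n. L2_norm M (\<lambda>x. psum c {..<n} x - v x)) \<longlonglongrightarrow> 0"
    using psum_tendsto[OF v(1)] by (simp add: v(2) L2_norm_def norm_minus_commute)
  ultimately have "v \<in> snd ` G"
    by (intro cl[unfolded closed_range_def, rule_format, of "\<lambda>n. psum c {..<n}" v] conjI allI v(1))
  then obtain u where "(u, v) \<in> G" by force
  then have u: "u \<in> L2 M" and "\<And>i. coef v i = \<nu> i * coef u i" by (auto simp: graph)
  then have "coef u (r k) = 1" for k
    using v(2)[of "r k"] r[of k] by (auto simp: c_def S_def)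
  moreover have "(\<lambda>k. (cmod (coef u (r k)))\<^sup>2) \<longlonglongrightarrow> 0"
    using LIMSEQ_subseq_LIMSEQ[OF summable_LIMSEQ_zero[OF Bessel[OF u]] mono] by (simp add: o_def)
  ultimately show False using LIMSEQ_unique[OF tendsto_const] by fastforce
qed

theorem diagonal_negative_spectrum:
  "(\<forall>\<mu>\<in>negative_spectrum M G. is_eigenvalue M G \<mu> \<and> finite_multiplicity M G \<mu>)
     \<and> {x. x islimpt negative_spectrum M G} = {0} \<and> \<not> closed_range M G"
  using limit_points not_closed_range eigenvalue_basis finite_multiplicity_neg
  by (auto simp: negative_spectrum_eq)

end

section \<open>Smooth functions on the three-sphere\<close>

lemma frechet_cong:
  assumes "open S" "x \<in> S" "\<And>y. y \<in> S \<Longrightarrow> f y = g y"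
  shows "f differentiable (at x) \<longleftrightarrow> g differentiable (at x)"
    and "frechet_derivative f (at x) = frechet_derivative g (at x)"
proof -
  have "(f has_derivative D) (at x) \<longleftrightarrow> (g has_derivative D) (at x)" for D
    using assms has_derivative_transform_within_open[of f D x UNIV S g]
      has_derivative_transform_within_open[of g D x UNIV S f] by auto
  then show "f differentiable (at x) \<longleftrightarrow> g differentiable (at x)"
    "frechet_derivative f (at x) = frechet_derivative g (at x)"
    by (simp_all add: differentiable_def frechet_derivative_def)
qed

lemma Ck_cong:
  assumes "open S" "\<And>x. x \<in> S \<Longrightarrow> f x = g x"
  shows "Ck_on k S f \<longleftrightarrow> Ck_on k S g"
  using assms(2)
proof (induction k arbitrary: f g)
  case 0
  then show ?case by (auto cong: continuous_on_cong)
next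
  case (Suc k)
  have "Ck_on k S (\<lambda>x. frechet_derivative f (at x) v) \<longleftrightarrow> Ck_on k S (\<lambda>x. frechet_derivative g (at x) v)" for v
    by (rule Suc.IH) (simp add: frechet_cong(2)[OF assms(1) _ Suc.prems])
  then show ?case using frechet_cong(1)[OF assms(1) _ Suc.prems] by auto
qed

lemma Ck_Suc_imp: "Ck_on (Suc k) S f \<Longrightarrow> Ck_on k S f"
proof (induction k arbitrary: f)
  case 0
  then have "f differentiable_on S" by (auto simp: differentiable_on_def intro: differentiable_at_withinI)
  then show ?case by (simp add: differentiable_imp_continuous_on)
next
  case (Suc k)
  then show ?case by (simp del: Ck_on.simps add: Ck_on.simps(2)[of "Suc k"] Ck_on.simps(2)[of k])
qed

lemma Ck_const: "Ck_on k S (\<lambda>x. c)"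
  by (induction k arbitrary: c) auto

lemma Ck_differentiable: "Ck_on (Suc k) S f \<Longrightarrow> x \<in> S \<Longrightarrow> f differentiable (at x)"
  by simp

lemma Ck_SucI:
  assumes "open S" "\<And>x. x \<in> S \<Longrightarrow> (f has_derivative D x) (at x)" "\<And>v. Ck_on k S (\<lambda>x. D x v)"
  shows "Ck_on (Suc k) S f"
proof -
  have "Ck_on k S (\<lambda>x. frechet_derivative f (at x) v)" for v
    using assms(3)[of v]
    by (subst Ck_cong[OF assms(1), of _ "\<lambda>x. D x v"]) (simp_all add: frechet_derivative_at[OF assms(2), symmetric])
  then show ?thesis using assms(2) by (auto simp: differentiable_def)
qed

lemma frechet_has_derivative: "f differentiable (at x) \<Longrightarrow> (f has_derivative frechet_derivative f (at x)) (at x)"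
  by (simp add: frechet_derivative_works[symmetric])

lemma Ck_add:
  assumes "open S" "Ck_on k S f" "Ck_on k S g"
  shows "Ck_on k S (\<lambda>x. f x + g x)"
  using assms(2,3)
proof (induction k arbitrary: f g)
  case 0
  then show ?case by (simp add: continuous_on_add)
next
  case (Suc k)
  show ?case
    by (rule Ck_SucI[OF assms(1) has_derivative_add[OF frechet_has_derivative frechet_has_derivative]])
      (use Suc in auto)
qed

lemma Ck_mult:
  fixes f g :: "'a::real_normed_vector \<Rightarrow> complex"
  assumes "open S" "Ck_on k S f" "Ck_on k S g"
  shows "Ck_on k S (\<lambda>x. f x * g x)"
  using assms(2,3)
proof (induction k arbitrary: f g)
  case 0
  then show ?case by (simp add: continuous_on_mult)
next
  case (Suc k)
  show ?case
  proof (rule Ck_SucI[OF assms(1) has_derivative_mult[OF frechet_has_derivative frechet_has_derivative]])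
    show "Ck_on k S (\<lambda>x. f x * frechet_derivative g (at x) v + frechet_derivative f (at x) v * g x)" for v
      using Ck_Suc_imp[OF Suc.prems(1)] Ck_Suc_imp[OF Suc.prems(2)] Suc.prems
      by (intro Ck_add[OF assms(1)] Suc.IH) auto
  qed (use Suc.prems in auto)
qed

lemma Ck_linear:
  assumes "open S" "bounded_linear L" "Ck_on k S f"
  shows "Ck_on k S (\<lambda>x. L (f x))"
  using assms(3)
proof (induction k arbitrary: f)
  case 0
  then show ?case by (simp add: bounded_linear.continuous_on[OF assms(2)])
next
  case (Suc k)
  show ?case
    by (rule Ck_SucI[OF assms(1) bounded_linear.has_derivative[OF assms(2) frechet_has_derivative]])
      (use Suc in auto)
qed

lemma Ck_bounded_linear: "open S \<Longrightarrow> bounded_linear L \<Longrightarrow> Ck_on k S L"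
proof (induction k)
  case 0
  then show ?case by (simp add: linear_continuous_on)
next
  case (Suc k)
  show ?case
    by (rule Ck_SucI[OF Suc.prems(1) bounded_linear_imp_has_derivative[OF Suc.prems(2)]]) (rule Ck_const)
qed

abbreviation punct :: "c2 set" where "punct \<equiv> - {0}"

lemma open_punct: "open punct" by (intro open_Compl closed_singleton)

text \<open>The derivative in direction \<open>v\<close> is minus the cube of the function itself
  times the linear function \<open>q \<mapsto> v \<bullet> q\<close>, so the induction on
  \<open>k\<close> closes.\<close>

lemma Ck_inv_norm: "Ck_on k punct (\<lambda>q::c2. complex_of_real (inverse (norm q)))"
proof (induction k)
  case 0
  then show ?case by (auto intro!: continuous_intros)
next
  case (Suc k)
  let ?N = "\<lambda>q::c2. complex_of_real (inverse (norm q))"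
  show ?case
  proof (rule Ck_SucI[OF open_punct])
    fix x :: c2 assume "x \<in> punct"
    then have "((\<lambda>q. complex_of_real (inverse (norm q))) has_derivative
        (\<lambda>v. complex_of_real (- (inverse (norm x) * (v \<bullet> sgn x) * inverse (norm x))))) (at x)"
      by (auto intro!: derivative_eq_intros intro: has_derivative_norm)
    moreover have "complex_of_real (- (inverse (norm x) * (v \<bullet> sgn x) * inverse (norm x)))
        = ?N x * ?N x * ?N x * complex_of_real (- (v \<bullet> x))" for v
      by (simp add: sgn_div_norm inner_scaleR_right divide_inverse)
    ultimately show "(?N has_derivative (\<lambda>v. ?N x * ?N x * ?N x * complex_of_real (- (v \<bullet> x)))) (at x)"
      by (simp only:)
  next
    fix v :: c2
    have "bounded_linear (\<lambda>x. complex_of_real (- (v \<bullet> x)))"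
      by (intro bounded_linear_of_real[THEN bounded_linear_compose] bounded_linear_minus bounded_linear_inner_right)
    then show "Ck_on k punct (\<lambda>x. ?N x * ?N x * ?N x * complex_of_real (- (v \<bullet> x)))"
      by (intro Ck_mult open_punct Suc Ck_bounded_linear)
  qed
qed

section \<open>Functions on the sphere and their radial extensions\<close>

lemma norm_S3: "p \<in> S3 \<longleftrightarrow> norm p = 1"
  by (cases p) (simp add: S3_def norm_prod_def)

lemma S3_nonzero: "p \<in> S3 \<Longrightarrow> p \<noteq> 0"
  by (auto simp: norm_S3)

lemma norm_sq_c2: "complex_of_real ((norm p)\<^sup>2) = fst p * cnj (fst p) + snd p * cnj (snd p)"
  by (cases p) (simp add: norm_prod_def complex_norm_square[symmetric] del: of_real_power)

lemma S3_eq: "p \<in> S3 \<Longrightarrow> fst p * cnj (fst p) + snd p * cnj (snd p) = 1"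
  using norm_sq_c2[of p] by (simp add: norm_S3)

text \<open>The norm is its inverse times its square; the square is a polynomial in the coordinates
  and their conjugates.\<close>

lemma Ck_norm: "Ck_on k punct (\<lambda>q::c2. complex_of_real (norm q))"
proof -
  have fs: "Ck_on k punct (fst :: c2 \<Rightarrow> complex)" "Ck_on k punct (snd :: c2 \<Rightarrow> complex)"
    by (intro Ck_bounded_linear open_punct bounded_linear_fst bounded_linear_snd)+
  then have "Ck_on k punct (\<lambda>q::c2. complex_of_real (inverse (norm q)) * (fst q * cnj (fst q) + snd q * cnj (snd q)))"
    by (intro Ck_mult Ck_add open_punct Ck_inv_norm Ck_linear[OF _ bounded_linear_cnj])
  moreover have eq: "complex_of_real (norm q) = complex_of_real (inverse (norm q)) * (fst q * cnj (fst q) + snd q * cnj (snd q))"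
    if "q \<in> punct" for q
    unfolding norm_sq_c2[symmetric] of_real_mult[symmetric] using that by (simp add: power2_eq_square)
  ultimately show ?thesis
    by (simp only: Ck_cong[OF open_punct, of "\<lambda>q. complex_of_real (norm q)"
      "\<lambda>q. complex_of_real (inverse (norm q)) * (fst q * cnj (fst q) + snd q * cnj (snd q))", OF eq])
qed

lemma radial_in_S3: "q \<noteq> 0 \<Longrightarrow> q /\<^sub>R norm q \<in> S3"
  by (simp add: norm_S3)

lemma radial_ext_S3: "p \<in> S3 \<Longrightarrow> radial_ext f p = f p"
  by (simp add: radial_ext_def norm_S3)

lemma radial_ext_cong: "(\<And>p. p \<in> S3 \<Longrightarrow> f p = g p) \<Longrightarrow> q \<noteq> 0 \<Longrightarrow> radial_ext f q = radial_ext g q"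
  by (simp add: radial_ext_def radial_in_S3)

lemma smooth_cong: "(\<And>p. p \<in> S3 \<Longrightarrow> f p = g p) \<Longrightarrow> smooth_S3 f \<longleftrightarrow> smooth_S3 g"
proof -
  assume eq: "\<And>p. p \<in> S3 \<Longrightarrow> f p = g p"
  have "radial_ext f q = radial_ext g q" if "q \<in> punct" for q
    using that by (intro radial_ext_cong eq) auto
  then have "Ck_on k punct (radial_ext f) \<longleftrightarrow> Ck_on k punct (radial_ext g)" for k
    by (intro Ck_cong open_punct)
  then show ?thesis unfolding smooth_S3_def by blast
qed

lemma smooth_const [intro]: "smooth_S3 (\<lambda>p. c)"
  by (simp add: smooth_S3_def radial_ext_def Ck_const)

lemma smooth_add [intro]: "smooth_S3 f \<Longrightarrow> smooth_S3 g \<Longrightarrow> smooth_S3 (\<lambda>p. f p + g p)"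
  unfolding smooth_S3_def radial_ext_def by (intro allI Ck_add open_punct) auto

lemma smooth_mult [intro]: "smooth_S3 f \<Longrightarrow> smooth_S3 g \<Longrightarrow> smooth_S3 (\<lambda>p. f p * g p)"
  unfolding smooth_S3_def radial_ext_def by (intro allI Ck_mult open_punct) auto

lemma smooth_cnj [intro]: "smooth_S3 f \<Longrightarrow> smooth_S3 (\<lambda>p. cnj (f p))"
  unfolding smooth_S3_def radial_ext_def by (intro allI Ck_linear[OF _ bounded_linear_cnj] open_punct) auto

lemma smooth_minus [intro]: "smooth_S3 f \<Longrightarrow> smooth_S3 (\<lambda>p. - f p)"
  using smooth_mult[OF smooth_const[of "-1"]] by simp

lemma smooth_diff [intro]: "smooth_S3 f \<Longrightarrow> smooth_S3 g \<Longrightarrow> smooth_S3 (\<lambda>p. f p - g p)"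
  using smooth_add[OF _ smooth_minus] by simp

lemma smooth_sum [intro]: "(\<And>i. i \<in> I \<Longrightarrow> smooth_S3 (f i)) \<Longrightarrow> smooth_S3 (\<lambda>p. \<Sum>i\<in>I. f i p)"
  by (induction I rule: infinite_finite_induct) auto

lemma smooth_fst [intro]: "smooth_S3 fst" and smooth_snd [intro]: "smooth_S3 snd"
proof -
  have "Ck_on k punct (radial_ext L)" if L: "bounded_linear L" for k and L :: "c2 \<Rightarrow> complex"
  proof -
    have "radial_ext L = (\<lambda>q. complex_of_real (inverse (norm q)) * L q)"
      by (simp add: radial_ext_def linear_cmul[OF bounded_linear.linear[OF L]] scaleR_conv_of_real)
    then show ?thesis by (simp only:) (intro Ck_mult open_punct Ck_inv_norm Ck_bounded_linear L)
  qed
  then show "smooth_S3 fst" "smooth_S3 snd"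
    by (simp_all add: smooth_S3_def bounded_linear_fst bounded_linear_snd)
qed

lemma smooth_differentiable: "smooth_S3 f \<Longrightarrow> q \<noteq> 0 \<Longrightarrow> radial_ext f differentiable (at q)"
  unfolding smooth_S3_def using Ck_differentiable[of 0 punct "radial_ext f" q] by blast

lemma smooth_has_derivative:
  "smooth_S3 f \<Longrightarrow> q \<noteq> 0 \<Longrightarrow> (radial_ext f has_derivative frechet_derivative (radial_ext f) (at q)) (at q)"
  by (intro frechet_has_derivative smooth_differentiable)

lemma smooth_continuous: "smooth_S3 f \<Longrightarrow> continuous_on S3 f"
proof -
  assume f: "smooth_S3 f"
  then have "continuous_on punct (radial_ext f)" using Ck_on.simps(1) unfolding smooth_S3_def by metis
  then have "continuous_on S3 (radial_ext f)" by (rule continuous_on_subset) (auto dest: S3_nonzero)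
  then show ?thesis by (simp add: radial_ext_S3 cong: continuous_on_cong)
qed

text \<open>The radial extension is homogeneous of degree \<open>0\<close>, so its derivative is homogeneous of degree \<open>-1\<close>.\<close>

lemma radial_derivative_scale:
  assumes f: "smooth_S3 f" and q: "q \<noteq> 0"
  shows "frechet_derivative (radial_ext f) (at (q /\<^sub>R norm q)) v
    = complex_of_real (norm q) * frechet_derivative (radial_ext f) (at q) v"
proof -
  define c where "c = inverse (norm q)"
  have c: "c > 0" using q by (simp add: c_def)
  have inv: "radial_ext f (c *\<^sub>R x) = radial_ext f x" for x
  proof -
    have "inverse (c * m) * c = inverse m" for m using c by (cases "m = 0") (auto simp: field_simps)
    then show ?thesis using c by (simp add: radial_ext_def mult.assoc del: inverse_mult_distrib)
  qed
  have "(radial_ext f has_derivative frechet_derivative (radial_ext f) (at (c *\<^sub>R q))) (at (c *\<^sub>R q))"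
    using q c by (intro smooth_has_derivative f) auto
  moreover have "((\<lambda>x. c *\<^sub>R x) has_derivative (\<lambda>v. c *\<^sub>R v)) (at q)"
    by (intro has_derivative_scaleR_right has_derivative_ident)
  ultimately have "((\<lambda>x. radial_ext f (c *\<^sub>R x)) has_derivative
      (\<lambda>v. frechet_derivative (radial_ext f) (at (c *\<^sub>R q)) (c *\<^sub>R v))) (at q)"
    using has_derivative_compose by blast
  then have "(\<lambda>v. frechet_derivative (radial_ext f) (at (c *\<^sub>R q)) (c *\<^sub>R v)) = frechet_derivative (radial_ext f) (at q)"
    unfolding inv by (rule frechet_derivative_at)
  then have "frechet_derivative (radial_ext f) (at (c *\<^sub>R q)) (c *\<^sub>R v) = frechet_derivative (radial_ext f) (at q) v"
    by metis
  moreover have "linear (frechet_derivative (radial_ext f) (at (c *\<^sub>R q)))"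
    using q c by (intro linear_frechet_derivative smooth_differentiable f) auto
  ultimately show ?thesis
    using q by (simp add: linear_cmul c_def scaleR_conv_of_real field_simps)
qed

text \<open>Off the sphere, the radial extension of a derivative is not the derivative of the radial
  extension; the two differ by the factor \<open>norm q\<close>, which is smooth away from
  0.\<close>

lemma smooth_derivative:
  assumes f: "smooth_S3 f"
  shows "smooth_S3 (\<lambda>p. frechet_derivative (radial_ext f) (at p) v)"
  unfolding smooth_S3_def
proof
  fix k
  have "Ck_on (Suc k) punct (radial_ext f)" using f unfolding smooth_S3_def by blast
  then have "Ck_on k punct (\<lambda>q. frechet_derivative (radial_ext f) (at q) v)" unfolding Ck_on.simps by blast
  then have "Ck_on k punct (\<lambda>q. complex_of_real (norm q) * frechet_derivative (radial_ext f) (at q) v)"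
    by (intro Ck_mult open_punct Ck_norm)
  moreover have "radial_ext (\<lambda>p. frechet_derivative (radial_ext f) (at p) v) q
      = complex_of_real (norm q) * frechet_derivative (radial_ext f) (at q) v" if "q \<in> punct" for q
    using radial_derivative_scale[OF f, of q v] that by (simp add: radial_ext_def[of "\<lambda>p. frechet_derivative (radial_ext f) (at p) v"])
  ultimately show "Ck_on k punct (radial_ext (\<lambda>p. frechet_derivative (radial_ext f) (at p) v))"
    by (subst Ck_cong[OF open_punct]) auto
qed

section \<open>Differentials and vector fields in Wirtinger components\<close>

lemma vector_4 [simp]:
  "(vector [x, y, z, w] :: 'a::zero ^ 4) $ 1 = x"
  "(vector [x, y, z, w] :: 'a::zero ^ 4) $ 2 = y"
  "(vector [x, y, z, w] :: 'a::zero ^ 4) $ 3 = z"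
  "(vector [x, y, z, w] :: 'a::zero ^ 4) $ 4 = w"
  unfolding vector_def by simp_all

lemma pairing_4: "pairing \<alpha> X = \<alpha> $ 1 * X $ 1 + \<alpha> $ 2 * X $ 2 + \<alpha> $ 3 * X $ 3 + \<alpha> $ 4 * X $ 4"
  by (simp add: pairing_def sum_4)

abbreviation DD :: "(c2 \<Rightarrow> complex) \<Rightarrow> c2 \<Rightarrow> c2 \<Rightarrow> complex" where
  "DD f p \<equiv> frechet_derivative (radial_ext f) (at p)"

lemma diff_fun_nth:
  "diff_fun f p $ 1 = (DD f p (1, 0) - \<i> * DD f p (\<i>, 0)) / 2"
  "diff_fun f p $ 2 = (DD f p (1, 0) + \<i> * DD f p (\<i>, 0)) / 2"
  "diff_fun f p $ 3 = (DD f p (0, 1) - \<i> * DD f p (0, \<i>)) / 2"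
  "diff_fun f p $ 4 = (DD f p (0, 1) + \<i> * DD f p (0, \<i>)) / 2"
  by (simp_all add: diff_fun_def Let_def)

lemma smooth_diff_fun: "smooth_S3 f \<Longrightarrow> smooth_S3 (\<lambda>p. diff_fun f p $ j)"
proof -
  assume f: "smooth_S3 f"
  have "\<forall>j. smooth_S3 (\<lambda>p. diff_fun f p $ j)"
    unfolding forall_4 diff_fun_nth divide_inverse
    by (intro conjI smooth_mult smooth_add smooth_diff smooth_const smooth_derivative f)
  then show ?thesis ..
qed

lemma smooth_vf [intro]: "smooth_field X \<Longrightarrow> smooth_S3 f \<Longrightarrow> smooth_S3 (vf_apply X f)"
  unfolding vf_apply_def[abs_def] pairing_def
  by (intro smooth_sum smooth_mult smooth_diff_fun) (auto simp: smooth_field_def)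

lemma DD_cong: "(\<And>q. q \<in> S3 \<Longrightarrow> f q = g q) \<Longrightarrow> p \<noteq> 0 \<Longrightarrow> DD f p = DD g p"
  by (rule frechet_cong(2)[OF open_punct]) (auto intro: radial_ext_cong)

lemma diff_fun_cong: "(\<And>q. q \<in> S3 \<Longrightarrow> f q = g q) \<Longrightarrow> p \<noteq> 0 \<Longrightarrow> diff_fun f p = diff_fun g p"
  unfolding diff_fun_def using DD_cong[of f g p] by simp

lemma vf_cong:
  "(\<And>q. q \<in> S3 \<Longrightarrow> f q = g q) \<Longrightarrow> p \<in> S3 \<Longrightarrow> vf_apply X f p = vf_apply X g p"
  unfolding vf_apply_def using diff_fun_cong[of f g p] S3_nonzero by metis

lemma DD_const: "DD (\<lambda>p. c) p v = 0"
  by (simp add: radial_ext_def)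

lemma DD_add:
  assumes "smooth_S3 f" "smooth_S3 g" "p \<noteq> 0"
  shows "DD (\<lambda>q. f q + g q) p v = DD f p v + DD g p v"
proof -
  have "radial_ext (\<lambda>q. f q + g q) = (\<lambda>q. radial_ext f q + radial_ext g q)" by (simp add: radial_ext_def)
  then show ?thesis
    using frechet_derivative_at[OF has_derivative_add[OF smooth_has_derivative[OF assms(1,3)] smooth_has_derivative[OF assms(2,3)]]]
    by (metis (no_types))
qed

lemma DD_mult:
  assumes "smooth_S3 f" "smooth_S3 g" "p \<in> S3"
  shows "DD (\<lambda>q. f q * g q) p v = f p * DD g p v + DD f p v * g p"
proof -
  have "radial_ext (\<lambda>q. f q * g q) = (\<lambda>q. radial_ext f q * radial_ext g q)" by (simp add: radial_ext_def)
  then have "DD (\<lambda>q. f q * g q) p = (\<lambda>v. radial_ext f p * DD g p v + DD f p v * radial_ext g p)"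
    using frechet_derivative_at[OF has_derivative_mult[OF smooth_has_derivative smooth_has_derivative], OF assms(1) _ assms(2), of p]
      S3_nonzero[OF assms(3)] by simp
  then show ?thesis by (simp add: radial_ext_S3 assms(3))
qed

lemma DD_cnj:
  assumes "smooth_S3 f" "p \<noteq> 0"
  shows "DD (\<lambda>q. cnj (f q)) p v = cnj (DD f p v)"
proof -
  have "radial_ext (\<lambda>q. cnj (f q)) = (\<lambda>q. cnj (radial_ext f q))" by (simp add: radial_ext_def)
  then have "DD (\<lambda>q. cnj (f q)) p = (\<lambda>v. cnj (DD f p v))"
    using frechet_derivative_at[OF has_derivative_cnj[OF smooth_has_derivative[OF assms]]] by simp
  then show ?thesis by simp
qed

lemma diff_fun_add:
  assumes "smooth_S3 f" "smooth_S3 g" "p \<noteq> 0"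
  shows "diff_fun (\<lambda>q. f q + g q) p $ j = diff_fun f p $ j + diff_fun g p $ j"
proof -
  have "\<forall>j. diff_fun (\<lambda>q. f q + g q) p $ j = diff_fun f p $ j + diff_fun g p $ j"
    unfolding forall_4 diff_fun_nth DD_add[OF assms] by (simp add: field_simps)
  then show ?thesis ..
qed

lemma diff_fun_mult:
  assumes "smooth_S3 f" "smooth_S3 g" "p \<in> S3"
  shows "diff_fun (\<lambda>q. f q * g q) p $ j = f p * diff_fun g p $ j + diff_fun f p $ j * g p"
proof -
  have "\<forall>j. diff_fun (\<lambda>q. f q * g q) p $ j = f p * diff_fun g p $ j + diff_fun f p $ j * g p"
    unfolding forall_4 diff_fun_nth DD_mult[OF assms] by (simp add: field_simps)
  then show ?thesis ..
qed

lemma diff_fun_const: "diff_fun (\<lambda>q. c) p $ j = 0"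
proof -
  have "\<forall>j. diff_fun (\<lambda>q. c) p $ j = 0"
    unfolding forall_4 diff_fun_nth DD_const by simp
  then show ?thesis ..
qed

lemma vf_add:
  "smooth_S3 f \<Longrightarrow> smooth_S3 g \<Longrightarrow> p \<in> S3 \<Longrightarrow> vf_apply X (\<lambda>q. f q + g q) p = vf_apply X f p + vf_apply X g p"
  by (simp add: vf_apply_def pairing_4 diff_fun_add S3_nonzero algebra_simps)

lemma vf_mult:
  "smooth_S3 f \<Longrightarrow> smooth_S3 g \<Longrightarrow> p \<in> S3 \<Longrightarrow> vf_apply X (\<lambda>q. f q * g q) p = f p * vf_apply X g p + vf_apply X f p * g p"
  by (simp add: vf_apply_def pairing_4 diff_fun_mult algebra_simps)

lemma vf_const [simp]: "vf_apply X (\<lambda>q. c) p = 0"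
  by (simp add: vf_apply_def pairing_4 diff_fun_const)

lemma vf_scale: "smooth_S3 f \<Longrightarrow> p \<in> S3 \<Longrightarrow> vf_apply X (\<lambda>q. c * f q) p = c * vf_apply X f p"
  by (simp add: vf_mult smooth_const)

lemma vf_minus: "smooth_S3 f \<Longrightarrow> p \<in> S3 \<Longrightarrow> vf_apply X (\<lambda>q. - f q) p = - vf_apply X f p"
  using vf_scale[of f p X "-1"] by simp

lemma vf_diff:
  "smooth_S3 f \<Longrightarrow> smooth_S3 g \<Longrightarrow> p \<in> S3 \<Longrightarrow> vf_apply X (\<lambda>q. f q - g q) p = vf_apply X f p - vf_apply X g p"
  using vf_add[of f "\<lambda>q. - g q" p X] by (simp add: vf_minus smooth_minus)

lemma vf_sum:
  "(\<And>i. i \<in> I \<Longrightarrow> smooth_S3 (f i)) \<Longrightarrow> p \<in> S3 \<Longrightarrow> vf_apply X (\<lambda>q. \<Sum>i\<in>I. f i q) p = (\<Sum>i\<in>I. vf_apply X (f i) p)"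
  by (induction I rule: infinite_finite_induct) (simp_all add: vf_add smooth_sum)

lemma conj_vec_nth [simp]: "conj_vec X $ 1 = cnj (X $ 2)" "conj_vec X $ 2 = cnj (X $ 1)"
  "conj_vec X $ 3 = cnj (X $ 4)" "conj_vec X $ 4 = cnj (X $ 3)"
  by (simp_all add: conj_vec_def)

lemma conj_vec_conj_vec [simp]: "conj_vec (conj_vec X) = X"
  by (simp add: vec_eq_iff forall_4)

lemma pairing_conj: "pairing (conj_vec \<alpha>) (conj_vec X) = cnj (pairing \<alpha> X)"
  by (simp add: pairing_4)

lemma vf_cnj:
  assumes "smooth_S3 f" "p \<in> S3"
  shows "vf_apply X (\<lambda>q. cnj (f q)) p = cnj (vf_apply (\<lambda>q. conj_vec (X q)) f p)"
proof -
  have "diff_fun (\<lambda>q. cnj (f q)) p = conj_vec (diff_fun f p)"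
    using assms by (simp add: vec_eq_iff forall_4 diff_fun_nth DD_cnj S3_nonzero)
  then show ?thesis using pairing_conj[of "diff_fun f p" "conj_vec (X p)"]
    by (simp add: vf_apply_def)
qed

section \<open>The pseudohermitian structure of the Rossi sphere\<close>

lemma tangent_iff: "X \<in> tangent_S3 p \<longleftrightarrow>
    cnj (fst p) * X $ 1 + fst p * X $ 2 + cnj (snd p) * X $ 3 + snd p * X $ 4 = 0"
  by (simp add: tangent_S3_def pairing_4)

lemma tangent_conj: "X \<in> tangent_S3 p \<Longrightarrow> conj_vec X \<in> tangent_S3 p"
  unfolding tangent_iff by (drule arg_cong[of _ _ cnj]) (simp add: algebra_simps)

lemma DD_coord:
  assumes p: "p \<in> S3" and L: "bounded_linear L"
  shows "DD L p v = L v - L p * complex_of_real (v \<bullet> p)"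
proof -
  have e: "radial_ext L = (\<lambda>q. complex_of_real (inverse (norm q)) * L q)"
    by (simp add: radial_ext_def linear_cmul[OF bounded_linear.linear[OF L]] scaleR_conv_of_real)
  have n: "norm p = 1" using p by (simp add: norm_S3)
  have "((\<lambda>q. complex_of_real (inverse (norm q))) has_derivative
      (\<lambda>v. complex_of_real (- (inverse (norm p) * (v \<bullet> sgn p) * inverse (norm p))))) (at p)"
    using S3_nonzero[OF p] by (auto intro!: derivative_eq_intros intro: has_derivative_norm)
  then have "((\<lambda>q. complex_of_real (inverse (norm q))) has_derivative (\<lambda>v. complex_of_real (- (v \<bullet> p)))) (at p)"
    by (simp only: n sgn_div_norm) simp
  from has_derivative_mult[OF this bounded_linear_imp_has_derivative[OF L, of "at p"]]
  have "(radial_ext L has_derivative (\<lambda>v. complex_of_real (inverse (norm p)) * L v + complex_of_real (- (v \<bullet> p)) * L p)) (at p)"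
    unfolding e .
  then have "DD L p = (\<lambda>v. complex_of_real (inverse (norm p)) * L v + complex_of_real (- (v \<bullet> p)) * L p)"
    by (rule frechet_derivative_at[symmetric])
  then show ?thesis by (simp add: n)
qed

text \<open>Extending a coordinate radially adds to its differential a multiple of the conormal form
  of the sphere, and tangent vectors are annihilated by that form.\<close>

lemma diff_coord:
  assumes p: "p \<in> S3" and X: "X \<in> tangent_S3 p"
  shows "pairing (diff_fun fst p) X = X $ 1" "pairing (diff_fun (\<lambda>q. cnj (fst q)) p) X = X $ 2"
    "pairing (diff_fun snd p) X = X $ 3" "pairing (diff_fun (\<lambda>q. cnj (snd q)) p) X = X $ 4"
proof -
  have 1: "pairing (diff_fun fst p) X = X $ 1" "pairing (diff_fun snd p) X = X $ 3"
    if X: "X \<in> tangent_S3 p" for X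
  proof -
    define r1 where "r1 = complex_of_real (Re (fst p))"
    define m1 where "m1 = complex_of_real (Im (fst p))"
    define r2 where "r2 = complex_of_real (Re (snd p))"
    define m2 where "m2 = complex_of_real (Im (snd p))"
    have e: "r1 + \<i> * m1 = fst p" "r1 - \<i> * m1 = cnj (fst p)" "r2 + \<i> * m2 = snd p" "r2 - \<i> * m2 = cnj (snd p)"
      by (simp_all add: complex_eq_iff r1_def m1_def r2_def m2_def)
    have i: "complex_of_real ((1, 0) \<bullet> p) = r1" "complex_of_real ((\<i>, 0) \<bullet> p) = m1"
      "complex_of_real ((0, 1) \<bullet> p) = r2" "complex_of_real ((0, \<i>) \<bullet> p) = m2"
      by (simp_all add: inner_prod_def inner_complex_def r1_def m1_def r2_def m2_def)
    have d': "diff_fun fst p $ 1 = 1 - fst p / 2 * (r1 - \<i> * m1)" "diff_fun fst p $ 2 = - fst p / 2 * (r1 + \<i> * m1)"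
       "diff_fun fst p $ 3 = - fst p / 2 * (r2 - \<i> * m2)" "diff_fun fst p $ 4 = - fst p / 2 * (r2 + \<i> * m2)"
       "diff_fun snd p $ 3 = 1 - snd p / 2 * (r2 - \<i> * m2)" "diff_fun snd p $ 4 = - snd p / 2 * (r2 + \<i> * m2)"
       "diff_fun snd p $ 1 = - snd p / 2 * (r1 - \<i> * m1)" "diff_fun snd p $ 2 = - snd p / 2 * (r1 + \<i> * m1)"
      unfolding diff_fun_nth DD_coord[OF p bounded_linear_fst] DD_coord[OF p bounded_linear_snd] i fst_conv snd_conv
      by (simp_all add: field_simps)
    note d = d'[unfolded e]
    have "pairing (diff_fun fst p) X = X $ 1 - fst p / 2 *
        (cnj (fst p) * X $ 1 + fst p * X $ 2 + cnj (snd p) * X $ 3 + snd p * X $ 4)"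
      unfolding pairing_4 d by (simp add: algebra_simps)
    moreover have "pairing (diff_fun snd p) X = X $ 3 - snd p / 2 *
        (cnj (fst p) * X $ 1 + fst p * X $ 2 + cnj (snd p) * X $ 3 + snd p * X $ 4)"
      unfolding pairing_4 d by (simp add: algebra_simps)
    ultimately show "pairing (diff_fun fst p) X = X $ 1" "pairing (diff_fun snd p) X = X $ 3"
      using X by (simp_all add: tangent_iff)
  qed
  show "pairing (diff_fun fst p) X = X $ 1" "pairing (diff_fun snd p) X = X $ 3"
    by (rule 1[OF X])+
  show "pairing (diff_fun (\<lambda>q. cnj (fst q)) p) X = X $ 2" "pairing (diff_fun (\<lambda>q. cnj (snd q)) p) X = X $ 4"
    using 1[OF tangent_conj[OF X]] vf_cnj[OF smooth_fst p, of "\<lambda>_. X"] vf_cnj[OF smooth_snd p, of "\<lambda>_. X"]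
    by (simp_all add: vf_apply_def)
qed

lemma vf_coord:
  assumes p: "p \<in> S3" and X: "X p \<in> tangent_S3 p"
  shows "vf_apply X fst p = X p $ 1" "vf_apply X (\<lambda>q. cnj (fst q)) p = X p $ 2"
    "vf_apply X snd p = X p $ 3" "vf_apply X (\<lambda>q. cnj (snd q)) p = X p $ 4"
  using diff_coord[OF p X] by (simp_all add: vf_apply_def)

lemma pair_lin:
  "smooth_S3 f \<Longrightarrow> smooth_S3 g \<Longrightarrow> p \<in> S3 \<Longrightarrow>
     pairing (diff_fun (\<lambda>q. f q + g q) p) X = pairing (diff_fun f p) X + pairing (diff_fun g p) X"
  "smooth_S3 f \<Longrightarrow> smooth_S3 g \<Longrightarrow> p \<in> S3 \<Longrightarrow>
     pairing (diff_fun (\<lambda>q. f q * g q) p) X = f p * pairing (diff_fun g p) X + pairing (diff_fun f p) X * g p"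
  "smooth_S3 f \<Longrightarrow> p \<in> S3 \<Longrightarrow> pairing (diff_fun (\<lambda>q. c * f q) p) X = c * pairing (diff_fun f p) X"
  "smooth_S3 f \<Longrightarrow> p \<in> S3 \<Longrightarrow> pairing (diff_fun (\<lambda>q. - f q) p) X = - pairing (diff_fun f p) X"
  "pairing (diff_fun (\<lambda>q. c) p) X = 0"
  using vf_add[of f g p "\<lambda>_. X"] vf_mult[of f g p "\<lambda>_. X"] vf_scale[of f p "\<lambda>_. X" c] vf_minus[of f p "\<lambda>_. X"]
    vf_const[of "\<lambda>_. X" c p, unfolded vf_apply_def]
  by (simp_all add: vf_apply_def)

lemma diff_coord_scale:
  assumes p: "p \<in> S3" and X: "X \<in> tangent_S3 p"
  shows "pairing (diff_fun (\<lambda>q. c * fst q) p) X = c * X $ 1" "pairing (diff_fun (\<lambda>q. c * cnj (fst q)) p) X = c * X $ 2"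
    "pairing (diff_fun (\<lambda>q. c * snd q) p) X = c * X $ 3" "pairing (diff_fun (\<lambda>q. c * cnj (snd q)) p) X = c * X $ 4"
  by (simp_all only: pair_lin(3) smooth_fst smooth_snd smooth_cnj p diff_coord[OF p X])

lemma pairing_axis: "pairing (axis j 1) X = X $ j"
  by (simp add: pairing_def axis_def if_distrib[of "\<lambda>z. z * _"] cong: if_cong)

lemma ext_d_4: "ext_d \<alpha> p X Y =
    (\<Sum>j\<in>UNIV. pairing (diff_fun (\<lambda>q. \<alpha> q $ j) p) X * Y $ j - pairing (diff_fun (\<lambda>q. \<alpha> q $ j) p) Y * X $ j)"
  by (simp add: ext_d_def wedge_def pairing_axis)

lemma contact_nth [simp]: "contact_form p $ 1 = - (\<i> / 2) * cnj (fst p)" "contact_form p $ 2 = \<i> / 2 * fst p"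
  "contact_form p $ 3 = - (\<i> / 2) * cnj (snd p)" "contact_form p $ 4 = \<i> / 2 * snd p"
  by (cases p; simp add: contact_form_def)+

lemma Z_std_nth [simp]: "Z_std p $ 1 = cnj (snd p)" "Z_std p $ 2 = 0" "Z_std p $ 3 = - cnj (fst p)" "Z_std p $ 4 = 0"
  by (cases p; simp add: Z_std_def)+

lemma Z_rossi_nth [simp]: "Z_rossi t p $ 1 = cnj (snd p)" "Z_rossi t p $ 2 = t * snd p"
  "Z_rossi t p $ 3 = - cnj (fst p)" "Z_rossi t p $ 4 = - t * fst p"
  by (simp_all add: Z_rossi_def)

lemma smooth_fieldI: "smooth_S3 (\<lambda>p. X p $ 1) \<Longrightarrow> smooth_S3 (\<lambda>p. X p $ 2) \<Longrightarrow> smooth_S3 (\<lambda>p. X p $ 3) \<Longrightarrow> smooth_S3 (\<lambda>p. X p $ 4)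
    \<Longrightarrow> smooth_field X"
  by (simp add: smooth_field_def forall_4)

lemma smooth_conj_field: "smooth_field X \<Longrightarrow> smooth_field (\<lambda>p. conj_vec (X p))"
  by (rule smooth_fieldI) (auto simp: smooth_field_def)

lemma smooth_contact: "smooth_field contact_form"
  by (rule smooth_fieldI) (simp_all only: contact_nth, (intro smooth_mult smooth_const smooth_cnj smooth_fst smooth_snd)+)

lemma smooth_Z_std: "smooth_field Z_std"
  by (rule smooth_fieldI) (simp_all only: Z_std_nth, (intro smooth_minus smooth_const smooth_cnj smooth_fst smooth_snd)+)

lemma smooth_Z_rossi: "smooth_field (Z_rossi t)"
  by (rule smooth_fieldI) (simp_all only: Z_rossi_nth, (intro smooth_minus smooth_mult smooth_const smooth_cnj smooth_fst smooth_snd)+)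

lemma tangent_Z_std: "Z_std p \<in> tangent_S3 p" and tangent_Z_rossi: "Z_rossi t p \<in> tangent_S3 p"
  by (simp_all add: tangent_iff)

section \<open>The Reeb field, the coframe and the Tanaka-Webster data\<close>

definition reeb :: cfield where
  "reeb p = vector [\<i> * fst p, - \<i> * cnj (fst p), \<i> * snd p, - \<i> * cnj (snd p)]"

lemma reeb_nth [simp]: "reeb p $ 1 = \<i> * fst p" "reeb p $ 2 = - \<i> * cnj (fst p)" "reeb p $ 3 = \<i> * snd p" "reeb p $ 4 = - \<i> * cnj (snd p)"
  by (simp_all add: reeb_def)

lemma smooth_reeb: "smooth_field reeb"
  by (rule smooth_fieldI) (simp_all only: reeb_nth, (intro smooth_mult smooth_const smooth_cnj smooth_fst smooth_snd)+)

lemma tangent_reeb: "reeb p \<in> tangent_S3 p"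
  by (simp add: tangent_iff)

text \<open>\<open>Z_std\<close>, its conjugate and \<open>reeb\<close> form a frame of the
  complexified tangent bundle; \<open>a\<close>, \<open>b\<close>, \<open>c\<close> are the
  coefficients, read off with the dual forms.\<close>

lemma tangent_frame:
  assumes p: "p \<in> S3" and X: "X \<in> tangent_S3 p"
  obtains a b c where
    "X $ 1 = a * cnj (snd p) + \<i> * c * fst p" "X $ 2 = b * snd p - \<i> * c * cnj (fst p)"
    "X $ 3 = - a * cnj (fst p) + \<i> * c * snd p" "X $ 4 = - b * fst p - \<i> * c * cnj (snd p)"
proof
  \<comment> \<open>Conjugates get names of their own: \<open>algebra\<close> decides polynomial
    identities and has to treat them as independent variables related by \<open>S\<close> and
    \<open>T\<close>.\<close>
  define z where "z = fst p"
  define zb where "zb = cnj z"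
  define w where "w = snd p"
  define wb where "wb = cnj w"
  have S: "z * zb + w * wb = 1" using S3_eq[OF p] by (simp add: z_def zb_def w_def wb_def)
  have T: "zb * X $ 1 + z * X $ 2 + wb * X $ 3 + w * X $ 4 = 0"
    using X by (simp add: tangent_iff z_def zb_def w_def wb_def)
  have I: "\<i> * \<i> = -1" by simp
  let ?a = "w * X $ 1 - z * X $ 3" and ?b = "wb * X $ 2 - zb * X $ 4"
  let ?c = "(\<i> / 2) * (z * X $ 2 - zb * X $ 1 + w * X $ 4 - wb * X $ 3)"
  have c: "2 * (\<i> * ?c) = zb * X $ 1 - z * X $ 2 + wb * X $ 3 - w * X $ 4"
    by (simp add: algebra_simps)
  have "X $ 1 = ?a * wb + \<i> * ?c * z" "X $ 2 = ?b * w - \<i> * ?c * zb"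
    "X $ 3 = - ?a * zb + \<i> * ?c * w" "X $ 4 = - ?b * z - \<i> * ?c * wb"
    using S T c by algebra+
  then show "X $ 1 = ?a * cnj (snd p) + \<i> * ?c * fst p" "X $ 2 = ?b * snd p - \<i> * ?c * cnj (fst p)"
    "X $ 3 = - ?a * cnj (fst p) + \<i> * ?c * snd p" "X $ 4 = - ?b * fst p - \<i> * ?c * cnj (snd p)"
    by (simp_all add: z_def zb_def w_def wb_def)
qed

lemma ext_d_contact:
  assumes p: "p \<in> S3" and X: "X \<in> tangent_S3 p" and Y: "Y \<in> tangent_S3 p"
  shows "ext_d contact_form p X Y = \<i> * (X $ 1 * Y $ 2 - X $ 2 * Y $ 1 + X $ 3 * Y $ 4 - X $ 4 * Y $ 3)"
  unfolding ext_d_4 sum_4 contact_nth diff_coord_scale[OF p X] diff_coord_scale[OF p Y]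
  by (simp add: field_simps)

lemma contact_Z [simp]: "pairing (contact_form p) (Z_rossi t p) = 0"
  "pairing (contact_form p) (conj_vec (Z_rossi t p)) = 0"
  by (simp_all add: pairing_4 algebra_simps)

lemma levi_rossi: "p \<in> S3 \<Longrightarrow> levi_coeff contact_form (Z_rossi t) p = 1 - t\<^sup>2"
proof -
  assume p: "p \<in> S3"
  have "levi_coeff contact_form (Z_rossi t) p = (1 - t\<^sup>2) * (fst p * cnj (fst p) + snd p * cnj (snd p))"
    unfolding levi_coeff_def levi_def ext_d_contact[OF p tangent_Z_rossi tangent_conj[OF tangent_Z_rossi]]
    by (simp add: algebra_simps power2_eq_square)
  then show ?thesis using S3_eq[OF p] by simp
qed

lemma contact_reeb: "p \<in> S3 \<Longrightarrow> pairing (contact_form p) (reeb p) = 1"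
proof -
  assume p: "p \<in> S3"
  have "pairing (contact_form p) (reeb p) = fst p * cnj (fst p) + snd p * cnj (snd p)"
    by (simp add: pairing_4 algebra_simps)
  then show ?thesis using S3_eq[OF p] by simp
qed

lemma reeb_is_reeb: "is_reeb contact_form reeb"
  unfolding is_reeb_def
proof (intro conjI ballI smooth_reeb tangent_reeb contact_reeb)
  fix p X assume p: "p \<in> S3" and X: "X \<in> tangent_S3 p"
  show "ext_d contact_form p (reeb p) X = 0"
  proof -
    have "cnj (fst p) * X $ 1 + fst p * X $ 2 + cnj (snd p) * X $ 3 + snd p * X $ 4 = 0"
      using X by (simp add: tangent_iff)
    then show ?thesis unfolding ext_d_contact[OF p tangent_reeb X] reeb_nth by algebra
  qed
qed

text \<open>\<open>is_tanaka_webster\<close> quantifies existentially over the Reeb field. Testing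
  with \<open>Z_std\<close> and its conjugate removes the two horizontal coefficients, and the
  normalization fixes the third.\<close>

lemma reeb_unique:
  assumes T: "is_reeb contact_form T" and p: "p \<in> S3"
  shows "T p = reeb p"
proof -
  have t: "T p \<in> tangent_S3 p" and c: "pairing (contact_form p) (T p) = 1"
    and d: "\<And>X. X \<in> tangent_S3 p \<Longrightarrow> ext_d contact_form p (T p) X = 0"
    using T p by (auto simp: is_reeb_def)
  obtain a b e where f: "T p $ 1 = a * cnj (snd p) + \<i> * e * fst p" "T p $ 2 = b * snd p - \<i> * e * cnj (fst p)"
    "T p $ 3 = - a * cnj (fst p) + \<i> * e * snd p" "T p $ 4 = - b * fst p - \<i> * e * cnj (snd p)"
    by (rule tangent_frame[OF p t])
  define z where "z = fst p"
  define zb where "zb = cnj z"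
  define w where "w = snd p"
  define wb where "wb = cnj w"
  note zd = z_def zb_def w_def wb_def
  have S: "z * zb + w * wb = 1" using S3_eq[OF p] by (simp add: zd)
  have "ext_d contact_form p (T p) (Z_std p) = 0" by (intro d tangent_Z_std)
  then have "T p $ 2 * wb - T p $ 4 * zb = 0"
    unfolding ext_d_contact[OF p t tangent_Z_std] by (simp add: zd algebra_simps)
  then have b: "b = 0" using S unfolding f zd[symmetric] by algebra
  have "ext_d contact_form p (T p) (conj_vec (Z_std p)) = 0" by (intro d tangent_conj tangent_Z_std)
  then have "T p $ 1 * w - T p $ 3 * z = 0"
    unfolding ext_d_contact[OF p t tangent_conj[OF tangent_Z_std]] by (simp add: zd algebra_simps)
  then have a: "a = 0" using S unfolding f zd[symmetric] by algebra
  have "pairing (contact_form p) (T p) = e * (z * zb + w * wb)"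
    unfolding pairing_4 f a b by (simp add: zd algebra_simps)
  then have e: "e = 1" using c S by simp
  show ?thesis unfolding vec_eq_iff forall_4 f a b e by simp
qed

definition coframe :: "real \<Rightarrow> cfield" where
  "coframe t p = (1 / complex_of_real (1 - t\<^sup>2)) *s
     vector [snd p, - t * cnj (snd p), - fst p, t * cnj (fst p)]"

lemma coframe_nth: "coframe t p $ 1 = 1 / complex_of_real (1 - t\<^sup>2) * snd p"
  "coframe t p $ 2 = - t / complex_of_real (1 - t\<^sup>2) * cnj (snd p)"
  "coframe t p $ 3 = - 1 / complex_of_real (1 - t\<^sup>2) * fst p"
  "coframe t p $ 4 = t / complex_of_real (1 - t\<^sup>2) * cnj (fst p)"
  by (simp_all add: coframe_def)

lemma smooth_coframe: "smooth_field (coframe t)"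
  by (rule smooth_fieldI) (simp_all only: coframe_nth, (intro smooth_mult smooth_const smooth_cnj smooth_fst smooth_snd)+)

lemma one_minus_t2: "\<bar>t\<bar> < 1 \<Longrightarrow> complex_of_real (1 - t\<^sup>2) \<noteq> 0"
  by (simp only: of_real_eq_0_iff) (auto simp: abs_square_eq_1)

lemma coframe_is_coframe:
  assumes t: "\<bar>t\<bar> < 1"
  shows "is_coframe (Z_rossi t) reeb (coframe t)"
  unfolding is_coframe_def
proof (intro conjI ballI smooth_coframe)
  fix p assume p: "p \<in> S3"
  let ?h = "complex_of_real (1 - t\<^sup>2)"
  have h: "?h \<noteq> 0" by (rule one_minus_t2[OF t])
  have "pairing (coframe t p) (Z_rossi t p) = ((1 - t\<^sup>2) * (fst p * cnj (fst p) + snd p * cnj (snd p))) / ?h"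
    unfolding pairing_4 coframe_nth by (simp add: algebra_simps power2_eq_square add_divide_distrib diff_divide_distrib)
  then show "pairing (coframe t p) (Z_rossi t p) = 1" using h S3_eq[OF p] by simp
  show "pairing (coframe t p) (conj_vec (Z_rossi t p)) = 0" "pairing (coframe t p) (reeb p) = 0"
    unfolding pairing_4 coframe_nth by (simp_all add: algebra_simps)
qed

text \<open>A multiple of the contact form, so all connection terms in the Kohn Laplacian and in the
  CR Paneitz operator vanish. The factor is purely imaginary because the Levi coefficient is
  constant.\<close>

definition connection :: "real \<Rightarrow> cfield" where
  "connection t p = (- 2 * \<i> * (1 + t\<^sup>2) / complex_of_real (1 - t\<^sup>2)) *s contact_form p"

lemma smooth_connection: "smooth_field (connection t)"
  using smooth_contact unfolding smooth_field_def connection_def vector_smult_component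
  by (intro allI smooth_mult smooth_const) blast

lemma pairing_connection:
  "pairing (connection t p) X = (- 2 * \<i> * (1 + t\<^sup>2) / complex_of_real (1 - t\<^sup>2)) * pairing (contact_form p) X"
  by (simp add: connection_def pairing_def sum_distrib_left mult.assoc)

text \<open>The value for which the torsion factor \<open>\<i> * A11 * (1 / h)\<close> becomes
  \<open>4 * t / (1 - t^2)\<close>: the origin of the term \<open>4 * t\<close> in
  \<open>Qm\<close>.\<close>

abbreviation torsion :: "real \<Rightarrow> complex" where
  "torsion t \<equiv> 4 * \<i> * t / complex_of_real (1 - t\<^sup>2)"

lemma ext_d_coframe:
  assumes p: "p \<in> S3" and X: "X \<in> tangent_S3 p" and Y: "Y \<in> tangent_S3 p"
  shows "ext_d (coframe t) p X Y = 2 / complex_of_real (1 - t\<^sup>2) *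
    (X $ 3 * Y $ 1 - X $ 1 * Y $ 3 + t * (X $ 2 * Y $ 4 - X $ 4 * Y $ 2))"
  unfolding ext_d_4 sum_4 coframe_nth
  unfolding diff_coord_scale[OF p X] diff_coord_scale[OF p Y]
  by (simp add: divide_inverse algebra_simps)

text \<open>On the frame coefficients of \<open>X\<close> and \<open>Y\<close> the claim is a
  polynomial identity modulo the relations \<open>S\<close>, \<open>H\<close> and
  \<open>I\<close>.\<close>

lemma structure_equation:
  assumes t: "\<bar>t\<bar> < 1" and p: "p \<in> S3" and X: "X \<in> tangent_S3 p" and Y: "Y \<in> tangent_S3 p"
  shows "ext_d (coframe t) p X Y = wedge (coframe t p) (connection t p) X Y
    + torsion t * wedge (contact_form p) (conj_vec (coframe t p)) X Y"
proof -
  define H where "H = 1 / complex_of_real (1 - t\<^sup>2)"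
  define T where "T = complex_of_real t"
  have H: "H * (1 - T * T) = 1"
    using one_minus_t2[OF t] by (simp add: H_def T_def power2_eq_square)
  define z where "z = fst p"
  define zb where "zb = cnj z"
  define w where "w = snd p"
  define wb where "wb = cnj w"
  note zd = z_def zb_def w_def wb_def
  have S: "z * zb + w * wb = 1" using S3_eq[OF p] by (simp add: zd)
  have I: "\<i> * \<i> = -1" by simp
  have co: "pairing (coframe t p) V = H * (a - T * b)" "pairing (conj_vec (coframe t p)) V = H * (b - T * a)"
      "pairing (contact_form p) V = c"
    if V: "V $ 1 = a * cnj (snd p) + \<i> * c * fst p" "V $ 2 = b * snd p - \<i> * c * cnj (fst p)"
    "V $ 3 = - a * cnj (fst p) + \<i> * c * snd p" "V $ 4 = - b * fst p - \<i> * c * cnj (snd p)" for V a b c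
  proof -
    have n: "coframe t p $ 1 = H * w" "coframe t p $ 2 = - (T * H) * wb" "coframe t p $ 3 = - H * z" "coframe t p $ 4 = T * H * zb"
      by (simp_all add: coframe_nth H_def T_def zd)
    have cn: "conj_vec (coframe t p) $ 1 = - (T * H) * w" "conj_vec (coframe t p) $ 2 = H * wb"
        "conj_vec (coframe t p) $ 3 = T * H * z" "conj_vec (coframe t p) $ 4 = - H * zb"
      by (simp_all add: n) (simp_all add: H_def T_def zd)
    note V' = V[folded z_def w_def, folded zb_def wb_def]
    show "pairing (coframe t p) V = H * (a - T * b)"
      unfolding pairing_4 n V' using S by algebra
    show "pairing (conj_vec (coframe t p)) V = H * (b - T * a)"
      unfolding pairing_4 cn V' using S by algebra
    have "2 * (\<i> * pairing (contact_form p) V) = 2 * (\<i> * c)"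
    proof -
      have "2 * (\<i> * pairing (contact_form p) V) = zb * V $ 1 - z * V $ 2 + wb * V $ 3 - w * V $ 4"
        unfolding pairing_4 contact_nth by (simp add: zd algebra_simps)
      also have "\<dots> = 2 * (\<i> * c)" unfolding V' using S by algebra
      finally show ?thesis .
    qed
    then show "pairing (contact_form p) V = c" by simp
  qed
  obtain a b c where x: "X $ 1 = a * cnj (snd p) + \<i> * c * fst p" "X $ 2 = b * snd p - \<i> * c * cnj (fst p)"
    "X $ 3 = - a * cnj (fst p) + \<i> * c * snd p" "X $ 4 = - b * fst p - \<i> * c * cnj (snd p)"
    by (rule tangent_frame[OF p X])
  obtain a' b' c' where y: "Y $ 1 = a' * cnj (snd p) + \<i> * c' * fst p" "Y $ 2 = b' * snd p - \<i> * c' * cnj (fst p)"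
    "Y $ 3 = - a' * cnj (fst p) + \<i> * c' * snd p" "Y $ 4 = - b' * fst p - \<i> * c' * cnj (snd p)"
    by (rule tangent_frame[OF p Y])
  have cc: "- 2 * \<i> * (1 + t\<^sup>2) / complex_of_real (1 - t\<^sup>2) = - 2 * \<i> * (1 + T * T) * H"
    "torsion t = 4 * \<i> * T * H" "2 / complex_of_real (1 - t\<^sup>2) = 2 * H"
    by (simp_all add: H_def T_def power2_eq_square)
  show ?thesis
    unfolding ext_d_coframe[OF p X Y] wedge_def pairing_connection cc
    unfolding co[OF x] co[OF y] x[folded z_def w_def, folded zb_def wb_def] y[folded z_def w_def, folded zb_def wb_def]
      T_def[symmetric]
    using S H I by algebra
qed

lemma rossi_tanaka_webster:
  assumes t: "\<bar>t\<bar> < 1"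
  shows "is_tanaka_webster contact_form (Z_rossi t) (connection t) (\<lambda>_. torsion t)"
proof -
  have "pairing (diff_fun (levi_coeff contact_form (Z_rossi t)) p) X =
      levi_coeff contact_form (Z_rossi t) p * (pairing (connection t p) X + pairing (conj_vec (connection t p)) X)"
    if p: "p \<in> S3" for p X
  proof -
    have "diff_fun (levi_coeff contact_form (Z_rossi t)) p = diff_fun (\<lambda>_. 1 - t\<^sup>2) p"
      using p by (intro diff_fun_cong levi_rossi S3_nonzero)
    then have "pairing (diff_fun (levi_coeff contact_form (Z_rossi t)) p) X = 0" by (simp only: pair_lin(5))
    moreover have "conj_vec (connection t p) = - connection t p"
    proof -
      define r where "r = - (2 * (1 + t\<^sup>2) / (1 - t\<^sup>2))"
      have k: "- 2 * \<i> * (1 + t\<^sup>2) / complex_of_real (1 - t\<^sup>2) = \<i> * complex_of_real r"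
        by (simp add: r_def mult_ac)
      show ?thesis unfolding connection_def k by (simp add: vec_eq_iff forall_4)
    qed
    ultimately show ?thesis by (simp add: pairing_4)
  qed
  then show ?thesis
    unfolding is_tanaka_webster_def
    using smooth_connection smooth_const reeb_is_reeb coframe_is_coframe[OF t] structure_equation[OF t] by blast
qed

text \<open>The choice in \<open>tanaka_webster\<close> may come with another coframe, since
  \<open>is_coframe\<close> fixes \<open>\<theta>1\<close> only on tangent vectors. Along the sphere
  \<open>\<theta>1\<close> differs from \<open>coframe t\<close> by a multiple \<open>c\<close> of
  the conormal form, the differential of \<open>|z|^2 + |w|^2\<close>; this multiple has zero
  exterior derivative on pairs of tangent vectors. Evaluating the structure equation on
  \<open>(Z, Zbar)\<close> and \<open>(T, Zbar)\<close> then gives the two values.\<close>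

lemma tanaka_webster_unique:
  assumes t: "\<bar>t\<bar> < 1" and tw: "is_tanaka_webster contact_form (Z_rossi t) \<omega> A" and p: "p \<in> S3"
  shows "pairing (\<omega> p) (conj_vec (Z_rossi t p)) = 0" "A p = torsion t"
proof -
  obtain T \<theta>1 where T: "is_reeb contact_form T" and co: "is_coframe (Z_rossi t) T \<theta>1"
    and eq: "\<And>p X Y. p \<in> S3 \<Longrightarrow> X \<in> tangent_S3 p \<Longrightarrow> Y \<in> tangent_S3 p \<Longrightarrow>
       ext_d \<theta>1 p X Y = wedge (\<theta>1 p) (\<omega> p) X Y + A p * wedge (contact_form p) (conj_vec (\<theta>1 p)) X Y"
    using tw unfolding is_tanaka_webster_def by blast
  have s\<theta>: "smooth_S3 (\<lambda>q. \<theta>1 q $ j)" for j using co by (simp add: is_coframe_def smooth_field_def)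
  have sco: "smooth_S3 (\<lambda>q. coframe t q $ j)" for j using smooth_coframe by (simp add: smooth_field_def)
  define \<gamma> where "\<gamma> q = \<theta>1 q - coframe t q" for q
  \<comment> \<open>The multiple is recovered from components of \<open>\<gamma>\<close> by the
    equation of the sphere, which shows that it is smooth.\<close>
  define c where "c q = \<gamma> q $ 1 * fst q + \<gamma> q $ 3 * snd q" for q
  have sc: "smooth_S3 c"
    unfolding c_def \<gamma>_def vector_minus_component by (intro smooth_add smooth_mult smooth_diff s\<theta> sco smooth_fst smooth_snd)
  have \<gamma>: "\<gamma> q $ 1 = c q * cnj (fst q) \<and> \<gamma> q $ 2 = c q * fst q \<and> \<gamma> q $ 3 = c q * cnj (snd q) \<and> \<gamma> q $ 4 = c q * snd q"
    if q: "q \<in> S3" for q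
  proof -
    have "pairing (\<theta>1 q) (reeb q) = 0" using co q reeb_unique[OF T q] by (metis is_coframe_def)
    then have 0: "pairing (\<gamma> q) (Z_rossi t q) = 0" "pairing (\<gamma> q) (conj_vec (Z_rossi t q)) = 0" "pairing (\<gamma> q) (reeb q) = 0"
      using co coframe_is_coframe[OF t] q
      by (simp_all add: is_coframe_def \<gamma>_def pairing_def left_diff_distrib sum_subtractf)
    define z where "z = fst q"
    define zb where "zb = cnj z"
    define w where "w = snd q"
    define wb where "wb = cnj w"
    define s where "s = complex_of_real t"
    note zd = z_def zb_def w_def wb_def
    have S: "z * zb + w * wb = 1" using S3_eq[OF q] by (simp add: zd)
    have s: "1 - s * s \<noteq> 0" using one_minus_t2[OF t] by (simp add: s_def power2_eq_square)
    have 1: "(\<gamma> q $ 1 * wb - \<gamma> q $ 3 * zb) + s * (\<gamma> q $ 2 * w - \<gamma> q $ 4 * z) = 0"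
      "s * (\<gamma> q $ 1 * wb - \<gamma> q $ 3 * zb) + (\<gamma> q $ 2 * w - \<gamma> q $ 4 * z) = 0"
      using 0(1,2) by (simp_all add: pairing_4 zd s_def algebra_simps)
    have "(1 - s * s) * (\<gamma> q $ 1 * wb - \<gamma> q $ 3 * zb) = 0" "(1 - s * s) * (\<gamma> q $ 2 * w - \<gamma> q $ 4 * z) = 0"
      using 1 by algebra+
    then have 2: "\<gamma> q $ 1 * wb - \<gamma> q $ 3 * zb = 0" "\<gamma> q $ 2 * w - \<gamma> q $ 4 * z = 0"
      using s by simp_all
    have "\<i> * (\<gamma> q $ 1 * z - \<gamma> q $ 2 * zb + \<gamma> q $ 3 * w - \<gamma> q $ 4 * wb) = 0"
      using 0(3) by (simp add: pairing_4 zd algebra_simps)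
    then have 3: "\<gamma> q $ 1 * z - \<gamma> q $ 2 * zb + \<gamma> q $ 3 * w - \<gamma> q $ 4 * wb = 0" by simp
    have c: "c q = \<gamma> q $ 1 * z + \<gamma> q $ 3 * w" by (simp add: c_def zd)
    have "\<gamma> q $ 1 = c q * zb" "\<gamma> q $ 2 = c q * z" "\<gamma> q $ 3 = c q * wb" "\<gamma> q $ 4 = c q * w"
      using S 2 3 unfolding c by algebra+
    then show ?thesis by (simp add: zd)
  qed
  have ext: "ext_d \<theta>1 p X Y = ext_d (coframe t) p X Y" if X: "X \<in> tangent_S3 p" and Y: "Y \<in> tangent_S3 p" for X Y
  proof -
    have d: "pairing (diff_fun (\<lambda>q. \<theta>1 q $ j) p) V = pairing (diff_fun (\<lambda>q. coframe t q $ j) p) V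
        + (c p * pairing (diff_fun \<rho> p) V + pairing (diff_fun c p) V * \<rho> p)"
      if "\<And>q. q \<in> S3 \<Longrightarrow> \<gamma> q $ j = c q * \<rho> q" "smooth_S3 \<rho>" for j \<rho> V
    proof -
      have "\<theta>1 q $ j = coframe t q $ j + c q * \<rho> q" if "q \<in> S3" for q
        using \<open>\<And>q. q \<in> S3 \<Longrightarrow> \<gamma> q $ j = c q * \<rho> q\<close>[OF that] by (simp add: \<gamma>_def algebra_simps)
      then have "diff_fun (\<lambda>q. \<theta>1 q $ j) p = diff_fun (\<lambda>q. coframe t q $ j + c q * \<rho> q) p"
        using S3_nonzero[OF p] by (rule diff_fun_cong)
      then show ?thesis using that(2) by (simp add: pair_lin sco sc p smooth_mult)
    qed
    have d1: "pairing (diff_fun (\<lambda>q. \<theta>1 q $ 1) p) V = pairing (diff_fun (\<lambda>q. coframe t q $ 1) p) V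
        + (c p * V $ 2 + pairing (diff_fun c p) V * cnj (fst p))"
      "pairing (diff_fun (\<lambda>q. \<theta>1 q $ 2) p) V = pairing (diff_fun (\<lambda>q. coframe t q $ 2) p) V
        + (c p * V $ 1 + pairing (diff_fun c p) V * fst p)"
      "pairing (diff_fun (\<lambda>q. \<theta>1 q $ 3) p) V = pairing (diff_fun (\<lambda>q. coframe t q $ 3) p) V
        + (c p * V $ 4 + pairing (diff_fun c p) V * cnj (snd p))"
      "pairing (diff_fun (\<lambda>q. \<theta>1 q $ 4) p) V = pairing (diff_fun (\<lambda>q. coframe t q $ 4) p) V
        + (c p * V $ 3 + pairing (diff_fun c p) V * snd p)"
      if "V \<in> tangent_S3 p" for V
      using d[of 1 "\<lambda>q. cnj (fst q)" V] d[of 2 fst V] d[of 3 "\<lambda>q. cnj (snd q)" V] d[of 4 snd V] \<gamma>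
      unfolding diff_coord[OF p that] by (simp_all add: smooth_fst smooth_snd smooth_cnj)
    have XY: "cnj (fst p) * X $ 1 + fst p * X $ 2 + cnj (snd p) * X $ 3 + snd p * X $ 4 = 0"
       "cnj (fst p) * Y $ 1 + fst p * Y $ 2 + cnj (snd p) * Y $ 3 + snd p * Y $ 4 = 0"
      using X Y by (simp_all add: tangent_iff)
    \<comment> \<open>The terms with \<open>c p\<close> cancel because the conormal form is closed,
      those with the differential of \<open>c\<close> because \<open>X\<close> and \<open>Y\<close>
      are tangent.\<close>
    show ?thesis
      unfolding ext_d_4 sum_4 d1[OF X] d1[OF Y] using XY by algebra
  qed
  have tp: "T p = reeb p" by (rule reeb_unique[OF T p])
  have Zb: "conj_vec (Z_rossi t p) \<in> tangent_S3 p" by (intro tangent_conj tangent_Z_rossi)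
  have co1: "pairing (\<theta>1 p) (Z_rossi t p) = 1" "pairing (\<theta>1 p) (conj_vec (Z_rossi t p)) = 0" "pairing (\<theta>1 p) (reeb p) = 0"
    "pairing (coframe t p) (Z_rossi t p) = 1" "pairing (coframe t p) (conj_vec (Z_rossi t p)) = 0" "pairing (coframe t p) (reeb p) = 0"
    using co coframe_is_coframe[OF t] p tp by (auto simp: is_coframe_def)
  have co2: "pairing (conj_vec (\<theta>1 p)) (conj_vec (Z_rossi t p)) = 1" "pairing (conj_vec (coframe t p)) (conj_vec (Z_rossi t p)) = 1"
    by (simp_all add: pairing_conj co1)
  show "pairing (\<omega> p) (conj_vec (Z_rossi t p)) = 0"
    using eq[OF p tangent_Z_rossi[of t] Zb] structure_equation[OF t p tangent_Z_rossi[of t] Zb] ext[OF tangent_Z_rossi[of t] Zb]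
    by (simp add: wedge_def co1 pairing_connection)
  show "A p = torsion t"
    using eq[OF p tangent_reeb Zb] structure_equation[OF t p tangent_reeb Zb] ext[OF tangent_reeb Zb]
    by (simp add: wedge_def co1 co2 pairing_connection contact_reeb p)
qed

section \<open>The CR Paneitz operator on smooth functions\<close>

abbreviation Zr :: "real \<Rightarrow> (c2 \<Rightarrow> complex) \<Rightarrow> c2 \<Rightarrow> complex" where
  "Zr t \<equiv> vf_apply (Z_rossi t)"

abbreviation Zrb :: "real \<Rightarrow> (c2 \<Rightarrow> complex) \<Rightarrow> c2 \<Rightarrow> complex" where
  "Zrb t \<equiv> vf_apply (\<lambda>q. conj_vec (Z_rossi t q))"

definition rossi_op :: "real \<Rightarrow> (c2 \<Rightarrow> complex) \<Rightarrow> c2 \<Rightarrow> complex" where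
  "rossi_op t u = (\<lambda>p. 1 / complex_of_real ((1 - t\<^sup>2)\<^sup>2) *
     Zrb t (\<lambda>q. Zr t (Zr t (Zrb t u)) q + 4 * t * Zrb t u q) p)"

lemma smooth_Zr [intro]: "smooth_S3 u \<Longrightarrow> smooth_S3 (Zr t u)" and smooth_Zrb [intro]: "smooth_S3 u \<Longrightarrow> smooth_S3 (Zrb t u)"
  by (rule smooth_vf[OF smooth_Z_rossi] smooth_vf[OF smooth_conj_field[OF smooth_Z_rossi]], assumption)+

text \<open>The connection is zero on \<open>Zbar\<close>, its conjugate is zero on
  \<open>Z\<close>, and the Levi coefficient is constant on the sphere, so the factors
  \<open>1 / h\<close> can be pulled out of the derivatives.\<close>

lemma cr_paneitz_rossi:
  assumes t: "\<bar>t\<bar> < 1" and u: "smooth_S3 u" and p: "p \<in> S3"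
  shows "cr_paneitz contact_form (Z_rossi t) u p = rossi_op t u p"
proof -
  obtain \<omega> A where tw: "tanaka_webster contact_form (Z_rossi t) = (\<omega>, A)" by fastforce
  have "is_tanaka_webster contact_form (Z_rossi t) \<omega> A"
  proof -
    have "case tanaka_webster contact_form (Z_rossi t) of (\<omega>, A) \<Rightarrow> is_tanaka_webster contact_form (Z_rossi t) \<omega> A"
      unfolding tanaka_webster_def
      by (rule someI[of _ "(connection t, \<lambda>_. torsion t)"]) (use rossi_tanaka_webster[OF t] in simp)
    then show ?thesis by (simp add: tw)
  qed
  note un = tanaka_webster_unique[OF t this]
  let ?h = "complex_of_real (1 - t\<^sup>2)"
  have h: "?h \<noteq> 0" by (rule one_minus_t2[OF t])
  have lv: "levi_coeff contact_form (Z_rossi t) q = ?h" if "q \<in> S3" for q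
    using levi_rossi[OF that] by simp
  have kohn: "kohn_laplacian contact_form (Z_rossi t) u q = (- 1 / ?h) * Zr t (Zrb t u) q" if q: "q \<in> S3" for q
  proof -
    have "pairing (conj_vec (\<omega> q)) (Z_rossi t q) = 0"
      using pairing_conj[of "\<omega> q" "conj_vec (Z_rossi t q)"] un(1)[OF q] by simp
    then show ?thesis by (simp add: kohn_laplacian_def tw lv[OF q])
  qed
  define W where "W q = - Zr t (kohn_laplacian contact_form (Z_rossi t) u) q
      + \<i> * (levi_coeff contact_form (Z_rossi t) q * cnj (A q)) * (1 / levi_coeff contact_form (Z_rossi t) q) * Zrb t u q" for q
  have W: "W q = (1 / ?h) * (Zr t (Zr t (Zrb t u)) q + 4 * t * Zrb t u q)" if q: "q \<in> S3" for q
  proof -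
    have "Zr t (kohn_laplacian contact_form (Z_rossi t) u) q = Zr t (\<lambda>q. (- 1 / ?h) * Zr t (Zrb t u) q) q"
      by (rule vf_cong[OF kohn q])
    also have "\<dots> = (- 1 / ?h) * Zr t (Zr t (Zrb t u)) q"
      by (intro vf_scale smooth_Zr smooth_Zrb u q)
    finally have zk: "Zr t (kohn_laplacian contact_form (Z_rossi t) u) q = (- 1 / ?h) * Zr t (Zr t (Zrb t u)) q" .
    have tc: "cnj (torsion t) = - (4 * \<i> * t / ?h)" by simp
    have "- (- 1 / k * x) + \<i> * (k * (- (4 * \<i> * t / k))) * (1 / k) * y = 1 / k * (x + 4 * t * y)"
      if "k \<noteq> 0" for k x y :: complex
      using that by (simp add: field_simps)
    from this[OF h] show ?thesis
      unfolding W_def lv[OF q] un(2)[OF q] zk tc .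
  qed
  have "cr_paneitz contact_form (Z_rossi t) u p = (1 / ?h) * Zrb t W p"
    unfolding cr_paneitz_def Let_def tw prod.case W_def[symmetric] using un(1)[OF p] by (simp add: lv[OF p])
  also have "Zrb t W p = Zrb t (\<lambda>q. (1 / ?h) * (Zr t (Zr t (Zrb t u)) q + 4 * t * Zrb t u q)) p"
    by (rule vf_cong[OF W p])
  also have "\<dots> = (1 / ?h) * Zrb t (\<lambda>q. Zr t (Zr t (Zrb t u)) q + 4 * t * Zrb t u q) p"
    by (intro vf_scale smooth_add smooth_mult smooth_const smooth_Zr smooth_Zrb u p)
  finally show ?thesis by (simp add: rossi_op_def power2_eq_square)
qed

section \<open>The measure in Hopf coordinates\<close>

definition jac :: "real \<times> real \<times> real \<Rightarrow> real" where
  "jac = (\<lambda>(\<eta>, a, b). 2 * (sin \<eta> * cos \<eta>))"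

lemma hopf_S3: "hopf x \<in> S3"
  by (cases x) (simp add: S3_def hopf_def norm_mult power_mult_distrib)

lemma hopf_has_derivative:
  "(hopf has_derivative (\<lambda>(h, k, l). (complex_of_real (- sin \<eta> * h) * cis a + \<i> * complex_of_real (cos \<eta> * k) * cis a, complex_of_real (cos \<eta> * h) * cis b + \<i> * complex_of_real (sin \<eta> * l) * cis b)))
     (at (\<eta>, a, b))"
proof -
  have c: "cis t = complex_of_real (cos t) + \<i> * complex_of_real (sin t)" for t
    by (simp add: complex_eq_iff)
  have h: "hopf = (\<lambda>x. (complex_of_real (cos (fst x)) * (complex_of_real (cos (fst (snd x))) + \<i> * complex_of_real (sin (fst (snd x)))),
     complex_of_real (sin (fst x)) * (complex_of_real (cos (snd (snd x))) + \<i> * complex_of_real (sin (snd (snd x))))))"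
    by (auto simp: hopf_def c fun_eq_iff)
  show ?thesis
    unfolding h c
    by (rule has_derivative_eq_rhs, (rule derivative_intros)+)
       (auto simp: fun_eq_iff algebra_simps)
qed

lemma hopf_frechet:
  "frechet_derivative hopf (at (\<eta>, a, b)) (h, k, l) =
    (complex_of_real (- sin \<eta> * h) * cis a + \<i> * complex_of_real (cos \<eta> * k) * cis a, complex_of_real (cos \<eta> * h) * cis b + \<i> * complex_of_real (sin \<eta> * l) * cis b)"
  by (simp add: frechet_derivative_at[OF hopf_has_derivative, symmetric])

lemma continuous_hopf: "continuous_on A hopf"
  unfolding hopf_def case_prod_beta by (intro continuous_intros)

lemma hopf_eq: "fst (hopf (\<eta>, a, b)) = complex_of_real (cos \<eta>) * cis a" "snd (hopf (\<eta>, a, b)) = complex_of_real (sin \<eta>) * cis b"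
  by (simp_all add: hopf_def)

lemma real_vec_nth [simp]: "real_vec v $ 1 = fst v" "real_vec v $ 2 = cnj (fst v)" "real_vec v $ 3 = snd v" "real_vec v $ 4 = cnj (snd v)"
  by (simp_all add: real_vec_def)

lemma cnj_cis: "cnj (cis a) = cis (- a)" by (simp add: complex_eq_iff)

lemma contact_volume_hopf:
  assumes x: "x \<in> hopf_box"
  shows "(let D = frechet_derivative hopf (at x) in
     cmod (contact_volume contact_form (hopf x) (real_vec (D (1, 0, 0))) (real_vec (D (0, 1, 0))) (real_vec (D (0, 0, 1))))) = jac x"
proof -
  obtain \<eta> a b where xe: "x = (\<eta>, a, b)" by (cases x)
  have \<eta>: "0 < \<eta>" "\<eta> < pi / 2" using x by (auto simp: hopf_box_def xe)
  define c where "c = complex_of_real (cos \<eta>)"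
  define s where "s = complex_of_real (sin \<eta>)"
  have cs: "c * c + s * s = 1"
    unfolding c_def s_def of_real_mult[symmetric] of_real_add[symmetric] using sin_cos_squared_add3[of \<eta>] by simp
  define X where "X = real_vec (frechet_derivative hopf (at x) (1, 0, 0))"
  define Y where "Y = real_vec (frechet_derivative hopf (at x) (0, 1, 0))"
  define V where "V = real_vec (frechet_derivative hopf (at x) (0, 0, 1))"
  define e where "e = cis a"
  define e' where "e' = cis (- a)"
  define f where "f = cis b"
  define f' where "f' = cis (- b)"
  have ef: "e * e' = 1" "f * f' = 1" by (simp_all add: e_def e'_def f_def f'_def cis_mult)
  have X: "X $ 1 = - s * e" "X $ 2 = - s * e'" "X $ 3 = c * f" "X $ 4 = c * f'"
    by (simp_all add: X_def xe hopf_frechet c_def s_def e_def e'_def f_def f'_def cnj_cis)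
  have Y: "Y $ 1 = \<i> * c * e" "Y $ 2 = - \<i> * c * e'" "Y $ 3 = 0" "Y $ 4 = 0"
    by (simp_all add: Y_def xe hopf_frechet c_def s_def e_def e'_def f_def f'_def cnj_cis)
  have V: "V $ 1 = 0" "V $ 2 = 0" "V $ 3 = \<i> * s * f" "V $ 4 = - \<i> * s * f'"
    by (simp_all add: V_def xe hopf_frechet c_def s_def e_def e'_def f_def f'_def cnj_cis)
  have p: "fst (hopf x) = c * e" "snd (hopf x) = s * f" "cnj (fst (hopf x)) = c * e'" "cnj (snd (hopf x)) = s * f'"
    by (simp_all add: xe hopf_eq c_def s_def e_def e'_def f_def f'_def cnj_cis)
  have t: "X \<in> tangent_S3 (hopf x)" "Y \<in> tangent_S3 (hopf x)" "V \<in> tangent_S3 (hopf x)"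
    unfolding tangent_iff p(3,4) unfolding p(1,2) X Y V using ef by algebra+
  note S = hopf_S3[of x]
  \<comment> \<open>The order of the Hopf coordinates is negatively oriented for the volume form,
    whence the sign; the modulus in \<open>contact_measure\<close> removes it.\<close>
  have "contact_volume contact_form (hopf x) X Y V = - 2 * (s * c)"
    unfolding contact_volume_def ext_d_contact[OF S t(2,3)] ext_d_contact[OF S t(3,1)] ext_d_contact[OF S t(1,2)]
      pairing_4 contact_nth p(3,4)
    unfolding p(1,2) X Y V
    using ef cs by (simp add: field_simps) algebra
  also have "\<dots> = complex_of_real (- jac x)" by (simp add: s_def c_def jac_def xe)
  finally have "cmod (contact_volume contact_form (hopf x) X Y V) = \<bar>jac x\<bar>"
    by (simp only: norm_of_real abs_minus_cancel)
  moreover have "0 \<le> jac x"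
    using \<eta> sin_gt_zero[of \<eta>] cos_gt_zero[of \<eta>] pi_gt_zero by (simp add: jac_def xe)
  ultimately show ?thesis by (simp add: Let_def X_def Y_def V_def)
qed

lemma jac_pos: "x \<in> hopf_box \<Longrightarrow> 0 < jac x"
  using sin_gt_zero cos_gt_zero pi_gt_zero by (cases x) (auto simp: hopf_box_def jac_def)

lemma continuous_jac: "continuous_on A jac"
  unfolding jac_def case_prod_beta by (intro continuous_intros)

lemma hopf_box_eq: "hopf_box = box (0, 0, 0) (pi / 2, 2 * pi, 2 * pi)"
  by (auto simp: hopf_box_def box_def Basis_prod_def inner_prod_def)

lemma hopf_box_borel [measurable]: "hopf_box \<in> sets borel"
  by (simp add: hopf_box_eq)

lemma compact_S3: "compact S3"
proof -
  have "S3 = sphere (0 :: c2) 1" by (simp add: set_eq_iff norm_S3)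
  then show ?thesis using compact_sphere by metis
qed

lemma S3_borel [measurable]: "S3 \<in> sets borel"
  by (intro borel_closed compact_imp_closed compact_S3)

lemma jac_measurable [measurable]: "jac \<in> borel_measurable borel"
  by (intro borel_measurable_continuous_onI continuous_jac)

lemma hopf_measurable [measurable]: "hopf \<in> measurable borel (restrict_space borel S3)"
  by (intro measurable_restrict_space2 borel_measurable_continuous_onI continuous_hopf) (simp_all add: hopf_S3)

text \<open>The density in the definition is recognized as measurable through its agreement with
  \<open>jac\<close> on the box; outside the box nothing is claimed about it.\<close>

lemma S3_measure_eq:
  "S3_measure = distr (density (restrict_space lborel hopf_box) (\<lambda>x. ennreal (jac x))) (restrict_space borel S3) hopf"
proof -
  let ?B = "restrict_space lborel hopf_box"
  define f where "f x = (let D = frechet_derivative hopf (at x) in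
      ennreal (cmod (contact_volume contact_form (hopf x)
        (real_vec (D (1, 0, 0))) (real_vec (D (0, 1, 0))) (real_vec (D (0, 0, 1))))))" for x
  have e: "f x = ennreal (jac x)" if "x \<in> hopf_box" for x
    using contact_volume_hopf[OF that] by (simp add: f_def Let_def)
  have m: "(\<lambda>x. ennreal (jac x)) \<in> borel_measurable ?B"
    by (intro measurable_restrict_space1) simp
  then have "f \<in> borel_measurable ?B"
    by (rule measurable_cong[THEN iffD2, rotated]) (simp add: e space_restrict_space)
  then have "density ?B f = density ?B (\<lambda>x. ennreal (jac x))"
    using m by (intro density_cong) (auto simp: e space_restrict_space)
  then show ?thesis by (simp add: S3_measure_def contact_measure_def f_def[abs_def])
qed

lemma space_S3_measure [simp]: "space S3_measure = S3"
  and sets_S3_measure [measurable_cong]: "sets S3_measure = sets (restrict_space borel S3)"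
  by (simp_all add: S3_measure_eq space_restrict_space)

lemma hopf_measurable_box: "hopf \<in> measurable (density (restrict_space lborel hopf_box) (\<lambda>x. ennreal (jac x))) (restrict_space borel S3)"
proof -
  have "hopf \<in> measurable (restrict_space lborel hopf_box) (restrict_space borel S3)"
    by (intro measurable_restrict_space1) simp
  then show ?thesis by simp
qed

lemma integral_S3:
  fixes g :: "c2 \<Rightarrow> 'b::{banach, second_countable_topology}"
  assumes g: "g \<in> borel_measurable S3_measure"
  shows "(\<integral>p. g p \<partial>S3_measure) = (\<integral>x. indicator hopf_box x *\<^sub>R (jac x *\<^sub>R g (hopf x)) \<partial>lborel)"
    and "integrable S3_measure g \<longleftrightarrow> integrable lborel (\<lambda>x. indicator hopf_box x *\<^sub>R (jac x *\<^sub>R g (hopf x)))"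
proof -
  let ?B = "restrict_space lborel hopf_box"
  have g': "g \<in> borel_measurable (restrict_space borel S3)"
    using g by (simp add: measurable_cong_sets[OF sets_S3_measure refl])
  have gh: "(\<lambda>x. g (hopf x)) \<in> borel_measurable ?B"
    using measurable_compose[OF hopf_measurable_box g'] by simp
  have j: "jac \<in> borel_measurable ?B" "AE x in ?B. 0 \<le> jac x"
    by (intro measurable_restrict_space1, simp) (auto simp: space_restrict_space intro!: AE_I2 less_imp_le jac_pos)
  show "(\<integral>p. g p \<partial>S3_measure) = (\<integral>x. indicator hopf_box x *\<^sub>R (jac x *\<^sub>R g (hopf x)) \<partial>lborel)"
    unfolding S3_measure_eq integral_distr[OF hopf_measurable_box g'] integral_density[OF gh j]
    by (subst integral_restrict_space) auto
  show "integrable S3_measure g \<longleftrightarrow> integrable lborel (\<lambda>x. indicator hopf_box x *\<^sub>R (jac x *\<^sub>R g (hopf x)))"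
    unfolding S3_measure_eq integrable_distr_eq[OF hopf_measurable_box g'] integrable_density[OF gh j]
    by (subst integrable_restrict_space) auto
qed

lemma continuous_measurable_S3: "continuous_on S3 g \<Longrightarrow> g \<in> borel_measurable S3_measure"
  by (simp add: measurable_cong_sets[OF sets_S3_measure refl] borel_measurable_continuous_on_restrict)

lemma continuous_integrable_box:
  fixes G :: "real \<times> real \<times> real \<Rightarrow> complex"
  assumes "continuous_on UNIV G"
  shows "integrable lborel (\<lambda>x. indicator hopf_box x *\<^sub>R G x)"
    and "(\<integral>x. indicator hopf_box x *\<^sub>R G x \<partial>lborel) = integral (cbox (0, 0, 0) (pi / 2, 2 * pi, 2 * pi)) G"
proof -
  have "set_integrable lborel (cbox (0, 0, 0) (pi / 2, 2 * pi, 2 * pi)) G"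
    unfolding set_integrable_def
    by (rule borel_integrable_compact) (auto intro: continuous_on_subset[OF assms])
  then have i: "set_integrable lborel hopf_box G"
    unfolding hopf_box_eq by (rule set_integrable_subset) (auto simp: box_subset_cbox)
  then show "integrable lborel (\<lambda>x. indicator hopf_box x *\<^sub>R G x)" by (simp add: set_integrable_def)
  have "(\<integral>x. indicator hopf_box x *\<^sub>R G x \<partial>lborel) = integral hopf_box G"
    using set_borel_integral_eq_integral(2)[OF i] by (simp add: set_lebesgue_integral_def)
  then show "(\<integral>x. indicator hopf_box x *\<^sub>R G x \<partial>lborel) = integral (cbox (0, 0, 0) (pi / 2, 2 * pi, 2 * pi)) G"
    unfolding hopf_box_eq integral_open_interval .
qed

lemma continuous_S3:
  assumes g: "continuous_on S3 (g :: c2 \<Rightarrow> complex)"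
  shows "integrable S3_measure g"
    and "(\<integral>p. g p \<partial>S3_measure) = integral (cbox (0, 0, 0) (pi / 2, 2 * pi, 2 * pi)) (\<lambda>x. jac x *\<^sub>R g (hopf x))"
proof -
  have "continuous_on UNIV (\<lambda>x. jac x *\<^sub>R g (hopf x))"
    by (intro continuous_on_scaleR continuous_jac continuous_on_compose2[OF g continuous_hopf]) (auto simp: hopf_S3)
  from continuous_integrable_box[OF this] show "integrable S3_measure g"
    "(\<integral>p. g p \<partial>S3_measure) = integral (cbox (0, 0, 0) (pi / 2, 2 * pi, 2 * pi)) (\<lambda>x. jac x *\<^sub>R g (hopf x))"
    by (simp_all add: integral_S3[OF continuous_measurable_S3[OF g]])
qed

lemma finite_S3_measure: "finite_measure S3_measure"
proof
  have "integrable S3_measure (\<lambda>p. 1 :: complex)" by (intro continuous_S3 continuous_on_const)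
  then have "emeasure S3_measure (space S3_measure) < \<infinity>" by (simp add: integrable_iff_bounded)
  then show "emeasure S3_measure (space S3_measure) \<noteq> \<infinity>" by simp
qed

lemma continuous_L2: "continuous_on S3 g \<Longrightarrow> g \<in> L2 S3_measure"
proof (rule L2I)
  assume g: "continuous_on S3 g"
  then show "g \<in> borel_measurable S3_measure" by (rule continuous_measurable_S3)
  have "integrable S3_measure (\<lambda>p. complex_of_real ((cmod (g p))\<^sup>2))"
    by (intro continuous_S3 continuous_intros g)
  then show "integrable S3_measure (\<lambda>p. (cmod (g p))\<^sup>2)"
    by (subst (asm) complex_of_real_integrable_eq)
qed

section \<open>Integrals of exact derivatives over the coordinate box\<close>

lemma integral_derivative_zero:
  fixes g A :: "real \<times> 'b::euclidean_space \<Rightarrow> complex"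
  assumes g: "continuous_on UNIV g" and l: "0 \<le> l"
    and A: "\<And>x y. ((\<lambda>x. A (x, y)) has_vector_derivative g (x, y)) (at x)"
    and per: "\<And>y. A (l, y) = A (0, y)"
  shows "integral (cbox (0, c) (l, d)) g = 0"
proof -
  have "integral (cbox (0, c) (l, d)) g = integral (cbox 0 l) (\<lambda>x. integral (cbox c d) (\<lambda>y. g (x, y)))"
    by (intro integral_prod_continuous continuous_on_subset[OF g]) auto
  also have "\<dots> = integral (cbox c d) (\<lambda>y. integral (cbox 0 l) (\<lambda>x. g (x, y)))"
    by (rule integral_swap_continuous) (simp add: continuous_on_subset[OF g])
  also have "\<dots> = 0"
  proof -
    have "integral (cbox 0 l) (\<lambda>x. g (x, y)) = 0" for y
    proof -
      have "((\<lambda>x. g (x, y)) has_integral (A (l, y) - A (0, y))) {0..l}"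
        by (rule fundamental_theorem_of_calculus[OF l has_vector_derivative_at_within[OF A]])
      from integral_unique[OF this] show ?thesis using per[of y] by simp
    qed
    then show ?thesis by simp
  qed
  finally show ?thesis .
qed

lemma integral_inner_zero:
  fixes g :: "real \<times> 'b::euclidean_space \<Rightarrow> complex"
  assumes g: "continuous_on UNIV g" and z: "\<And>x. integral (cbox c d) (\<lambda>y. g (x, y)) = 0"
  shows "integral (cbox (0, c) (l, d)) g = 0"
proof -
  have "integral (cbox (0, c) (l, d)) g = integral (cbox 0 l) (\<lambda>x. integral (cbox c d) (\<lambda>y. g (x, y)))"
    by (intro integral_prod_continuous continuous_on_subset[OF g]) auto
  then show ?thesis by (simp add: z)
qed

text \<open>Fubini for continuous functions reduces each alternative to the fundamental theorem of
  calculus in the variable of differentiation. A divergence in Hopf coordinates is a sum of terms of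
  these three kinds.\<close>

lemma integral_box_derivative_zero:
  fixes g A :: "real \<times> real \<times> real \<Rightarrow> complex"
  assumes g: "continuous_on UNIV g"
    and A: "(\<forall>\<eta> a b. ((\<lambda>\<eta>. A (\<eta>, a, b)) has_vector_derivative g (\<eta>, a, b)) (at \<eta>)) \<and> (\<forall>a b. A (pi / 2, a, b) = A (0, a, b))
      \<or> (\<forall>\<eta> a b. ((\<lambda>a. A (\<eta>, a, b)) has_vector_derivative g (\<eta>, a, b)) (at a)) \<and> (\<forall>\<eta> b. A (\<eta>, 2 * pi, b) = A (\<eta>, 0, b))
      \<or> (\<forall>\<eta> a b. ((\<lambda>b. A (\<eta>, a, b)) has_vector_derivative g (\<eta>, a, b)) (at b)) \<and> (\<forall>\<eta> a. A (\<eta>, a, 2 * pi) = A (\<eta>, a, 0))"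
  shows "integral (cbox (0, 0, 0) (pi / 2, 2 * pi, 2 * pi)) g = 0"
proof -
  have slice: "continuous_on UNIV (\<lambda>y. g (\<eta>, y))" for \<eta>
    by (rule continuous_on_compose2[OF g]) (auto intro: continuous_intros)
  show ?thesis
  using A
proof (elim disjE conjE)
  assume "\<forall>\<eta> a b. ((\<lambda>\<eta>. A (\<eta>, a, b)) has_vector_derivative g (\<eta>, a, b)) (at \<eta>)" "\<forall>a b. A (pi / 2, a, b) = A (0, a, b)"
  then show ?thesis by (intro integral_derivative_zero[OF g, where A = A]) auto
next
  assume A: "\<forall>\<eta> a b. ((\<lambda>a. A (\<eta>, a, b)) has_vector_derivative g (\<eta>, a, b)) (at a)" "\<forall>\<eta> b. A (\<eta>, 2 * pi, b) = A (\<eta>, 0, b)"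
  have "integral (cbox (0, 0) (2 * pi, 2 * pi)) (\<lambda>y. g (\<eta>, y)) = 0" for \<eta>
    using A slice by (intro integral_derivative_zero[where A = "\<lambda>y. A (\<eta>, y)"]) auto
  then show ?thesis by (rule integral_inner_zero[OF g])
next
  assume A: "\<forall>\<eta> a b. ((\<lambda>b. A (\<eta>, a, b)) has_vector_derivative g (\<eta>, a, b)) (at b)" "\<forall>\<eta> a. A (\<eta>, a, 2 * pi) = A (\<eta>, a, 0)"
  have "integral (cbox (0, 0) (2 * pi, 2 * pi)) (\<lambda>y. g (\<eta>, y)) = 0" for \<eta>
  proof (rule integral_inner_zero)
    show "continuous_on UNIV (\<lambda>y. g (\<eta>, y))" by (rule slice)
    fix a
    have "((\<lambda>b. g (\<eta>, a, b)) has_integral (A (\<eta>, a, 2 * pi) - A (\<eta>, a, 0))) {0..2 * pi}"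
      by (rule fundamental_theorem_of_calculus[OF _ has_vector_derivative_at_within]) (use A in auto)
    then show "integral (cbox 0 (2 * pi)) (\<lambda>b. g (\<eta>, a, b)) = 0" using A(2) by (simp add: integral_unique)
  qed
  then show ?thesis by (rule integral_inner_zero[OF g])
qed

qed

lemma DD_real_vec:
  assumes "smooth_S3 f" "p \<noteq> 0"
  shows "DD f p v = pairing (diff_fun f p) (real_vec v)"
proof -
  have l: "linear (DD f p)" by (intro linear_frechet_derivative smooth_differentiable assms)
  have "v = (Re (fst v) *\<^sub>R (1, 0) + Im (fst v) *\<^sub>R (\<i>, 0)) + (Re (snd v) *\<^sub>R (0, 1) + Im (snd v) *\<^sub>R (0, \<i>))"
    by (cases v) (simp add: complex_eq_iff)
  then have "DD f p v = (Re (fst v) * DD f p (1, 0) + Im (fst v) * DD f p (\<i>, 0)) + (Re (snd v) * DD f p (0, 1) + Im (snd v) * DD f p (0, \<i>))"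
    using arg_cong[of _ _ "DD f p"] unfolding linear_add[OF l, symmetric] scaleR_conv_of_real[symmetric] linear_cmul[OF l, symmetric]
    by blast
  then have e1: "DD f p v = (x * DD f p (1, 0) + y * DD f p (\<i>, 0)) + (x' * DD f p (0, 1) + y' * DD f p (0, \<i>))"
    if "x = complex_of_real (Re (fst v))" "y = complex_of_real (Im (fst v))"
      "x' = complex_of_real (Re (snd v))" "y' = complex_of_real (Im (snd v))" for x y x' y'
    using that by simp
  define x where "x = complex_of_real (Re (fst v))"
  define y where "y = complex_of_real (Im (fst v))"
  define x' where "x' = complex_of_real (Re (snd v))"
  define y' where "y' = complex_of_real (Im (snd v))"
  have e2: "real_vec v $ 1 = x + \<i> * y" "real_vec v $ 2 = x - \<i> * y" "real_vec v $ 3 = x' + \<i> * y'" "real_vec v $ 4 = x' - \<i> * y'"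
    by (simp_all add: complex_eq_iff x_def y_def x'_def y'_def)
  show ?thesis
    unfolding pairing_4 diff_fun_nth e1[OF x_def y_def x'_def y'_def] e2 by (simp add: field_simps)
qed

lemma curve_derivative:
  assumes f: "smooth_S3 f" and g: "(g has_vector_derivative g') (at t)" and S: "\<And>t. g t \<in> S3"
  shows "((\<lambda>t. f (g t)) has_vector_derivative pairing (diff_fun f (g t)) (real_vec g')) (at t)"
proof -
  have n: "g t \<noteq> 0" by (rule S3_nonzero[OF S])
  have "(radial_ext f has_derivative DD f (g t)) (at (g t))" by (rule smooth_has_derivative[OF f n])
  from vector_derivative_diff_chain_within[OF g, of "radial_ext f" "DD f (g t)"] has_derivative_at_withinI[OF this]
  have "((radial_ext f \<circ> g) has_vector_derivative DD f (g t) g') (at t)" by simp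
  then show ?thesis by (simp add: o_def radial_ext_S3 S DD_real_vec[OF f n])
qed

lemma hopf_curves:
  "((\<lambda>\<eta>. hopf (\<eta>, a, b)) has_vector_derivative frechet_derivative hopf (at (\<eta>, a, b)) (1, 0, 0)) (at \<eta>)"
  "((\<lambda>a. hopf (\<eta>, a, b)) has_vector_derivative frechet_derivative hopf (at (\<eta>, a, b)) (0, 1, 0)) (at a)"
  "((\<lambda>b. hopf (\<eta>, a, b)) has_vector_derivative frechet_derivative hopf (at (\<eta>, a, b)) (0, 0, 1)) (at b)"
proof -
  have h: "(hopf has_derivative frechet_derivative hopf (at (\<eta>, a, b))) (at (\<eta>, a, b))"
    using frechet_has_derivative hopf_has_derivative differentiable_def by blast
  have 1: "((\<lambda>\<eta>. (\<eta>, a, b)) has_vector_derivative (1, 0, 0)) (at \<eta>)"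
    and 2: "((\<lambda>a. (\<eta>, a, b)) has_vector_derivative (0, 1, 0)) (at a)"
    and 3: "((\<lambda>b. (\<eta>, a, b)) has_vector_derivative (0, 0, 1)) (at b)"
    by (auto intro!: derivative_eq_intros simp: has_vector_derivative_def zero_prod_def)
  show "((\<lambda>\<eta>. hopf (\<eta>, a, b)) has_vector_derivative frechet_derivative hopf (at (\<eta>, a, b)) (1, 0, 0)) (at \<eta>)"
    using vector_derivative_diff_chain_within[OF 1 has_derivative_at_withinI[OF h]] by (simp add: o_def)
  show "((\<lambda>a. hopf (\<eta>, a, b)) has_vector_derivative frechet_derivative hopf (at (\<eta>, a, b)) (0, 1, 0)) (at a)"
    using vector_derivative_diff_chain_within[OF 2 has_derivative_at_withinI[OF h]] by (simp add: o_def)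
  show "((\<lambda>b. hopf (\<eta>, a, b)) has_vector_derivative frechet_derivative hopf (at (\<eta>, a, b)) (0, 0, 1)) (at b)"
    using vector_derivative_diff_chain_within[OF 3 has_derivative_at_withinI[OF h]] by (simp add: o_def)
qed

text \<open>In Hopf coordinates,
  \<open>2 sin \<eta> cos \<eta> Z_std f = \<partial>\<^sub>\<eta> (- sin \<eta> cos \<eta> E f) + \<partial>\<^sub>a (- \<i> sin\<^sup>2 \<eta> E f) + \<partial>\<^sub>b (\<i> cos\<^sup>2 \<eta> E f)\<close>
  with \<open>E = exp (- \<i> (a + b))\<close>.\<close>

definition rot1 :: cfield where "rot1 p = vector [\<i> * fst p, - \<i> * cnj (fst p), 0, 0]"

definition rot2 :: cfield where "rot2 p = vector [0, 0, \<i> * snd p, - \<i> * cnj (snd p)]"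

lemma integral_fields:
  assumes f: "smooth_S3 f"
  shows "(\<integral>p. vf_apply Z_std f p \<partial>S3_measure) = 0"
    and "(\<integral>p. vf_apply rot1 f p \<partial>S3_measure) = 0"
    and "(\<integral>p. vf_apply rot2 f p \<partial>S3_measure) = 0"
proof -
  define c where "c x = complex_of_real (cos (fst x))" for x :: "real \<times> real \<times> real"
  define s where "s x = complex_of_real (sin (fst x))" for x :: "real \<times> real \<times> real"
  define e where "e x = cis (fst (snd x))" for x :: "real \<times> real \<times> real"
  define e' where "e' x = cis (- fst (snd x))" for x :: "real \<times> real \<times> real"
  define u where "u x = cis (snd (snd x))" for x :: "real \<times> real \<times> real"
  define u' where "u' x = cis (- snd (snd x))" for x :: "real \<times> real \<times> real"
  define F where "F x = f (hopf x)" for x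
  define P where "P j x = diff_fun f (hopf x) $ j" for j x
  define Fe where "Fe x = - (s x * e x) * P 1 x - s x * e' x * P 2 x + c x * u x * P 3 x + c x * u' x * P 4 x" for x
  define Fa where "Fa x = \<i> * c x * e x * P 1 x - \<i> * c x * e' x * P 2 x" for x
  define Fb where "Fb x = \<i> * s x * u x * P 3 x - \<i> * s x * u' x * P 4 x" for x
  have eu: "e x * e' x = 1" "u x * u' x = 1" for x by (simp_all add: e_def e'_def u_def u'_def cis_mult)
  have cont: "continuous_on UNIV c" "continuous_on UNIV s" "continuous_on UNIV e" "continuous_on UNIV e'"
      "continuous_on UNIV u" "continuous_on UNIV u'" "continuous_on UNIV F" "\<And>j. continuous_on UNIV (P j)"
    unfolding c_def s_def e_def e'_def u_def u'_def F_def P_def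
    by (intro continuous_intros continuous_on_compose2[OF smooth_continuous continuous_hopf] f smooth_diff_fun; auto simp: hopf_S3)+
  have ce: "continuous_on UNIV Fe" "continuous_on UNIV Fa" "continuous_on UNIV Fb"
    unfolding Fe_def Fa_def Fb_def by (intro continuous_intros cont)+
  have d: "((\<lambda>\<eta>. F (\<eta>, a, b)) has_vector_derivative Fe (\<eta>, a, b)) (at \<eta>)"
    "((\<lambda>a. F (\<eta>, a, b)) has_vector_derivative Fa (\<eta>, a, b)) (at a)"
    "((\<lambda>b. F (\<eta>, a, b)) has_vector_derivative Fb (\<eta>, a, b)) (at b)" for \<eta> a b
    unfolding F_def
    using curve_derivative[OF f hopf_curves(1) hopf_S3, of a b \<eta>] curve_derivative[OF f hopf_curves(2) hopf_S3, of \<eta> b a]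
      curve_derivative[OF f hopf_curves(3) hopf_S3, of \<eta> a b]
    unfolding pairing_4 real_vec_nth hopf_frechet
    by (simp_all add: Fe_def Fa_def Fb_def P_def c_def s_def e_def e'_def u_def u'_def cnj_cis mult_ac)
  have dc: "((\<lambda>\<eta>. c (\<eta>, a, b)) has_vector_derivative - s (\<eta>, a, b)) (at \<eta>)"
      "((\<lambda>\<eta>. s (\<eta>, a, b)) has_vector_derivative c (\<eta>, a, b)) (at \<eta>)"
      "((\<lambda>a. e' (\<eta>, a, b)) has_vector_derivative - \<i> * e' (\<eta>, a, b)) (at a)"
      "((\<lambda>b. u' (\<eta>, a, b)) has_vector_derivative - \<i> * u' (\<eta>, a, b)) (at b)" for \<eta> a b
  proof -
    have r: "((\<lambda>t. complex_of_real (cos t)) has_vector_derivative - complex_of_real (sin t)) (at t)"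
      "((\<lambda>t. complex_of_real (sin t)) has_vector_derivative complex_of_real (cos t)) (at t)" for t
      unfolding has_vector_derivative_def
      by (rule has_derivative_eq_rhs, (rule derivative_intros)+, simp add: fun_eq_iff scaleR_conv_of_real)+
    have ci: "((\<lambda>t. cis (- t)) has_vector_derivative - \<i> * cis (- t)) (at t)" for t
    proof -
      have e: "cis (- t) = complex_of_real (cos t) - \<i> * complex_of_real (sin t)" for t
        by (simp add: complex_eq_iff)
      have "((\<lambda>t. complex_of_real (cos t) - \<i> * complex_of_real (sin t)) has_vector_derivative
          - complex_of_real (sin t) - \<i> * complex_of_real (cos t)) (at t)"
        by (rule has_vector_derivative_diff[OF r(1) has_vector_derivative_mult_right[OF r(2)]])
      moreover have "- complex_of_real (sin t) - \<i> * complex_of_real (cos t)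
          = - \<i> * (complex_of_real (cos t) - \<i> * complex_of_real (sin t))"
        by (simp add: algebra_simps)
      ultimately show ?thesis unfolding e by (simp only:)
    qed
    show "((\<lambda>\<eta>. c (\<eta>, a, b)) has_vector_derivative - s (\<eta>, a, b)) (at \<eta>)"
      "((\<lambda>\<eta>. s (\<eta>, a, b)) has_vector_derivative c (\<eta>, a, b)) (at \<eta>)"
      "((\<lambda>a. e' (\<eta>, a, b)) has_vector_derivative - \<i> * e' (\<eta>, a, b)) (at a)"
      "((\<lambda>b. u' (\<eta>, a, b)) has_vector_derivative - \<i> * u' (\<eta>, a, b)) (at b)"
      using r ci by (simp_all add: c_def s_def e'_def u'_def)
  qed
  \<comment> \<open>\<open>g1\<close>, \<open>g2\<close>, \<open>g3\<close> are the three
    derivatives in the divergence form of the standard field. Their primitives agree at both ends: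
    the first contains \<open>sin \<eta> * cos \<eta>\<close>, which is 0 at 0 and at
    \<open>pi / 2\<close>, the others are periodic. \<open>h2\<close> and \<open>h3\<close> are the
    corresponding single derivatives for the two rotations.\<close>
  define g1 where "g1 x = - (e' x * u' x) * (s x * c x * Fe x + (s x * - s x + c x * c x) * F x)" for x
  define g2 where "g2 x = - \<i> * (s x * s x * u' x) * (e' x * Fa x + - \<i> * e' x * F x)" for x
  define g3 where "g3 x = \<i> * (c x * c x * e' x) * (u' x * Fb x + - \<i> * u' x * F x)" for x
  define h2 where "h2 x = 2 * (s x * c x) * Fa x" for x
  define h3 where "h3 x = 2 * (s x * c x) * Fb x" for x
  have cg: "continuous_on UNIV g1" "continuous_on UNIV g2" "continuous_on UNIV g3" "continuous_on UNIV h2" "continuous_on UNIV h3"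
    unfolding g1_def g2_def g3_def h2_def h3_def by (intro continuous_intros cont ce)+
  let ?B = "cbox (0, 0, 0) (pi / 2, 2 * pi, 2 * pi) :: (real \<times> real \<times> real) set"
  have per: "hopf (\<eta>, 2 * pi, b) = hopf (\<eta>, 0, b)" "hopf (\<eta>, a, 2 * pi) = hopf (\<eta>, a, 0)" for \<eta> a b
    by (simp_all add: hopf_def)
  have per': "cis (- (2 * pi)) = 1" by (simp add: complex_eq_iff)
  have i1: "integral ?B g1 = 0"
  proof (rule integral_box_derivative_zero[OF cg(1), where A = "\<lambda>x. - (e' x * u' x) * (s x * c x * F x)"], intro disjI1 conjI allI)
    fix \<eta> a b :: real
    show "((\<lambda>\<eta>. - (e' (\<eta>, a, b) * u' (\<eta>, a, b)) * (s (\<eta>, a, b) * c (\<eta>, a, b) * F (\<eta>, a, b))) has_vector_derivative g1 (\<eta>, a, b)) (at \<eta>)"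
      using has_vector_derivative_mult_right[OF has_vector_derivative_mult[OF has_vector_derivative_mult[OF dc(2)[of a b] dc(1)[of a b]] d(1)[of a b]],
        of "- (cis (- a) * cis (- b))" \<eta>]
      unfolding g1_def by (simp only: e'_def u'_def fst_conv snd_conv)
  next
    fix a b :: real
    show "- (e' (pi / 2, a, b) * u' (pi / 2, a, b)) * (s (pi / 2, a, b) * c (pi / 2, a, b) * F (pi / 2, a, b))
      = - (e' (0, a, b) * u' (0, a, b)) * (s (0, a, b) * c (0, a, b) * F (0, a, b))"
      by (simp add: c_def s_def)
  qed
  have i2: "integral ?B g2 = 0"
  proof (rule integral_box_derivative_zero[OF cg(2), where A = "\<lambda>x. - \<i> * (s x * s x * u' x) * (e' x * F x)"],
      rule disjI2, rule disjI1, intro conjI allI)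
    fix \<eta> a b :: real
    show "((\<lambda>a. - \<i> * (s (\<eta>, a, b) * s (\<eta>, a, b) * u' (\<eta>, a, b)) * (e' (\<eta>, a, b) * F (\<eta>, a, b))) has_vector_derivative g2 (\<eta>, a, b)) (at a)"
      using has_vector_derivative_mult_right[OF has_vector_derivative_mult[OF dc(3)[of \<eta> b a] d(2)[of \<eta> b a]],
        of "- \<i> * (complex_of_real (sin \<eta>) * complex_of_real (sin \<eta>) * cis (- b))"]
      unfolding g2_def by (simp only: s_def u'_def fst_conv snd_conv)
  qed (simp add: s_def u'_def e'_def F_def per per')
  have i3: "integral ?B g3 = 0"
  proof (rule integral_box_derivative_zero[OF cg(3), where A = "\<lambda>x. \<i> * (c x * c x * e' x) * (u' x * F x)"],
      rule disjI2, rule disjI2, intro conjI allI)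
    fix \<eta> a b :: real
    show "((\<lambda>b. \<i> * (c (\<eta>, a, b) * c (\<eta>, a, b) * e' (\<eta>, a, b)) * (u' (\<eta>, a, b) * F (\<eta>, a, b))) has_vector_derivative g3 (\<eta>, a, b)) (at b)"
      using has_vector_derivative_mult_right[OF has_vector_derivative_mult[OF dc(4)[of \<eta> a b] d(3)[of \<eta> a b]],
        of "\<i> * (complex_of_real (cos \<eta>) * complex_of_real (cos \<eta>) * cis (- a))"]
      unfolding g3_def by (simp only: c_def e'_def fst_conv snd_conv)
  qed (simp add: c_def u'_def e'_def F_def per per')
  have j2: "integral ?B h2 = 0"
  proof (rule integral_box_derivative_zero[OF cg(4), where A = "\<lambda>x. 2 * (s x * c x) * F x"], rule disjI2, rule disjI1, intro conjI allI)
    fix \<eta> a b :: real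
    show "((\<lambda>a. 2 * (s (\<eta>, a, b) * c (\<eta>, a, b)) * F (\<eta>, a, b)) has_vector_derivative h2 (\<eta>, a, b)) (at a)"
      using has_vector_derivative_mult_right[OF d(2)[of \<eta> b a], of "2 * (complex_of_real (sin \<eta>) * complex_of_real (cos \<eta>))"]
      unfolding h2_def by (simp only: c_def s_def fst_conv)
  qed (simp add: c_def s_def F_def per)
  have j3: "integral ?B h3 = 0"
  proof (rule integral_box_derivative_zero[OF cg(5), where A = "\<lambda>x. 2 * (s x * c x) * F x"], rule disjI2, rule disjI2, intro conjI allI)
    fix \<eta> a b :: real
    show "((\<lambda>b. 2 * (s (\<eta>, a, b) * c (\<eta>, a, b)) * F (\<eta>, a, b)) has_vector_derivative h3 (\<eta>, a, b)) (at b)"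
      using has_vector_derivative_mult_right[OF d(3)[of \<eta> a b], of "2 * (complex_of_real (sin \<eta>) * complex_of_real (cos \<eta>))"]
      unfolding h3_def by (simp only: c_def s_def fst_conv)
  qed (simp add: c_def s_def F_def per)
  have p: "fst (hopf x) = c x * e x" "snd (hopf x) = s x * u x" "cnj (fst (hopf x)) = c x * e' x" "cnj (snd (hopf x)) = s x * u' x" for x
    by (cases x; simp add: hopf_eq c_def s_def e_def e'_def u_def u'_def cnj_cis)+
  have jc: "jac x *\<^sub>R z = 2 * (s x * c x) * z" for x z
    by (cases x) (simp add: jac_def scaleR_conv_of_real s_def c_def)
  have "jac x *\<^sub>R vf_apply Z_std f (hopf x) = g1 x + g2 x + g3 x" for x
    unfolding jc vf_apply_def pairing_4 Z_std_nth p(3,4) P_def[symmetric] g1_def g2_def g3_def Fe_def Fa_def Fb_def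
    using eu[of x] by (simp add: algebra_simps) algebra
  moreover have "(\<integral>p. vf_apply Z_std f p \<partial>S3_measure) = integral ?B (\<lambda>x. jac x *\<^sub>R vf_apply Z_std f (hopf x))"
    by (intro continuous_S3 smooth_continuous smooth_vf smooth_Z_std f)
  moreover have "integral ?B (\<lambda>x. g1 x + g2 x + g3 x) = integral ?B g1 + integral ?B g2 + integral ?B g3"
    by (simp add: integral_add integrable_add integrable_continuous continuous_on_subset[OF cg(1)] continuous_on_subset[OF cg(2)] continuous_on_subset[OF cg(3)])
  ultimately show "(\<integral>p. vf_apply Z_std f p \<partial>S3_measure) = 0" using i1 i2 i3 by simp
  have sr: "smooth_field rot1" "smooth_field rot2"
    by (rule smooth_fieldI; simp only: rot1_def rot2_def vector_4; intro smooth_mult smooth_const smooth_cnj smooth_fst smooth_snd)+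
  have "jac x *\<^sub>R vf_apply rot1 f (hopf x) = h2 x" for x
    unfolding jc vf_apply_def pairing_4 rot1_def vector_4 p(3,4) unfolding p(1,2) P_def[symmetric] h2_def Fa_def by (simp add: algebra_simps)
  moreover have "(\<integral>p. vf_apply rot1 f p \<partial>S3_measure) = integral ?B (\<lambda>x. jac x *\<^sub>R vf_apply rot1 f (hopf x))"
    by (intro continuous_S3 smooth_continuous smooth_vf sr f)
  ultimately show "(\<integral>p. vf_apply rot1 f p \<partial>S3_measure) = 0" using j2 by simp
  have "jac x *\<^sub>R vf_apply rot2 f (hopf x) = h3 x" for x
    unfolding jc vf_apply_def pairing_4 rot2_def vector_4 p(3,4) unfolding p(1,2) P_def[symmetric] h3_def Fb_def by (simp add: algebra_simps)
  moreover have "(\<integral>p. vf_apply rot2 f p \<partial>S3_measure) = integral ?B (\<lambda>x. jac x *\<^sub>R vf_apply rot2 f (hopf x))"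
    by (intro continuous_S3 smooth_continuous smooth_vf sr f)
  ultimately show "(\<integral>p. vf_apply rot2 f p \<partial>S3_measure) = 0" using j3 by simp
qed

section \<open>Spherical harmonics\<close>

abbreviation LL :: "(c2 \<Rightarrow> complex) \<Rightarrow> c2 \<Rightarrow> complex" where
  "LL \<equiv> vf_apply Z_std"

abbreviation LB :: "(c2 \<Rightarrow> complex) \<Rightarrow> c2 \<Rightarrow> complex" where
  "LB \<equiv> vf_apply (\<lambda>q. conj_vec (Z_std q))"

lemma integral_S3_cong: "(\<And>p. p \<in> S3 \<Longrightarrow> f p = g p) \<Longrightarrow> (\<integral>p. f p \<partial>S3_measure) = (\<integral>p. g p \<partial>S3_measure)"
  by (intro Bochner_Integration.integral_cong) auto

lemma smooth_integrable: "smooth_S3 f \<Longrightarrow> integrable S3_measure f"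
  by (intro continuous_S3 smooth_continuous)

lemma smooth_L2: "smooth_S3 f \<Longrightarrow> f \<in> L2 S3_measure"
  by (intro continuous_L2 smooth_continuous)

section \<open>Integration by parts and transposes\<close>

definition div_free :: "cfield \<Rightarrow> bool" where
  "div_free X \<longleftrightarrow> smooth_field X \<and> (\<forall>f. smooth_S3 f \<longrightarrow> (\<integral>p. vf_apply X f p \<partial>S3_measure) = 0)"

lemma div_free_std: "div_free Z_std"
  by (simp add: div_free_def smooth_Z_std integral_fields)

lemma vf_conj_field: "smooth_S3 f \<Longrightarrow> p \<in> S3 \<Longrightarrow>
    vf_apply (\<lambda>q. conj_vec (X q)) f p = cnj (vf_apply X (\<lambda>q. cnj (f q)) p)"
  using vf_cnj[of "\<lambda>q. cnj (f q)" p "\<lambda>q. conj_vec (X q)"] smooth_cnj[of f] by (simp add: conj_vec_conj_vec)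

lemma div_free_conj: "div_free X \<Longrightarrow> div_free (\<lambda>q. conj_vec (X q))"
  unfolding div_free_def
proof (intro conjI allI impI)
  fix f assume X: "smooth_field X \<and> (\<forall>f. smooth_S3 f \<longrightarrow> (\<integral>p. vf_apply X f p \<partial>S3_measure) = 0)" and f: "smooth_S3 f"
  have "(\<integral>p. vf_apply (\<lambda>q. conj_vec (X q)) f p \<partial>S3_measure) = (\<integral>p. cnj (vf_apply X (\<lambda>q. cnj (f q)) p) \<partial>S3_measure)"
    by (intro integral_S3_cong vf_conj_field f)
  also have "\<dots> = 0" using X smooth_cnj[OF f] unfolding Bochner_Integration.integral_cnj by simp
  finally show "(\<integral>p. vf_apply (\<lambda>q. conj_vec (X q)) f p \<partial>S3_measure) = 0" .
qed (auto intro: smooth_conj_field)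

lemma Zr_eq: "Zr t f p = LL f p + t * LB f p"
  and Zrb_eq: "Zrb t f p = LB f p + t * LL f p"
  by (simp_all add: vf_apply_def pairing_4 conj_vec_def algebra_simps)

lemma div_free_rossi: "div_free (Z_rossi t)"
  unfolding div_free_def
proof (intro conjI allI impI smooth_Z_rossi)
  fix f assume f: "smooth_S3 f"
  have L: "smooth_S3 (LL f)" "smooth_S3 (LB f)"
    by (intro smooth_vf smooth_Z_std smooth_conj_field f)+
  have "(\<integral>p. LL f p + t * LB f p \<partial>S3_measure) = (\<integral>p. LL f p \<partial>S3_measure) + t * (\<integral>p. LB f p \<partial>S3_measure)"
    by (simp add: smooth_integrable L)
  then show "(\<integral>p. Zr t f p \<partial>S3_measure) = 0"
    using div_free_std div_free_conj[OF div_free_std] f by (simp add: Zr_eq div_free_def)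
qed

lemma integral_parts:
  assumes X: "div_free X" and f: "smooth_S3 f" and g: "smooth_S3 g"
  shows "(\<integral>p. vf_apply X f p * g p \<partial>S3_measure) = - (\<integral>p. f p * vf_apply X g p \<partial>S3_measure)"
proof -
  have sX: "smooth_field X" using X by (simp add: div_free_def)
  have i: "integrable S3_measure (\<lambda>p. vf_apply X f p * g p)" "integrable S3_measure (\<lambda>p. f p * vf_apply X g p)"
    by (intro smooth_integrable smooth_mult smooth_vf sX f g)+
  have "0 = (\<integral>p. vf_apply X (\<lambda>q. f q * g q) p \<partial>S3_measure)"
    using X smooth_mult[OF f g] by (simp add: div_free_def)
  also have "\<dots> = (\<integral>p. vf_apply X f p * g p + f p * vf_apply X g p \<partial>S3_measure)"
    by (intro integral_S3_cong) (simp add: vf_mult f g)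
  also have "\<dots> = (\<integral>p. vf_apply X f p * g p \<partial>S3_measure) + (\<integral>p. f p * vf_apply X g p \<partial>S3_measure)"
    using i by simp
  finally show ?thesis by (simp add: eq_neg_iff_add_eq_0)
qed

lemma cip_vf:
  assumes X: "div_free X" and f: "smooth_S3 f" and g: "smooth_S3 g"
  shows "cip S3_measure (vf_apply X f) g = - cip S3_measure f (vf_apply (\<lambda>q. conj_vec (X q)) g)"
proof -
  have "cip S3_measure f (vf_apply (\<lambda>q. conj_vec (X q)) g) = (\<integral>p. f p * vf_apply X (\<lambda>q. cnj (g q)) p \<partial>S3_measure)"
    unfolding cip_def by (intro integral_S3_cong) (simp add: vf_conj_field g)
  then show ?thesis
    using integral_parts[OF X f smooth_cnj[OF g]] by (simp add: cip_def)
qed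

text \<open>For the bilinear pairing each field is skew, and the words \<open>Zbar Z Z Zbar\<close>
  and \<open>Zbar Zbar\<close> are palindromes of even length, so the operator is its own
  transpose.\<close>

lemma rossi_op_transpose:
  assumes f: "smooth_S3 f" and g: "smooth_S3 g"
  shows "(\<integral>p. rossi_op t f p * g p \<partial>S3_measure) = (\<integral>p. f p * rossi_op t g p \<partial>S3_measure)"
proof -
  have Z: "div_free (Z_rossi t)" and W: "div_free (\<lambda>q. conj_vec (Z_rossi t q))"
    by (intro div_free_conj div_free_rossi)+
  define c where "c = 1 / complex_of_real ((1 - t\<^sup>2)\<^sup>2)"
  define I where "I h = (\<integral>p. h p \<partial>S3_measure)" for h :: "c2 \<Rightarrow> complex"
  define F where "F = Zrb t f"
  define G where "G = Zrb t g"
  have s: "smooth_S3 F" "smooth_S3 G" unfolding F_def G_def by (intro smooth_Zrb f g)+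
  have Is: "I (\<lambda>p. c * h p) = c * I h" for h c by (simp add: I_def)
  have Ia: "I (\<lambda>p. h p + k p) = I h + I k" if "smooth_S3 h" "smooth_S3 k" for h k
    using that by (simp add: I_def smooth_integrable)
  have pZ: "I (\<lambda>p. Zr t h p * k p) = - I (\<lambda>p. h p * Zr t k p)" if "smooth_S3 h" "smooth_S3 k" for h k
    unfolding I_def by (rule integral_parts[OF Z that])
  have pW: "I (\<lambda>p. Zrb t h p * k p) = - I (\<lambda>p. h p * Zrb t k p)" if "smooth_S3 h" "smooth_S3 k" for h k
    unfolding I_def by (rule integral_parts[OF W that])
  have 1: "I (\<lambda>p. (Zr t (Zr t H) p + 4 * t * H p) * K p) = I (\<lambda>p. Zr t (Zr t H) p * K p) + 4 * t * I (\<lambda>p. H p * K p)"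
    if "smooth_S3 H" "smooth_S3 K" for H K :: "c2 \<Rightarrow> complex"
  proof -
    have "I (\<lambda>p. (Zr t (Zr t H) p + 4 * t * H p) * K p) = I (\<lambda>p. Zr t (Zr t H) p * K p + 4 * t * (H p * K p))"
      by (simp add: algebra_simps)
    also have "\<dots> = I (\<lambda>p. Zr t (Zr t H) p * K p) + I (\<lambda>p. 4 * t * (H p * K p))"
      by (intro Ia smooth_mult smooth_const smooth_Zr that)
    finally show ?thesis by (simp add: Is)
  qed
  have "I (\<lambda>p. rossi_op t f p * g p) = c * I (\<lambda>p. Zrb t (\<lambda>q. Zr t (Zr t F) q + 4 * t * F q) p * g p)"
    by (simp add: rossi_op_def F_def c_def mult.assoc flip: Is)
  also have "\<dots> = c * - I (\<lambda>p. (Zr t (Zr t F) p + 4 * t * F p) * G p)"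
    unfolding G_def by (subst pW) (intro smooth_add smooth_mult smooth_const smooth_Zr s g refl)+
  also have "I (\<lambda>p. (Zr t (Zr t F) p + 4 * t * F p) * G p) = I (\<lambda>p. F p * (Zr t (Zr t G) p + 4 * t * G p))"
  proof -
    have "I (\<lambda>p. Zr t (Zr t F) p * G p) = I (\<lambda>p. F p * Zr t (Zr t G) p)"
      by (simp add: pZ smooth_Zr s)
    then show ?thesis using 1[OF s] 1[OF s(2) s(1)] by (simp add: mult.commute)
  qed
  also have "c * - \<dots> = c * I (\<lambda>p. f p * Zrb t (\<lambda>q. Zr t (Zr t G) q + 4 * t * G q) p)"
    unfolding F_def by (subst pW) (intro smooth_add smooth_mult smooth_const smooth_Zr s f | simp)+
  also have "\<dots> = I (\<lambda>p. f p * rossi_op t g p)"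
    by (simp add: rossi_op_def G_def c_def mult.left_commute flip: Is)
  finally show ?thesis by (simp add: I_def)
qed

text \<open>Conjugation exchanges \<open>Z\<close> and \<open>Zbar\<close>. Together with
  \<open>Qm_swap\<close> this will make conjugates of eigenfunctions eigenfunctions for the same
  real eigenvalue, as required for testing coefficients with \<open>distributional\<close>.\<close>

lemma rossi_op_cnj:
  assumes u: "smooth_S3 u" and p: "p \<in> S3"
  shows "rossi_op t (\<lambda>q. cnj (u q)) p =
    cnj (1 / complex_of_real ((1 - t\<^sup>2)\<^sup>2) * Zr t (\<lambda>q. Zrb t (Zrb t (Zr t u)) q + 4 * complex_of_real t * Zr t u q) p)"
proof -
  have b: "Zrb t (\<lambda>q. cnj (v q)) p = cnj (Zr t v p)" if "smooth_S3 v" "p \<in> S3" for v p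
    using vf_cnj[OF that, of "\<lambda>q. conj_vec (Z_rossi t q)"] by (simp add: conj_vec_conj_vec)
  have a: "Zr t (\<lambda>q. cnj (v q)) p = cnj (Zrb t v p)" if "smooth_S3 v" "p \<in> S3" for v p
    using vf_cnj[OF that, of "Z_rossi t"] by simp
  have 1: "Zr t (Zrb t (\<lambda>q. cnj (u q))) p = cnj (Zrb t (Zr t u) p)" if "p \<in> S3" for p
    using vf_cong[of "Zrb t (\<lambda>q. cnj (u q))" "\<lambda>q. cnj (Zr t u q)" p "Z_rossi t"] b[OF u] a[OF smooth_Zr[OF u] that] that by simp
  have 2: "Zr t (Zr t (Zrb t (\<lambda>q. cnj (u q)))) p = cnj (Zrb t (Zrb t (Zr t u)) p)" if "p \<in> S3" for p
    using vf_cong[of "Zr t (Zrb t (\<lambda>q. cnj (u q)))" "\<lambda>q. cnj (Zrb t (Zr t u) q)" p "Z_rossi t"] 1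
      a[OF smooth_Zrb[OF smooth_Zr[OF u]] that] that by simp
  have 3: "Zrb t (\<lambda>q. Zr t (Zr t (Zrb t (\<lambda>q. cnj (u q)))) q + 4 * complex_of_real t * Zrb t (\<lambda>q. cnj (u q)) q) p
    = Zrb t (\<lambda>q. cnj (Zrb t (Zrb t (Zr t u)) q + 4 * complex_of_real t * Zr t u q)) p"
    by (rule vf_cong[OF _ p]) (simp add: 2 b[OF u])
  have 4: "Zrb t (\<lambda>q. cnj (Zrb t (Zrb t (Zr t u)) q + 4 * complex_of_real t * Zr t u q)) p
    = cnj (Zr t (\<lambda>q. Zrb t (Zrb t (Zr t u)) q + 4 * complex_of_real t * Zr t u q) p)"
    by (intro b smooth_add smooth_mult smooth_const smooth_Zrb smooth_Zr u p)
  show ?thesis unfolding rossi_op_def by (simp only: 3 4) simp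
qed

section \<open>Ladders of spherical harmonics\<close>

lemma LL_coord: assumes p: "p \<in> S3"
  shows "LL fst p = cnj (snd p)" "LL (\<lambda>q. cnj (fst q)) p = 0" "LL snd p = - cnj (fst p)" "LL (\<lambda>q. cnj (snd q)) p = 0"
  using vf_coord[OF p, of Z_std] by (simp_all add: tangent_Z_std)

lemma LB_coord: assumes p: "p \<in> S3"
  shows "LB fst p = 0" "LB (\<lambda>q. cnj (fst q)) p = snd p" "LB snd p = 0" "LB (\<lambda>q. cnj (snd q)) p = - fst p"
  using vf_coord[OF p, of "\<lambda>q. conj_vec (Z_std q)"] by (simp_all add: tangent_Z_std tangent_conj)

text \<open>An unnormalized weight basis of the representation of dimension \<open>n + 1\<close>.
  With step factors \<open>i + 1\<close> upwards and \<open>n - i\<close> downwards, as for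
  coefficients of a generating polynomial of degree \<open>n\<close>, no square roots occur.\<close>

definition ladder :: "nat \<Rightarrow> (nat \<Rightarrow> c2 \<Rightarrow> complex) \<Rightarrow> bool" where
  "ladder n F \<longleftrightarrow> (\<forall>i. smooth_S3 (F i)) \<and> (\<forall>i>n. F i = (\<lambda>p. 0)) \<and>
     (\<forall>p\<in>S3. LB (F 0) p = 0 \<and> (\<forall>i. LL (F i) p = of_nat (Suc i) * F (Suc i) p \<and>
        LB (F (Suc i)) p = - (of_nat n - of_nat i) * F i p))"

text \<open>The coefficients of the product of \<open>a + s b\<close> with the polynomial in
  \<open>s\<close> whose coefficients are \<open>F i\<close>.\<close>

fun mulstep :: "(c2 \<Rightarrow> complex) \<Rightarrow> (c2 \<Rightarrow> complex) \<Rightarrow> (nat \<Rightarrow> c2 \<Rightarrow> complex) \<Rightarrow> nat \<Rightarrow> c2 \<Rightarrow> complex" where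
  "mulstep a b F 0 = (\<lambda>p. a p * F 0 p)"
| "mulstep a b F (Suc i) = (\<lambda>p. a p * F (Suc i) p + b p * F i p)"

text \<open>The pair \<open>a\<close>, \<open>b\<close> is a copy of the two-dimensional
  representation. By the Leibniz rule the step factors of the product are again those of a ladder,
  with \<open>n\<close> raised by 1.\<close>

lemma ladder_mulstep:
  assumes F: "ladder n F" and s: "smooth_S3 a" "smooth_S3 b"
    and ab: "\<And>p. p \<in> S3 \<Longrightarrow> LL a p = b p \<and> LL b p = 0 \<and> LB a p = 0 \<and> LB b p = - a p"
  shows "ladder (Suc n) (mulstep a b F)"
proof -
  have sF: "smooth_S3 (F i)" and zF: "n < i \<Longrightarrow> F i p = 0" for i p
    using F by (auto simp: ladder_def)
  have sm: "smooth_S3 (\<lambda>p. a p * F i p)" "smooth_S3 (\<lambda>p. b p * F i p)" for i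
    by (intro smooth_mult s sF)+
  have dF: "LB (F 0) p = 0" "LL (F i) p = of_nat (Suc i) * F (Suc i) p"
    "LB (F (Suc i)) p = - (of_nat n - of_nat i) * F i p" if "p \<in> S3" for i p
    using F that by (simp_all add: ladder_def)
  have "smooth_S3 (mulstep a b F i)" for i
    by (cases i) (simp_all add: sm smooth_add)
  moreover have "mulstep a b F i p = 0" if "Suc n < i" for i p
    using that by (cases i) (simp_all add: zF)
  then have "\<forall>i>Suc n. mulstep a b F i = (\<lambda>p. 0)" by (simp add: fun_eq_iff)
  moreover have "LB (mulstep a b F 0) p = 0" if "p \<in> S3" for p
    using that by (simp add: vf_mult s sF dF ab)
  moreover have "LL (mulstep a b F i) p = of_nat (Suc i) * mulstep a b F (Suc i) p" if "p \<in> S3" for p i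
    using that by (cases i) (simp_all add: vf_mult vf_add s sF sm dF ab algebra_simps)
  moreover have "LB (mulstep a b F (Suc i)) p = - (of_nat (Suc n) - of_nat i) * mulstep a b F i p" if "p \<in> S3" for p i
    using that by (cases i) (simp_all add: vf_mult vf_add s sF sm dF ab algebra_simps)
  ultimately show ?thesis by (simp add: ladder_def)
qed

text \<open>\<open>Y k m i\<close> is the coefficient of \<open>s\<^sup>i\<close> in \<open>(z + s wbar)\<^sup>k (w - s zbar)\<^sup>m\<close>.\<close>

fun Y :: "nat \<Rightarrow> nat \<Rightarrow> nat \<Rightarrow> c2 \<Rightarrow> complex" where
  "Y 0 0 = (\<lambda>i p. if i = 0 then 1 else 0)"
| "Y 0 (Suc m) = mulstep snd (\<lambda>p. - cnj (fst p)) (Y 0 m)"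
| "Y (Suc k) m = mulstep fst (\<lambda>p. cnj (snd p)) (Y k m)"

lemma ladder_Y: "ladder (k + m) (Y k m)"
proof (induction k m rule: Y.induct)
  case 1
  show ?case by (auto simp: ladder_def smooth_const)
next
  case (2 m)
  then have "ladder (Suc (0 + m)) (Y 0 (Suc m))"
    unfolding Y.simps
    by (rule ladder_mulstep) (auto simp: vf_minus smooth_cnj smooth_fst LL_coord LB_coord intro: smooth_minus smooth_snd smooth_cnj smooth_fst)
  then show ?case by simp
next
  case (3 k m)
  then have "ladder (Suc (k + m)) (Y (Suc k) m)"
    unfolding Y.simps
    by (rule ladder_mulstep) (auto simp: LL_coord LB_coord intro: smooth_snd smooth_cnj smooth_fst)
  then show ?case by simp
qed

lemma smooth_Y: "smooth_S3 (Y k m i)"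
  and Y_zero: "k + m < i \<Longrightarrow> Y k m i p = 0"
  and LL_Y: "p \<in> S3 \<Longrightarrow> LL (Y k m i) p = of_nat (Suc i) * Y k m (Suc i) p"
  and LB_Y: "p \<in> S3 \<Longrightarrow> LB (Y k m 0) p = 0"
    "p \<in> S3 \<Longrightarrow> LB (Y k m (Suc i)) p = - (of_nat (k + m) - of_nat i) * Y k m i p"
  using ladder_Y[of k m] by (simp_all add: ladder_def)

lemma Y_0: "Y k m 0 p = fst p ^ k * snd p ^ m"
  by (induction k m rule: Y.induct) simp_all

lemma smooth_rot: "smooth_field rot1" "smooth_field rot2"
  by (rule smooth_fieldI; simp only: rot1_def rot2_def vector_4; intro smooth_mult smooth_const smooth_cnj smooth_fst smooth_snd)+

lemma rot_real: "conj_vec (rot1 p) = rot1 p" "conj_vec (rot2 p) = rot2 p"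
  by (simp_all add: vec_eq_iff forall_4 rot1_def rot2_def)

lemma div_free_rot: "div_free rot1" "div_free rot2"
  by (simp_all add: div_free_def smooth_rot integral_fields)

lemma smooth_power: "smooth_S3 f \<Longrightarrow> smooth_S3 (\<lambda>p. f p ^ k)"
  by (induction k) (auto intro: smooth_const smooth_mult)

lemma vf_power_eigen:
  assumes "smooth_S3 f" "p \<in> S3" "vf_apply X f p = c * f p"
  shows "vf_apply X (\<lambda>q. f q ^ k) p = of_nat k * c * f p ^ k"
  by (induction k) (simp_all add: vf_mult assms smooth_power algebra_simps)

lemma rot_Y_0:
  assumes p: "p \<in> S3"
  shows "vf_apply rot1 (Y k m 0) p = of_nat k * \<i> * Y k m 0 p" "vf_apply rot2 (Y k m 0) p = of_nat m * \<i> * Y k m 0 p"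
proof -
  have t: "rot1 p \<in> tangent_S3 p" "rot2 p \<in> tangent_S3 p" by (simp_all add: tangent_iff rot1_def rot2_def)
  have "vf_apply rot1 fst p = \<i> * fst p" "vf_apply rot1 snd p = 0 * snd p" "vf_apply rot2 fst p = 0 * fst p" "vf_apply rot2 snd p = \<i> * snd p"
    using vf_coord[OF p, of rot1] vf_coord[OF p, of rot2] t by (simp_all add: rot1_def rot2_def)
  note e = this(1,3)[THEN vf_power_eigen[OF smooth_fst p]] this(2,4)[THEN vf_power_eigen[OF smooth_snd p]]
  have Y: "Y k m 0 = (\<lambda>q. fst q ^ k * snd q ^ m)" by (simp add: fun_eq_iff Y_0)
  show "vf_apply rot1 (Y k m 0) p = of_nat k * \<i> * Y k m 0 p" "vf_apply rot2 (Y k m 0) p = of_nat m * \<i> * Y k m 0 p"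
    unfolding Y by (simp_all add: vf_mult smooth_power smooth_fst smooth_snd p e algebra_simps)
qed

section \<open>Orthogonality and normalization\<close>

abbreviation cs :: "(c2 \<Rightarrow> complex) \<Rightarrow> (c2 \<Rightarrow> complex) \<Rightarrow> complex" where
  "cs \<equiv> cip S3_measure"

lemma cs_cong: "(\<And>p. p \<in> S3 \<Longrightarrow> f p = f' p) \<Longrightarrow> (\<And>p. p \<in> S3 \<Longrightarrow> g p = g' p) \<Longrightarrow> cs f g = cs f' g'"
  unfolding cip_def by (rule integral_S3_cong) simp

lemma cs_scale: "cs (\<lambda>p. c * f p) g = c * cs f g" "cs f (\<lambda>p. c * g p) = cnj c * cs f g"
proof -
  show "cs (\<lambda>p. c * f p) g = c * cs f g" by (rule cip_scale)
  have "cs f (\<lambda>p. c * g p) = cnj (cs (\<lambda>p. c * g p) f)" by (rule cip_cnj)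
  also have "\<dots> = cnj c * cnj (cs g f)" by (simp only: cip_scale complex_cnj_mult)
  also have "cnj (cs g f) = cs f g" by (rule cip_cnj[symmetric])
  finally show "cs f (\<lambda>p. c * g p) = cnj c * cs f g" .
qed

lemma cs_zero: "cs (\<lambda>p. 0) g = 0" "cs f (\<lambda>p. 0) = 0"
  by (simp_all add: cip_def)

lemma choose_step: "real (Suc i) * real (n choose Suc i) = (real n - real i) * real (n choose i)"
proof (cases "i \<le> n")
  case True
  have "Suc i * (n choose Suc i) = (n - i) * (n choose i)"
    by (metis binomial_absorption binomial_absorb_comp)
  then have "real (Suc i * (n choose Suc i)) = real ((n - i) * (n choose i))" by simp
  then show ?thesis using True by (simp only: of_nat_mult of_nat_diff)
qed (simp add: binomial_eq_0)

text \<open>\<open>LL\<close> and \<open>- LB\<close> are adjoint. Moving one across the inner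
  product lowers both indices at once and finally leaves a pairing with one index 0, which is 0
  unless both are.\<close>

lemma cs_Y_step:
  "of_nat (Suc i) * cs (Y k m (Suc i)) (Y k' m' (Suc j)) = (of_nat (k' + m') - of_nat j) * cs (Y k m i) (Y k' m' j)"
  "cs (Y k m (Suc i)) (Y k' m' 0) = 0"
  "cs (Y k m 0) (Y k' m' (Suc j)) = 0"
proof -
  have a: "cs (LL (Y k m i)) g = - cs (Y k m i) (LB g)" "cs (LB (Y k m 0)) g = - cs (Y k m 0) (LL g)" if "smooth_S3 g" for g i
    using cip_vf[OF div_free_std smooth_Y that] cip_vf[OF div_free_conj[OF div_free_std] smooth_Y that] by simp_all
  have l: "cs (LL (Y k m i)) g = of_nat (Suc i) * cs (Y k m (Suc i)) g" for g
    unfolding cs_scale[symmetric] by (rule cs_cong) (simp_all only: LL_Y)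
  have "cs (Y k m i) (LB (Y k' m' (Suc j))) = cs (Y k m i) (\<lambda>p. - (of_nat (k' + m') - of_nat j) * Y k' m' j p)"
    by (rule cs_cong) (simp_all only: LB_Y)
  then show "of_nat (Suc i) * cs (Y k m (Suc i)) (Y k' m' (Suc j)) = (of_nat (k' + m') - of_nat j) * cs (Y k m i) (Y k' m' j)"
    using a(1)[OF smooth_Y, of i k' m' "Suc j"] l[of "Y k' m' (Suc j)"] unfolding cs_scale by (simp add: algebra_simps)
  have "cs (Y k m i) (LB (Y k' m' 0)) = cs (Y k m i) (\<lambda>p. 0)"
    by (rule cs_cong) (simp_all only: LB_Y)
  then have "of_nat (Suc i) * cs (Y k m (Suc i)) (Y k' m' 0) = 0"
    using a(1)[OF smooth_Y, of i k' m' 0] l[of "Y k' m' 0"] by (simp add: cs_zero)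
  then show "cs (Y k m (Suc i)) (Y k' m' 0) = 0" by (simp only: mult_eq_0_iff of_nat_eq_0_iff) simp
  have "cs (Y k m 0) (LL (Y k' m' j)) = cs (Y k m 0) (\<lambda>p. of_nat (Suc j) * Y k' m' (Suc j) p)"
    "cs (LB (Y k m 0)) (Y k' m' j) = cs (\<lambda>p. 0) (Y k' m' j)"
    by (rule cs_cong; simp only: LL_Y LB_Y)+
  then have "of_nat (Suc j) * cs (Y k m 0) (Y k' m' (Suc j)) = 0"
    using a(2)[OF smooth_Y, of k' m' j] unfolding cs_scale cs_zero by simp
  then show "cs (Y k m 0) (Y k' m' (Suc j)) = 0" by (simp only: mult_eq_0_iff of_nat_eq_0_iff) simp
qed

text \<open>\<open>Y k m 0\<close> is the monomial \<open>z^k w^m\<close>, a joint eigenfunction of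
  the rotations \<open>rot1\<close> and \<open>rot2\<close> with eigenvalues \<open>k * \<i>\<close>
  and \<open>m * \<i>\<close>. Both fields are real and divergence free, hence skew-adjoint, so
  different exponents are orthogonal.\<close>

lemma cs_Y_0: "(k, m) \<noteq> (k', m') \<Longrightarrow> cs (Y k m 0) (Y k' m' 0) = 0"
proof -
  assume ne: "(k, m) \<noteq> (k', m')"
  have r: "cs (vf_apply X (Y k m 0)) (Y k' m' 0) = - cs (Y k m 0) (vf_apply X (Y k' m' 0))"
    if "X \<in> {rot1, rot2}" for X
    using that cip_vf[OF div_free_rot(1) smooth_Y smooth_Y] cip_vf[OF div_free_rot(2) smooth_Y smooth_Y] by (auto simp: rot_real)
  have "cs (vf_apply rot1 (Y k m 0)) (Y k' m' 0) = cs (\<lambda>p. of_nat k * \<i> * Y k m 0 p) (Y k' m' 0)"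
    "cs (Y k m 0) (vf_apply rot1 (Y k' m' 0)) = cs (Y k m 0) (\<lambda>p. of_nat k' * \<i> * Y k' m' 0 p)"
    "cs (vf_apply rot2 (Y k m 0)) (Y k' m' 0) = cs (\<lambda>p. of_nat m * \<i> * Y k m 0 p) (Y k' m' 0)"
    "cs (Y k m 0) (vf_apply rot2 (Y k' m' 0)) = cs (Y k m 0) (\<lambda>p. of_nat m' * \<i> * Y k' m' 0 p)"
    by (rule cs_cong; simp only: rot_Y_0)+
  then have "cs (Y k m 0) (Y k' m' 0) = 0 \<or> k = k'" "cs (Y k m 0) (Y k' m' 0) = 0 \<or> m = m'"
    using r[of rot1] r[of rot2] unfolding cs_scale by (auto simp: algebra_simps)
  then show ?thesis using ne by blast
qed

lemma cs_Y: "cs (Y k m i) (Y k' m' j) =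
    (if (k, m, i) = (k', m', j) then of_nat (k + m choose i) * cs (Y k m 0) (Y k m 0) else 0)"
proof -
  have "cs (Y k m i) (Y k' m' j) = (if i = j then of_nat (k' + m' choose i) * cs (Y k m 0) (Y k' m' 0) else 0)"
  proof (induction i arbitrary: j)
    case 0
    show ?case by (cases j) (simp_all add: cs_Y_step)
  next
    case (Suc i)
    show ?case
    proof (cases j)
      case 0
      then show ?thesis by (simp add: cs_Y_step)
    next
      case (Suc l)
      let ?n = "k' + m'"
      have "of_nat (Suc i) * cs (Y k m (Suc i)) (Y k' m' j) = (if i = l then (of_nat ?n - of_nat i) * of_nat (?n choose i) * cs (Y k m 0) (Y k' m' 0) else 0)"
        unfolding Suc cs_Y_step Suc.IH by simp
      also have "(of_nat ?n - of_nat i) * of_nat (?n choose i) = (of_nat (Suc i) * of_nat (?n choose Suc i) :: complex)"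
        using arg_cong[OF choose_step[of i ?n], of complex_of_real] by simp
      finally have "of_nat (Suc i) * (cs (Y k m (Suc i)) (Y k' m' j) - (if i = l then of_nat (?n choose Suc i) * cs (Y k m 0) (Y k' m' 0) else 0)) = 0"
        by (simp add: right_diff_distrib del: of_nat_Suc)
      then have "cs (Y k m (Suc i)) (Y k' m' j) = (if i = l then of_nat (?n choose Suc i) * cs (Y k m 0) (Y k' m' 0) else 0)"
        by (simp only: mult_eq_0_iff of_nat_eq_0_iff) simp
      then show ?thesis using Suc by simp
    qed
  qed
  then show ?thesis using cs_Y_0[of k m k' m'] by (cases "(k, m) = (k', m')") auto
qed

definition nrm :: "nat \<Rightarrow> nat \<Rightarrow> real" where
  "nrm k m = (\<integral>p. (cmod (Y k m 0 p))\<^sup>2 \<partial>S3_measure)"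

lemma cs_Y_00: "cs (Y k m 0) (Y k m 0) = complex_of_real (nrm k m)"
  by (simp add: nrm_def cip_self)

text \<open>The monomial has no zero over the open Hopf box and the density is positive there, so a
  vanishing integral would make the box negligible.\<close>

lemma nrm_pos: "0 < nrm k m"
proof -
  let ?f = "\<lambda>p. (cmod (Y k m 0 p))\<^sup>2"
  let ?g = "\<lambda>x. indicator hopf_box x *\<^sub>R (jac x *\<^sub>R ?f (hopf x))"
  have m: "?f \<in> borel_measurable S3_measure" and i: "integrable S3_measure ?f"
    using smooth_L2[OF smooth_Y, of k m 0] by (auto simp: L2_def)
  have g0: "0 \<le> ?g x" for x using jac_pos[of x] by (cases "x \<in> hopf_box") auto
  have gi: "integrable lborel ?g" using i unfolding integral_S3(2)[OF m] .
  have e: "nrm k m = (\<integral>x. ?g x \<partial>lborel)" unfolding nrm_def by (rule integral_S3(1)[OF m])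
  have "nrm k m \<noteq> 0"
  proof
    assume "nrm k m = 0"
    then have "AE x in lborel. ?g x = 0" using integral_nonneg_eq_0_iff_AE[OF gi] g0 unfolding e by simp
    moreover have "?g x \<noteq> 0" if x: "x \<in> hopf_box" for x
    proof -
      obtain \<eta> a b where xe: "x = (\<eta>, a, b)" by (cases x)
      have "0 < \<eta>" "\<eta> < pi / 2" using x by (auto simp: hopf_box_def xe)
      then have "0 < cos \<eta>" "0 < sin \<eta>" by (auto intro: cos_gt_zero sin_gt_zero)
      then have "Y k m 0 (hopf x) \<noteq> 0" by (simp add: Y_0 xe hopf_eq)
      then show ?thesis using jac_pos[OF x] x by simp
    qed
    ultimately have "AE x in lborel. x \<notin> hopf_box" by (auto elim: eventually_mono)
    then have "hopf_box \<in> null_sets lborel" by (subst AE_iff_null_sets) auto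
    then have "negligible hopf_box" by (simp add: negligible_iff_null_sets null_sets_completionI)
    moreover have "(pi / 4, pi, pi) \<in> hopf_box" by (simp add: hopf_box_def)
    moreover have "open hopf_box" unfolding hopf_box_eq by (rule open_box)
    ultimately show False using open_not_negligible by blast
  qed
  moreover have "0 \<le> nrm k m" unfolding nrm_def by simp
  ultimately show ?thesis by simp
qed

definition EE :: "nat \<Rightarrow> nat \<Rightarrow> nat \<Rightarrow> c2 \<Rightarrow> complex" where
  "EE k m i p = complex_of_real (1 / sqrt (real (k + m choose i) * nrm k m)) * Y k m i p"

lemma smooth_EE: "smooth_S3 (EE k m i)"
  unfolding EE_def[abs_def] by (intro smooth_mult smooth_const smooth_Y)

lemma cs_EE:
  assumes "i \<le> k + m" "j \<le> k' + m'"
  shows "cs (EE k m i) (EE k' m' j) = (if (k, m, i) = (k', m', j) then 1 else 0)"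
proof -
  define r where "r = real (k + m choose i) * nrm k m"
  have r: "0 < r" using assms(1) nrm_pos[of k m] by (simp add: r_def)
  have "complex_of_real (1 / sqrt r) * complex_of_real (1 / sqrt r) * complex_of_real r = 1"
    using r by (simp add: of_real_mult[symmetric] del: of_real_mult)
  moreover have "of_nat (k + m choose i) * complex_of_real (nrm k m) = complex_of_real r" by (simp add: r_def)
  moreover have "cs (EE k m i) (EE k m i) = complex_of_real (1 / sqrt r) *
      (complex_of_real (1 / sqrt r) * (of_nat (k + m choose i) * complex_of_real (nrm k m)))"
    unfolding EE_def[abs_def] cs_scale cs_Y[unfolded cs_Y_00] r_def[symmetric] by (simp only: complex_cnj_complex_of_real simp_thms if_True)
  ultimately have "cs (EE k m i) (EE k m i) = 1" by (simp only: mult.assoc)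
  moreover have "cs (EE k m i) (EE k' m' j) = 0" if "(k, m, i) \<noteq> (k', m', j)"
    unfolding EE_def[abs_def] cs_scale cs_Y[unfolded cs_Y_00] using that by (simp only: if_False mult_zero_right)
  ultimately show ?thesis by (cases "(k, m, i) = (k', m', j)") (auto simp only: prod.inject if_True if_False simp_thms)
qed

text \<open>Normalizing by the square root of the binomial coefficient turns both step factors,
  \<open>i + 1\<close> and \<open>n - i\<close>, into the same number \<open>cf n i\<close>: the
  matrices of \<open>LL\<close> and \<open>- LB\<close> become the transposed pair
  \<open>up\<close>, \<open>dn\<close>.\<close>

lemma sqrt_choose_step:
  assumes "i \<le> n"
  shows "real (Suc i) * sqrt (real (n choose Suc i)) = cf n i * sqrt (real (n choose i))"
    and "(real n - real i) * sqrt (real (n choose i)) = cf n i * sqrt (real (n choose Suc i))"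
proof -
  have "real (Suc i) * sqrt (real (n choose Suc i)) = sqrt (real (Suc i) * (real (Suc i) * real (n choose Suc i)))"
    by (simp add: real_sqrt_mult)
  also have "\<dots> = sqrt (real (Suc i) * real (n - i) * real (n choose i))"
    unfolding choose_step using assms by (simp add: of_nat_diff mult.assoc)
  finally show "real (Suc i) * sqrt (real (n choose Suc i)) = cf n i * sqrt (real (n choose i))"
    by (simp add: cf_def real_sqrt_mult)
  have "(real n - real i) * sqrt (real (n choose i)) = sqrt (real (n - i) * ((real n - real i) * real (n choose i)))"
    using assms by (simp add: real_sqrt_mult of_nat_diff)
  also have "\<dots> = sqrt (real (Suc i) * real (n - i) * real (n choose Suc i))"
    unfolding choose_step[symmetric] by (simp add: mult_ac)
  finally show "(real n - real i) * sqrt (real (n choose i)) = cf n i * sqrt (real (n choose Suc i))"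
    by (simp add: cf_def real_sqrt_mult)
qed

lemma LL_EE: assumes p: "p \<in> S3" and i: "i \<le> k + m"
  shows "LL (EE k m i) p = complex_of_real (cf (k + m) i) * EE k m (Suc i) p"
\<comment> \<open>At the top the binomial coefficient with \<open>Suc i\<close> is 0 and cannot be
  divided by; there both sides vanish through \<open>Y_zero\<close> and
  \<open>cf_zero\<close>.\<close>
proof (cases "i = k + m")
  case True
  have "LL (EE k m i) p = complex_of_real (1 / sqrt (real (k + m choose i) * nrm k m)) * (of_nat (Suc i) * Y k m (Suc i) p)"
    unfolding EE_def[abs_def] by (simp only: vf_scale smooth_Y p LL_Y)
  then show ?thesis using True by (simp add: Y_zero cf_zero)
next
  case False
  define a where "a = sqrt (real (k + m choose i))"
  define b where "b = sqrt (real (k + m choose Suc i))"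
  define v where "v = sqrt (nrm k m)"
  have nz: "a \<noteq> 0" "b \<noteq> 0" "v \<noteq> 0" using False i nrm_pos[of k m] by (auto simp: a_def b_def v_def)
  have "real (Suc i) * b = cf (k + m) i * a" using sqrt_choose_step(1)[OF i] by (simp add: a_def b_def)
  then have e: "1 / (a * v) * real (Suc i) = cf (k + m) i * (1 / (b * v))"
    using nz by (simp add: field_simps del: of_nat_Suc)
  have "LL (EE k m i) p = complex_of_real (1 / (a * v)) * (of_nat (Suc i) * Y k m (Suc i) p)"
    unfolding EE_def[abs_def] real_sqrt_mult a_def v_def by (simp only: vf_scale smooth_Y p LL_Y)
  also have "\<dots> = complex_of_real (1 / (a * v) * real (Suc i)) * Y k m (Suc i) p" by simp
  also have "\<dots> = complex_of_real (cf (k + m) i) * EE k m (Suc i) p"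
    unfolding e by (simp add: EE_def real_sqrt_mult b_def v_def)
  finally show ?thesis .
qed

lemma LB_EE: assumes p: "p \<in> S3"
  shows "LB (EE k m 0) p = 0"
    and "i < k + m \<Longrightarrow> LB (EE k m (Suc i)) p = - complex_of_real (cf (k + m) i) * EE k m i p"
proof -
  show "LB (EE k m 0) p = 0"
    unfolding EE_def[abs_def] by (simp only: vf_scale smooth_Y p LB_Y mult_zero_right)
  assume i: "i < k + m"
  define a where "a = sqrt (real (k + m choose i))"
  define b where "b = sqrt (real (k + m choose Suc i))"
  define v where "v = sqrt (nrm k m)"
  have nz: "a \<noteq> 0" "b \<noteq> 0" "v \<noteq> 0" using i nrm_pos[of k m] by (auto simp: a_def b_def v_def)
  have eq: "(real (k + m) - real i) * a = cf (k + m) i * b" using sqrt_choose_step(2)[of i "k + m"] i by (simp add: a_def b_def)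
  have "1 / (b * v) * (real (k + m) - real i) = ((real (k + m) - real i) * a) / (a * (b * v))" using nz by simp
  also have "\<dots> = cf (k + m) i * (1 / (a * v))" unfolding eq using nz by simp
  finally have e: "1 / (b * v) * (real (k + m) - real i) = cf (k + m) i * (1 / (a * v))" .
  have "LB (EE k m (Suc i)) p = complex_of_real (1 / (b * v)) * (- (of_nat (k + m) - of_nat i) * Y k m i p)"
    unfolding EE_def[abs_def] real_sqrt_mult b_def v_def by (simp only: vf_scale smooth_Y p LB_Y)
  also have "\<dots> = - complex_of_real (1 / (b * v) * (real (k + m) - real i)) * Y k m i p" 
    by (simp only: of_real_mult of_real_diff of_real_of_nat_eq mult_minus_left mult_minus_right mult.assoc)
  also have "\<dots> = - complex_of_real (cf (k + m) i) * EE k m i p"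
    unfolding e by (simp add: EE_def real_sqrt_mult a_def v_def)
  finally show "LB (EE k m (Suc i)) p = - complex_of_real (cf (k + m) i) * EE k m i p" .
qed

definition Phi :: "nat \<Rightarrow> nat \<Rightarrow> (nat \<Rightarrow> real) \<Rightarrow> c2 \<Rightarrow> complex" where
  "Phi k m x p = (\<Sum>i\<le>k + m. complex_of_real (x i) * EE k m i p)"

lemma smooth_Phi: "smooth_S3 (Phi k m x)"
  unfolding Phi_def[abs_def] by (intro smooth_sum smooth_mult smooth_const smooth_EE)

lemma Phi_cong: "(\<And>i. i \<le> k + m \<Longrightarrow> x i = y i) \<Longrightarrow> Phi k m x p = Phi k m y p"
  unfolding Phi_def by (intro sum.cong refl) simp

lemma Phi_lin:
  "Phi k m (\<lambda>i. x i + y i) p = Phi k m x p + Phi k m y p"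
  "Phi k m (\<lambda>i. x i - y i) p = Phi k m x p - Phi k m y p"
  "Phi k m (\<lambda>i. c * x i) p = complex_of_real c * Phi k m x p"
  by (simp_all add: Phi_def ring_distribs sum.distrib sum_subtractf sum_distrib_left mult.assoc)

lemma LL_Phi: assumes p: "p \<in> S3" shows "LL (Phi k m x) p = Phi k m (up (k + m) x) p"
proof -
  let ?n = "k + m"
  have "LL (Phi k m x) p = (\<Sum>i\<le>?n. complex_of_real (x i) * LL (EE k m i) p)"
    unfolding Phi_def[abs_def] using p by (subst vf_sum) (auto intro: smooth_mult smooth_const smooth_EE simp: vf_scale smooth_EE)
  also have "\<dots> = (\<Sum>i\<le>?n. complex_of_real (x i) * (complex_of_real (cf ?n i) * EE k m (Suc i) p))"
    by (intro sum.cong refl) (simp add: LL_EE p)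
  also have "\<dots> = (\<Sum>i<?n. complex_of_real (up ?n x (Suc i)) * EE k m (Suc i) p)"
    by (simp add: lessThan_Suc_atMost[symmetric] cf_zero up_Suc mult_ac)
  also have "\<dots> = Phi k m (up ?n x) p"
    by (simp add: Phi_def sum.atMost_shift up_0)
  finally show ?thesis .
qed

lemma LB_Phi: assumes p: "p \<in> S3" shows "LB (Phi k m x) p = - Phi k m (dn (k + m) x) p"
proof -
  let ?n = "k + m"
  have "LB (Phi k m x) p = (\<Sum>i\<le>?n. complex_of_real (x i) * LB (EE k m i) p)"
    unfolding Phi_def[abs_def] using p by (subst vf_sum) (auto intro: smooth_mult smooth_const smooth_EE simp: vf_scale smooth_EE)
  also have "\<dots> = (\<Sum>i<?n. complex_of_real (x (Suc i)) * LB (EE k m (Suc i)) p)"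
    by (simp add: sum.atMost_shift LB_EE p)
  also have "\<dots> = (\<Sum>i<?n. - complex_of_real (dn ?n x i) * EE k m i p)"
    by (intro sum.cong refl) (simp add: LB_EE p dn_def)
  also have "\<dots> = - Phi k m (dn ?n x) p"
    by (simp add: Phi_def lessThan_Suc_atMost[symmetric] dn_def cf_zero sum_negf)
  finally show ?thesis .
qed

lemma Zr_Phi: "p \<in> S3 \<Longrightarrow> Zr t (Phi k m x) p = Phi k m (Za t (k + m) x) p"
  and Zrb_Phi: "p \<in> S3 \<Longrightarrow> Zrb t (Phi k m x) p = Phi k m (Zb t (k + m) x) p"
  by (simp_all add: Zr_eq Zrb_eq LL_Phi LB_Phi Za_abs Zb_abs Phi_lin)

lemma Zr_Phi': assumes "\<And>p. p \<in> S3 \<Longrightarrow> f p = Phi k m x p" "p \<in> S3"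
  shows "Zr t f p = Phi k m (Za t (k + m) x) p" "Zrb t f p = Phi k m (Zb t (k + m) x) p"
  using vf_cong[of f "Phi k m x" p "Z_rossi t"] vf_cong[of f "Phi k m x" p "\<lambda>q. conj_vec (Z_rossi t q)"] assms
  by (simp_all add: Zr_Phi Zrb_Phi)

lemma rossi_op_Phi:
  assumes p: "p \<in> S3"
  shows "rossi_op t (Phi k m x) p = complex_of_real (1 / (1 - t\<^sup>2)\<^sup>2) * Phi k m (Qm t (k + m) x) p"
    and "rossi_op t (\<lambda>q. cnj (Phi k m x q)) p = complex_of_real (1 / (1 - t\<^sup>2)\<^sup>2) * cnj (Phi k m (Qm t (k + m) x) p)"
proof -
  have "Zrb t (\<lambda>q. Zr t (Zr t (Zrb t (Phi k m x))) q + 4 * complex_of_real t * Zrb t (Phi k m x) q) p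
    = Phi k m (Qm t (k + m) x) p"
    unfolding Qm_def by (rule Zr_Phi'(2)[OF _ p], subst Phi_lin(1))
      (use Phi_lin(3)[of k m "4 * t"] in \<open>simp add: Zr_Phi' Zrb_Phi\<close>)
  then show "rossi_op t (Phi k m x) p = complex_of_real (1 / (1 - t\<^sup>2)\<^sup>2) * Phi k m (Qm t (k + m) x) p"
    by (simp add: rossi_op_def)
  have "Zr t (\<lambda>q. Zrb t (Zrb t (Zr t (Phi k m x))) q + 4 * complex_of_real t * Zr t (Phi k m x) q) p
    = Phi k m (Qm t (k + m) x) p"
    unfolding Qm_swap by (rule Zr_Phi'(1)[OF _ p], subst Phi_lin(1))
      (use Phi_lin(3)[of k m "4 * t"] in \<open>simp add: Zr_Phi' Zr_Phi\<close>)
  then show "rossi_op t (\<lambda>q. cnj (Phi k m x q)) p = complex_of_real (1 / (1 - t\<^sup>2)\<^sup>2) * cnj (Phi k m (Qm t (k + m) x) p)"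
    unfolding rossi_op_cnj[OF smooth_Phi p] by simp
qed

lemma cs_Phi: "cs (Phi k m x) (Phi k' m' y) = (if (k, m) = (k', m') then complex_of_real (ip (k + m) x y) else 0)"
proof -
  have "cs (Phi k m x) (Phi k' m' y) = (\<Sum>i\<le>k + m. complex_of_real (x i) * cs (EE k m i) (Phi k' m' y))"
    unfolding Phi_def[of k m, abs_def]
    by (subst cip_sum) (auto intro!: smooth_L2 smooth_Phi smooth_mult smooth_const smooth_EE simp: cs_scale)
  also have "\<dots> = (\<Sum>i\<le>k + m. complex_of_real (x i) * (if (k, m) = (k', m') then complex_of_real (y i) else 0))"
  proof (intro sum.cong refl arg_cong2[of _ _ _ _ "(*)"])
    fix i assume i: "i \<in> {..k + m}"
    have "cs (EE k m i) (Phi k' m' y) = cnj (cs (Phi k' m' y) (EE k m i))" by (rule cip_cnj)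
    also have "cs (Phi k' m' y) (EE k m i) = (\<Sum>j\<le>k' + m'. complex_of_real (y j) * cs (EE k' m' j) (EE k m i))"
      unfolding Phi_def[of k' m', abs_def]
      by (subst cip_sum) (auto intro!: smooth_L2 smooth_mult smooth_const smooth_EE simp: cs_scale)
    also have "\<dots> = (\<Sum>j\<le>k' + m'. if j = i then (if (k, m) = (k', m') then complex_of_real (y i) else 0) else 0)"
      using i by (intro sum.cong refl) (auto simp: cs_EE)
    also have "\<dots> = (if (k, m) = (k', m') then complex_of_real (y i) else 0)"
      using i by auto
    finally show "cs (EE k m i) (Phi k' m' y) = (if (k, m) = (k', m') then complex_of_real (y i) else 0)" by simp
  qed
  finally show ?thesis by (cases "(k, m) = (k', m')") (auto simp: ip_def)
qed

section \<open>Completeness of the spherical harmonics\<close>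

text \<open>The linear span of the harmonics. \<open>YS_cong\<close> ignores values off the sphere,
  because the derivative formulas hold only on it.\<close>

inductive YS :: "(c2 \<Rightarrow> complex) \<Rightarrow> bool" where
  YS_Y: "YS (Y k m i)"
| YS_add: "YS f \<Longrightarrow> YS g \<Longrightarrow> YS (\<lambda>p. f p + g p)"
| YS_scale: "YS f \<Longrightarrow> YS (\<lambda>p. c * f p)"
| YS_cong: "YS f \<Longrightarrow> (\<And>p. p \<in> S3 \<Longrightarrow> f p = g p) \<Longrightarrow> YS g"

lemma smooth_YS: "YS f \<Longrightarrow> smooth_S3 f"
proof (induction rule: YS.induct)
  case (YS_cong f g)
  then show ?case using smooth_cong[of f g] by blast
qed (auto intro: smooth_Y smooth_add smooth_mult smooth_const)

lemma YS_zero: "YS (\<lambda>p. 0)"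
  using YS_scale[OF YS_Y[of 0 0 0], of 0] by simp

lemma YS_LL: "YS f \<Longrightarrow> YS (LL f)"
proof (induction rule: YS.induct)
  case (YS_Y k m i)
  show ?case
    by (rule YS_cong[OF YS_scale[OF YS.YS_Y[of k m "Suc i"], of "of_nat (Suc i)"]]) (rule LL_Y[symmetric])
next
  case (YS_add f g)
  show ?case by (rule YS_cong[OF YS.YS_add[OF YS_add.IH]]) (simp add: vf_add smooth_YS YS_add)
next
  case (YS_scale f c)
  show ?case by (rule YS_cong[OF YS.YS_scale[OF YS_scale.IH, of c]]) (simp add: vf_scale smooth_YS YS_scale)
next
  case (YS_cong f g)
  show ?case by (rule YS.YS_cong[OF YS_cong.IH]) (rule vf_cong[OF YS_cong.hyps(2)])
qed

definition mono4 :: "nat \<Rightarrow> nat \<Rightarrow> nat \<Rightarrow> nat \<Rightarrow> c2 \<Rightarrow> complex" where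
  "mono4 a b c d p = fst p ^ a * snd p ^ b * cnj (fst p) ^ c * cnj (snd p) ^ d"

lemma vf_power: "smooth_S3 f \<Longrightarrow> p \<in> S3 \<Longrightarrow> vf_apply X (\<lambda>q. f q ^ k) p = of_nat k * f p ^ (k - 1) * vf_apply X f p"
proof (induction k)
  case (Suc k)
  have "vf_apply X (\<lambda>q. f q ^ Suc k) p = f p * vf_apply X (\<lambda>q. f q ^ k) p + vf_apply X f p * f p ^ k"
    by (simp add: vf_mult smooth_power Suc.prems)
  also have "\<dots> = of_nat (Suc k) * f p ^ (Suc k - 1) * vf_apply X f p"
    unfolding Suc.IH[OF Suc.prems] by (cases k) (simp_all add: algebra_simps)
  finally show ?case .
qed simp

lemma smooth_mono4: "smooth_S3 (mono4 a b c d)"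
  unfolding mono4_def[abs_def] by (intro smooth_mult smooth_power smooth_cnj smooth_fst smooth_snd)

lemma vf_mono4:
  assumes p: "p \<in> S3"
  shows "LL (mono4 a b c d) p = of_nat a * mono4 (a - 1) b c (Suc d) p - of_nat b * mono4 a (b - 1) (Suc c) d p"
    and "LB (mono4 a b c d) p = of_nat c * mono4 a (Suc b) (c - 1) d p - of_nat d * mono4 (Suc a) b c (d - 1) p"
proof -
  have s: "smooth_S3 (\<lambda>p. fst p ^ a)" "smooth_S3 (\<lambda>p. snd p ^ b)" "smooth_S3 (\<lambda>p. cnj (fst p) ^ c)" "smooth_S3 (\<lambda>p. cnj (snd p) ^ d)"
    by (intro smooth_power smooth_cnj smooth_fst smooth_snd)+
  note s2 = smooth_mult[OF s(1,2)]
  note s3 = smooth_mult[OF s2 s(3)]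
  note v = vf_mult[OF s3 s(4) p] vf_mult[OF s2 s(3) p] vf_mult[OF s(1,2) p]
    vf_power[OF smooth_fst p] vf_power[OF smooth_snd p] vf_power[OF smooth_cnj[OF smooth_fst] p] vf_power[OF smooth_cnj[OF smooth_snd] p]
  show "LL (mono4 a b c d) p = of_nat a * mono4 (a - 1) b c (Suc d) p - of_nat b * mono4 a (b - 1) (Suc c) d p"
    unfolding mono4_def[abs_def] v LL_coord[OF p] by (simp add: algebra_simps)
  show "LB (mono4 a b c d) p = of_nat c * mono4 a (Suc b) (c - 1) d p - of_nat d * mono4 (Suc a) b c (d - 1) p"
    unfolding mono4_def[abs_def] v LB_coord[OF p] by (simp add: algebra_simps)
qed

text \<open>Since \<open>L Lbar\<close> reproduces a monomial up to monomials of lower degree in \<open>zbar, wbar\<close>, induction on that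
  degree expresses all monomials by the functions \<open>Y k m i\<close>.\<close>

lemma LL_LB_mono4:
  assumes p: "p \<in> S3"
  shows "LL (LB (mono4 a b c d)) p = - (of_nat (c + d) * of_nat (a + b + 1)) * mono4 a b c d p
    + (of_nat (c * a) * mono4 (a - 1) b (c - 1) d p + of_nat (d * b) * mono4 a (b - 1) c (d - 1) p)"
proof -
  have pw: "of_nat n * (x * x ^ (n - 1)) = (of_nat n * x ^ n :: complex)" for n x
    by (cases n) simp_all
  define z w zb wb where "z = fst p" and "w = snd p" and "zb = cnj (fst p)" and "wb = cnj (snd p)"
  have sp: "z * zb + w * wb = 1" using S3_eq[OF p] by (simp add: z_def w_def zb_def wb_def)
  define P P1 Q Q1 R R1 S S1 where "P = z ^ a" and "P1 = z ^ (a - 1)" and "Q = w ^ b" and "Q1 = w ^ (b - 1)"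
    and "R = zb ^ c" and "R1 = zb ^ (c - 1)" and "S = wb ^ d" and "S1 = wb ^ (d - 1)"
  define A B C D :: complex where "A = of_nat a" and "B = of_nat b" and "C = of_nat c" and "D = of_nat d"
  have f: "A * (z * P1) = A * P" "B * (w * Q1) = B * Q" "C * (zb * R1) = C * R" "D * (wb * S1) = D * S"
    unfolding A_def B_def C_def D_def P_def P1_def Q_def Q1_def R_def R1_def S_def S1_def by (rule pw)+
  have "LL (LB (mono4 a b c d)) p = LL (\<lambda>p. of_nat c * mono4 a (Suc b) (c - 1) d p - of_nat d * mono4 (Suc a) b c (d - 1) p) p"
    by (rule vf_cong[OF _ p]) (rule vf_mono4)
  also have "\<dots> = of_nat c * LL (mono4 a (Suc b) (c - 1) d) p - of_nat d * LL (mono4 (Suc a) b c (d - 1)) p"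
    by (simp add: vf_diff vf_scale smooth_mult smooth_const smooth_mono4 p)
  also have "\<dots> = C * (A * (P1 * (w * Q) * R1 * (wb * S)) - (B + 1) * (P * Q * (zb * R1) * S))
     - D * ((A + 1) * (P * Q * R * (wb * S1)) - B * (z * P * Q1 * (zb * R) * S1))"
    unfolding vf_mono4[OF p] mono4_def A_def B_def C_def D_def P_def P1_def Q_def Q1_def R_def R1_def S_def S1_def z_def w_def zb_def wb_def
    by (simp add: add.commute)
  also have "\<dots> = - ((C + D) * (A + B + 1)) * (P * Q * R * S) + (C * A * (P1 * Q * R1 * S) + D * B * (P * Q1 * R * S1))"
    using f sp by algebra
  finally show ?thesis
    unfolding mono4_def A_def B_def C_def D_def P_def P1_def Q_def Q1_def R_def R1_def S_def S1_def z_def w_def zb_def wb_def by simp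
qed

lemma YS_diff: "YS f \<Longrightarrow> YS g \<Longrightarrow> YS (\<lambda>p. f p - g p)"
  using YS_add[OF _ YS_scale[of g "-1"], of f] by simp

lemma YS_mono4: "YS (mono4 a b c d)"
proof (induction "c + d" arbitrary: a b c d)
  case 0
  then have "mono4 a b c d = Y a b 0" by (simp add: fun_eq_iff mono4_def Y_0)
  then show ?case by (simp add: YS_Y)
next
  case (Suc n)
  \<comment> \<open>The factor \<open>of_nat c\<close> or \<open>of_nat d\<close> is 0 exactly when
    truncated subtraction fails to lower the degree; otherwise the induction hypothesis
    applies.\<close>
  have low: "YS (\<lambda>p. of_nat c * of_nat e * mono4 a' b' (c - 1) d p)" "YS (\<lambda>p. of_nat d * of_nat e * mono4 a' b' c (d - 1) p)" for a' b' e
  proof -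
    show "YS (\<lambda>p. of_nat c * of_nat e * mono4 a' b' (c - 1) d p)"
      using Suc.hyps(1)[of "c - 1" d] Suc.hyps(2) by (cases c) (auto intro: YS_scale YS_zero)
    show "YS (\<lambda>p. of_nat d * of_nat e * mono4 a' b' c (d - 1) p)"
      using Suc.hyps(1)[of c "d - 1"] Suc.hyps(2) by (cases d) (auto intro: YS_scale YS_zero)
  qed
  have "YS (\<lambda>p. of_nat c * of_nat 1 * mono4 a (Suc b) (c - 1) d p - of_nat d * of_nat 1 * mono4 (Suc a) b c (d - 1) p)"
    by (intro YS_diff low)
  then have "YS (LB (mono4 a b c d))"
    by (rule YS_cong) (simp add: vf_mono4)
  then have LB: "YS (LL (LB (mono4 a b c d)))" by (rule YS_LL)
  define N :: complex where "N = of_nat (c + d) * of_nat (a + b + 1)"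
  have "c + d \<noteq> 0" "a + b + 1 \<noteq> 0" using Suc.hyps(2) by linarith+
  then have N: "N \<noteq> 0" unfolding N_def mult_eq_0_iff of_nat_eq_0_iff by blast
  have "YS (\<lambda>p. 1 / N * ((of_nat c * of_nat a * mono4 (a - 1) b (c - 1) d p + of_nat d * of_nat b * mono4 a (b - 1) c (d - 1) p)
      - LL (LB (mono4 a b c d)) p))"
    by (intro YS_scale YS_diff YS_add low LB)
  then show ?case
  proof (rule YS_cong)
    fix p assume "p \<in> S3"
    show "1 / N * ((of_nat c * of_nat a * mono4 (a - 1) b (c - 1) d p + of_nat d * of_nat b * mono4 a (b - 1) c (d - 1) p)
      - LL (LB (mono4 a b c d)) p) = mono4 a b c d p"
      unfolding LL_LB_mono4[OF \<open>p \<in> S3\<close>] N_def[symmetric] of_nat_mult using N by simp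
  qed
qed

section \<open>Polynomials in the coordinates and their conjugates\<close>

inductive PS :: "(c2 \<Rightarrow> complex) \<Rightarrow> bool" where
  PS_mono: "PS (mono4 a b c d)"
| PS_add: "PS f \<Longrightarrow> PS g \<Longrightarrow> PS (\<lambda>p. f p + g p)"
| PS_scale: "PS f \<Longrightarrow> PS (\<lambda>p. c * f p)"

lemma PS_YS: "PS f \<Longrightarrow> YS f"
  by (induction rule: PS.induct) (auto intro: YS_mono4 YS_add YS_scale)

lemma mono4_mult: "mono4 a b c d p * mono4 a' b' c' d' p = mono4 (a + a') (b + b') (c + c') (d + d') p"
  by (simp add: mono4_def power_add mult_ac)

lemma PS_mult: "PS f \<Longrightarrow> PS g \<Longrightarrow> PS (\<lambda>p. f p * g p)"
proof (induction rule: PS.induct)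
  case (PS_mono a b c d)
  from this show ?case
  proof (induction rule: PS.induct)
    case (PS_mono a' b' c' d')
    show ?case unfolding mono4_mult by (rule PS.PS_mono)
  next
    case (PS_add f g)
    then show ?case by (simp add: distrib_left PS.PS_add)
  next
    case (PS_scale f e)
    then show ?case by (simp add: mult.left_commute[of _ e] PS.PS_scale)
  qed
next
  case (PS_add f f')
  then show ?case by (simp add: distrib_right PS.PS_add)
next
  case (PS_scale f e)
  then show ?case by (simp add: mult.assoc PS.PS_scale)
qed

lemma PS_real_polynomial: "real_polynomial_function f \<Longrightarrow> PS (\<lambda>p. complex_of_real (f p))"
proof (induction rule: real_polynomial_function.induct)
  case (linear f)
  define A B C D where "A = f (1, 0)" and "B = f (\<i>, 0)" and "C = f (0, 1)" and "D = f (0, \<i>)"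
  have l: "f p = A * Re (fst p) + B * Im (fst p) + C * Re (snd p) + D * Im (snd p)" for p
  proof -
    have "p = Re (fst p) *\<^sub>R (1, 0) + Im (fst p) *\<^sub>R (\<i>, 0) + Re (snd p) *\<^sub>R (0, 1) + Im (snd p) *\<^sub>R (0, \<i>)"
      by (simp add: prod_eq_iff complex_eq_iff)
    then have "f p = f (Re (fst p) *\<^sub>R (1, 0) + Im (fst p) *\<^sub>R (\<i>, 0) + Re (snd p) *\<^sub>R (0, 1) + Im (snd p) *\<^sub>R (0, \<i>))" by simp
    also have "\<dots> = A * Re (fst p) + B * Im (fst p) + C * Re (snd p) + D * Im (snd p)"
      unfolding A_def B_def C_def D_def
      using bounded_linear.linear[OF linear] by (simp only: linear_add linear_cmul) simp
    finally show ?thesis .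
  qed
  have "PS (\<lambda>p. (A / 2 - \<i> * B / 2) * mono4 1 0 0 0 p + (A / 2 + \<i> * B / 2) * mono4 0 0 1 0 p
     + (C / 2 - \<i> * D / 2) * mono4 0 1 0 0 p + (C / 2 + \<i> * D / 2) * mono4 0 0 0 1 p)"
    by (intro PS_add PS_scale PS_mono)
  moreover have "(A / 2 - \<i> * B / 2) * mono4 1 0 0 0 p + (A / 2 + \<i> * B / 2) * mono4 0 0 1 0 p
     + (C / 2 - \<i> * D / 2) * mono4 0 1 0 0 p + (C / 2 + \<i> * D / 2) * mono4 0 0 0 1 p = complex_of_real (f p)" for p
    unfolding l by (simp add: mono4_def complex_eq_iff algebra_simps)
  ultimately show ?case by simp
next
  case (const c)
  have "PS (\<lambda>p. complex_of_real c * mono4 0 0 0 0 p)" by (intro PS_scale PS_mono)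
  then show ?case by (simp add: mono4_def)
next
  case (add f g)
  then show ?case by (simp add: PS_add)
next
  case (mult f g)
  then show ?case by (simp add: PS_mult)
qed

section \<open>From polynomials to Borel sets\<close>

lemma L2_indicator: "A \<in> sets borel \<Longrightarrow> (\<lambda>p. indicator A p :: complex) \<in> L2 S3_measure"
proof (rule L2I)
  assume A: "A \<in> sets borel"
  have "(\<lambda>p. indicator A p :: complex) \<in> borel_measurable (restrict_space borel S3)"
    using A by (intro measurable_restrict_space1 borel_measurable_indicator)
  then show m: "(\<lambda>p. indicator A p :: complex) \<in> borel_measurable S3_measure"
    by (simp add: measurable_cong_sets[OF sets_S3_measure refl])
  show "integrable S3_measure (\<lambda>p. (cmod (indicator A p))\<^sup>2)"
    by (rule finite_measure.integrable_const_bound[OF finite_S3_measure, of _ 1]) (use m in \<open>auto simp: indicator_def\<close>)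
qed

lemma L2_integrable_S3: "u \<in> L2 S3_measure \<Longrightarrow> integrable S3_measure u"
  using L2_mult_integrable[of u S3_measure "\<lambda>p. 1"] continuous_L2[of "\<lambda>p. 1"] by (simp add: continuous_on_const)

text \<open>The measure is finite, so \<open>u\<close> is integrable and uniform approximation by
  Stone-Weierstrass is enough.\<close>

lemma integral_continuous_zero:
  assumes u: "u \<in> L2 S3_measure"
    and poly: "\<And>f. real_polynomial_function f \<Longrightarrow> (\<integral>p. u p * complex_of_real (f p) \<partial>S3_measure) = 0"
    and \<phi>: "continuous_on S3 (\<phi> :: c2 \<Rightarrow> real)"
  shows "(\<integral>p. u p * complex_of_real (\<phi> p) \<partial>S3_measure) = 0"
proof -
  let ?I = "\<integral>p. u p * complex_of_real (\<phi> p) \<partial>S3_measure"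
  define K where "K = (\<integral>p. cmod (u p) \<partial>S3_measure)"
  have ui: "integrable S3_measure (\<lambda>p. cmod (u p))" using L2_integrable_S3[OF u] by simp
  have "cmod ?I \<le> e * K" if e: "0 < e" for e
  proof -
    obtain g :: "c2 \<Rightarrow> real" where g: "real_polynomial_function g" "\<And>p. p \<in> S3 \<Longrightarrow> \<bar>\<phi> p - g p\<bar> < e"
      by (rule Stone_Weierstrass_real_polynomial_function[OF compact_S3 \<phi> e]) (rule that)
    have cg: "continuous_on S3 g"
      using g(1) by (intro continuous_on_polymonial_function) (simp add: real_polynomial_function_eq)
    have i: "integrable S3_measure (\<lambda>p. u p * complex_of_real (h p))" if "continuous_on S3 h" for h
      by (intro L2_mult_integrable u continuous_L2 continuous_intros that)
    have "?I = (\<integral>p. u p * complex_of_real (\<phi> p) \<partial>S3_measure) - (\<integral>p. u p * complex_of_real (g p) \<partial>S3_measure)"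
      by (simp add: poly[OF g(1)])
    also have "\<dots> = (\<integral>p. u p * complex_of_real (\<phi> p) - u p * complex_of_real (g p) \<partial>S3_measure)"
      by (intro Bochner_Integration.integral_diff[symmetric] i \<phi> cg)
    also have "cmod \<dots> \<le> (\<integral>p. cmod (u p * complex_of_real (\<phi> p) - u p * complex_of_real (g p)) \<partial>S3_measure)"
      by (rule integral_norm_bound)
    also have "\<dots> \<le> (\<integral>p. e * cmod (u p) \<partial>S3_measure)"
    proof (rule integral_mono)
      show "integrable S3_measure (\<lambda>p. cmod (u p * complex_of_real (\<phi> p) - u p * complex_of_real (g p)))"
        by (intro integrable_norm Bochner_Integration.integrable_diff i \<phi> cg)
      show "integrable S3_measure (\<lambda>p. e * cmod (u p))" using ui by simp
      fix p assume "p \<in> space S3_measure"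
      then have "\<bar>\<phi> p - g p\<bar> \<le> e" using g(2)[of p] by simp
      then have "cmod (u p) * \<bar>\<phi> p - g p\<bar> \<le> cmod (u p) * e" by (intro mult_left_mono) auto
      then show "cmod (u p * complex_of_real (\<phi> p) - u p * complex_of_real (g p)) \<le> e * cmod (u p)"
        by (simp add: norm_mult mult.commute flip: right_diff_distrib of_real_diff)
    qed
    finally show ?thesis by (simp add: K_def)
  qed
  note b = this
  have K: "0 \<le> K" unfolding K_def by simp
  have "cmod ?I \<le> 0 + e" if e: "0 < e" for e
  proof -
    have "cmod ?I \<le> e / (K + 1) * K" using e K by (intro b) auto
    also have "\<dots> \<le> e" using e K by (simp add: field_simps)
    finally show ?thesis by simp
  qed
  then have "cmod ?I \<le> 0" by (rule field_le_epsilon)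
  then show ?thesis by simp
qed

text \<open>The indicator of a nonempty closed set is the pointwise limit of the continuous
  functions \<open>f k\<close>, built from the distance to the set; \<open>cmod (u p)\<close>
  dominates the integrands.\<close>

lemma integral_closed_zero:
  assumes u: "u \<in> L2 S3_measure"
    and cont: "\<And>\<phi> :: c2 \<Rightarrow> real. continuous_on S3 \<phi> \<Longrightarrow> (\<integral>p. u p * complex_of_real (\<phi> p) \<partial>S3_measure) = 0"
    and C: "closed C"
  shows "(\<integral>p. u p * indicator C p \<partial>S3_measure) = 0"
proof (cases "C = {}")
  case False
  define f where "f k p = max 0 (1 - real k * infdist p C)" for k p
  have f01: "0 \<le> f k p" "f k p \<le> 1" for k p by (simp_all add: f_def infdist_nonneg)
  have fc: "continuous_on S3 (f k)" for k unfolding f_def by (intro continuous_intros)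
  have lim: "(\<lambda>k. complex_of_real (f k p)) \<longlonglongrightarrow> indicator C p" for p
  proof (cases "p \<in> C")
    case True
    then have "f k p = 1" for k by (simp add: f_def)
    then show ?thesis using True by simp
  next
    case p: False
    then have d: "0 < infdist p C" using infdist_pos_not_in_closed[OF C False] by simp
    obtain N where N: "1 < real N * infdist p C" using reals_Archimedean3[OF d] by blast
    have "f k p = 0" if "N \<le> k" for k
    proof -
      have "real N * infdist p C \<le> real k * infdist p C" using that d by (intro mult_right_mono) auto
      then show ?thesis using N by (simp add: f_def)
    qed
    then have "eventually (\<lambda>k. complex_of_real (f k p) = 0) sequentially"
      unfolding eventually_sequentially by (intro exI[of _ N]) auto
    then show ?thesis using p by (simp add: tendsto_eventually)
  qed
  have "(\<lambda>k. \<integral>p. u p * complex_of_real (f k p) \<partial>S3_measure) \<longlonglongrightarrow> (\<integral>p. u p * indicator C p \<partial>S3_measure)"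
  proof (rule integral_dominated_convergence[where w = "\<lambda>p. cmod (u p)"])
    show "(\<lambda>p. u p * indicator C p) \<in> borel_measurable S3_measure"
      using L2_mult_integrable[OF u L2_indicator] C by (intro borel_measurable_integrable) auto
    show "(\<lambda>p. u p * complex_of_real (f k p)) \<in> borel_measurable S3_measure" for k
      by (intro borel_measurable_integrable L2_mult_integrable u continuous_L2 continuous_intros fc)
    show "integrable S3_measure (\<lambda>p. cmod (u p))" using L2_integrable_S3[OF u] by simp
    show "AE p in S3_measure. (\<lambda>k. u p * complex_of_real (f k p)) \<longlonglongrightarrow> u p * indicator C p"
      by (intro AE_I2 tendsto_intros lim)
    show "AE p in S3_measure. cmod (u p * complex_of_real (f k p)) \<le> cmod (u p)" for k
      using f01 by (intro AE_I2) (simp add: norm_mult mult_left_le)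
  qed
  then show ?thesis by (simp add: cont[OF fc] LIMSEQ_const_iff)
qed simp

text \<open>Closed sets form an intersection-stable generator, so Dynkin's theorem applies; the step
  for disjoint unions uses dominated convergence on the finite partial unions.\<close>

lemma integral_borel_zero:
  assumes u: "u \<in> L2 S3_measure"
    and C: "\<And>C. closed C \<Longrightarrow> (\<integral>p. u p * indicator C p \<partial>S3_measure) = 0"
    and A: "A \<in> sets borel"
  shows "(\<integral>p. u p * indicator A p \<partial>S3_measure) = 0"
proof -
  have b: "sigma_sets UNIV (Collect closed) = sets (borel :: c2 measure)"
    by (simp add: borel_eq_closed)
  have i: "integrable S3_measure (\<lambda>p. u p * indicator A p)" if "A \<in> sets borel" for A
    by (rule L2_mult_integrable[OF u L2_indicator[OF that]])
  have "Int_stable (Collect closed :: c2 set set)" by (auto simp: Int_stable_def)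
  moreover have "Collect closed \<subseteq> Pow (UNIV :: c2 set)" by simp
  moreover have "A \<in> sigma_sets UNIV (Collect closed)" using A by (simp only: b)
  ultimately show ?thesis
  proof (induction rule: sigma_sets_induct_disjoint)
    case (basic A)
    then show ?case by (simp add: C)
  next
    case empty
    show ?case by simp
  next
    case (compl A)
    have "(\<integral>p. u p * indicator (UNIV - A) p \<partial>S3_measure) = (\<integral>p. u p * indicator UNIV p - u p * indicator A p \<partial>S3_measure)"
      by (intro Bochner_Integration.integral_cong refl) (simp add: indicator_def)
    also have "\<dots> = 0"
      using compl i[of UNIV] i[of A] C[of UNIV] by (simp add: b)
    finally show ?case .
  next
    case (union F)
    have F: "F n \<in> sets borel" for n using union.hyps(2) unfolding b by auto
    define B where "B n = (\<Union>k<n. F k)" for n :: nat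
    have Bm: "B n \<in> sets borel" for n unfolding B_def by (intro sets.finite_UN F) auto
    have B0: "(\<integral>p. u p * indicator (B n) p \<partial>S3_measure) = 0" for n
    proof (induction n)
      case 0
      show ?case by (simp add: B_def)
    next
      case (Suc n)
      have "F n \<inter> F k = {}" if "k < n" for k
        using disjoint_family_onD[OF union.hyps(1), of n k] that by simp
      then have d: "F n \<inter> B n = {}" unfolding B_def by blast
      have "B (Suc n) = B n \<union> F n" by (auto simp: B_def less_Suc_eq)
      then have "u p * indicator (B (Suc n)) p = u p * indicator (B n) p + u p * indicator (F n) p" for p
        using d by (cases "p \<in> B n") (auto simp: indicator_def)
      then show ?case using Suc union.IH[of n] i[OF Bm[of n]] i[OF F[of n]] by simp
    qed
    have "(\<lambda>n. \<integral>p. u p * indicator (B n) p \<partial>S3_measure) \<longlonglongrightarrow> (\<integral>p. u p * indicator (\<Union>k. F k) p \<partial>S3_measure)"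
    proof (rule integral_dominated_convergence[where w = "\<lambda>p. cmod (u p)"])
      show "(\<lambda>p. u p * indicator (\<Union>k. F k) p) \<in> borel_measurable S3_measure"
        using F by (intro borel_measurable_integrable i) auto
      show "(\<lambda>p. u p * indicator (B n) p) \<in> borel_measurable S3_measure" for n
        by (intro borel_measurable_integrable i Bm)
      show "integrable S3_measure (\<lambda>p. cmod (u p))" using L2_integrable_S3[OF u] by simp
      show "AE p in S3_measure. (\<lambda>n. u p * indicator (B n) p) \<longlonglongrightarrow> u p * indicator (\<Union>k. F k) p"
        unfolding B_def by (intro AE_I2 tendsto_intros LIMSEQ_indicator_UN)
      show "AE p in S3_measure. cmod (u p * indicator (B n) p) \<le> cmod (u p)" for n
        by (intro AE_I2) (simp add: indicator_def)
    qed
    then show ?case by (simp add: B0 LIMSEQ_const_iff)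
  qed
qed

lemma AE_Re_nonpos:
  assumes u: "u \<in> L2 S3_measure"
    and A: "\<And>A. A \<in> sets borel \<Longrightarrow> (\<integral>p. u p * indicator A p \<partial>S3_measure) = 0"
  shows "AE p in S3_measure. Re (u p) \<le> 0"
proof -
  define B where "B = {p \<in> space S3_measure. 0 < Re (u p)}"
  have [measurable]: "u \<in> borel_measurable S3_measure" by (rule L2_measurable[OF u])
  have "B \<in> sets S3_measure" unfolding B_def by measurable
  then have B: "B \<in> sets borel"
    unfolding sets_S3_measure by (simp add: sets_restrict_space_iff)
  have i: "integrable S3_measure (\<lambda>p. u p * indicator B p)"
    by (rule L2_mult_integrable[OF u L2_indicator[OF B]])
  have pw: "Re (u p * indicator B p) = (if p \<in> B then Re (u p) else 0)" for p
    by (cases "p \<in> B") simp_all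
  have "(\<integral>p. Re (u p * indicator B p) \<partial>S3_measure) = Re (\<integral>p. u p * indicator B p \<partial>S3_measure)"
    by (rule integral_Re[OF i])
  also have "\<dots> = 0" by (simp add: A[OF B])
  finally have z: "(\<integral>p. Re (u p * indicator B p) \<partial>S3_measure) = 0" .
  have "AE p in S3_measure. Re (u p * indicator B p) = 0"
  proof (subst integral_nonneg_eq_0_iff_AE[symmetric])
    show "integrable S3_measure (\<lambda>p. Re (u p * indicator B p))" using i by (rule integrable_Re)
    show "AE p in S3_measure. 0 \<le> Re (u p * indicator B p)" unfolding pw by (intro AE_I2) (simp add: B_def)
  qed (rule z)
  moreover have "Re (u p) \<le> 0" if "p \<in> space S3_measure" "Re (u p * indicator B p) = 0" for p
    using that unfolding pw by (auto simp: B_def split: if_splits)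
  ultimately show ?thesis by (rule AE_mp[OF _ AE_I2[OF impI]])
qed

text \<open>Orthogonality to the harmonics passes to their span, which contains all polynomials,
  then to continuous functions, indicators of closed sets and indicators of Borel sets; testing on
  the set where a real part is positive finishes the proof.\<close>

theorem Y_complete:
  assumes u: "u \<in> L2 S3_measure" and z: "\<And>k m i. cs u (Y k m i) = 0"
  shows "AE p in S3_measure. u p = 0"
proof -
  have YS0: "cs u f = 0" if "YS f" for f
    using that
  proof (induction rule: YS.induct)
    case (YS_Y k m i)
    show ?case by (rule z)
  next
    case (YS_add f g)
    have "cs (\<lambda>p. f p + g p) u = cs f u + cs g u"
      by (intro cip_add smooth_L2 smooth_YS YS_add u)
    then show ?case
      using YS_add.IH cip_cnj[of S3_measure u "\<lambda>p. f p + g p"] cip_cnj[of S3_measure f u] cip_cnj[of S3_measure g u]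
      by (metis add.right_neutral complex_cnj_cnj complex_cnj_zero cip_cnj)
  next
    case (YS_scale f c)
    then show ?case by (simp add: cs_scale)
  next
    case (YS_cong f g)
    then show ?case using cs_cong[of u u f g] by simp
  qed
  have "(\<integral>p. u p * complex_of_real (f p) \<partial>S3_measure) = 0" if "real_polynomial_function f" for f
    using YS0[OF PS_YS[OF PS_real_polynomial[OF that]]] by (simp add: cip_def)
  note 1 = integral_borel_zero[OF u integral_closed_zero[OF u integral_continuous_zero[OF u this]]]
  \<comment> \<open>The multiples by 1, -1, \<open>\<i>\<close> and \<open>-\<i>\<close> bound the
    real and the imaginary part from both sides.\<close>
  have 2: "AE p in S3_measure. Re (c * u p) \<le> 0" for c
    by (intro AE_Re_nonpos L2_scale u) (simp add: 1 mult.assoc)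
  from 2[of 1] 2[of "-1"] 2[of "\<i>"] 2[of "-\<i>"] show ?thesis
    by eventually_elim (simp add: complex_eq_iff)
qed

section \<open>The spectrum of the CR Paneitz operator\<close>

lemma orthonormal_Parseval:
  assumes q: "orthonormal n (Suc n) q"
  shows "(\<Sum>i\<le>n. ip n x (q i) * ip n y (q i)) = ip n x y"
proof -
  have "(\<Sum>i\<le>n. ip n x (q i) * ip n y (q i)) = (\<Sum>i\<le>n. \<Sum>p\<le>n. \<Sum>r\<le>n. x p * y r * (q i p * q i r))"
    unfolding ip_def sum_product by (intro sum.cong refl) (simp add: mult_ac)
  also have "\<dots> = (\<Sum>p\<le>n. \<Sum>r\<le>n. \<Sum>i\<le>n. x p * y r * (q i p * q i r))"
    by (subst sum.swap) (intro sum.cong refl sum.swap)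
  also have "\<dots> = (\<Sum>p\<le>n. \<Sum>r\<le>n. if p = r then x p * y r else 0)"
    by (intro sum.cong refl) (simp add: sum_distrib_left[symmetric] orthonormal_complete[OF q])
  also have "\<dots> = ip n x y" by (simp add: ip_def)
  finally show ?thesis .
qed

lemma Qm_spectral:
  "\<exists>q l. orthonormal n (Suc n) q \<and> (\<forall>i\<le>n. \<forall>p\<le>n. Qm t n (q i) p = l i * q i p)"
proof -
  interpret symmetric_op n "Qm t n"
    by unfold_locales (rule Qm_add, rule Qm_scale, rule ip_Qm)
  obtain q :: "nat \<Rightarrow> nat \<Rightarrow> real" and l :: "nat \<Rightarrow> real" where
    "orthonormal n (Suc n) q" "\<And>i p. i \<le> n \<Longrightarrow> p \<le> n \<Longrightarrow> Qm t n (q i) p = l i * q i p"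
    by (rule spectral) (rule that)
  then show ?thesis by blast
qed

text \<open>For each pair \<open>(k, m)\<close> the harmonics \<open>EE k m i\<close> carry the
  matrix \<open>Qm t (k + m)\<close>, so its orthonormal eigenvectors give eigenfunctions indexed by
  triples with \<open>i \<le> k + m\<close>. That the maximal distributional operator is exactly the
  diagonal one needs both these functions and their conjugates as test functions.\<close>

theorem rossi_paneitz_diagonal:
  fixes t :: real
  assumes t: "0 < \<bar>t\<bar>" "\<bar>t\<bar> < 1"
  obtains \<phi> \<nu> where "diagonal_operator S3_measure \<phi> \<nu> (rossi_paneitz t)"
proof -
  obtain q l where on: "\<And>n. orthonormal n (Suc n) (q n)"
    and eig: "\<And>n i p. i \<le> n \<Longrightarrow> p \<le> n \<Longrightarrow> Qm t n (q n i) p = l n i * q n i p"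
    using Qm_spectral[of _ t] by metis
  define h where "h = (1 - t\<^sup>2)\<^sup>2"
  have "t\<^sup>2 < 1" using t(2) by (simp add: abs_square_less_1)
  then have h: "0 < h" by (simp add: h_def)
  define T where "T = {(k, m, i :: nat). i \<le> k + m}"
  define F where "F = (\<lambda>(k, m, i). Phi k m (q (k + m) i))"
  define N where "N = (\<lambda>(k, m, i :: nat). l (k + m) i / h)"
  have Fe: "F (k, m, i) = Phi k m (q (k + m) i)" and Ne: "N (k, m, i) = l (k + m) i / h" for k m i
    by (simp_all add: F_def N_def)
  have sF: "smooth_S3 (F a)" for a by (cases a) (simp add: Fe smooth_Phi)
  have orthF: "cs (F a) (F b) = (if a = b then 1 else 0)" if ab: "a \<in> T" "b \<in> T" for a b
  proof -
    obtain k m i k' m' i' where [simp]: "a = (k, m, i)" "b = (k', m', i')" by (metis prod_cases3)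
    show ?thesis
      using ab on[of "k + m"] by (auto simp: Fe cs_Phi T_def orthonormal_def)
  qed
  have opF: "rossi_op t (F a) p = N a * F a p" "rossi_op t (\<lambda>q. cnj (F a q)) p = N a * cnj (F a p)"
    if a: "a \<in> T" and p: "p \<in> S3" for a p
  proof -
    obtain k m i where [simp]: "a = (k, m, i)" by (metis prod_cases3)
    have "Phi k m (Qm t (k + m) (q (k + m) i)) p = Phi k m (\<lambda>r. l (k + m) i * q (k + m) i r) p"
      using a by (intro Phi_cong eig) (auto simp: T_def)
    then have e: "Phi k m (Qm t (k + m) (q (k + m) i)) p = l (k + m) i * F a p"
      by (simp add: Phi_lin Fe)
    show "rossi_op t (F a) p = N a * F a p" "rossi_op t (\<lambda>q. cnj (F a q)) p = N a * cnj (F a p)"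
      using rossi_op_Phi[OF p, of t k m "q (k + m) i"] unfolding e by (simp_all add: Fe Ne h_def)
  qed
  have completeF: "AE p in S3_measure. u p = 0"
    if u: "u \<in> L2 S3_measure" and z: "\<And>a. a \<in> T \<Longrightarrow> cs u (F a) = 0" for u
  proof (rule Y_complete[OF u])
    fix k m r :: nat
    let ?n = "k + m"
    show "cs u (Y k m r) = 0"
    proof (cases "r \<le> ?n")
      case False
      then show ?thesis using cs_cong[of u u "Y k m r" "\<lambda>p. 0"] by (simp add: Y_zero cs_zero)
    next
      case True
      have e: "(\<Sum>i\<le>?n. complex_of_real (q ?n i r) * F (k, m, i) p) = EE k m r p" for p
      proof -
        have "(\<Sum>i\<le>?n. complex_of_real (q ?n i r) * F (k, m, i) p)
            = (\<Sum>i\<le>?n. \<Sum>s\<le>?n. complex_of_real (q ?n i r * q ?n i s) * EE k m s p)"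
          by (simp add: Fe Phi_def sum_distrib_left mult.assoc)
        also have "\<dots> = (\<Sum>s\<le>?n. complex_of_real (\<Sum>i\<le>?n. q ?n i r * q ?n i s) * EE k m s p)"
          by (subst sum.swap) (simp add: sum_distrib_right)
        also have "\<dots> = (\<Sum>s\<le>?n. if s = r then EE k m s p else 0)"
          using True by (intro sum.cong refl) (simp add: orthonormal_complete[OF on])
        also have "\<dots> = EE k m r p" using True by simp
        finally show ?thesis .
      qed
      have "cs (EE k m r) u = cs (\<lambda>p. \<Sum>i\<le>?n. complex_of_real (q ?n i r) * F (k, m, i) p) u"
        unfolding e ..
      also have "\<dots> = (\<Sum>i\<le>?n. complex_of_real (q ?n i r) * cs (F (k, m, i)) u)"
        by (subst cip_sum) (auto intro!: u smooth_L2 smooth_mult smooth_const sF simp: cs_scale)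
      also have "\<dots> = 0"
      proof (intro sum.neutral ballI)
        fix i assume "i \<in> {..?n}"
        then have "cs u (F (k, m, i)) = 0" by (intro z) (simp add: T_def)
        then show "complex_of_real (q ?n i r) * cs (F (k, m, i)) u = 0"
          using cip_cnj[of S3_measure "F (k, m, i)" u] by simp
      qed
      finally have E0: "cs u (EE k m r) = 0"
        using cip_cnj[of S3_measure u "EE k m r"] by simp
      define c where "c = complex_of_real (1 / sqrt (real (?n choose r) * nrm k m))"
      have c: "c \<noteq> 0" using True nrm_pos[of k m] by (simp add: c_def)
      have "cs u (EE k m r) = cnj c * cs u (Y k m r)"
        unfolding EE_def[abs_def] c_def[symmetric] by (rule cs_scale)
      then show ?thesis using E0 c by simp
    qed
  qed
  \<comment> \<open>An enumeration of the countably infinite set of triples, as the locale is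
    indexed by natural numbers.\<close>
  define e where "e = from_nat_into T"
  have "inj (\<lambda>k :: nat. (k, 0 :: nat, 0 :: nat))" by (simp add: inj_on_def)
  then have "infinite (range (\<lambda>k :: nat. (k, 0 :: nat, 0 :: nat)))" by (rule range_inj_infinite)
  moreover have "range (\<lambda>k :: nat. (k, 0 :: nat, 0 :: nat)) \<subseteq> T" by (auto simp: T_def)
  ultimately have "infinite T" using finite_subset by blast
  then have "bij_betw e UNIV T" unfolding e_def by (intro bij_betw_from_nat_into) auto
  then have inj: "inj e" and ran: "range e = T" by (auto simp: bij_betw_def)
  have eT: "e j \<in> T" for j using ran by auto
  have "diagonal_operator S3_measure (\<lambda>j. F (e j)) (\<lambda>j. N (e j)) (rossi_paneitz t)"
  proof -
    interpret orthonormal_basis S3_measure "\<lambda>j. F (e j)"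
    proof
      show "F (e i) \<in> L2 S3_measure" for i by (intro smooth_L2 sF)
      show "cs (F (e i)) (F (e j)) = (if i = j then 1 else 0)" for i j
        using orthF[OF eT eT] inj by (simp add: inj_eq)
      fix u assume u: "u \<in> L2 S3_measure" and z: "\<And>i. cs u (F (e i)) = 0"
      show "AE x in S3_measure. u x = 0"
      proof (rule completeF[OF u])
        fix a assume "a \<in> T"
        then obtain i where "a = e i" using ran by auto
        then show "cs u (F a) = 0" using z by simp
      qed
    qed
    have P: "(\<integral>x. cr_paneitz contact_form (Z_rossi t) \<phi> x * \<psi> x \<partial>S3_measure) = (\<integral>x. rossi_op t \<phi> x * \<psi> x \<partial>S3_measure)"
      if "smooth_S3 \<phi>" for \<phi> \<psi>
      by (intro integral_S3_cong) (simp add: cr_paneitz_rossi t that)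
    show ?thesis
    proof
      fix u w
      show "(u, w) \<in> rossi_paneitz t \<longleftrightarrow> u \<in> L2 S3_measure \<and> w \<in> L2 S3_measure \<and> (\<forall>i. coef w i = N (e i) * coef u i)"
      proof (intro iffI conjI allI)
        assume uw: "(u, w) \<in> rossi_paneitz t"
        then show "u \<in> L2 S3_measure" "w \<in> L2 S3_measure"
          by (simp_all add: rossi_paneitz_def maximal_operator_def)
        fix i
        \<comment> \<open>Pairing bilinearly with a conjugated basis function computes a
          coefficient, and by \<open>opF\<close> the transpose maps this test function to its
          multiple by \<open>N (e i)\<close>.\<close>
        let ?\<psi> = "\<lambda>p. cnj (F (e i) p)"
        have s: "smooth_S3 ?\<psi>" by (intro smooth_cnj sF)
        have "(\<integral>x. cr_paneitz contact_form (Z_rossi t) \<phi> x * ?\<psi> x \<partial>S3_measure)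
            = (\<integral>x. \<phi> x * (N (e i) * ?\<psi> x) \<partial>S3_measure)" if \<phi>: "smooth_S3 \<phi>" for \<phi>
          unfolding P[OF \<phi>] rossi_op_transpose[OF \<phi> s] by (intro integral_S3_cong) (simp add: opF eT)
        moreover have "smooth_S3 (\<lambda>p. complex_of_real (N (e i)) * ?\<psi> p)" by (intro smooth_mult smooth_const s)
        ultimately have "(\<integral>x. w x * ?\<psi> x \<partial>S3_measure) = (\<integral>x. u x * (N (e i) * ?\<psi> x) \<partial>S3_measure)"
          using uw s unfolding rossi_paneitz_def maximal_operator_def distributional_def by blast
        then show "coef w i = N (e i) * coef u i"
          by (simp only: cip_def mult.left_commute[of _ "complex_of_real (N (e i))"] integral_mult_right_zero)
      next
        assume *: "u \<in> L2 S3_measure \<and> w \<in> L2 S3_measure \<and> (\<forall>i. coef w i = N (e i) * coef u i)"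
        have "(\<integral>x. w x * \<psi> x \<partial>S3_measure) = (\<integral>x. u x * g x \<partial>S3_measure)"
          if s: "smooth_S3 \<psi>" "smooth_S3 g" and tr: "\<And>\<phi>. smooth_S3 \<phi> \<Longrightarrow>
            (\<integral>x. cr_paneitz contact_form (Z_rossi t) \<phi> x * \<psi> x \<partial>S3_measure) = (\<integral>x. \<phi> x * g x \<partial>S3_measure)" for \<psi> g
        proof (rule sums_unique2)
          \<comment> \<open>The transpose relation for the basis function itself yields its pairing
            with \<open>g\<close>; hence the two integrals have the same expansion.\<close>
          have "(\<integral>x. F (e i) x * g x \<partial>S3_measure) = N (e i) * (\<integral>x. F (e i) x * \<psi> x \<partial>S3_measure)" for i
          proof -
            have "(\<integral>x. F (e i) x * g x \<partial>S3_measure) = (\<integral>x. N (e i) * (F (e i) x * \<psi> x) \<partial>S3_measure)"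
              unfolding tr[OF sF, symmetric] P[OF sF] by (intro integral_S3_cong) (simp add: opF eT)
            then show ?thesis by simp
          qed
          then have eq: "coef u i * (\<integral>x. F (e i) x * g x \<partial>S3_measure) = coef w i * (\<integral>x. F (e i) x * \<psi> x \<partial>S3_measure)" for i
            using * by simp
          show "(\<lambda>i. coef w i * (\<integral>x. F (e i) x * \<psi> x \<partial>S3_measure)) sums (\<integral>x. w x * \<psi> x \<partial>S3_measure)"
            using * smooth_L2[OF s(1)] by (intro pairing_sums) auto
          show "(\<lambda>i. coef w i * (\<integral>x. F (e i) x * \<psi> x \<partial>S3_measure)) sums (\<integral>x. u x * g x \<partial>S3_measure)"
            unfolding eq[symmetric] using * smooth_L2[OF s(2)] by (intro pairing_sums) auto
        qed
        then show "(u, w) \<in> rossi_paneitz t"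
          using * by (auto simp: rossi_paneitz_def maximal_operator_def distributional_def)
      qed
    next
      fix \<epsilon> :: real assume \<epsilon>: "0 < \<epsilon>"
      obtain n0 :: nat where n0: "\<And>n x. n0 \<le> n \<Longrightarrow> - (\<epsilon> * h) * ip n x x \<le> ip n (Qm t n x) x"
        by (rule Qm_form_ge_neg[OF t, of "\<epsilon> * h"]) (use \<epsilon> h in simp, rule that)
      have "N a \<ge> - \<epsilon>" if a: "(k, m, i) = a" "a \<in> T" "n0 \<le> k + m" for a k m i
      proof -
        let ?x = "q (k + m) i"
        have i: "i \<le> k + m" using a by (auto simp: T_def)
        have 1: "ip (k + m) ?x ?x = 1" using on[of "k + m"] i by (simp add: orthonormal_def)
        have "ip (k + m) (Qm t (k + m) ?x) ?x = ip (k + m) (\<lambda>p. l (k + m) i * ?x p) ?x"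
          by (intro ip_cong eig i refl)
        then have "ip (k + m) (Qm t (k + m) ?x) ?x = l (k + m) i" by (simp add: ip_scale 1)
        then have "- (\<epsilon> * h) \<le> l (k + m) i" using n0[OF a(3), of ?x] by (simp add: 1)
        then show ?thesis using h a(1) by (auto simp: Ne field_simps)
      qed
      \<comment> \<open>An eigenvalue below \<open>- \<epsilon>\<close> forces
        \<open>k + m < n0\<close>, which bounds all three components because
        \<open>i \<le> k + m\<close>.\<close>
      then have "{a \<in> T. N a < - \<epsilon>} \<subseteq> {..n0} \<times> {..n0} \<times> {..n0}"
        by (force simp: T_def not_le[symmetric])
      then have "finite {a \<in> T. N a < - \<epsilon>}" by (rule finite_subset) simp
      then have "finite (e -` {a \<in> T. N a < - \<epsilon>})" by (rule finite_vimageI) (rule inj)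
      then show "finite {i. N (e i) < - \<epsilon>}" by (simp add: vimage_def eT)
    next
      \<comment> \<open>With only nonnegative eigenvalues the form would be nonnegative in spectral
        coordinates, against \<open>Qm_negu\<close>.\<close>
      have "\<exists>i\<le>n. l n i < 0" if n: "odd n" for n
      proof (rule ccontr)
        assume no: "\<not> (\<exists>i\<le>n. l n i < 0)"
        let ?x = "negu t n"
        have "ip n (Qm t n ?x) ?x = (\<Sum>i\<le>n. ip n (Qm t n ?x) (q n i) * ip n ?x (q n i))"
          by (rule orthonormal_Parseval[OF on, symmetric])
        also have "\<dots> = (\<Sum>i\<le>n. l n i * (ip n ?x (q n i))\<^sup>2)"
        proof (intro sum.cong refl)
          fix i assume i: "i \<in> {..n}"
          have "ip n ?x (Qm t n (q n i)) = ip n ?x (\<lambda>p. l n i * q n i p)"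
            by (intro ip_cong eig refl) (use i in auto)
          then show "ip n (Qm t n ?x) (q n i) * ip n ?x (q n i) = l n i * (ip n ?x (q n i))\<^sup>2"
            by (simp add: ip_Qm ip_scale_right power2_eq_square)
        qed
        also have "\<dots> \<ge> 0" using no by (intro sum_nonneg mult_nonneg_nonneg) (auto simp: not_less)
        finally show False using Qm_negu[of t n] t n by simp
      qed
      then obtain r where r: "\<And>n. odd n \<Longrightarrow> r n \<le> n \<and> l n (r n) < 0" by metis
      \<comment> \<open>One negative eigenvalue for each odd degree suffices; taking
        \<open>m = 0\<close> makes the degree visible in the first component, hence \<open>f\<close>
        injective.\<close>
      define f where "f n = (2 * n + 1, 0 :: nat, r (2 * n + 1))" for n
      have "inj f" by (auto simp: inj_on_def f_def)
      then have "infinite (range f)" by (rule range_inj_infinite)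
      moreover have "range f \<subseteq> {a \<in> T. N a < 0}"
        using r h by (auto simp: f_def T_def Ne divide_neg_pos)
      ultimately have "infinite {a \<in> T. N a < 0}" using finite_subset by blast
      moreover have "{a \<in> T. N a < 0} \<subseteq> e ` {i. N (e i) < 0}" using ran by auto
      ultimately show "infinite {i. N (e i) < 0}" using finite_subset by blast
    qed
  qed
  then show thesis by (rule that)
qed

theorem theorem7p2:
  fixes t :: real
  assumes "0 < \<bar>t\<bar>" and "\<bar>t\<bar> < 1"
  shows "(\<forall>\<mu>\<in>negative_spectrum S3_measure (rossi_paneitz t).
            is_eigenvalue S3_measure (rossi_paneitz t) \<mu> \<and>
            finite_multiplicity S3_measure (rossi_paneitz t) \<mu>)
       \<and> {x. x islimpt negative_spectrum S3_measure (rossi_paneitz t)} = {0}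
       \<and> \<not> closed_range S3_measure (rossi_paneitz t)"
proof -
  obtain \<phi> \<nu> where "diagonal_operator S3_measure \<phi> \<nu> (rossi_paneitz t)"
    by (rule rossi_paneitz_diagonal[OF assms])
  then show ?thesis by (rule diagonal_operator.diagonal_negative_spectrum)
qed

end
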